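(* Let $\Omega\subset\mathbb R^2$ be a compact convex set with nonempty interior whose boundary is a simple closed curve of class $\mathcal C^2$. Then $$\int_{A(2,1)}\frac{1}{\sigma(L\cap \Omega)}\,dL\geq\frac{\pi^2}{2},$$ where $\sigma(L\cap\Omega)$ is the length of the chord $L\cap\Omega$ and $A(2,1)$ is the space of lines of $\mathbb R^2$ (the integrand being taken as $0$ for lines not meeting $\Omega$). Equality holds if and only if $\Omega$ is a round disk. Moreover, the left hand side is invariant under Möbius transformations keeping $\Omega$ convex; i.e., if $\phi$ is a Möbius transformation of $\mathbb R^2\cup\{\infty\}$ such that $\phi(\Omega)\subset\mathbb R^2$ is again a (compact) convex set, then the integrals for $\Omega$ and $\phi(\Omega)$ coincide.
   Context: $A(2,1)$ is the space of unoriented affine lines of $\mathbb R^2$ and $dL$ is its measure invariant under rigid motions, with the standard normalization $dL=dp\,d\varphi$, where the line is $\{x: x_1\cos\varphi+x_2\sin\varphi=p\}$ with $p\ge 0$, $\varphi\in[0,2\pi)$. *)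

theory Defs
  imports "HOL-Analysis.Analysis"
begin

definition affine_lines :: "(real^2) set set" where
  "affine_lines = {L. affine L \<and> aff_dim L = 1}"

definition line_of :: "real \<times> real \<Rightarrow> (real^2) set" where
  "line_of = (\<lambda>(p, \<phi>). {x. x $ 1 * cos \<phi> + x $ 2 * sin \<phi> = p})"

definition line_params :: "(real \<times> real) set" where
  "line_params = {0..} \<times> {0..<2 * pi}"

(* The invariant measure dL = dp d\<phi>: the image of Lebesgue measure on the parameter strip, on
   the largest \<sigma>-algebra making the parametrization measurable. The parametrization is
   injective off the null set p = 0. *)
definition line_measure :: "(real^2) set measure" where
  "line_measure =
     distr (restrict_space lborel line_params)
       (sigma affine_lines
          {\<A>. \<A> \<subseteq> affine_lines \<and> line_of -` \<A> \<inter> line_params \<in> sets borel})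
       line_of"

(* For compact convex \<Omega> the chord L \<inter> \<Omega> is a closed segment, so its diameter is its length;
   see chord_length_closed_segment below. *)
definition chord_length :: "(real^2) set \<Rightarrow> (real^2) set \<Rightarrow> real" where
  "chord_length L \<Omega> = diameter (L \<inter> \<Omega>)"

(* Lines touching \<Omega> in a single point get the value 1 / 0 = \<infinity> in ennreal. *)
definition inverse_chord_integral :: "(real^2) set \<Rightarrow> ennreal" where
  "inverse_chord_integral \<Omega> =
     (\<integral>\<^sup>+ L. (if L \<inter> \<Omega> = {} then 0 else 1 / ennreal (chord_length L \<Omega>)) \<partial>line_measure)"

(* The parametrization is regular, and periodicity makes it C^2 across the closing point as well. *)
definition C2_simple_closed_curve :: "(real^2) set \<Rightarrow> bool" where
  "C2_simple_closed_curve S \<longleftrightarrow>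
     (\<exists>\<gamma> \<gamma>' \<gamma>'' :: real \<Rightarrow> real^2.
        (\<forall>t. (\<gamma> has_vector_derivative \<gamma>' t) (at t)) \<and>
        (\<forall>t. (\<gamma>' has_vector_derivative \<gamma>'' t) (at t)) \<and>
        continuous_on UNIV \<gamma>'' \<and>
        (\<forall>t. \<gamma>' t \<noteq> 0) \<and>
        (\<forall>t. \<gamma> (t + 1) = \<gamma> t) \<and>
        simple_path \<gamma> \<and> path_image \<gamma> = S)"

(* The extended plane is (real^2) option, with None as the point at infinity, as in
   Alexandroff_compactification. *)
definition circle_inversion :: "real^2 \<Rightarrow> real \<Rightarrow> (real^2) option \<Rightarrow> (real^2) option" where
  "circle_inversion c r P =
     (case P of
        None \<Rightarrow> Some c
      | Some x \<Rightarrow> if x = c then None else Some (c + (r\<^sup>2 / (dist x c)\<^sup>2) *\<^sub>R (x - c)))"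

(* Reflection in the line u \<bullet> x = p, where u is a unit vector. *)
definition line_reflection :: "real^2 \<Rightarrow> real \<Rightarrow> (real^2) option \<Rightarrow> (real^2) option" where
  "line_reflection u p = map_option (\<lambda>x. x - (2 * (u \<bullet> x - p)) *\<^sub>R u)"

(* The full group generated by inversions in circles and reflections in lines: it consists of the
   orientation-preserving maps (a z + b) / (c z + d) and of their compositions with complex
   conjugation. The generators are involutions, so no closure under inverses is needed. *)
inductive moebius_transformation :: "((real^2) option \<Rightarrow> (real^2) option) \<Rightarrow> bool" where
  ident: "moebius_transformation id"
| inversion: "r > 0 \<Longrightarrow> moebius_transformation f \<Longrightarrow> moebius_transformation (circle_inversion c r \<circ> f)"
| reflection: "norm u = 1 \<Longrightarrow> moebius_transformation f \<Longrightarrow> moebius_transformation (line_reflection u p \<circ> f)"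

lemma line_of_eq_inner: "line_of (p, \<phi>) = {x. vector [cos \<phi>, sin \<phi>] \<bullet> x = p}"
  by (auto simp: line_of_def inner_vec_def sum_2 mult.commute)

lemma line_of_in_affine_lines: "line_of q \<in> affine_lines"
proof -
  obtain p \<phi> where q: "q = (p, \<phi>)" by (cases q)
  have "vector [cos \<phi>, sin \<phi>] \<noteq> (0 :: real^2)"
  proof
    assume "vector [cos \<phi>, sin \<phi>] = (0 :: real^2)"
    then have "cos \<phi> = 0" "sin \<phi> = 0"
      by (metis vector_2 zero_index)+
    then show False
      using sin_cos_squared_add[of \<phi>] by simp
  qed
  then show ?thesis
    by (simp add: q line_of_eq_inner affine_lines_def affine_hyperplane)
qed

lemma line_of_image: "line_of ` line_params = affine_lines"
proof (intro equalityI subsetI)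
  fix L assume "L \<in> line_of ` line_params"
  then show "L \<in> affine_lines"
    using line_of_in_affine_lines by blast
next
  fix L assume "L \<in> affine_lines"
  then have L: "affine L" "aff_dim L = int DIM(real^2) - 1"
    by (auto simp: affine_lines_def)
  then obtain a b where a: "a \<noteq> 0" and Lab: "L = {x. a \<bullet> x = b}"
    using aff_dim_eq_hyperplane[of L] by (auto simp: affine_hull_eq[THEN iffD2])
  define s where "s = (if b < 0 then - 1 else 1 :: real)"
  define v where "v = (s / norm a) *\<^sub>R a"
  define p where "p = s * b / norm a"
  have s: "s \<noteq> 0" "\<bar>s\<bar> = 1" by (auto simp: s_def)
  have p: "p \<ge> 0" by (simp add: p_def s_def)
  have Lv: "L = {x. v \<bullet> x = p}"
    using a s by (auto simp: Lab v_def p_def field_simps)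
  have "norm v = 1"
    using a s by (simp add: v_def)
  then have "(v $ 1)\<^sup>2 + (v $ 2)\<^sup>2 = 1"
    by (simp add: norm_vec_def L2_set_def sum_2 real_sqrt_eq_1_iff)
  then obtain t where t: "0 \<le> t" "t < 2 * pi" "v $ 1 = cos t" "v $ 2 = sin t"
    using sincos_total_2pi by metis
  have "L = line_of (p, t)"
    by (auto simp: Lv line_of_def inner_vec_def sum_2 t mult.commute)
  then show "L \<in> line_of ` line_params"
    using p t by (auto simp: line_params_def)
qed

lemma line_params_borel: "line_params \<in> sets borel"
proof -
  have "line_params \<in> sets (borel \<Otimes>\<^sub>M borel)"
    unfolding line_params_def by (rule pair_measureI) simp_all
  then show ?thesis by (simp only: borel_prod)
qed

lemma sigma_algebra_lines:
  "sigma_algebra affine_lines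
     {\<A>. \<A> \<subseteq> affine_lines \<and> line_of -` \<A> \<inter> line_params \<in> sets borel}" (is "sigma_algebra _ ?S")
proof (rule sigma_algebra_iff2[THEN iffD2], intro conjI ballI allI impI)
  show "?S \<subseteq> Pow affine_lines" "{} \<in> ?S" by auto
next
  fix \<A> assume A: "\<A> \<in> ?S"
  have "line_of -` (affine_lines - \<A>) \<inter> line_params = line_params - line_of -` \<A> \<inter> line_params"
    using line_of_in_affine_lines by auto
  then show "affine_lines - \<A> \<in> ?S"
    using A line_params_borel by auto
next
  fix A :: "nat \<Rightarrow> _" assume A: "range A \<subseteq> ?S"
  have "line_of -` (\<Union>i. A i) \<inter> line_params = (\<Union>i. line_of -` A i \<inter> line_params)"
    by auto
  also have "\<dots> \<in> sets borel"
    using A by (intro sets.countable_UN) auto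
  finally show "(\<Union>i. A i) \<in> ?S"
    using A by auto
qed

lemma space_line_measure: "space line_measure = affine_lines"
  by (simp add: line_measure_def space_measure_of_conv)

lemma sets_line_measure:
  "sets line_measure =
     {\<A>. \<A> \<subseteq> affine_lines \<and> line_of -` \<A> \<inter> line_params \<in> sets borel}"
  unfolding line_measure_def sets_distr
  by (rule sigma_algebra.sets_measure_of_eq[OF sigma_algebra_lines])

lemma emeasure_line_measure:
  assumes "\<A> \<in> sets line_measure"
  shows "emeasure line_measure \<A> = emeasure lborel (line_of -` \<A> \<inter> line_params)"
proof -
  let ?P = "restrict_space lborel line_params"
  let ?S = "{\<A>. \<A> \<subseteq> affine_lines \<and> line_of -` \<A> \<inter> line_params \<in> sets borel}"
  have space: "space ?P = line_params"
    by (simp add: space_restrict_space)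
  have "line_of \<in> measurable ?P (sigma affine_lines ?S)"
    using line_of_in_affine_lines line_params_borel
    by (intro measurable_measure_of) (auto simp: space sets_restrict_space_iff)
  moreover have "\<A> \<in> sets (sigma affine_lines ?S)"
    using assms by (simp add: line_measure_def)
  ultimately show ?thesis
    using line_params_borel
    by (simp add: line_measure_def emeasure_distr space emeasure_restrict_space)
qed

lemma chord_length_closed_segment:
  assumes "L \<in> affine_lines" "compact \<Omega>" "convex \<Omega>" "L \<inter> \<Omega> \<noteq> {}"
  obtains a b where "L \<inter> \<Omega> = closed_segment a b" "chord_length L \<Omega> = dist a b"
proof -
  have L: "affine L" "aff_dim L = 1"
    using assms by (auto simp: affine_lines_def)
  have "compact (L \<inter> \<Omega>)" "convex (L \<inter> \<Omega>)"
    using L assms by (auto intro: closed_Int_compact affine_closed convex_Int affine_imp_convex)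
  moreover have "collinear (L \<inter> \<Omega>)"
    using L aff_dim_subset[of "L \<inter> \<Omega>" L] by (simp add: collinear_aff_dim)
  ultimately obtain a b where ab: "L \<inter> \<Omega> = closed_segment a b"
    using assms compact_convex_collinear_segment by metis
  have "diameter (closed_segment a b) \<le> dist a b"
  proof (rule diameter_le)
    fix x y assume "x \<in> closed_segment a b" "y \<in> closed_segment a b"
    then obtain u v where uv: "0 \<le> u" "u \<le> 1" "x = (1 - u) *\<^sub>R a + u *\<^sub>R b"
      "0 \<le> v" "v \<le> 1" "y = (1 - v) *\<^sub>R a + v *\<^sub>R b"
      by (auto simp: in_segment)
    have "x - y = (v - u) *\<^sub>R (a - b)"
      unfolding uv(3,6) by (simp add: algebra_simps)
    then have "norm (x - y) = \<bar>v - u\<bar> * dist a b"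
      by (simp add: dist_norm)
    also have "\<dots> \<le> 1 * dist a b"
      using uv by (intro mult_right_mono) auto
    finally show "norm (x - y) \<le> dist a b" by simp
  qed auto
  moreover have "dist a b \<le> diameter (closed_segment a b)"
    by (intro diameter_bounded_bound) (auto simp: compact_imp_bounded)
  ultimately show thesis
    using that[of a b] ab by (simp add: chord_length_def)
qed

end

theory Submission
  imports Defs "HOL-Complex_Analysis.Complex_Analysis" "HOL-Real_Asymp.Real_Asymp"
begin

text \<open>A line meeting the boundary curve \<open>\<gamma>\<close> in \<open>\<gamma> s\<close> and \<open>\<gamma> t\<close> satisfies
  \<open>dL = sin \<alpha> sin \<beta> / \<sigma> ds dt\<close>, where \<open>\<alpha>\<close>, \<open>\<beta>\<close> are its angles with the curve. Hence twice the integral is the energy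
  \<open>\<integral>\<integral> k(s,t) k(t,s) ds dt\<close> with \<open>k(s,t) = Im (\<gamma>' s / (\<gamma> s - \<gamma> t))\<close>. A Moebius map changes \<open>k(s,t)\<close> by a function
  of \<open>s\<close> alone that is the derivative of a single-valued argument, and \<open>\<integral> k(t,s) dt = \<pi>\<close> for every \<open>s\<close>, so the energy is invariant.

  For the inequality take a Riemann map \<open>F\<close> of the disc onto the interior, which extends to the boundary, and a
  logarithm \<open>H(z,w)\<close> of \<open>(F z - F w) / (z - w)\<close>. In the circle parameter \<open>a\<close> of \<open>F\<close>, the kernel \<open>k\<close> is the derivative in
  \<open>a\<close> of \<open>(a + b) / 2 + Im H(cis a, cis b)\<close>. Since \<open>H\<close> is holomorphic in both variables, its imaginary part has on the
  torus no Fourier modes \<open>(m,n)\<close> with \<open>m\<close>, \<open>n\<close> of opposite sign. Parseval then turns the energy into \<open>\<pi>\<^sup>2\<close> plus a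
  nonnegative combination of the squared moduli of the modes with \<open>m n > 0\<close>. Parseval is replaced by Fejer means, because
  \<open>F'\<close> need not be controlled on the circle. In the case of equality all these modes vanish, so \<open>H(z,w)\<close> is a sum of
  functions of \<open>z\<close> and of \<open>w\<close>; this forces \<open>F\<close> to be a Moebius map and the domain to be a disc.\<close>

section \<open>Logarithms along curves and regular closed curves\<close>

text \<open>Positivity is a matter of signs. The mixed mode of the kernel at \<open>(m, n)\<close>
  is \<open>- \<i> * m\<close> times the phase mode \<open>e m (- n)\<close>, so the product of the
  modes at \<open>(m, n)\<close> and \<open>(n, m)\<close> is \<open>- m * n\<close> times a squared
  modulus, and the phase has no modes where this would be negative. The term
  \<open>pi\<^sup>2\<close> is the mode at the origin: the total turning \<open>pi\<close> of a
  chord, once for each endpoint. The obstacle is boundary regularity. The second derivative is what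
  bounds \<open>k\<close> near the diagonal, and that bound makes tangent discs of one fixed radius
  fit into the domain. Comparing the Riemann map with these discs from inside, and with the
  supporting half-planes from outside, yields Lipschitz bounds in both directions and hence the
  boundary extension. The logarithm stays undefined on the diagonal of the torus, and only its
  imaginary part is shown to be bounded. So its modes are computed on smaller tori and carried to
  the limit, and the partial integration runs over arcs that avoid the diagonal.\<close>

lemma round_shift:
  fixes x :: real
  obtains n :: int where "\<bar>x + of_int n\<bar> \<le> 1/2"
proof
  show "\<bar>x + of_int (- round x)\<bar> \<le> 1/2"
    using of_int_round_abs_le[of x] by linarith
qed

text \<open>Since \<open>h y - h x\<close> tends to 0, its imaginary part soon lies in the strip
  where \<open>Ln\<close> inverts \<open>exp\<close>. Any continuous logarithm is therefore locally
  a shifted principal one and inherits its differentiability; the next two lemmas are the real and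
  the complex version of this.\<close>

lemma continuous_log_eventually:
  fixes h f :: "'a::topological_space \<Rightarrow> complex"
  assumes h: "(h \<longlongrightarrow> h x) F" and eq: "\<forall>\<^sub>F y in F. f y = exp (h y)" and fx: "f x = exp (h x)"
  shows "\<forall>\<^sub>F y in F. h y = Ln (f y / f x) + h x"
proof -
  have "((\<lambda>y. h y - h x) \<longlongrightarrow> 0) F"
    using tendsto_diff[OF h tendsto_const[of "h x"]] by simp
  then have "\<forall>\<^sub>F y in F. dist (h y - h x) 0 < pi"
    by (rule tendstoD) simp
  then show ?thesis
    using eq
  proof eventually_elim
    case (elim y)
    have "\<bar>Im (h y - h x)\<bar> < pi"
      using elim(1) abs_Im_le_cmod[of "h y - h x"] by (simp del: minus_complex.sel)
    then have "Ln (exp (h y - h x)) = h y - h x"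
      by (intro Ln_exp) auto
    then show ?case
      using elim(2) fx by (simp add: exp_diff)
  qed
qed

lemma continuous_log_has_vector_derivative:
  fixes h f :: "real \<Rightarrow> complex"
  assumes h: "isCont h x" and eq: "\<forall>\<^sub>F y in nhds x. f y = exp (h y)"
    and f: "(f has_vector_derivative f') (at x)"
  shows "(h has_vector_derivative f' / f x) (at x)"
proof -
  have fx: "f x = exp (h x)" using eq eventually_nhds_x_imp_x by blast
  have h': "(h \<longlongrightarrow> h x) (nhds x)"
    using h by (simp add: continuous_at tendsto_at_iff_tendsto_nhds)
  have ev: "\<forall>\<^sub>F y in nhds x. h y = Ln (f y / f x) + h x"
    by (rule continuous_log_eventually[OF h' eq fx])
  have "((\<lambda>y. f y / f x) has_vector_derivative f' / f x) (at x)"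
    using has_vector_derivative_mult_left[OF f, of "1 / f x"] by simp
  then have "(Ln \<circ> (\<lambda>y. f y / f x) has_vector_derivative f' / f x * 1) (at x)"
  proof (rule field_vector_diff_chain_at)
    have "f x / f x = 1" using fx by simp
    then show "(Ln has_field_derivative 1) (at (f x / f x))"
      using has_field_derivative_Ln[of 1] by simp
  qed
  then have "((\<lambda>y. Ln (f y / f x) + h x) has_vector_derivative f' / f x) (at x)"
    by (auto intro!: derivative_eq_intros simp: o_def)
  moreover have "\<forall>\<^sub>F y in nhds x. Ln (f y / f x) + h x = h y"
    using ev by eventually_elim simp
  ultimately show ?thesis
    using has_vector_derivative_cong_ev[of UNIV "\<lambda>y. Ln (f y / f x) + h x" h x] fx
    by simp
qed

lemma continuous_log_holomorphic:
  fixes h f :: "complex \<Rightarrow> complex"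
  assumes S: "open S" and h: "continuous_on S h" and eq: "\<And>z. z \<in> S \<Longrightarrow> f z = exp (h z)"
    and f: "f holomorphic_on S"
  shows "h holomorphic_on S"
proof -
  have "h field_differentiable at x" if x: "x \<in> S" for x
  proof -
    have evS: "\<forall>\<^sub>F y in nhds x. y \<in> S" using S x by (rule eventually_nhds_in_open)
    have h': "(h \<longlongrightarrow> h x) (nhds x)"
      using h S x by (simp add: continuous_on_eq_continuous_at continuous_at tendsto_at_iff_tendsto_nhds)
    have ev: "\<forall>\<^sub>F y in nhds x. h y = Ln (f y / f x) + h x"
      by (rule continuous_log_eventually[of h x "nhds x" f, OF h' _ eq[OF x]]) (use evS eq in \<open>auto elim: eventually_mono\<close>)
    have fd: "f field_differentiable at x"
      using f S x by (simp add: holomorphic_on_imp_differentiable_at)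
    then obtain f' where f': "(f has_field_derivative f') (at x)"
      by (auto simp: field_differentiable_def)
    have nz: "f x \<noteq> 0" using eq[OF x] by simp
    have "((\<lambda>y. Ln (f y / f x) + h x) has_field_derivative f' / f x) (at x)"
      using nz by (auto intro!: derivative_eq_intros f')
    then have "(h has_field_derivative f' / f x) (at x)"
      using DERIV_cong_ev[OF refl ev refl] by simp
    then show ?thesis by (auto simp: field_differentiable_def)
  qed
  then show ?thesis
    using S by (simp add: holomorphic_on_open field_differentiable_def)
qed

section \<open>Simple closed curves of period 1 and the boundedness of the kernel\<close>

locale C2_closed_curve =
  fixes \<gamma> \<gamma>' \<gamma>'' :: "real \<Rightarrow> complex"
  assumes deriv1: "(\<gamma> has_vector_derivative \<gamma>' t) (at t)"
    and deriv2: "(\<gamma>' has_vector_derivative \<gamma>'' t) (at t)"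
    and cont2: "continuous_on UNIV \<gamma>''"
    and regular: "\<gamma>' t \<noteq> 0"
    and period: "\<gamma> (t + 1) = \<gamma> t"
    and inj: "\<lbrakk>0 \<le> s; s < 1; 0 \<le> t; t < 1; \<gamma> s = \<gamma> t\<rbrakk> \<Longrightarrow> s = t"
begin

lemma cont: "continuous_on S \<gamma>"
  by (meson continuous_on_vector_derivative has_vector_derivative_at_within deriv1)

lemma cont1: "continuous_on S \<gamma>'"
  by (meson continuous_on_vector_derivative has_vector_derivative_at_within deriv2)

lemma cont_compose: "continuous_on S f \<Longrightarrow> continuous_on S (\<lambda>x. \<gamma> (f x))"
  by (rule continuous_on_compose2[OF cont[of UNIV]]) auto

lemma cont1_compose: "continuous_on S f \<Longrightarrow> continuous_on S (\<lambda>x. \<gamma>' (f x))"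
  by (rule continuous_on_compose2[OF cont1[of UNIV]]) auto

lemma period1: "\<gamma>' (t + 1) = \<gamma>' t"
proof -
  have "((\<lambda>t. \<gamma> (t + 1)) has_vector_derivative \<gamma>' (t + 1)) (at t)"
  proof -
    have "(\<gamma> \<circ> (\<lambda>t. t + 1) has_vector_derivative (1 *\<^sub>R \<gamma>' (t + 1))) (at t)"
      by (rule vector_diff_chain_at) (auto intro!: derivative_eq_intros deriv1)
    then show ?thesis by (simp add: o_def)
  qed
  then have "(\<gamma> has_vector_derivative \<gamma>' (t + 1)) (at t)" by (simp only: period)
  then show ?thesis
    using deriv1 by (rule vector_derivative_unique_at)
qed

lemma period_int: "\<gamma> (t + of_int n) = \<gamma> t"
proof (induction n rule: int_induct[where k = 0])
  case (step1 i) then show ?case using period[of "t + of_int i"] by (simp add: algebra_simps)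
next
  case (step2 i) then show ?case using period[of "t + of_int (i - 1)"] by (simp add: algebra_simps)
qed simp

lemma period1_int: "\<gamma>' (t + of_int n) = \<gamma>' t"
proof (induction n rule: int_induct[where k = 0])
  case (step1 i) then show ?case using period1[of "t + of_int i"] by (simp add: algebra_simps)
next
  case (step2 i) then show ?case using period1[of "t + of_int (i - 1)"] by (simp add: algebra_simps)
qed simp

lemma period_frac: "\<gamma> (frac t) = \<gamma> t"
  using period_int[of t "- \<lfloor>t\<rfloor>"] by (simp add: frac_def)

lemma eq_iff: "\<gamma> s = \<gamma> t \<longleftrightarrow> s - t \<in> \<int>"
proof
  assume "\<gamma> s = \<gamma> t"
  then have "frac s = frac t"
    using inj[of "frac s" "frac t"] by (simp add: period_frac frac_ge_0 frac_lt_1)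
  then have "s - t = of_int (\<lfloor>s\<rfloor> - \<lfloor>t\<rfloor>)" by (simp add: frac_def)
  then show "s - t \<in> \<int>" by (metis Ints_of_int)
next
  assume "s - t \<in> \<int>"
  then obtain n where "s = t + of_int n" by (metis Ints_cases add.commute diff_add_cancel)
  then show "\<gamma> s = \<gamma> t" by (simp add: period_int)
qed

lemma neq: "s < t \<Longrightarrow> t < s + 1 \<Longrightarrow> \<gamma> s \<noteq> \<gamma> t"
proof
  assume *: "s < t" "t < s + 1" "\<gamma> s = \<gamma> t"
  then have "t - s \<in> \<int>" by (metis eq_iff)
  then obtain n :: int where "t - s = of_int n" by (elim Ints_cases)
  with * have "0 < (of_int n :: real)" "(of_int n :: real) < of_int 1" by auto
  then show False by (simp only: of_int_less_iff of_int_0_less_iff)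
qed

lemma range_eq: "range \<gamma> = \<gamma> ` {0..1}"
proof -
  have "\<gamma> t \<in> \<gamma> ` {0..1}" for t
    by (rule image_eqI[of _ _ "frac t"]) (auto simp: period_frac frac_ge_0 frac_lt_1 less_imp_le)
  then show ?thesis by auto
qed

text \<open>The rate at which the direction of the chord from \<open>\<gamma> t\<close> to \<open>\<gamma> s\<close> turns as \<open>s\<close> moves.\<close>

definition k :: "real \<Rightarrow> real \<Rightarrow> real"
  where "k s t = Im (\<gamma>' s / (\<gamma> s - \<gamma> t))"

lemma k_period_int: "k (s + of_int m) (t + of_int n) = k s t"
  by (simp add: k_def period_int period1_int)

lemma k_eq: "k s t = Im (\<gamma>' s * cnj (\<gamma> s - \<gamma> t)) / (cmod (\<gamma> s - \<gamma> t))\<^sup>2"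
proof -
  have "\<gamma>' s / (\<gamma> s - \<gamma> t) = (\<gamma>' s * cnj (\<gamma> s - \<gamma> t)) / of_real ((cmod (\<gamma> s - \<gamma> t))\<^sup>2)"
    using complex_div_cnj[of "\<gamma>' s" "\<gamma> s - \<gamma> t"] by simp
  then show ?thesis by (simp only: k_def Im_divide_of_real)
qed

text \<open>Compactness makes the second order Taylor bound and the chord-arc bound uniform. For
  close parameters the chord is bounded below by regularity, for the others by injectivity. The
  range \<open>1/2\<close> suffices because every pair of parameters has such representatives modulo
  1.\<close>

lemma taylor_bounds:
  obtains M c where "M > 0" "c > 0"
    "\<And>s t. 0 \<le> s \<Longrightarrow> s \<le> 1 \<Longrightarrow> \<bar>t - s\<bar> \<le> 1/2 \<Longrightarrow> cmod (\<gamma> t - \<gamma> s - (t - s) *\<^sub>R \<gamma>' s) \<le> M * (t - s)\<^sup>2"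
    "\<And>s t. 0 \<le> s \<Longrightarrow> s \<le> 1 \<Longrightarrow> \<bar>t - s\<bar> \<le> 1/2 \<Longrightarrow> cmod (\<gamma> t - \<gamma> s) \<ge> c * \<bar>t - s\<bar>"
    "\<And>s. cmod (\<gamma>' s) \<le> M"
proof -
  \<comment> \<open>The interval \<open>{-1..2}\<close> contains every point at distance at most
    \<open>1/2\<close> from \<open>{0..1}\<close>, together with the segments joining them.\<close>
  have "bounded (\<gamma>'' ` {-1..2})" "bounded (\<gamma>' ` {0..1})"
    using cont2 cont1[of "{0..1}"] by (auto intro!: compact_imp_bounded compact_continuous_image intro: continuous_on_subset)
  then obtain M1 M2 where M1: "\<And>t. t \<in> {-1..2} \<Longrightarrow> cmod (\<gamma>'' t) \<le> M1"
    and M2: "\<And>t. t \<in> {0..1} \<Longrightarrow> cmod (\<gamma>' t) \<le> M2"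
    unfolding bounded_iff ball_simps by metis
  define M where "M = max 1 (max M1 M2)"
  have M: "M > 0" "\<And>t. t \<in> {-1..2} \<Longrightarrow> cmod (\<gamma>'' t) \<le> M" "\<And>t. t \<in> {0..1} \<Longrightarrow> cmod (\<gamma>' t) \<le> M"
    using M1 M2 by (fastforce simp: M_def)+
  have M3: "cmod (\<gamma>' s) \<le> M" for s
    using M(3)[of "frac s"] period1_int[of s "- \<lfloor>s\<rfloor>"] by (simp add: frac_def frac_ge_0 frac_lt_1 less_imp_le) (metis M(3) atLeastAtMost_iff frac_def frac_ge_0 frac_lt_1 less_imp_le)
  have d1: "cmod (\<gamma>' t - \<gamma>' s) \<le> M * \<bar>t - s\<bar>" if "s \<in> {-1..2}" "t \<in> {-1..2}" for s t
  proof -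
    have "norm (\<gamma>' t - \<gamma>' s) \<le> M * norm (t - s)"
    proof (rule differentiable_bound[where S = "{-1..2}" and f' = "\<lambda>x h. h *\<^sub>R \<gamma>'' x"])
      fix x :: real assume x: "x \<in> {-1..2}"
      show "(\<gamma>' has_derivative (\<lambda>h. h *\<^sub>R \<gamma>'' x)) (at x within {-1..2})"
        using deriv2 by (simp add: has_vector_derivative_def has_derivative_at_withinI)
      show "onorm (\<lambda>h. h *\<^sub>R \<gamma>'' x) \<le> M"
        by (rule onorm_le) (use M(2)[OF x] in \<open>simp add: mult.commute[of M] mult_left_mono\<close>)
    qed (use that in auto)
    then show ?thesis by simp
  qed
  have t2: "cmod (\<gamma> t - \<gamma> s - (t - s) *\<^sub>R \<gamma>' s) \<le> M * (t - s)\<^sup>2"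
    if "0 \<le> s" "s \<le> 1" "\<bar>t - s\<bar> \<le> 1/2" for s t
  proof -
    have "norm ((\<gamma> t - (t - s) *\<^sub>R \<gamma>' s) - (\<gamma> s - (s - s) *\<^sub>R \<gamma>' s)) \<le> (M * \<bar>t - s\<bar>) * norm (t - s)"
    proof (rule differentiable_bound[where S = "closed_segment s t" and f' = "\<lambda>x h. h *\<^sub>R (\<gamma>' x - \<gamma>' s)"])
      fix x assume x: "x \<in> closed_segment s t"
      then have x': "x \<in> {-1..2}" "\<bar>x - s\<bar> \<le> \<bar>t - s\<bar>"
        using that by (auto simp: closed_segment_eq_real_ivl split: if_splits)
      have "((\<lambda>t. \<gamma> t - (t - s) *\<^sub>R \<gamma>' s) has_vector_derivative (\<gamma>' x - \<gamma>' s)) (at x)"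
        by (auto intro!: derivative_eq_intros deriv1)
      then show "((\<lambda>t. \<gamma> t - (t - s) *\<^sub>R \<gamma>' s) has_derivative (\<lambda>h. h *\<^sub>R (\<gamma>' x - \<gamma>' s))) (at x within closed_segment s t)"
        by (simp add: has_vector_derivative_def has_derivative_at_withinI)
      have "cmod (\<gamma>' x - \<gamma>' s) \<le> M * \<bar>t - s\<bar>"
        using d1[of s x] x' that M(1) by (auto intro: order_trans mult_left_mono)
      then show "onorm (\<lambda>h. h *\<^sub>R (\<gamma>' x - \<gamma>' s)) \<le> M * \<bar>t - s\<bar>"
        by (intro onorm_le) (simp add: mult.commute[of "M * _"] mult_left_mono)
    qed auto
    then show ?thesis by (simp add: power2_eq_square algebra_simps flip: abs_mult)
  qed
  obtain s0 where s0: "s0 \<in> {0..1}" "\<And>s. s \<in> {0..1} \<Longrightarrow> cmod (\<gamma>' s0) \<le> cmod (\<gamma>' s)"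
    using continuous_attains_inf[of "{0..1::real}" "\<lambda>s. cmod (\<gamma>' s)"] continuous_on_norm[OF cont1[of "{0..1}"]]
    by (metis atLeastAtMost_iff compact_Icc empty_iff order_refl zero_le_one)
  define m where "m = cmod (\<gamma>' s0)"
  have m: "m > 0" "\<And>s. s \<in> {0..1} \<Longrightarrow> m \<le> cmod (\<gamma>' s)" using regular s0 by (auto simp: m_def)
  \<comment> \<open>For \<open>\<bar>t - s\<bar>\<close> below \<open>u0\<close> the Taylor error
    \<open>M * (t - s)\<^sup>2\<close> is at most half of the linear term, which is at least
    \<open>m * \<bar>t - s\<bar>\<close>.\<close>
  define u0 where "u0 = min (1/2) (m / (2*M))"
  have u0: "u0 > 0" "u0 \<le> 1/2" "M * u0 \<le> m / 2" using m M by (auto simp: u0_def min_def field_simps)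
  let ?K = "{0..1::real} \<times> ({-1/2..-u0} \<union> {u0..1/2})"
  have "compact ?K" "?K \<noteq> {}" using u0 by (auto intro!: compact_Times compact_Un)
  moreover have "continuous_on ?K (\<lambda>(s,u). cmod (\<gamma> (s + u) - \<gamma> s))"
    by (auto simp: split_def intro!: continuous_intros cont_compose)
  ultimately obtain q where q: "q \<in> ?K" "\<And>p. p \<in> ?K \<Longrightarrow> (\<lambda>(s,u). cmod (\<gamma> (s + u) - \<gamma> s)) q \<le> (\<lambda>(s,u). cmod (\<gamma> (s + u) - \<gamma> s)) p"
    using continuous_attains_inf[of ?K "\<lambda>(s,u). cmod (\<gamma> (s + u) - \<gamma> s)"] by blast
  define c1 where "c1 = cmod (\<gamma> (fst q + snd q) - \<gamma> (fst q))"
  have "\<gamma> (fst q + snd q) \<noteq> \<gamma> (fst q)"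
    using neq[of "fst q" "fst q + snd q"] neq[of "fst q + snd q" "fst q"] q(1) u0 by (auto simp: mem_Times_iff)
  then have c1: "c1 > 0" by (simp add: c1_def)
  have c1': "c1 \<le> cmod (\<gamma> (s + u) - \<gamma> s)" if "s \<in> {0..1}" "u0 \<le> \<bar>u\<bar>" "\<bar>u\<bar> \<le> 1/2" for s u
    using q(2)[of "(s,u)"] that by (auto simp: c1_def split_def abs_if split: if_splits)
  define c where "c = min c1 (m/2)"
  have "c > 0" using c1 m by (simp add: c_def)
  moreover have "c * \<bar>t - s\<bar> \<le> cmod (\<gamma> t - \<gamma> s)" if st: "0 \<le> s" "s \<le> 1" "\<bar>t - s\<bar> \<le> 1/2" for s t
  proof (cases "u0 \<le> \<bar>t - s\<bar>")
    case True
    have "c * \<bar>t - s\<bar> \<le> c * 1" using st \<open>c > 0\<close> by (intro mult_left_mono) auto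
    also have "\<dots> \<le> c1" by (simp add: c_def)
    also have "\<dots> \<le> cmod (\<gamma> t - \<gamma> s)" using c1'[of s "t - s"] True st by simp
    finally show ?thesis .
  next
    case False
    have "cmod ((t - s) *\<^sub>R \<gamma>' s) \<le> cmod (\<gamma> t - \<gamma> s) + cmod (\<gamma> t - \<gamma> s - (t - s) *\<^sub>R \<gamma>' s)"
      by (metis norm_minus_commute norm_triangle_sub)
    moreover have "m * \<bar>t - s\<bar> \<le> cmod ((t - s) *\<^sub>R \<gamma>' s)"
      using m(2)[of s] st by (simp add: mult.commute mult_right_mono)
    moreover have "M * (t - s)\<^sup>2 \<le> m / 2 * \<bar>t - s\<bar>"
    proof -
      have "M * (t - s)\<^sup>2 = (M * \<bar>t - s\<bar>) * \<bar>t - s\<bar>" by (simp add: power2_eq_square mult.assoc flip: abs_mult)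
      also have "\<dots> \<le> (M * u0) * \<bar>t - s\<bar>" using False M(1) by (intro mult_right_mono mult_left_mono) auto
      also have "\<dots> \<le> m / 2 * \<bar>t - s\<bar>" using u0(3) by (intro mult_right_mono) auto
      finally show ?thesis .
    qed
    ultimately have "m / 2 * \<bar>t - s\<bar> \<le> cmod (\<gamma> t - \<gamma> s)" using t2[OF st] by linarith
    moreover have "c * \<bar>t - s\<bar> \<le> m / 2 * \<bar>t - s\<bar>" by (intro mult_right_mono) (auto simp: c_def)
    ultimately show ?thesis by linarith
  qed
  ultimately show thesis using that[of M c] M t2 M3 by blast
qed

text \<open>The first order Taylor term of \<open>\<gamma> s - \<gamma> t\<close> makes
  \<open>\<gamma>' s * cnj (\<gamma> s - \<gamma> t)\<close> real, so the numerator of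
  \<open>k_eq\<close> is quadratic in \<open>t - s\<close>, like the squared chord below it. On the
  diagonal itself \<open>k\<close> is 0 by division by zero.\<close>

lemma k_bounded: obtains C where "C > 0" "\<And>s t. \<bar>k s t\<bar> \<le> C"
proof -
  obtain M c where M: "M > 0" "c > 0"
    "\<And>s t. 0 \<le> s \<Longrightarrow> s \<le> 1 \<Longrightarrow> \<bar>t - s\<bar> \<le> 1/2 \<Longrightarrow> cmod (\<gamma> t - \<gamma> s - (t - s) *\<^sub>R \<gamma>' s) \<le> M * (t - s)\<^sup>2"
    "\<And>s t. 0 \<le> s \<Longrightarrow> s \<le> 1 \<Longrightarrow> \<bar>t - s\<bar> \<le> 1/2 \<Longrightarrow> cmod (\<gamma> t - \<gamma> s) \<ge> c * \<bar>t - s\<bar>"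
    "\<And>s. cmod (\<gamma>' s) \<le> M" using taylor_bounds by metis
  have le: "\<bar>k s t\<bar> \<le> M * M / c\<^sup>2" if st: "0 \<le> s" "s \<le> 1" "\<bar>t - s\<bar> \<le> 1/2" for s t
  proof (cases "t = s")
    case False
    define e where "e = \<gamma> t - \<gamma> s - (t - s) *\<^sub>R \<gamma>' s"
    have e: "\<gamma> s - \<gamma> t = - (of_real (t - s) * \<gamma>' s + e)" by (simp add: e_def scaleR_conv_of_real)
    have "Im (\<gamma>' s * cnj (\<gamma> s - \<gamma> t)) = - Im (\<gamma>' s * cnj e)"
      unfolding e by (simp add: algebra_simps)
    then have "\<bar>Im (\<gamma>' s * cnj (\<gamma> s - \<gamma> t))\<bar> \<le> cmod (\<gamma>' s * cnj e)"
      by (metis abs_Im_le_cmod abs_minus_cancel)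
    also have "\<dots> \<le> M * (M * (t - s)\<^sup>2)"
      using M(3)[OF st, folded e_def] M(5)[of s] M(1)
      unfolding norm_mult complex_mod_cnj by (intro mult_mono) auto
    finally have num: "\<bar>Im (\<gamma>' s * cnj (\<gamma> s - \<gamma> t))\<bar> \<le> M * M * (t - s)\<^sup>2" by (simp add: mult.assoc)
    have "(c * \<bar>t - s\<bar>)\<^sup>2 \<le> (cmod (\<gamma> s - \<gamma> t))\<^sup>2"
      using M(4)[OF st] M(2) by (intro power_mono) (auto simp: norm_minus_commute)
    then have den: "c\<^sup>2 * (t - s)\<^sup>2 \<le> (cmod (\<gamma> s - \<gamma> t))\<^sup>2" by (simp add: power_mult_distrib)
    have pos: "c\<^sup>2 * (t - s)\<^sup>2 > 0" using M(2) False by simp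
    have "\<bar>k s t\<bar> = \<bar>Im (\<gamma>' s * cnj (\<gamma> s - \<gamma> t))\<bar> / (cmod (\<gamma> s - \<gamma> t))\<^sup>2"
      by (simp only: k_eq abs_divide abs_power2)  
    also have "\<dots> \<le> (M * M * (t - s)\<^sup>2) / (c\<^sup>2 * (t - s)\<^sup>2)"
      using num den pos M(1) by (intro frac_le) auto
    also have "\<dots> = M * M / c\<^sup>2" using False by simp
    finally show ?thesis .
  qed (use M in \<open>simp add: k_def\<close>)
  have "\<bar>k s t\<bar> \<le> M * M / c\<^sup>2" for s t
  proof -
    obtain n where n: "\<bar>(t - frac s) + of_int n\<bar> \<le> 1/2" using round_shift[of "t - frac s"] by blast
    have "k s t = k (s + of_int (- \<lfloor>s\<rfloor>)) (t + of_int n)" by (simp only: k_period_int)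
    also have "\<dots> = k (frac s) (t + of_int n)" by (simp add: frac_def)
    finally show ?thesis using le[of "frac s" "t + of_int n"] n frac_lt_1[of s]
      by (simp add: frac_ge_0 algebra_simps less_imp_le)
  qed
  then show thesis using that[of "M * M / c\<^sup>2"] M by simp
qed

lemma k_borel: "(\<lambda>(s,t). k s t) \<in> borel_measurable borel"
proof -
  have "(\<lambda>p. \<gamma>' (fst p)) \<in> borel_measurable (borel :: (real \<times> real) measure)"
    "(\<lambda>p. \<gamma> (fst p)) \<in> borel_measurable (borel :: (real \<times> real) measure)"
    "(\<lambda>p. \<gamma> (snd p)) \<in> borel_measurable (borel :: (real \<times> real) measure)"
    by (intro borel_measurable_continuous_onI cont_compose cont1_compose continuous_intros)+
  then show ?thesis unfolding k_def split_def by measurable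
qed

lemma k_measurable[measurable (raw)]:
  assumes [measurable]: "f \<in> borel_measurable M" "g \<in> borel_measurable M"
  shows "(\<lambda>x. k (f x) (g x)) \<in> borel_measurable M"
proof -
  have "(\<lambda>x. (f x, g x)) \<in> measurable M borel" by measurable
  from measurable_compose[OF this k_borel] show ?thesis by simp
qed

end

section \<open>Turning of the chord direction on a convex curve\<close>

text \<open>After a translation by a multiple of \<open>T\<close> the window starts in
  \<open>{0..<T}\<close>; the part beyond \<open>T\<close> is moved back by one period, and the
  endpoints form a null set.\<close>

lemma set_nn_integral_shift_period:
  fixes f :: "real \<Rightarrow> ennreal"
  assumes f[measurable]: "f \<in> borel_measurable borel" and per: "\<And>x. f (x + T) = f x" and T: "T > 0"
  shows "(\<integral>\<^sup>+x. f x * indicator {c<..<c + T} x \<partial>lborel) = (\<integral>\<^sup>+x. f x * indicator {0..T} x \<partial>lborel)"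
proof -
  have per_int: "f (x + of_int n * T) = f x" for x n
  proof (induction n rule: int_induct[where k = 0])
    case (step1 i) then show ?case using per[of "x + of_int i * T"] by (simp add: algebra_simps)
  next
    case (step2 i) then show ?case using per[of "x + of_int (i - 1) * T"] by (simp add: algebra_simps)
  qed simp
  define n where "n = \<lfloor>c / T\<rfloor>"
  define d where "d = c - of_int n * T"
  have d: "0 \<le> d" "d < T"
  proof -
    have "of_int n \<le> c / T" "c / T < of_int n + 1" by (auto simp: n_def)
    then show "0 \<le> d" "d < T" using T by (auto simp: d_def field_simps)
  qed
  have shift: "(\<integral>\<^sup>+x. f x * indicator A x \<partial>lborel) = (\<integral>\<^sup>+x. f x * indicator A (x + of_int m * T) \<partial>lborel)"
    if [measurable]: "A \<in> sets borel" for A m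
    by (subst nn_integral_real_affine[where c = 1 and t = "of_int m * T"]) (auto simp: per_int add.commute)
  have "(\<integral>\<^sup>+x. f x * indicator {c<..<c + T} x \<partial>lborel) = (\<integral>\<^sup>+x. f x * indicator {d<..<d + T} x \<partial>lborel)"
    by (subst shift[of _ n]) (auto intro!: nn_integral_cong simp: d_def indicator_def)
  also have "\<dots> = (\<integral>\<^sup>+x. f x * indicator {d<..<T} x + f x * indicator {T..<d+T} x \<partial>lborel)"
    using d by (intro nn_integral_cong) (auto simp: indicator_def)
  also have "\<dots> = (\<integral>\<^sup>+x. f x * indicator {d<..<T} x \<partial>lborel) + (\<integral>\<^sup>+x. f x * indicator {T..<d+T} x \<partial>lborel)"
    by (rule nn_integral_add) auto
  also have "(\<integral>\<^sup>+x. f x * indicator {T..<d+T} x \<partial>lborel) = (\<integral>\<^sup>+x. f x * indicator {0..<d} x \<partial>lborel)"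
    by (subst shift[of _ 1]) (auto intro!: nn_integral_cong simp: indicator_def)
  also have "(\<integral>\<^sup>+x. f x * indicator {d<..<T} x \<partial>lborel) + (\<integral>\<^sup>+x. f x * indicator {0..<d} x \<partial>lborel)
     = (\<integral>\<^sup>+x. f x * indicator {d<..<T} x + f x * indicator {0..<d} x \<partial>lborel)"
    by (rule nn_integral_add[symmetric]) auto
  also have "\<dots> = (\<integral>\<^sup>+x. f x * indicator {0..T} x \<partial>lborel)"
  proof (rule nn_integral_cong_AE)
    have "AE x in lborel. x \<noteq> T \<and> x \<noteq> d" using AE_lborel_singleton[of T] AE_lborel_singleton[of d] by auto
    then show "AE x in lborel. f x * indicator {d<..<T} x + f x * indicator {0..<d} x = f x * indicator {0..T} x"
      by eventually_elim (use d in \<open>auto simp: indicator_def\<close>)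
  qed
  finally show ?thesis .
qed

lemma nn_integral_indicator_LIMSEQ:
  assumes f: "f \<in> borel_measurable M" and A: "\<And>n::nat. A n \<in> sets M" "incseq A"
  shows "(\<lambda>n. \<integral>\<^sup>+x. f x * indicator (A n) x \<partial>M) \<longlonglongrightarrow> (\<integral>\<^sup>+x. f x * indicator (\<Union>n. A n) x \<partial>M)"
proof -
  have "(\<lambda>n. emeasure (density M f) (A n)) \<longlonglongrightarrow> emeasure (density M f) (\<Union>n. A n)"
    by (rule Lim_emeasure_incseq) (use A in auto)
  then show ?thesis using f A by (simp add: emeasure_density sets.countable_UN)
qed

text \<open>The assumption \<open>ccw\<close> places the domain to the left of every oriented
  tangent line. It fixes the orientation; a clockwise boundary is brought into this form by
  reversing the parameter.\<close>

locale convex_curve = C2_closed_curve +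
  fixes \<Omega> :: "complex set"
  assumes compact: "compact \<Omega>" and convex: "convex \<Omega>" and interior: "interior \<Omega> \<noteq> {}"
    and frontier: "frontier \<Omega> = range \<gamma>"
    and ccw: "x \<in> \<Omega> \<Longrightarrow> 0 \<le> Im ((x - \<gamma> s) / \<gamma>' s)"
begin

lemma in_Omega: "\<gamma> t \<in> \<Omega>"
  using frontier_subset_closed[OF compact_imp_closed[OF compact]] unfolding frontier by blast

lemma k_nonneg: "0 \<le> k s t"
proof -
  define q where "q = (\<gamma> t - \<gamma> s) / \<gamma>' s"
  have "\<gamma>' s / (\<gamma> s - \<gamma> t) = - inverse q" by (simp add: q_def) (metis minus_diff_eq minus_divide_right)
  then have "k s t = Im q / (cmod q)\<^sup>2" by (simp add: k_def cmod_power2)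
  then show ?thesis using ccw[OF in_Omega] by (simp add: q_def)
qed

text \<open>A ball around \<open>x\<close> fits into the domain. Pushing \<open>x\<close> towards
  the tangent by the radius of the ball keeps the weak inequality, so it is strict at
  \<open>x\<close>.\<close>

lemma interior_left_of_tangent:
  assumes "x \<in> interior \<Omega>"
  shows "0 < Im ((x - \<gamma> s) / \<gamma>' s)"
proof -
  obtain e where e: "e > 0" "cball x e \<subseteq> \<Omega>" using assms by (auto simp: mem_interior_cball)
  define y where "y = x - of_real (e / cmod (\<gamma>' s)) * (\<i> * \<gamma>' s)"
  have "y \<in> \<Omega>" using e regular[of s]
    by (intro subsetD[OF e(2)]) (simp add: y_def dist_norm norm_mult norm_divide)
  then have "0 \<le> Im ((y - \<gamma> s) / \<gamma>' s)" by (rule ccw)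
  also have "(y - \<gamma> s) / \<gamma>' s = (x - \<gamma> s) / \<gamma>' s - of_real (e / cmod (\<gamma>' s)) * \<i>"
    using regular[of s] by (simp add: y_def field_simps)
  also have "Im \<dots> = Im ((x - \<gamma> s) / \<gamma>' s) - e / cmod (\<gamma>' s)" by simp
  finally show ?thesis using e(1) regular[of s] by (auto simp: field_simps divide_pos_pos intro: less_le_trans[of _ "e / cmod (\<gamma>' s)"])
qed

text \<open>The angle from the tangent at \<open>\<gamma> s\<close> to the chord towards \<open>\<gamma> t\<close>. The rotation by \<open>- pi / 2\<close> keeps \<open>Ln\<close> away from its cut.\<close>

definition ang :: "real \<Rightarrow> real \<Rightarrow> real"
  where "ang s t = Im (Ln (- \<i> * ((\<gamma> t - \<gamma> s) / \<gamma>' s))) + pi / 2"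

lemma ang_arg_slit:
  assumes "s < t" "t < s + 1"
  shows "- \<i> * ((\<gamma> t - \<gamma> s) / \<gamma>' s) \<notin> \<real>\<^sub>\<le>\<^sub>0" "- \<i> * ((\<gamma> t - \<gamma> s) / \<gamma>' s) \<noteq> 0"
proof -
  define w where "w = - \<i> * ((\<gamma> t - \<gamma> s) / \<gamma>' s)"
  have "Re w \<ge> 0" using ccw[OF in_Omega, of t s] unfolding w_def by (simp only: mult_minus_left Re_i_times uminus_complex.sel)
  moreover have nz: "w \<noteq> 0" using neq[OF assms] regular[of s] by (auto simp: w_def)
  ultimately show "- \<i> * ((\<gamma> t - \<gamma> s) / \<gamma>' s) \<notin> \<real>\<^sub>\<le>\<^sub>0" "- \<i> * ((\<gamma> t - \<gamma> s) / \<gamma>' s) \<noteq> 0"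
    unfolding w_def[symmetric] by (auto simp: complex_nonpos_Reals_iff complex_eq_iff)
qed

lemma ang_deriv:
  assumes "s < t" "t < s + 1"
  shows "(ang s has_real_derivative k t s) (at t)"
proof -
  let ?w = "\<lambda>t. - \<i> * ((\<gamma> t - \<gamma> s) / \<gamma>' s)"
  have "(?w has_vector_derivative (- \<i> / \<gamma>' s) * \<gamma>' t) (at t)"
    using has_vector_derivative_mult_right[OF has_vector_derivative_diff[OF deriv1[of t] has_vector_derivative_const[of "\<gamma> s"]], of "- \<i> / \<gamma>' s"]
    by simp
  then have "(Ln \<circ> ?w has_vector_derivative ((- \<i> / \<gamma>' s) * \<gamma>' t) * inverse (?w t)) (at t)"
    by (rule field_vector_diff_chain_at) (rule has_field_derivative_Ln[OF ang_arg_slit(1)[OF assms]])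
  also have "((- \<i> / \<gamma>' s) * \<gamma>' t) * inverse (?w t) = \<gamma>' t / (\<gamma> t - \<gamma> s)"
    using regular[of s] neq[OF assms] by (simp add: field_simps)
  finally have "((\<lambda>t. Im (Ln (?w t))) has_vector_derivative Im (\<gamma>' t / (\<gamma> t - \<gamma> s))) (at t)"
    using bounded_linear.has_vector_derivative[OF bounded_linear_Im] by (simp add: o_def)
  then have "((\<lambda>t. Im (Ln (?w t)) + pi/2) has_real_derivative Im (\<gamma>' t / (\<gamma> t - \<gamma> s))) (at t)"
    by (auto simp: has_real_derivative_iff_has_vector_derivative intro!: derivative_eq_intros)
  then show ?thesis by (simp add: ang_def[abs_def] k_def)
qed

lemma cis_ang:
  assumes "s < t" "t < s + 1"
  shows "(\<gamma> t - \<gamma> s) / \<gamma>' s = of_real (cmod ((\<gamma> t - \<gamma> s) / \<gamma>' s)) * cis (ang s t)"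
proof -
  let ?w = "- \<i> * ((\<gamma> t - \<gamma> s) / \<gamma>' s)"
  have "?w = exp (Ln ?w)" using ang_arg_slit(2)[OF assms] by simp
  also have "\<dots> = of_real (cmod ?w) * cis (Im (Ln ?w))"
    using ang_arg_slit(2)[OF assms] by (simp add: exp_eq_polar)
  finally have "\<i> * ?w = of_real (cmod ?w) * (\<i> * cis (Im (Ln ?w)))"
    by (metis mult.left_commute)
  also have "\<i> * cis (Im (Ln ?w)) = cis (ang s t)" unfolding ang_def by (simp only: cis_pi_half[symmetric] cis_mult add.commute)
  also have "\<i> * ?w = (\<gamma> t - \<gamma> s) / \<gamma>' s" by (simp only: mult_minus_left mult_minus_right mult.assoc[symmetric] i_squared) simp
  finally show ?thesis by (simp add: norm_mult norm_divide)
qed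

lemma diff_quotient_tendsto: "((\<lambda>t. (\<gamma> t - \<gamma> s) / of_real (t - s)) \<longlongrightarrow> \<gamma>' s) (at s)"
proof -
  have "((\<lambda>t. (\<gamma> t - \<gamma> s - (t - s) *\<^sub>R \<gamma>' s) /\<^sub>R norm (t - s)) \<longlongrightarrow> 0) (at s)"
    using deriv1[of s] by (simp add: has_vector_derivative_def has_derivative_at_within)
  then have "((\<lambda>t. norm ((\<gamma> t - \<gamma> s) / of_real (t - s) - \<gamma>' s)) \<longlongrightarrow> 0) (at s)"
  proof (rule Lim_transform_eventually[OF tendsto_norm_zero])
    have "norm ((\<gamma> t - \<gamma> s - (t - s) *\<^sub>R \<gamma>' s) /\<^sub>R norm (t - s)) = norm ((\<gamma> t - \<gamma> s) / of_real (t - s) - \<gamma>' s)"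
      if "t \<noteq> s" for t
    proof -
      have "(\<gamma> t - \<gamma> s) / of_real (t - s) - \<gamma>' s = (\<gamma> t - \<gamma> s - (t - s) *\<^sub>R \<gamma>' s) / of_real (t - s)"
        using that by (simp add: diff_divide_distrib scaleR_conv_of_real)
      then show ?thesis by (simp only: norm_divide norm_scaleR norm_of_real) (simp add: divide_inverse mult.commute)
    qed
    then show "\<forall>\<^sub>F t in at s. norm ((\<gamma> t - \<gamma> s - (t - s) *\<^sub>R \<gamma>' s) /\<^sub>R norm (t - s)) = norm ((\<gamma> t - \<gamma> s) / of_real (t - s) - \<gamma>' s)"
      by (auto simp: eventually_at_filter)
  qed
  then show ?thesis using tendsto_norm_zero_iff LIM_zero_cancel by blast
qed

text \<open>Division of the chord by \<open>t - s > 0\<close> preserves its argument and turns the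
  limit into \<open>\<gamma>' s\<close>, whose angle with the tangent is 0.\<close>

lemma ang_tendsto_left: "(ang s \<longlongrightarrow> 0) (at_right s)"
proof -
  have ev: "\<forall>\<^sub>F t in at_right s. t \<in> {s<..<s+1}" by (rule eventually_at_right_real) simp
  have "((\<lambda>t. - \<i> * ((\<gamma> t - \<gamma> s) / of_real (t - s) / \<gamma>' s)) \<longlongrightarrow> - \<i> * (\<gamma>' s / \<gamma>' s)) (at_right s)"
    by (intro tendsto_intros filterlim_mono[OF diff_quotient_tendsto order_refl] at_le regular) auto
  then have "((\<lambda>t. Ln (- \<i> * ((\<gamma> t - \<gamma> s) / of_real (t - s) / \<gamma>' s))) \<longlongrightarrow> Ln (- \<i>)) (at_right s)"
    using regular[of s] by (intro tendsto_Ln) (auto simp: complex_nonpos_Reals_iff)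
  then have "((\<lambda>t. Im (Ln (- \<i> * ((\<gamma> t - \<gamma> s) / of_real (t - s) / \<gamma>' s))) + pi/2) \<longlongrightarrow> Im (Ln (- \<i>)) + pi/2) (at_right s)"
    by (intro tendsto_add tendsto_Im tendsto_const)
  then have "((\<lambda>t. Im (Ln (- \<i> * ((\<gamma> t - \<gamma> s) / of_real (t - s) / \<gamma>' s))) + pi/2) \<longlongrightarrow> 0) (at_right s)"
    by simp
  moreover have "\<forall>\<^sub>F t in at_right s. Im (Ln (- \<i> * ((\<gamma> t - \<gamma> s) / of_real (t - s) / \<gamma>' s))) + pi/2 = ang s t"
    using ev
  proof (eventually_elim)
    fix t assume t: "t \<in> {s<..<s+1}"
    have "- \<i> * ((\<gamma> t - \<gamma> s) / of_real (t - s) / \<gamma>' s) = of_real (1 / (t - s)) * (- \<i> * ((\<gamma> t - \<gamma> s) / \<gamma>' s))"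
      by simp
    also have "Ln \<dots> = Ln (of_real (1 / (t - s))) + Ln (- \<i> * ((\<gamma> t - \<gamma> s) / \<gamma>' s))"
      using t ang_arg_slit(2)[of s t] by (intro Ln_times_of_real) auto
    also have "Ln (of_real (1 / (t - s))) = of_real (ln (1 / (t - s)))" using t by (intro Ln_of_real) auto
    finally show "Im (Ln (- \<i> * ((\<gamma> t - \<gamma> s) / of_real (t - s) / \<gamma>' s))) + pi/2 = ang s t"
      by (simp add: ang_def)
  qed
  ultimately show ?thesis by (rule Lim_transform_eventually)
qed

text \<open>Near \<open>s + 1\<close> the divisor \<open>t - (s + 1)\<close> is negative, so the
  chord points against the tangent and the angle tends to \<open>pi\<close>.\<close>

lemma ang_tendsto_right: "(ang s \<longlongrightarrow> pi) (at_left (s + 1))"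
proof -
  have ev: "\<forall>\<^sub>F t in at_left (s + 1). t \<in> {s<..<s+1}" by (rule eventually_at_left_real) simp
  have 1: "((\<lambda>t. (\<gamma> t - \<gamma> s) / of_real (t - (s + 1))) \<longlongrightarrow> \<gamma>' s) (at (s + 1))"
    using diff_quotient_tendsto[of "s + 1"] by (simp add: period period1)
  have "((\<lambda>t. \<i> * ((\<gamma> t - \<gamma> s) / of_real (t - (s + 1)) / \<gamma>' s)) \<longlongrightarrow> \<i> * (\<gamma>' s / \<gamma>' s)) (at_left (s + 1))"
    by (intro tendsto_intros filterlim_mono[OF 1 order_refl] at_le regular) auto
  then have "((\<lambda>t. Ln (\<i> * ((\<gamma> t - \<gamma> s) / of_real (t - (s + 1)) / \<gamma>' s))) \<longlongrightarrow> Ln \<i>) (at_left (s + 1))"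
    using regular[of s] by (intro tendsto_Ln) (auto simp: complex_nonpos_Reals_iff)
  then have "((\<lambda>t. Im (Ln (\<i> * ((\<gamma> t - \<gamma> s) / of_real (t - (s + 1)) / \<gamma>' s))) + pi/2) \<longlongrightarrow> Im (Ln \<i>) + pi/2) (at_left (s + 1))"
    by (intro tendsto_add tendsto_Im tendsto_const)
  then have "((\<lambda>t. Im (Ln (\<i> * ((\<gamma> t - \<gamma> s) / of_real (t - (s + 1)) / \<gamma>' s))) + pi/2) \<longlongrightarrow> pi) (at_left (s + 1))"
    by simp
  moreover have "\<forall>\<^sub>F t in at_left (s + 1). Im (Ln (\<i> * ((\<gamma> t - \<gamma> s) / of_real (t - (s + 1)) / \<gamma>' s))) + pi/2 = ang s t"
    using ev
  proof (eventually_elim)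
    fix t assume t: "t \<in> {s<..<s+1}"
    have "\<i> * ((\<gamma> t - \<gamma> s) / of_real (t - (s + 1)) / \<gamma>' s) = of_real (1 / (s + 1 - t)) * (- \<i> * ((\<gamma> t - \<gamma> s) / \<gamma>' s))"
      using t by (simp add: divide_simps) (simp add: algebra_simps)
    also have "Ln \<dots> = Ln (of_real (1 / (s + 1 - t))) + Ln (- \<i> * ((\<gamma> t - \<gamma> s) / \<gamma>' s))"
      using t ang_arg_slit(2)[of s t] by (intro Ln_times_of_real) auto
    also have "Ln (of_real (1 / (s + 1 - t))) = of_real (ln (1 / (s + 1 - t)))" using t by (intro Ln_of_real) auto
    finally show "Im (Ln (\<i> * ((\<gamma> t - \<gamma> s) / of_real (t - (s + 1)) / \<gamma>' s))) + pi/2 = ang s t"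
      by (simp add: ang_def)
  qed
  ultimately show ?thesis by (rule Lim_transform_eventually)
qed

lemma ang_bounds:
  assumes "s < t" "t < s + 1"
  shows "0 \<le> ang s t" "ang s t \<le> pi"
proof -
  let ?w = "- \<i> * ((\<gamma> t - \<gamma> s) / \<gamma>' s)"
  have "Re ?w \<ge> 0" using ccw[OF in_Omega, of t s] by (simp only: mult_minus_left Re_i_times uminus_complex.sel)
  then have "\<bar>Im (Ln ?w)\<bar> \<le> pi / 2" using Re_Ln_pos_le ang_arg_slit(2)[OF assms] by blast
  then show "0 \<le> ang s t" "ang s t \<le> pi" unfolding ang_def by linarith+
qed

lemma k_cont: "(\<And>t. t \<in> S \<Longrightarrow> \<gamma> t \<noteq> \<gamma> s) \<Longrightarrow> continuous_on S (\<lambda>t. k t s)"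
  unfolding k_def by (intro continuous_on_Im continuous_on_divide continuous_on_diff continuous_on_const cont cont1) auto

text \<open>The lines through \<open>\<gamma> s\<close> are parametrised by their second point on
  the curve. The angle is only nondecreasing, since \<open>k\<close> vanishes along boundary
  segments, and at the ends of the parameter interval it only has limits; hence the substitution on
  compact subintervals followed by exhaustion.\<close>

lemma nn_integral_ang_substitution:
  fixes f :: "real \<Rightarrow> ennreal"
  assumes f[measurable]: "f \<in> borel_measurable borel"
  shows "(\<integral>\<^sup>+x. f x * indicator {0<..<pi} x \<partial>lborel)
    = (\<integral>\<^sup>+t. f (ang s t) * ennreal (k t s) * indicator {s<..<s+1} t \<partial>lborel)"
proof -
  \<comment> \<open>The summand 3 keeps \<open>d n\<close> below \<open>1/2\<close>, so that all the
    intervals are nonempty and lie in \<open>{s<..<s+1}\<close>.\<close>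
  define d where "d n = 1 / (real n + 3)" for n
  have d: "0 < d n" "d n < 1/2" for n by (auto simp: d_def field_simps)
  have d_dec: "d n \<le> d m" if "m \<le> n" for m n using that by (auto simp: d_def intro!: divide_left_mono)
  have d_lim: "d \<longlonglongrightarrow> 0" unfolding d_def by real_asymp
  let ?A = "\<lambda>n. {s + d n..s + 1 - d n}" and ?B = "\<lambda>n. {ang s (s + d n)..ang s (s + 1 - d n)}"
  have eq: "(\<integral>\<^sup>+x. f x * indicator (?B n) x \<partial>lborel)
    = (\<integral>\<^sup>+t. f (ang s t) * ennreal (k t s) * indicator (?A n) t \<partial>lborel)" for n
  proof (rule nn_integral_substitution_aux)
    show "(ang s has_real_derivative k t s) (at t)" if "t \<in> ?A n" for t
      using that d[of n] by (intro ang_deriv) auto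
    show "continuous_on (?A n) (\<lambda>t. k t s)"
    proof (rule k_cont)
      show "\<gamma> t \<noteq> \<gamma> s" if "t \<in> ?A n" for t using neq[of s t] that d[of n] by auto
    qed
  qed (use d[of n] in \<open>auto simp: k_nonneg\<close>)
  have mono_ang: "ang s x \<le> ang s y" if "s < x" "x \<le> y" "y < s + 1" for x y
    by (rule DERIV_nonneg_imp_nondecreasing[OF that(2)]) (use that ang_deriv k_nonneg in \<open>meson le_less_trans less_le_trans\<close>)
  have incA: "incseq ?A" using d_dec by (auto simp: incseq_def intro: order_trans[OF add_left_mono] order_trans[OF _ diff_left_mono])
  have incB: "incseq ?B"
  proof (unfold incseq_def, intro allI impI)
    fix m n :: nat assume "m \<le> n"
    then have "ang s (s + d n) \<le> ang s (s + d m)" "ang s (s + 1 - d m) \<le> ang s (s + 1 - d n)"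
      using d_dec[of m n] d[of m] d[of n] by (auto intro!: mono_ang)
    then show "?B m \<subseteq> ?B n" by auto
  qed
  have UA: "(\<Union>n. ?A n) = {s<..<s+1}"
  proof (intro equalityI subsetI)
    fix x assume x: "x \<in> {s<..<s+1}"
    have "\<forall>\<^sub>F n in sequentially. d n < min (x - s) (s + 1 - x)"
      using x by (intro order_tendstoD(2)[OF d_lim]) auto
    then obtain n where "d n < min (x - s) (s + 1 - x)" by (auto simp: eventually_sequentially)
    then show "x \<in> (\<Union>n. ?A n)" by (intro UN_I[of n]) auto
  next
    fix x assume "x \<in> (\<Union>n. ?A n)"
    then obtain n where "x \<in> ?A n" by blast
    then show "x \<in> {s<..<s+1}" using d[of n] by auto
  qed
  have lim1: "(\<lambda>n. ang s (s + d n)) \<longlonglongrightarrow> 0"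
    by (rule filterlim_compose[OF ang_tendsto_left])
       (auto simp: filterlim_at d less_imp_neq[OF d(1), symmetric] intro!: tendsto_eq_intros d_lim)
  have lim2: "(\<lambda>n. ang s (s + 1 - d n)) \<longlonglongrightarrow> pi"
    by (rule filterlim_compose[OF ang_tendsto_right])
       (auto simp: filterlim_at d less_imp_neq[OF d(1), symmetric] intro!: tendsto_eq_intros d_lim)
  have UB1: "(\<Union>n. ?B n) \<subseteq> {0..pi}"
  proof (rule UN_least)
    fix n
    have "0 \<le> ang s (s + d n)" "ang s (s + 1 - d n) \<le> pi" using d[of n] by (auto intro!: ang_bounds)
    then show "?B n \<subseteq> {0..pi}" by auto
  qed
  have UB2: "{0<..<pi} \<subseteq> (\<Union>n. ?B n)"
  proof
    fix x assume x: "x \<in> {0<..<pi}"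
    have "\<forall>\<^sub>F n in sequentially. ang s (s + d n) < x" "\<forall>\<^sub>F n in sequentially. x < ang s (s + 1 - d n)"
      using order_tendstoD(2)[OF lim1] order_tendstoD(1)[OF lim2] x by auto
    then have "\<forall>\<^sub>F n in sequentially. x \<in> ?B n" by eventually_elim auto
    then show "x \<in> (\<Union>n. ?B n)" by (auto simp: eventually_sequentially)
  qed
  have [measurable]: "(\<lambda>t. f (ang s t) * ennreal (k t s) * indicator {s<..<s+1} t) \<in> borel_measurable borel"
  proof -
    have [measurable]: "(\<lambda>t. indicator {s<..<s+1} t *\<^sub>R ang s t) \<in> borel_measurable borel"
      by (rule borel_measurable_continuous_on_indicator)
         (auto intro!: continuous_at_imp_continuous_on DERIV_isCont[OF ang_deriv])
    have "(\<lambda>t. f (ang s t) * ennreal (k t s) * indicator {s<..<s+1} t)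
       = (\<lambda>t. f (indicator {s<..<s+1} t *\<^sub>R ang s t) * ennreal (k t s) * indicator {s<..<s+1} t)"
      by (auto simp: indicator_def fun_eq_iff)
    moreover have "\<dots> \<in> borel_measurable borel" by measurable
    ultimately show ?thesis by simp
  qed
  have "(\<lambda>n. \<integral>\<^sup>+t. (f (ang s t) * ennreal (k t s) * indicator {s<..<s+1} t) * indicator (?A n) t \<partial>lborel)
    \<longlonglongrightarrow> (\<integral>\<^sup>+t. (f (ang s t) * ennreal (k t s) * indicator {s<..<s+1} t) * indicator (\<Union>n. ?A n) t \<partial>lborel)"
    by (rule nn_integral_indicator_LIMSEQ) (use incA in auto)
  also have "(\<lambda>n. \<integral>\<^sup>+t. (f (ang s t) * ennreal (k t s) * indicator {s<..<s+1} t) * indicator (?A n) t \<partial>lborel)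
     = (\<lambda>n. \<integral>\<^sup>+x. f x * indicator (?B n) x \<partial>lborel)"
    unfolding eq
  proof (rule ext, rule nn_integral_cong)
    fix n t show "(f (ang s t) * ennreal (k t s) * indicator {s<..<s+1} t) * indicator (?A n) t = f (ang s t) * ennreal (k t s) * indicator (?A n) t"
      using d[of n] by (auto simp: indicator_def)
  qed
  also have "(\<integral>\<^sup>+t. (f (ang s t) * ennreal (k t s) * indicator {s<..<s+1} t) * indicator (\<Union>n. ?A n) t \<partial>lborel)
     = (\<integral>\<^sup>+t. f (ang s t) * ennreal (k t s) * indicator {s<..<s+1} t \<partial>lborel)"
    unfolding UA by (intro nn_integral_cong) (auto simp: indicator_def)
  finally have "(\<lambda>n. \<integral>\<^sup>+x. f x * indicator (?B n) x \<partial>lborel)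
      \<longlonglongrightarrow> (\<integral>\<^sup>+t. f (ang s t) * ennreal (k t s) * indicator {s<..<s+1} t \<partial>lborel)" .
  moreover have "(\<lambda>n. \<integral>\<^sup>+x. f x * indicator (?B n) x \<partial>lborel)
      \<longlonglongrightarrow> (\<integral>\<^sup>+x. f x * indicator (\<Union>n. ?B n) x \<partial>lborel)"
    by (rule nn_integral_indicator_LIMSEQ) (use incB in auto)
  ultimately have "(\<integral>\<^sup>+t. f (ang s t) * ennreal (k t s) * indicator {s<..<s+1} t \<partial>lborel)
      = (\<integral>\<^sup>+x. f x * indicator (\<Union>n. ?B n) x \<partial>lborel)" by (rule LIMSEQ_unique)
  also have "\<dots> = (\<integral>\<^sup>+x. f x * indicator {0<..<pi} x \<partial>lborel)"
  proof (rule nn_integral_cong_AE)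
    have "AE x in lborel. x \<noteq> 0 \<and> x \<noteq> pi" using AE_lborel_singleton[of 0] AE_lborel_singleton[of pi] by auto
    then show "AE x in lborel. f x * indicator (\<Union>n. ?B n) x = f x * indicator {0<..<pi} x"
    proof eventually_elim
      case (elim x)
      then have "x \<in> (\<Union>n. ?B n) \<longleftrightarrow> x \<in> {0<..<pi}" using UB1 UB2 by force
      then show ?case by (simp add: indicator_def)
    qed
  qed
  finally show ?thesis ..
qed

text \<open>The chord from a fixed boundary point sweeps the angles from 0 to \<open>pi\<close>
  exactly once. That the value does not depend on \<open>s\<close> is what makes the energy
  invariant.\<close>

lemma nn_integral_k: "(\<integral>\<^sup>+t. ennreal (k t s) * indicator {0..1} t \<partial>lborel) = ennreal pi"
proof -
  have "(\<integral>\<^sup>+x. 1 * indicator {0<..<pi} x \<partial>lborel) = (\<integral>\<^sup>+t. ennreal (k t s) * indicator {s<..<s+1} t \<partial>lborel)"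
    using nn_integral_ang_substitution[of "\<lambda>_. 1" s] by simp
  also have "\<dots> = (\<integral>\<^sup>+t. ennreal (k t s) * indicator {0..1} t \<partial>lborel)"
    by (rule set_nn_integral_shift_period) (use k_period_int[of _ 1 _ 0] in auto)
  finally show ?thesis by simp
qed

end

section \<open>Chords of lines in the complex plane\<close>

text \<open>Turns a change of variables stated as an equivalence of integrability with value
  \<open>c\<close> into an identity of possibly infinite integrals: if one side fails to be
  integrable, both are infinite.\<close>

lemma nn_integral_eq_if_integrable_iff:
  fixes a b :: "real \<Rightarrow> real"
  assumes a: "a \<in> borel_measurable M" "\<And>x. 0 \<le> a x" and b: "b \<in> borel_measurable N" "\<And>x. 0 \<le> b x"
    and iff: "\<And>c. integrable M a \<and> integral\<^sup>L M a = c \<longleftrightarrow> integrable N b \<and> integral\<^sup>L N b = c"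
  shows "(\<integral>\<^sup>+x. ennreal (a x) \<partial>M) = (\<integral>\<^sup>+x. ennreal (b x) \<partial>N)"
proof (cases "integrable M a")
  case True
  then have "integrable N b" "integral\<^sup>L N b = integral\<^sup>L M a" using iff[of "integral\<^sup>L M a"] by auto
  then show ?thesis using True a b by (simp add: nn_integral_eq_integral)
next
  case False
  then have "\<not> integrable N b" using iff by metis
  have "(\<integral>\<^sup>+x. ennreal (a x) \<partial>M) = \<infinity>"
    using False a by (simp add: integrable_iff_bounded not_less top_unique)
  moreover have "(\<integral>\<^sup>+x. ennreal (b x) \<partial>N) = \<infinity>"
    using \<open>\<not> integrable N b\<close> b by (simp add: integrable_iff_bounded not_less top_unique)
  ultimately show ?thesis by simp
qed

lemma nn_integral_change_of_variables_inj:
  fixes f g g' :: "real \<Rightarrow> real"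
  assumes S[measurable]: "S \<in> sets borel"
    and der: "\<And>x. x \<in> S \<Longrightarrow> (g has_field_derivative g' x) (at x within S)" and inj: "inj_on g S"
    and f[measurable]: "f \<in> borel_measurable borel" and f0: "\<And>x. 0 \<le> f x"
    and g[measurable]: "g \<in> borel_measurable borel" and g'[measurable]: "g' \<in> borel_measurable borel"
  shows "(\<integral>\<^sup>+y. ennreal (f y) * indicator (g ` S) y \<partial>lborel) = (\<integral>\<^sup>+x. ennreal (\<bar>g' x\<bar> * f (g x)) * indicator S x \<partial>lborel)"
proof -
  have S': "S \<in> sets lebesgue" using S by simp
  have "g differentiable_on S" using der
    unfolding differentiable_on_def by (meson differentiable_def has_field_derivative_imp_has_derivative)
  then have gS: "g ` S \<in> sets lebesgue" by (intro differentiable_image_in_sets_lebesgue[OF S']) auto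
  have m1: "(\<lambda>x. indicator S x *\<^sub>R (\<bar>g' x\<bar> * f (g x))) \<in> borel_measurable lebesgue"
    by (intro measurable_completion) measurable
  have m2: "(\<lambda>x. indicator (g ` S) x *\<^sub>R f x) \<in> borel_measurable lebesgue"
    using gS f by (intro borel_measurable_scaleR borel_measurable_indicator measurable_completion) auto
  have iff: "integrable lebesgue (\<lambda>x. indicator (g ` S) x *\<^sub>R f x) \<and> (LINT x|lebesgue. indicator (g ` S) x *\<^sub>R f x) = c
    \<longleftrightarrow> integrable lebesgue (\<lambda>x. indicator S x *\<^sub>R (\<bar>g' x\<bar> * f (g x))) \<and> (LINT x|lebesgue. indicator S x *\<^sub>R (\<bar>g' x\<bar> * f (g x))) = c" for c
    using has_absolute_integral_change_of_variables_1'[OF S' der inj, of f c]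
      set_lebesgue_integral_eq_integral(2)[of "g ` S" f] set_lebesgue_integral_eq_integral(2)[of S "\<lambda>x. \<bar>g' x\<bar> * f (g x)"]
    unfolding set_integrable_def set_lebesgue_integral_def by auto
  have "(\<integral>\<^sup>+x. ennreal (indicator (g ` S) x *\<^sub>R f x) \<partial>lebesgue) = (\<integral>\<^sup>+x. ennreal (indicator S x *\<^sub>R (\<bar>g' x\<bar> * f (g x))) \<partial>lebesgue)"
    by (rule nn_integral_eq_if_integrable_iff[OF m2 _ m1 _ iff]) (auto simp: f0)
  then show ?thesis
    unfolding nn_integral_completion
    by (subst (1 2) nn_integral_cong[OF mult.commute]) (simp add: f0 ennreal_mult' ennreal_indicator mult.commute flip: ennreal_indicator)
qed

section \<open>Lines in the complex plane and measurability of the chord length\<close>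

definition cline :: "real \<Rightarrow> real \<Rightarrow> complex set"
  where "cline p \<phi> = {z. Re z * cos \<phi> + Im z * sin \<phi> = p}"

definition inverse_chord :: "complex set \<Rightarrow> real \<Rightarrow> real \<Rightarrow> ennreal"
  where "inverse_chord \<Omega> p \<phi> = (if cline p \<phi> \<inter> \<Omega> = {} then 0 else 1 / ennreal (diameter (cline p \<phi> \<inter> \<Omega>)))"

lemma closed_cline: "closed (cline p \<phi>)"
  unfolding cline_def by (intro closed_Collect_eq continuous_intros)

lemma cline_antipodal: "cline p (\<phi> + pi) = cline (- p) \<phi>"
  by (auto simp: cline_def)

lemma inverse_chord_antipodal: "inverse_chord \<Omega> p (\<phi> + pi) = inverse_chord \<Omega> (- p) \<phi>"
  by (simp add: inverse_chord_def cline_antipodal)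

lemma inverse_chord_period: "inverse_chord \<Omega> p (\<phi> + 2 * pi) = inverse_chord \<Omega> p \<phi>"
  by (simp add: inverse_chord_def cline_def)

text \<open>The lines with a chord of length at least \<open>c\<close> form a closed set: they are
  the projection, along the compact set of pairs of points of the domain, of a closed set of
  incidences.\<close>

lemma inverse_chord_borel:
  assumes "compact \<Omega>"
  shows "(\<lambda>(p, \<phi>). inverse_chord \<Omega> p \<phi>) \<in> borel_measurable borel"
proof -
  let ?on = "\<lambda>x q. Re x * cos (snd q) + Im x * sin (snd q) = fst q"
  have cl: "closed {q. \<exists>x y. x \<in> \<Omega> \<and> y \<in> \<Omega> \<and> ?on x q \<and> ?on y q \<and> c \<le> dist x y}" for c :: real
  proof -
    let ?T = "{r. ?on (fst (fst r)) (snd r) \<and> ?on (snd (fst r)) (snd r) \<and> c \<le> dist (fst (fst r)) (snd (fst r))}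
       :: ((complex \<times> complex) \<times> (real \<times> real)) set"
    have "closed ?T" by (intro closed_Collect_conj closed_Collect_eq closed_Collect_le continuous_intros)
    then have "closed {q. \<exists>xy. xy \<in> \<Omega> \<times> \<Omega> \<and> (xy, q) \<in> ?T}"
      by (intro closed_compact_projection compact_Times assms)
    also have "{q. \<exists>xy. xy \<in> \<Omega> \<times> \<Omega> \<and> (xy, q) \<in> ?T} = {q. \<exists>x y. x \<in> \<Omega> \<and> y \<in> \<Omega> \<and> ?on x q \<and> ?on y q \<and> c \<le> dist x y}"
      by auto
    finally show ?thesis .
  qed
  have comp: "compact (cline p \<phi> \<inter> \<Omega>)" for p \<phi> using assms closed_cline by (intro closed_Int_compact)
  let ?D = "\<lambda>q. diameter (cline (fst q) (snd q) \<inter> \<Omega>)"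
  \<comment> \<open>For \<open>c > 0\<close> a diameter of at least \<open>c\<close> excludes the
    empty chord, which also has diameter 0.\<close>
  have D_ge: "{q. c \<le> ?D q} = {q. \<exists>x y. x \<in> \<Omega> \<and> y \<in> \<Omega> \<and> ?on x q \<and> ?on y q \<and> c \<le> dist x y}" if "c > 0" for c
  proof (intro equalityI subsetI CollectI; elim CollectE exE conjE)
    fix q assume c: "c \<le> ?D q"
    then have "cline (fst q) (snd q) \<inter> \<Omega> \<noteq> {}" using that by auto
    from diameter_compact_attained[OF comp this] obtain x y where
      "x \<in> cline (fst q) (snd q) \<inter> \<Omega>" "y \<in> cline (fst q) (snd q) \<inter> \<Omega>" "dist x y = ?D q" by blast
    then show "\<exists>x y. x \<in> \<Omega> \<and> y \<in> \<Omega> \<and> ?on x q \<and> ?on y q \<and> c \<le> dist x y"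
      using c by (intro exI[of _ x] exI[of _ y]) (auto simp: cline_def)
  next
    fix q x y assume "x \<in> \<Omega>" "y \<in> \<Omega>" "?on x q" "?on y q" "c \<le> dist x y"
    moreover from this have "dist x y \<le> ?D q"
      by (intro diameter_bounded_bound compact_imp_bounded comp) (auto simp: cline_def)
    ultimately show "c \<le> ?D q" by simp
  qed
  have [measurable]: "?D \<in> borel_measurable borel"
    unfolding borel_measurable_iff_ge
  proof
    fix c :: real
    show "{q \<in> space borel. c \<le> ?D q} \<in> sets borel"
    proof (cases "c > 0")
      case True then show ?thesis using cl[of c] D_ge by (simp add: borel_closed)
    next
      case False
      then have "{q. c \<le> ?D q} = UNIV"
        using diameter_ge_0[OF compact_imp_bounded[OF comp]] by (auto intro: order_trans[of c 0])
      then show ?thesis by simp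
    qed
  qed
  have E: "{q. cline (fst q) (snd q) \<inter> \<Omega> = {}} \<in> sets borel"
  proof -
    have "- {q. cline (fst q) (snd q) \<inter> \<Omega> = {}} = {q. \<exists>x y. x \<in> \<Omega> \<and> y \<in> \<Omega> \<and> ?on x q \<and> ?on y q \<and> 0 \<le> dist x y}"
      by (auto simp: cline_def)
    then have "- {q. cline (fst q) (snd q) \<inter> \<Omega> = {}} \<in> sets borel" using cl[of 0] by (simp add: borel_closed)
    then show ?thesis by (metis borel_comp double_complement)
  qed
  show ?thesis
    unfolding inverse_chord_def split_def
    by (rule measurable_If) (use E in \<open>auto intro!: borel_measurable_divide_ennreal\<close>)
qed

lemma inverse_chord_measurable[measurable (raw)]:
  assumes "compact \<Omega>" and [measurable]: "f \<in> borel_measurable M" "g \<in> borel_measurable M"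
  shows "(\<lambda>x. inverse_chord \<Omega> (f x) (g x)) \<in> borel_measurable M"
proof -
  have "(\<lambda>x. (f x, g x)) \<in> measurable M borel" by measurable
  from measurable_compose[OF this inverse_chord_borel[OF assms(1)]] show ?thesis by simp
qed

section \<open>Passage from the space of lines to an iterated integral over the parameters\<close>

definition to_complex :: "real^2 \<Rightarrow> complex" where "to_complex x = Complex (x $ 1) (x $ 2)"

lemma to_complex_dist: "dist (to_complex x) (to_complex y) = dist x y"
  by (simp add: to_complex_def dist_complex_def dist_vec_def L2_set_def sum_2 cmod_def dist_real_def)

lemma linear_to_complex: "linear to_complex"
  by (rule linearI) (auto simp: to_complex_def complex_eq_iff)

lemma inj_to_complex: "inj to_complex"
  by (rule injI) (metis to_complex_dist dist_eq_0_iff)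

lemma surj_to_complex: "surj to_complex"
proof (rule surjI)
  show "to_complex (vector [Re z, Im z]) = z" for z by (simp add: to_complex_def)
qed

lemma diameter_to_complex: "diameter (to_complex ` S) = diameter S"
proof -
  have "(\<lambda>(x, y). dist x y) ` (to_complex ` S \<times> to_complex ` S) = (\<lambda>(x, y). dist x y) ` (S \<times> S)"
    by (force simp: image_iff to_complex_dist)
  then show ?thesis by (simp add: diameter_def)
qed

lemma to_complex_line_of: "to_complex ` line_of (p, \<phi>) = cline p \<phi>"
proof -
  have "z \<in> to_complex ` line_of (p, \<phi>)" if "z \<in> cline p \<phi>" for z
    by (rule image_eqI[of _ _ "vector [Re z, Im z]"]) (use that in \<open>auto simp: to_complex_def cline_def line_of_def\<close>)
  then show ?thesis by (auto simp: to_complex_def cline_def line_of_def)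
qed

lemma inverse_chord_integral_eq:
  assumes "compact \<Omega>"
  shows "inverse_chord_integral \<Omega> =
    (\<integral>\<^sup>+\<phi>. (\<integral>\<^sup>+p. inverse_chord (to_complex ` \<Omega>) p \<phi> * indicator {0..} p \<partial>lborel) * indicator {0..2*pi} \<phi> \<partial>lborel)"
proof -
  let ?f = "\<lambda>L. if L \<inter> \<Omega> = {} then 0 else 1 / ennreal (chord_length L \<Omega>)"
  let ?S = "{\<A>. \<A> \<subseteq> affine_lines \<and> line_of -` \<A> \<inter> line_params \<in> sets borel}"
  let ?P = "restrict_space lborel line_params"
  have comp: "compact (to_complex ` \<Omega>)"
    using assms linear_to_complex by (intro compact_continuous_image linear_continuous_on) (auto simp: linear_conv_bounded_linear)
  have f_line: "?f (line_of q) = inverse_chord (to_complex ` \<Omega>) (fst q) (snd q)" for q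
  proof -
    have "to_complex ` (line_of q \<inter> \<Omega>) = cline (fst q) (snd q) \<inter> to_complex ` \<Omega>"
      using to_complex_line_of[of "fst q" "snd q"] inj_to_complex by (simp add: image_Int)
    then show ?thesis
      unfolding inverse_chord_def chord_length_def by (metis diameter_to_complex image_is_empty)
  qed
  have meas_P: "(\<lambda>q. ?f (line_of q)) \<in> borel_measurable (borel :: (real \<times> real) measure)"
    unfolding f_line using inverse_chord_borel[OF comp] by (simp add: split_def)
  have m1: "line_of \<in> measurable ?P (sigma affine_lines ?S)"
    using line_of_in_affine_lines line_params_borel
    by (intro measurable_measure_of) (auto simp: space_restrict_space sets_restrict_space_iff)
  \<comment> \<open>The sigma-algebra on lines consists of the sets with Borel preimage under
    \<open>line_of\<close>, so measurability of the integrand is that of its composition with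
    \<open>line_of\<close>.\<close>
  have m2: "?f \<in> borel_measurable (sigma affine_lines ?S)"
  proof (rule measurableI)
    fix B :: "ennreal set" assume B: "B \<in> sets borel"
    have "line_of -` (?f -` B \<inter> affine_lines) \<inter> line_params = (\<lambda>q. ?f (line_of q)) -` B \<inter> line_params"
      using line_of_in_affine_lines by auto
    also have "\<dots> \<in> sets borel"
      using measurable_sets[OF meas_P B] line_params_borel by auto
    finally show "?f -` B \<inter> space (sigma affine_lines ?S) \<in> sets (sigma affine_lines ?S)"
      unfolding sigma_algebra.sets_measure_of_eq[OF sigma_algebra_lines] by (simp add: space_measure_of_conv)
  qed simp
  have "inverse_chord_integral \<Omega> = (\<integral>\<^sup>+q. ?f (line_of q) \<partial>?P)"
    unfolding inverse_chord_integral_def line_measure_def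
    by (subst nn_integral_distr[OF m1]) (simp_all only: measurable_distr_eq1 m2)
  also have "\<dots> = (\<integral>\<^sup>+q. ?f (line_of q) * indicator line_params q \<partial>lborel)"
    by (rule nn_integral_restrict_space) (simp add: line_params_borel)
  also have "\<dots> = (\<integral>\<^sup>+q. inverse_chord (to_complex ` \<Omega>) (fst q) (snd q) * indicator line_params q \<partial>(lborel \<Otimes>\<^sub>M lborel))"
    unfolding f_line lborel_prod ..
  also have "\<dots> = (\<integral>\<^sup>+\<phi>. \<integral>\<^sup>+p. inverse_chord (to_complex ` \<Omega>) p \<phi> * indicator line_params (p, \<phi>) \<partial>lborel \<partial>lborel)"
  proof -
    have "(\<lambda>q. inverse_chord (to_complex ` \<Omega>) (fst q) (snd q) * indicator line_params q) \<in> borel_measurable (lborel \<Otimes>\<^sub>M lborel)"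
      using meas_P line_params_borel unfolding f_line lborel_prod by simp
    from lborel_pair.nn_integral_snd[OF this] show ?thesis by simp
  qed
  also have "\<dots> = (\<integral>\<^sup>+\<phi>. (\<integral>\<^sup>+p. inverse_chord (to_complex ` \<Omega>) p \<phi> * indicator {0..} p \<partial>lborel) * indicator {0..2*pi} \<phi> \<partial>lborel)"
  proof (rule nn_integral_cong_AE)
    have "AE \<phi> in lborel. \<phi> \<noteq> 2 * pi" by (rule AE_lborel_singleton)
    then show "AE \<phi> in lborel. (\<integral>\<^sup>+p. inverse_chord (to_complex ` \<Omega>) p \<phi> * indicator line_params (p, \<phi>) \<partial>lborel)
      = (\<integral>\<^sup>+p. inverse_chord (to_complex ` \<Omega>) p \<phi> * indicator {0..} p \<partial>lborel) * indicator {0..2*pi} \<phi>"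
    proof eventually_elim
      case (elim \<phi>)
      then have "indicator line_params (p, \<phi>) = (indicator {0..} p * indicator {0..2*pi} \<phi> :: ennreal)" for p
        by (auto simp: line_params_def indicator_def)
      then show ?case using comp
        by (subst nn_integral_multc[symmetric]) (auto simp: mult.assoc)
    qed
  qed
  finally show ?thesis .
qed

text \<open>Here \<open>p\<close> runs over all reals. The pairs \<open>(p, \<phi>)\<close> and
  \<open>(- p, \<phi> + pi)\<close> give the same line, so every line is counted twice; this is one
  source of the factor 1/2 between the integral and the energy, in which each chord likewise appears
  with its endpoints in both orders.\<close>

lemma twice_inverse_chord_integral:
  assumes "compact \<Omega>"
  shows "2 * inverse_chord_integral \<Omega> =
    (\<integral>\<^sup>+\<phi>. (\<integral>\<^sup>+p. inverse_chord (to_complex ` \<Omega>) p \<phi> \<partial>lborel) * indicator {0..2*pi} \<phi> \<partial>lborel)"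
proof -
  let ?G = "inverse_chord (to_complex ` \<Omega>)"
  have comp: "compact (to_complex ` \<Omega>)"
    using assms linear_to_complex by (intro compact_continuous_image linear_continuous_on) (auto simp: linear_conv_bounded_linear)
  note [measurable] = inverse_chord_measurable[OF comp]
  define g where "g \<phi> = (\<integral>\<^sup>+p. ?G p \<phi> * indicator {0..} p \<partial>lborel)" for \<phi>
  have [measurable]: "g \<in> borel_measurable borel" unfolding g_def by measurable
  have split: "(\<integral>\<^sup>+p. ?G p \<phi> \<partial>lborel) = g \<phi> + g (\<phi> + pi)" for \<phi>
  proof -
    have "g (\<phi> + pi) = (\<integral>\<^sup>+p. ?G (- p) \<phi> * indicator {0..} p \<partial>lborel)"
      by (simp add: g_def inverse_chord_antipodal)
    also have "\<dots> = (\<integral>\<^sup>+p. ?G p \<phi> * indicator {..0} p \<partial>lborel)"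
      by (subst (2) nn_integral_real_affine[where c = "-1" and t = 0]) (auto intro!: nn_integral_cong simp: indicator_def)
    finally have "g \<phi> + g (\<phi> + pi) = (\<integral>\<^sup>+p. ?G p \<phi> * indicator {0..} p + ?G p \<phi> * indicator {..0} p \<partial>lborel)"
      unfolding g_def by (subst nn_integral_add) auto
    also have "\<dots> = (\<integral>\<^sup>+p. ?G p \<phi> \<partial>lborel)"
      by (rule nn_integral_cong_AE, use AE_lborel_singleton[of "0::real"] in eventually_elim) (auto simp: indicator_def)
    finally show ?thesis ..
  qed
  have per: "g (\<phi> + 2 * pi) = g \<phi>" for \<phi> by (simp add: g_def inverse_chord_period)
  have ae: "(\<integral>\<^sup>+\<phi>. h \<phi> * indicator {c<..<d} \<phi> \<partial>lborel) = (\<integral>\<^sup>+\<phi>. h \<phi> * indicator {c..d} \<phi> \<partial>lborel)" for h and c d :: real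
  proof (rule nn_integral_cong_AE)
    have "AE x in lborel. x \<noteq> c \<and> x \<noteq> d" using AE_lborel_singleton[of c] AE_lborel_singleton[of d] by auto
    then show "AE x in lborel. h x * indicator {c<..<d} x = (h x * indicator {c..d} x)"
      by eventually_elim (auto simp: indicator_def)
  qed
  have "(\<integral>\<^sup>+\<phi>. g (\<phi> + pi) * indicator {0..2*pi} \<phi> \<partial>lborel) = (\<integral>\<^sup>+\<phi>. g \<phi> * indicator {pi..pi+2*pi} \<phi> \<partial>lborel)"
    by (subst (2) nn_integral_real_affine[where c = 1 and t = pi]) (auto intro!: nn_integral_cong simp: indicator_def add.commute)
  also have "\<dots> = (\<integral>\<^sup>+\<phi>. g \<phi> * indicator {0..2*pi} \<phi> \<partial>lborel)"
    unfolding ae[symmetric, of g pi] by (rule set_nn_integral_shift_period) (auto simp: per)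
  finally have sh: "(\<integral>\<^sup>+\<phi>. g (\<phi> + pi) * indicator {0..2*pi} \<phi> \<partial>lborel) = (\<integral>\<^sup>+\<phi>. g \<phi> * indicator {0..2*pi} \<phi> \<partial>lborel)" .
  have "(\<integral>\<^sup>+\<phi>. (\<integral>\<^sup>+p. ?G p \<phi> \<partial>lborel) * indicator {0..2*pi} \<phi> \<partial>lborel)
     = (\<integral>\<^sup>+\<phi>. g \<phi> * indicator {0..2*pi} \<phi> + g (\<phi> + pi) * indicator {0..2*pi} \<phi> \<partial>lborel)"
    by (simp add: split distrib_right)
  also have "\<dots> = (\<integral>\<^sup>+\<phi>. g \<phi> * indicator {0..2*pi} \<phi> \<partial>lborel) + (\<integral>\<^sup>+\<phi>. g (\<phi> + pi) * indicator {0..2*pi} \<phi> \<partial>lborel)"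
    by (rule nn_integral_add) auto
  also have "\<dots> = 2 * (\<integral>\<^sup>+\<phi>. g \<phi> * indicator {0..2*pi} \<phi> \<partial>lborel)"
    unfolding sh by (rule mult_2[symmetric])
  also have "\<dots> = 2 * inverse_chord_integral \<Omega>"
    unfolding inverse_chord_integral_eq[OF assms] g_def ..
  finally show ?thesis ..
qed

lemma nn_integral_indicator_Ioo_Icc:
  "(\<integral>\<^sup>+x. h x * indicator {c<..<d} x \<partial>lborel) = (\<integral>\<^sup>+x. h x * indicator {c..d::real} x \<partial>lborel)"
proof (rule nn_integral_cong_AE)
  have "AE x in lborel. x \<noteq> c \<and> x \<noteq> d" using AE_lborel_singleton[of c] AE_lborel_singleton[of d] by auto
  then show "AE x in lborel. h x * indicator {c<..<d} x = (h x * indicator {c..d} x)"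
    by eventually_elim (auto simp: indicator_def)
qed

section \<open>The measure of lines in terms of the boundary points they pass through\<close>

context convex_curve
begin

definition proj :: "real \<Rightarrow> complex \<Rightarrow> real"
  where "proj \<phi> z = Re z * cos \<phi> + Im z * sin \<phi>"

lemma mem_cline: "z \<in> cline p \<phi> \<longleftrightarrow> proj \<phi> z = p"
  by (simp add: cline_def proj_def)

lemma proj_cnj: "proj \<phi> z = Re (z * cnj (cis \<phi>))"
  by (simp add: proj_def)

lemma proj_lin: "proj \<phi> (x + y) = proj \<phi> x + proj \<phi> y" "proj \<phi> (x - y) = proj \<phi> x - proj \<phi> y"
  "proj \<phi> (of_real r * x) = r * proj \<phi> x" "proj \<phi> (\<i> * cis \<phi>) = 0"
  by (auto simp: proj_def algebra_simps)

lemma proj_cont: "continuous_on S (proj \<phi>)"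
  unfolding proj_def by (intro continuous_intros)

lemma proj_deriv: "((\<lambda>s. proj \<phi> (\<gamma> s)) has_real_derivative proj \<phi> (\<gamma>' s)) (at s)"
proof -
  have "((\<lambda>s. Re (\<gamma> s)) has_vector_derivative Re (\<gamma>' s)) (at s)" "((\<lambda>s. Im (\<gamma> s)) has_vector_derivative Im (\<gamma>' s)) (at s)"
    using bounded_linear.has_vector_derivative[OF bounded_linear_Re deriv1] bounded_linear.has_vector_derivative[OF bounded_linear_Im deriv1] by auto
  then have "((\<lambda>s. Re (\<gamma> s) * cos \<phi> + Im (\<gamma> s) * sin \<phi>) has_real_derivative Re (\<gamma>' s) * cos \<phi> + Im (\<gamma>' s) * sin \<phi>) (at s)"
    unfolding has_real_derivative_iff_has_vector_derivative[symmetric]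
    by (intro DERIV_add DERIV_cmult_right)
  then show ?thesis unfolding proj_def .
qed

text \<open>A step \<open>l\<close> along a line with normal angle \<open>\<phi>\<close> goes to the
  side of the tangent at \<open>\<gamma> s\<close> given by the sign of
  \<open>l * proj \<phi> (\<gamma>' s)\<close>. The crossing arguments below are sign arguments
  based on this.\<close>

lemma Im_dir: "Im ((of_real l * (\<i> * cis \<phi>)) / \<gamma>' s) = l * proj \<phi> (\<gamma>' s) / (cmod (\<gamma>' s))\<^sup>2"
proof -
  have "(of_real l * (\<i> * cis \<phi>)) / \<gamma>' s = (of_real l * (\<i> * cis \<phi>) * cnj (\<gamma>' s)) / of_real ((cmod (\<gamma>' s))\<^sup>2)"
    using complex_div_cnj[of "of_real l * (\<i> * cis \<phi>)" "\<gamma>' s"] by simp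
  then show ?thesis by (simp add: proj_def algebra_simps)
qed

lemma same_line:
  assumes "proj \<phi> x = proj \<phi> y"
  obtains l where "y = x + of_real l * (\<i> * cis \<phi>)"
proof
  have "Re ((y - x) * cnj (cis \<phi>)) = 0" using assms by (simp only: proj_cnj[symmetric] proj_lin, simp?)
  then have "(y - x) * cnj (cis \<phi>) = of_real (Im ((y - x) * cnj (cis \<phi>))) * \<i>" by (simp add: complex_eq_iff)
  then have "(y - x) * (cnj (cis \<phi>) * cis \<phi>) = of_real (Im ((y - x) * cnj (cis \<phi>))) * \<i> * cis \<phi>" by (metis mult.assoc)
  also have "cnj (cis \<phi>) * cis \<phi> = 1" by (simp add: cis_cnj cis_mult)
  finally show "y = x + of_real (Im ((y - x) * cnj (cis \<phi>))) * (\<i> * cis \<phi>)" by (simp add: algebra_simps)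
qed

lemma extremal_tangent:
  assumes "(\<forall>x\<in>\<Omega>. proj \<phi> x \<le> proj \<phi> (\<gamma> s)) \<or> (\<forall>x\<in>\<Omega>. proj \<phi> (\<gamma> s) \<le> proj \<phi> x)"
  shows "proj \<phi> (\<gamma>' s) = 0"
  using assms
proof
  assume "\<forall>x\<in>\<Omega>. proj \<phi> x \<le> proj \<phi> (\<gamma> s)"
  then show ?thesis by (intro DERIV_local_max[OF proj_deriv, of 1]) (auto simp: in_Omega)
next
  assume "\<forall>x\<in>\<Omega>. proj \<phi> (\<gamma> s) \<le> proj \<phi> x"
  then show ?thesis by (intro DERIV_local_min[OF proj_deriv, of 1]) (auto simp: in_Omega)
qed

text \<open>From an interior point one walks towards whichever of \<open>x1\<close>,
  \<open>x2\<close> lies beyond the level \<open>p\<close>; by convexity only the last point of such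
  a walk can leave the interior.\<close>

lemma line_meets_interior:
  assumes "x1 \<in> \<Omega>" "x2 \<in> \<Omega>" "proj \<phi> x1 < p" "p < proj \<phi> x2"
  obtains y where "y \<in> interior \<Omega>" "proj \<phi> y = p"
proof -
  obtain y0 where y0: "y0 \<in> interior \<Omega>" using interior by blast
  have *: "\<exists>y\<in>interior \<Omega>. proj \<phi> y = p" if x: "x \<in> \<Omega>" and ne: "proj \<phi> y0 \<noteq> proj \<phi> x" and t: "t \<in> {0<..1}" "proj \<phi> x + t * (proj \<phi> y0 - proj \<phi> x) = p" for x t
  proof
    let ?y = "x - t *\<^sub>R (x - y0)"
    show "?y \<in> interior \<Omega>" using mem_interior_convex_shrink[OF convex y0 x, of t] t by auto
    show "proj \<phi> ?y = p" unfolding scaleR_conv_of_real proj_lin using t by (simp add: algebra_simps)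
  qed
  consider "proj \<phi> y0 = p" | "proj \<phi> y0 < p" | "proj \<phi> y0 > p" by linarith
  then have "\<exists>y\<in>interior \<Omega>. proj \<phi> y = p"
  proof cases
    case 2
    show ?thesis using *[OF assms(2), of "(proj \<phi> x2 - p) / (proj \<phi> x2 - proj \<phi> y0)"] 2 assms
      by (auto simp: field_simps)
  next
    case 3
    show ?thesis using *[OF assms(1), of "(p - proj \<phi> x1) / (proj \<phi> y0 - proj \<phi> x1)"] 3 assms
      by (auto simp: field_simps)
  qed (use y0 in auto)
  then show thesis using that by blast
qed

text \<open>The first point of the chord in the direction \<open>\<i> * cis \<phi>\<close> lies on
  the frontier. Since \<open>y\<close> comes later on the line and is strictly to the left of the
  tangent there, \<open>proj \<phi> (\<gamma>' s)\<close> is positive.\<close>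

lemma line_interior_entry:
  assumes y: "y \<in> interior \<Omega>" "proj \<phi> y = p"
  obtains s where "0 \<le> s" "s < 1" "proj \<phi> (\<gamma> s) = p" "proj \<phi> (\<gamma>' s) > 0"
proof -
  let ?d = "\<i> * cis \<phi>"
  have nd: "cmod ?d = 1" by (simp add: norm_mult)
  let ?C = "cline p \<phi> \<inter> \<Omega>"
  have yC: "y \<in> ?C" using y interior_subset by (auto simp: mem_cline)
  have C: "compact ?C" using closed_cline compact by (intro closed_Int_compact)
  have "continuous_on ?C (\<lambda>z. Re (z * cnj ?d))" by (intro continuous_intros)
  from continuous_attains_inf[OF C _ this] yC
  obtain x where x: "x \<in> ?C" "\<And>z. z \<in> ?C \<Longrightarrow> Re (x * cnj ?d) \<le> Re (z * cnj ?d)"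
    by blast
  have px: "proj \<phi> x = p" using x by (simp add: mem_cline)
  have dd: "?d * cnj ?d = 1" using complex_norm_square[of ?d] nd by simp
  have xni: "x \<notin> interior \<Omega>"
  proof
    assume "x \<in> interior \<Omega>"
    then obtain e where e: "e > 0" "cball x e \<subseteq> \<Omega>" by (auto simp: mem_interior_cball)
    let ?z = "x + of_real (- e) * ?d"
    have "?z \<in> \<Omega>" using e by (intro subsetD[OF e(2)]) (simp add: dist_norm norm_mult)
    moreover have "proj \<phi> ?z = p" by (simp only: proj_lin px, simp?)
    ultimately have "Re (x * cnj ?d) \<le> Re (?z * cnj ?d)" by (intro x(2)) (auto simp: mem_cline)
    also have "?z * cnj ?d = x * cnj ?d + of_real (- e) * (?d * cnj ?d)" by (simp only: algebra_simps)
    finally show False unfolding dd using e by simp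
  qed
  have "x \<in> frontier \<Omega>" using x xni closure_subset by (auto simp: frontier_def)
  then obtain s0 where "x = \<gamma> s0" using frontier by auto
  then have xs: "x = \<gamma> (frac s0)" by (simp add: period_frac)
  obtain l where l: "y = x + of_real l * ?d" using same_line[of \<phi> x y] px y by metis
  have "Re (x * cnj ?d) \<le> Re (y * cnj ?d)" by (rule x(2)[OF yC])
  also have "y * cnj ?d = x * cnj ?d + of_real l * (?d * cnj ?d)" unfolding l by (simp only: algebra_simps)
  finally have "l \<ge> 0" unfolding dd by simp
  have "0 < Im ((y - \<gamma> (frac s0)) / \<gamma>' (frac s0))" by (rule interior_left_of_tangent[OF y(1)])
  also have "y - \<gamma> (frac s0) = of_real l * ?d" using l xs by simp
  finally have "0 < l * proj \<phi> (\<gamma>' (frac s0)) / (cmod (\<gamma>' (frac s0)))\<^sup>2" unfolding Im_dir .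
  then have "0 < proj \<phi> (\<gamma>' (frac s0))" using \<open>l \<ge> 0\<close> by (auto simp: zero_less_divide_iff zero_less_mult_iff)
  then show thesis using that[of "frac s0"] px xs by (simp add: frac_lt_1)
qed

lemma diameter_pos_interior:
  assumes "y \<in> interior \<Omega>"
  shows "diameter (cline (proj \<phi> y) \<phi> \<inter> \<Omega>) > 0"
proof -
  obtain e where e: "e > 0" "cball y e \<subseteq> \<Omega>" using assms by (auto simp: mem_interior_cball)
  let ?z = "y + of_real e * (\<i> * cis \<phi>)"
  have "?z \<in> \<Omega>" using e by (intro subsetD[OF e(2)]) (simp add: dist_norm norm_mult)
  moreover have "proj \<phi> ?z = proj \<phi> y" by (simp only: proj_lin, simp?)
  moreover have "y \<in> \<Omega>" using assms interior_subset by blast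
  moreover have "bounded (cline (proj \<phi> y) \<phi> \<inter> \<Omega>)" using compact compact_imp_bounded bounded_subset by blast
  ultimately have "dist y ?z \<le> diameter (cline (proj \<phi> y) \<phi> \<inter> \<Omega>)"
    by (intro diameter_bounded_bound) (auto simp: mem_cline)
  moreover have "dist y ?z = e" using e by (simp add: dist_norm norm_mult)
  ultimately show ?thesis using e by simp
qed

text \<open>A line strictly between the two supporting lines enters the domain at exactly one
  boundary point with \<open>proj \<phi> (\<gamma>' s) > 0\<close>: of two such points each would
  have to lie ahead of the other. So \<open>s\<close> replaces \<open>p\<close> as variable, and the
  positive part discards the exit points.\<close>

lemma nn_integral_parallel_lines:
  "(\<integral>\<^sup>+p. inverse_chord \<Omega> p \<phi> \<partial>lborel)
   = (\<integral>\<^sup>+s. ennreal (max 0 (proj \<phi> (\<gamma>' s))) * inverse_chord \<Omega> (proj \<phi> (\<gamma> s)) \<phi> * indicator {0..1} s \<partial>lborel)"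
proof -
  obtain xm where xm: "xm \<in> \<Omega>" "\<And>x. x \<in> \<Omega> \<Longrightarrow> proj \<phi> xm \<le> proj \<phi> x"
    using continuous_attains_inf[OF compact _ proj_cont, of \<phi>] in_Omega by blast
  obtain xM where xM: "xM \<in> \<Omega>" "\<And>x. x \<in> \<Omega> \<Longrightarrow> proj \<phi> x \<le> proj \<phi> xM"
    using continuous_attains_sup[OF compact _ proj_cont, of \<phi>] in_Omega by blast
  have between: "\<exists>y\<in>interior \<Omega>. proj \<phi> y = p" if hyp: "p \<noteq> proj \<phi> xm" "p \<noteq> proj \<phi> xM" "cline p \<phi> \<inter> \<Omega> \<noteq> {}" for p
  proof -
    obtain z where "z \<in> \<Omega>" "proj \<phi> z = p" using hyp(3) mem_cline by blast
    then have "proj \<phi> xm < p" "p < proj \<phi> xM" using xm(2)[of z] xM(2)[of z] hyp by auto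
    then show ?thesis using line_meets_interior[OF xm(1) xM(1)] by metis
  qed
  define f where "f p = (if cline p \<phi> \<inter> \<Omega> = {} then 0 else 1 / diameter (cline p \<phi> \<inter> \<Omega>))" for p
  define S where "S = {s \<in> {0..<1}. proj \<phi> (\<gamma>' s) > 0}"
  have f0: "f p \<ge> 0" for p unfolding f_def
    using diameter_ge_0 compact compact_imp_bounded bounded_subset by (metis divide_nonneg_nonneg inf_le2 order_refl zero_le_one)
  \<comment> \<open>The two excluded levels are those of the supporting lines, where the chord may
    be a single point and the integrand infinite, whereas \<open>f\<close> is 0. They form a null
    set.\<close>
  have f_eq: "inverse_chord \<Omega> p \<phi> = ennreal (f p)" if "p \<noteq> proj \<phi> xm" "p \<noteq> proj \<phi> xM" for p
  proof (cases "cline p \<phi> \<inter> \<Omega> = {}")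
    case False
    from between[OF that this] obtain y where y: "y \<in> interior \<Omega>" "proj \<phi> y = p" by blast
    then have "diameter (cline p \<phi> \<inter> \<Omega>) > 0" using diameter_pos_interior by blast
    then show ?thesis using False by (simp add: inverse_chord_def f_def divide_ennreal flip: ennreal_1)
  qed (simp add: inverse_chord_def f_def)
  have f_meas: "f \<in> borel_measurable borel"
  proof -
    have "(\<lambda>p. enn2real (inverse_chord \<Omega> p \<phi>)) \<in> borel_measurable borel"
      using compact by measurable
    moreover have "enn2real (inverse_chord \<Omega> p \<phi>) = f p" for p
    proof (cases "cline p \<phi> \<inter> \<Omega> = {}")
      case False
      have "diameter (cline p \<phi> \<inter> \<Omega>) \<ge> 0" using diameter_ge_0 compact compact_imp_bounded bounded_subset by (metis inf_le2)
      then show ?thesis using False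
        by (cases "diameter (cline p \<phi> \<inter> \<Omega>) = 0") (auto simp: inverse_chord_def f_def divide_ennreal simp flip: ennreal_1)
    qed (simp add: inverse_chord_def f_def)
    ultimately show ?thesis by simp
  qed
  have S_meas: "S \<in> sets borel"
  proof -
    have "(\<lambda>s. proj \<phi> (\<gamma>' s)) \<in> borel_measurable borel" unfolding proj_def
      by (intro borel_measurable_continuous_onI continuous_intros cont1)
    then have "{s. proj \<phi> (\<gamma>' s) > 0} \<in> sets borel" by measurable
    moreover have "S = {0..<1} \<inter> {s. proj \<phi> (\<gamma>' s) > 0}" by (auto simp: S_def)
    ultimately show ?thesis by simp
  qed
  have injS: "inj_on (\<lambda>s. proj \<phi> (\<gamma> s)) S"
  proof (rule inj_onI)
    fix s t assume st: "s \<in> S" "t \<in> S" "proj \<phi> (\<gamma> s) = proj \<phi> (\<gamma> t)"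
    obtain l where l: "\<gamma> t = \<gamma> s + of_real l * (\<i> * cis \<phi>)" using same_line[OF st(3)] by blast
    have l': "\<gamma> t - \<gamma> s = of_real l * (\<i> * cis \<phi>)" "\<gamma> s - \<gamma> t = of_real (- l) * (\<i> * cis \<phi>)" using l by auto
    have "0 \<le> l * proj \<phi> (\<gamma>' s) / (cmod (\<gamma>' s))\<^sup>2" using ccw[OF in_Omega, of t s] unfolding l' Im_dir .
    moreover have "0 \<le> - l * proj \<phi> (\<gamma>' t) / (cmod (\<gamma>' t))\<^sup>2" using ccw[OF in_Omega, of s t] unfolding l' Im_dir .
    ultimately have "l \<ge> 0" "l \<le> 0" using st regular[of s] regular[of t] 
      by (auto simp: S_def zero_le_divide_iff divide_le_0_iff zero_le_mult_iff mult_le_0_iff)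
    then have "\<gamma> t = \<gamma> s" using l by simp
    then show "s = t" using inj[of s t] st by (auto simp: S_def)
  qed
  have "(\<integral>\<^sup>+p. inverse_chord \<Omega> p \<phi> \<partial>lborel) = (\<integral>\<^sup>+p. ennreal (f p) * indicator ((\<lambda>s. proj \<phi> (\<gamma> s)) ` S) p \<partial>lborel)"
  proof (rule nn_integral_cong_AE)
    have "AE p in lborel. p \<noteq> proj \<phi> xm \<and> p \<noteq> proj \<phi> xM" using AE_lborel_singleton[of "proj \<phi> xm"] AE_lborel_singleton[of "proj \<phi> xM"] by auto
    then show "AE p in lborel. inverse_chord \<Omega> p \<phi> = ennreal (f p) * indicator ((\<lambda>s. proj \<phi> (\<gamma> s)) ` S) p"
    proof eventually_elim
      case (elim p)
      then have p: "p \<noteq> proj \<phi> xm" "p \<noteq> proj \<phi> xM" by auto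
      show ?case
      proof (cases "cline p \<phi> \<inter> \<Omega> = {}")
        case False
        from between[OF p this] obtain y where y: "y \<in> interior \<Omega>" "proj \<phi> y = p" by blast
        then obtain s where "0 \<le> s" "s < 1" "proj \<phi> (\<gamma> s) = p" "proj \<phi> (\<gamma>' s) > 0" using line_interior_entry by metis
        then have "p \<in> (\<lambda>s. proj \<phi> (\<gamma> s)) ` S" by (auto simp: S_def)
        then show ?thesis using f_eq[OF p] by simp
      qed (simp add: inverse_chord_def f_def)
    qed
  qed
  also have "\<dots> = (\<integral>\<^sup>+s. ennreal (\<bar>proj \<phi> (\<gamma>' s)\<bar> * f (proj \<phi> (\<gamma> s))) * indicator S s \<partial>lborel)"
  proof (rule nn_integral_change_of_variables_inj[OF S_meas _ injS f_meas f0])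
    show "((\<lambda>s. proj \<phi> (\<gamma> s)) has_real_derivative proj \<phi> (\<gamma>' x)) (at x within S)" for x
      by (rule has_field_derivative_at_within[OF proj_deriv])
    show "(\<lambda>s. proj \<phi> (\<gamma> s)) \<in> borel_measurable borel" "(\<lambda>s. proj \<phi> (\<gamma>' s)) \<in> borel_measurable borel"
      unfolding proj_def by (intro borel_measurable_continuous_onI continuous_intros cont cont1)+
  qed
  also have "\<dots> = (\<integral>\<^sup>+s. ennreal (max 0 (proj \<phi> (\<gamma>' s))) * inverse_chord \<Omega> (proj \<phi> (\<gamma> s)) \<phi> * indicator {0..1} s \<partial>lborel)"
  proof (rule nn_integral_cong_AE)
    have "AE s in lborel. s \<noteq> (1::real)" by (rule AE_lborel_singleton)
    then show "AE s in lborel. ennreal (\<bar>proj \<phi> (\<gamma>' s)\<bar> * f (proj \<phi> (\<gamma> s))) * indicator S s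
       = ennreal (max 0 (proj \<phi> (\<gamma>' s))) * inverse_chord \<Omega> (proj \<phi> (\<gamma> s)) \<phi> * indicator {0..1} s"
    proof eventually_elim
      case (elim s)
      show ?case
      proof (cases "proj \<phi> (\<gamma>' s) > 0")
        case True
        then have "proj \<phi> (\<gamma> s) \<noteq> proj \<phi> xm" "proj \<phi> (\<gamma> s) \<noteq> proj \<phi> xM"
          using extremal_tangent[of \<phi> s] xm xM by auto
        then have "inverse_chord \<Omega> (proj \<phi> (\<gamma> s)) \<phi> = ennreal (f (proj \<phi> (\<gamma> s)))" by (rule f_eq)
        then show ?thesis using True elim f0 by (auto simp: S_def indicator_def ennreal_mult)
      qed (auto simp: S_def max_def)
    qed
  qed
  finally show ?thesis .
qed

text \<open>Positivity of both kernel values says that the line crosses the curve transversally at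
  both points. The two tangent half-planes then cut the line down to the segment between these
  points.\<close>

lemma inverse_chord_through_points:
  assumes st: "s < t" "t < s + 1" and pos: "k s t > 0" "k t s > 0"
    and on: "proj \<phi> (\<gamma> s) = proj \<phi> (\<gamma> t)"
  shows "inverse_chord \<Omega> (proj \<phi> (\<gamma> s)) \<phi> = ennreal (1 / cmod (\<gamma> t - \<gamma> s))"
proof -
  let ?d = "\<i> * cis \<phi>" and ?C = "cline (proj \<phi> (\<gamma> s)) \<phi> \<inter> \<Omega>"
  have nd: "cmod ?d = 1" by (simp add: norm_mult)
  obtain r where r: "\<gamma> t = \<gamma> s + of_real r * ?d" using same_line[OF on] by blast
  have rne: "r \<noteq> 0" using r neq[OF st] by auto
  have k1: "Im (of_real r * ?d / \<gamma>' s) > 0"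
  proof -
    have "k s t * (cmod ((\<gamma> t - \<gamma> s) / \<gamma>' s))\<^sup>2 = Im ((\<gamma> t - \<gamma> s) / \<gamma>' s)"
    proof -
      define q where "q = (\<gamma> t - \<gamma> s) / \<gamma>' s"
      have "\<gamma>' s / (\<gamma> s - \<gamma> t) = - inverse q" by (simp add: q_def) (metis minus_diff_eq minus_divide_right)
      then have "k s t = Im q / (cmod q)\<^sup>2" by (simp add: k_def cmod_power2)
      moreover have "q \<noteq> 0" using neq[OF st] regular[of s] by (auto simp: q_def)
      ultimately show ?thesis by (simp flip: q_def)
    qed
    moreover have "(\<gamma> t - \<gamma> s) / \<gamma>' s \<noteq> 0" using neq[OF st] regular[of s] by auto
    ultimately have "Im ((\<gamma> t - \<gamma> s) / \<gamma>' s) > 0" using pos by (metis mult_pos_pos norm_eq_zero zero_less_power2)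
    then show ?thesis using r by simp
  qed
  have k2: "Im (of_real (- r) * ?d / \<gamma>' t) > 0"
  proof -
    have "k t s * (cmod ((\<gamma> s - \<gamma> t) / \<gamma>' t))\<^sup>2 = Im ((\<gamma> s - \<gamma> t) / \<gamma>' t)"
    proof -
      define q where "q = (\<gamma> s - \<gamma> t) / \<gamma>' t"
      have "\<gamma>' t / (\<gamma> t - \<gamma> s) = - inverse q" by (simp add: q_def) (metis minus_diff_eq minus_divide_right)
      then have "k t s = Im q / (cmod q)\<^sup>2" by (simp add: k_def cmod_power2)
      moreover have "q \<noteq> 0" using neq[OF st] regular[of t] by (auto simp: q_def)
      ultimately show ?thesis by (simp flip: q_def)
    qed
    moreover have "(\<gamma> s - \<gamma> t) / \<gamma>' t \<noteq> 0" using neq[OF st] regular[of t] by auto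
    ultimately have "Im ((\<gamma> s - \<gamma> t) / \<gamma>' t) > 0" using pos by (metis mult_pos_pos norm_eq_zero zero_less_power2)
    moreover have "\<gamma> s - \<gamma> t = of_real (- r) * ?d" using r by simp
    ultimately show ?thesis by metis
  qed
  have A: "0 \<le> l / r \<and> l / r \<le> 1" if x: "\<gamma> s + of_real l * ?d \<in> \<Omega>" for l
  proof -
    have "0 \<le> Im (of_real l * ?d / \<gamma>' s)" using ccw[OF x, of s] by simp
    then have "0 \<le> l * proj \<phi> (\<gamma>' s)" unfolding Im_dir using regular[of s] by (simp add: zero_le_divide_iff)
    moreover have "0 < r * proj \<phi> (\<gamma>' s)" using k1 unfolding Im_dir using regular[of s] by (simp add: zero_less_divide_iff)
    ultimately have 1: "0 \<le> l / r" by (auto simp: zero_le_divide_iff zero_less_mult_iff zero_le_mult_iff)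
    have "\<gamma> s + of_real l * ?d - \<gamma> t = of_real (l - r) * ?d" using r by (simp add: algebra_simps)
    then have "0 \<le> Im (of_real (l - r) * ?d / \<gamma>' t)" using ccw[OF x, of t] by metis
    then have "0 \<le> (l - r) * proj \<phi> (\<gamma>' t)" unfolding Im_dir using regular[of t] by (simp add: zero_le_divide_iff)
    moreover have "0 < (- r) * proj \<phi> (\<gamma>' t)" using k2 unfolding Im_dir using regular[of t] by (simp add: divide_less_0_iff)
    ultimately have "l / r \<le> 1" by (auto simp: divide_le_eq zero_less_mult_iff zero_le_mult_iff mult_less_0_iff)
    with 1 show ?thesis by simp
  qed
  have bC: "bounded ?C" using compact compact_imp_bounded bounded_subset by blast
  have "dist (\<gamma> s) (\<gamma> t) \<le> diameter ?C"
    by (rule diameter_bounded_bound[OF bC]) (auto simp: mem_cline in_Omega on)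
  moreover have "diameter ?C \<le> dist (\<gamma> s) (\<gamma> t)"
  proof (rule diameter_le)
    fix x y assume x: "x \<in> ?C" and y: "y \<in> ?C"
    obtain l where l: "x = \<gamma> s + of_real l * ?d" using same_line[of \<phi> "\<gamma> s" x] x by (auto simp: mem_cline)
    obtain m where m: "y = \<gamma> s + of_real m * ?d" using same_line[of \<phi> "\<gamma> s" y] y by (auto simp: mem_cline)
    have "x - y = of_real (l - m) * ?d" using l m by (simp add: algebra_simps)
    then have "norm (x - y) = \<bar>l - m\<bar>" using nd by (simp only: norm_mult norm_of_real, simp?)
    moreover have "dist (\<gamma> s) (\<gamma> t) = \<bar>r\<bar>" using r nd by (simp add: dist_norm norm_mult)
    moreover have "\<bar>l - m\<bar> \<le> \<bar>r\<bar>"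
    proof -
      have "\<bar>l / r - m / r\<bar> \<le> 1" using A[of l] A[of m] x y l m by auto
      then have "\<bar>l - m\<bar> / \<bar>r\<bar> \<le> 1" by (simp flip: abs_divide add: diff_divide_distrib)
      then show ?thesis using rne by (simp add: divide_le_eq)
    qed
    ultimately show "norm (x - y) \<le> dist (\<gamma> s) (\<gamma> t)" by simp
  qed simp
  ultimately have "diameter ?C = cmod (\<gamma> t - \<gamma> s)" by (simp add: dist_norm norm_minus_commute)
  moreover have "?C \<noteq> {}" using in_Omega[of s] by (auto simp: mem_cline)
  moreover have "cmod (\<gamma> t - \<gamma> s) > 0" using neq[OF st] by auto
  ultimately show ?thesis by (simp add: inverse_chord_def divide_ennreal flip: ennreal_1)
qed

text \<open>In terms of the angle \<alpha> from the tangent to the line the weight is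
  \<open>cmod (\<gamma>' s) * sin \<alpha>\<close> divided by the chord length, which equals
  \<open>k s t\<close>; the second factor \<open>k t s\<close> is the Jacobian of \<alpha> in
  \<open>t\<close>.\<close>

lemma nn_integral_lines_through_point:
  "(\<integral>\<^sup>+\<phi>. ennreal (max 0 (proj \<phi> (\<gamma>' s))) * inverse_chord \<Omega> (proj \<phi> (\<gamma> s)) \<phi> * indicator {0..2*pi} \<phi> \<partial>lborel)
   = (\<integral>\<^sup>+t. ennreal (k s t * k t s) * indicator {0..1} t \<partial>lborel)"
proof -
  define f where "f \<phi> = ennreal (max 0 (proj \<phi> (\<gamma>' s))) * inverse_chord \<Omega> (proj \<phi> (\<gamma> s)) \<phi>" for \<phi>
  have [measurable]: "(\<lambda>\<phi>. proj \<phi> z) \<in> borel_measurable borel" for z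
    unfolding proj_def by (intro borel_measurable_continuous_onI continuous_intros)
  have [measurable]: "f \<in> borel_measurable borel" unfolding f_def using compact by measurable
  have per: "f (\<phi> + 2*pi) = f \<phi>" for \<phi> by (simp add: f_def inverse_chord_period proj_def)
  \<comment> \<open>With this origin the line with normal angle \<open>\<phi>0 + \<alpha>\<close>
    has the direction \<open>Arg (\<gamma>' s) + \<alpha>\<close>.\<close>
  define \<phi>0 where "\<phi>0 = Arg (\<gamma>' s) - pi/2"
  have g': "\<gamma>' s = of_real (cmod (\<gamma>' s)) * cis (\<phi>0 + pi/2)"
    using Arg_eq[OF regular[of s]] by (simp add: \<phi>0_def cis_conv_exp)
  have fp: "proj (\<phi>0 + \<alpha>) (\<gamma>' s) = cmod (\<gamma>' s) * sin \<alpha>" for \<alpha>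
  proof -
    have "\<gamma>' s * cnj (cis (\<phi>0 + \<alpha>)) = of_real (cmod (\<gamma>' s)) * cis (pi/2 - \<alpha>)"
      by (subst g') (simp add: cis_cnj cis_mult)
    then show ?thesis by (simp add: proj_cnj cos_diff)
  qed
  have "(\<integral>\<^sup>+\<phi>. f \<phi> * indicator {0..2*pi} \<phi> \<partial>lborel) = (\<integral>\<^sup>+\<phi>. f \<phi> * indicator {\<phi>0<..<\<phi>0+2*pi} \<phi> \<partial>lborel)"
    by (rule set_nn_integral_shift_period[symmetric]) (auto simp: per)
  also have "\<dots> = (\<integral>\<^sup>+\<alpha>. f (\<phi>0 + \<alpha>) * indicator {0<..<2*pi} \<alpha> \<partial>lborel)"
    by (subst nn_integral_real_affine[where c = 1 and t = \<phi>0]) (auto intro!: nn_integral_cong simp: indicator_def)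
  \<comment> \<open>On the second half turn the sine is nonpositive, so the positive part in
    \<open>f\<close> vanishes.\<close>
  also have "\<dots> = (\<integral>\<^sup>+\<alpha>. f (\<phi>0 + \<alpha>) * indicator {0<..<pi} \<alpha> \<partial>lborel)"
  proof (rule nn_integral_cong)
    fix \<alpha> :: real
    show "f (\<phi>0 + \<alpha>) * indicator {0<..<2*pi} \<alpha> = f (\<phi>0 + \<alpha>) * indicator {0<..<pi} \<alpha>"
    proof (cases "pi \<le> \<alpha> \<and> \<alpha> < 2 * pi")
      case True
      then have "sin \<alpha> \<le> 0" by (intro sin_le_zero) auto
      then have "max 0 (proj (\<phi>0 + \<alpha>) (\<gamma>' s)) = 0" unfolding fp by (auto simp: mult_nonneg_nonpos)
      then have "f (\<phi>0 + \<alpha>) = 0" by (simp add: f_def)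
      then show ?thesis by simp
    qed (auto simp: indicator_def)
  qed
  also have "\<dots> = (\<integral>\<^sup>+t. f (\<phi>0 + ang s t) * ennreal (k t s) * indicator {s<..<s+1} t \<partial>lborel)"
    by (rule nn_integral_ang_substitution[of "\<lambda>\<alpha>. f (\<phi>0 + \<alpha>)"]) measurable
  also have "\<dots> = (\<integral>\<^sup>+t. ennreal (k s t * k t s) * indicator {s<..<s+1} t \<partial>lborel)"
  proof (rule nn_integral_cong)
    fix t
    show "f (\<phi>0 + ang s t) * ennreal (k t s) * indicator {s<..<s+1} t = ennreal (k s t * k t s) * indicator {s<..<s+1} t"
    proof (cases "t \<in> {s<..<s+1}")
      case True
      then have st: "s < t" "t < s + 1" by auto
      define q where "q = (\<gamma> t - \<gamma> s) / \<gamma>' s"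
      have qne: "q \<noteq> 0" using neq[OF st] regular[of s] by (auto simp: q_def)
      have q: "q = of_real (cmod q) * cis (ang s t)" using cis_ang[OF st] by (simp add: q_def)
      have kq: "k s t = Im q / (cmod q)\<^sup>2"
      proof -
        have "\<gamma>' s / (\<gamma> s - \<gamma> t) = - inverse q" by (simp add: q_def) (metis minus_diff_eq minus_divide_right)
        then show ?thesis by (simp add: k_def cmod_power2)
      qed
      have "Im q = cmod q * sin (ang s t)" by (subst q) simp
      then have ks: "k s t = sin (ang s t) / cmod q" using qne by (simp add: kq power2_eq_square)
      have nq: "cmod q = cmod (\<gamma> t - \<gamma> s) / cmod (\<gamma>' s)" by (simp add: q_def norm_divide)
      have fp': "proj (\<phi>0 + ang s t) (\<gamma>' s) = cmod (\<gamma>' s) * sin (ang s t)" by (rule fp)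
      \<comment> \<open>The length of the chord is needed only where both kernel values are
        positive. If \<open>k t s = 0\<close> the Jacobian vanishes, and if \<open>k s t = 0\<close>
        the sine in \<open>f\<close> does, so the value of \<open>inverse_chord\<close> is then
        immaterial.\<close>
      have "f (\<phi>0 + ang s t) * ennreal (k t s) = ennreal (k s t * k t s)"
      proof (cases "k s t > 0 \<and> k t s > 0")
        case True
        have "proj (\<phi>0 + ang s t) (\<gamma> t - \<gamma> s) = 0"
        proof -
          have "\<gamma> t - \<gamma> s = \<gamma>' s * q" using regular[of s] by (simp add: q_def)
          also have "\<dots> = of_real (cmod (\<gamma>' s) * cmod q) * (cis (\<phi>0 + pi/2) * cis (ang s t))"
            by (subst g', subst q) (simp add: mult_ac)
          also have "cis (\<phi>0 + pi/2) * cis (ang s t) = \<i> * cis (\<phi>0 + ang s t)"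
            by (simp only: cis_pi_half[symmetric] cis_mult add_ac)
          finally show ?thesis by (simp only: proj_lin, simp?)
        qed
        then have on: "proj (\<phi>0 + ang s t) (\<gamma> s) = proj (\<phi>0 + ang s t) (\<gamma> t)" by (simp add: proj_lin)
        have "f (\<phi>0 + ang s t) = ennreal (max 0 (cmod (\<gamma>' s) * sin (ang s t))) * ennreal (1 / cmod (\<gamma> t - \<gamma> s))"
          unfolding f_def fp' using inverse_chord_through_points[OF st _ _ on] True by simp
        also have "\<dots> = ennreal (k s t)"
          using True qne by (subst ennreal_mult[symmetric]) (auto simp: ks nq zero_less_divide_iff max_def mult.commute)
        finally show ?thesis using True by (simp add: ennreal_mult)
      next
        case False
        then consider "k s t = 0" | "k t s = 0" using k_nonneg[of s t] k_nonneg[of t s] by linarith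
        then show ?thesis
        proof cases
          case 1
          then have "sin (ang s t) = 0" using ks qne by simp
          then have "f (\<phi>0 + ang s t) = 0" by (simp add: f_def fp')
          with 1 show ?thesis by simp
        qed simp
      qed
      then show ?thesis by simp
    qed simp
  qed
  also have "\<dots> = (\<integral>\<^sup>+t. ennreal (k s t * k t s) * indicator {0..1} t \<partial>lborel)"
    by (rule set_nn_integral_shift_period) (use k_period_int[of _ 0 _ 1] k_period_int[of _ 1 _ 0] in auto)
  finally show ?thesis by (simp add: f_def)
qed

lemma nn_integral_lines:
  "(\<integral>\<^sup>+\<phi>. (\<integral>\<^sup>+p. inverse_chord \<Omega> p \<phi> \<partial>lborel) * indicator {0..2*pi} \<phi> \<partial>lborel)
   = (\<integral>\<^sup>+s. (\<integral>\<^sup>+t. ennreal (k s t * k t s) * indicator {0..1} t \<partial>lborel) * indicator {0..1} s \<partial>lborel)"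
proof -
  let ?f = "\<lambda>s \<phi>. ennreal (max 0 (proj \<phi> (\<gamma>' s))) * inverse_chord \<Omega> (proj \<phi> (\<gamma> s)) \<phi>"
  have m: "(\<lambda>q. ?f (fst q) (snd q)) \<in> borel_measurable (lborel \<Otimes>\<^sub>M lborel)"
  proof -
    have "(\<lambda>q. proj (snd q) (\<gamma> (fst q))) \<in> borel_measurable (borel :: (real \<times> real) measure)"
      "(\<lambda>q. proj (snd q) (\<gamma>' (fst q))) \<in> borel_measurable (borel :: (real \<times> real) measure)"
      "snd \<in> borel_measurable (borel :: (real \<times> real) measure)"
      unfolding proj_def by (intro borel_measurable_continuous_onI continuous_intros cont_compose cont1_compose)+
    then show ?thesis using compact unfolding lborel_prod by measurable
  qed
  have m': "(\<lambda>q. ?f (fst q) (snd q) * indicator {0..1} (fst q) * indicator {0..2*pi} (snd q)) \<in> borel_measurable (lborel \<Otimes>\<^sub>M lborel)"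
    using m by measurable
  have m1: "(\<lambda>s. ?f s \<phi>) \<in> borel_measurable lborel" for \<phi>
    using measurable_Pair_compose_split[of "\<lambda>s \<phi>. ?f s \<phi>", OF _ measurable_ident measurable_const[of \<phi>]] m by (simp add: split_def)
  have m2: "(\<lambda>\<phi>. ?f s \<phi>) \<in> borel_measurable lborel" for s
    using measurable_Pair_compose_split[of "\<lambda>s \<phi>. ?f s \<phi>", OF _ measurable_const[of s] measurable_ident] m by (simp add: split_def)
  have "(\<integral>\<^sup>+\<phi>. (\<integral>\<^sup>+p. inverse_chord \<Omega> p \<phi> \<partial>lborel) * indicator {0..2*pi} \<phi> \<partial>lborel)
     = (\<integral>\<^sup>+\<phi>. (\<integral>\<^sup>+s. ?f s \<phi> * indicator {0..1} s * indicator {0..2*pi} \<phi> \<partial>lborel) \<partial>lborel)"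
    unfolding nn_integral_parallel_lines using m1 by (intro nn_integral_cong nn_integral_multc[symmetric]) auto
  also have "\<dots> = (\<integral>\<^sup>+s. (\<integral>\<^sup>+\<phi>. ?f s \<phi> * indicator {0..1} s * indicator {0..2*pi} \<phi> \<partial>lborel) \<partial>lborel)"
    using lborel_pair.Fubini[OF m'] by simp
  also have "\<dots> = (\<integral>\<^sup>+s. (\<integral>\<^sup>+\<phi>. ?f s \<phi> * indicator {0..2*pi} \<phi> \<partial>lborel) * indicator {0..1} s \<partial>lborel)"
  proof (rule nn_integral_cong)
    fix s :: real
    show "(\<integral>\<^sup>+\<phi>. ?f s \<phi> * indicator {0..1} s * indicator {0..2*pi} \<phi> \<partial>lborel) = (\<integral>\<^sup>+\<phi>. ?f s \<phi> * indicator {0..2*pi} \<phi> \<partial>lborel) * indicator {0..1} s"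
      using m2[of s] by (subst nn_integral_multc[symmetric]) (auto intro!: nn_integral_cong simp: indicator_def)
  qed
  finally show ?thesis unfolding nn_integral_lines_through_point .
qed

end

section \<open>The energy of a closed curve\<close>

abbreviation unit_interval :: "real measure" ("\<I>")
  where "\<I> \<equiv> restrict_space lborel {0..1}"

lemma unit_interval_measure: "emeasure \<I> {0..1} = 1" "measure \<I> {0..1} = 1"
proof -
  show "emeasure \<I> {0..1} = 1" by (simp add: emeasure_restrict_space)
  then show "measure \<I> {0..1} = 1" by (simp add: measure_def)
qed

lemma unit_interval_finite: "finite_measure \<I>"
  by (rule finite_measureI) (simp add: unit_interval_measure space_restrict_space)

lemma borel_measurable_unit_interval: "f \<in> borel_measurable borel \<Longrightarrow> f \<in> borel_measurable \<I>"
  by (intro measurable_restrict_space1) simp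

lemma pair_unit_interval_measurable:
  fixes f :: "real \<Rightarrow> real \<Rightarrow> 'b::topological_space"
  assumes "(\<lambda>(s,t). f s t) \<in> borel_measurable borel"
  shows "(\<lambda>(s,t). f s t) \<in> borel_measurable (\<I> \<Otimes>\<^sub>M \<I>)"
proof -
  have "(\<lambda>x. x) \<in> measurable (\<I> \<Otimes>\<^sub>M \<I>) (borel :: (real \<times> real) measure)"
  proof -
    have "fst \<in> measurable (\<I> \<Otimes>\<^sub>M \<I>) borel" "snd \<in> measurable (\<I> \<Otimes>\<^sub>M \<I>) borel"
      using measurable_compose[OF measurable_fst borel_measurable_unit_interval[OF measurable_ident]]
        measurable_compose[OF measurable_snd borel_measurable_unit_interval[OF measurable_ident]]
      by (auto simp: id_def)
    then have "(\<lambda>x. (fst x, snd x)) \<in> measurable (\<I> \<Otimes>\<^sub>M \<I>) (borel :: (real \<times> real) measure)"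
      by (rule borel_measurable_Pair)
    then show ?thesis by simp
  qed
  from measurable_compose[OF this assms] show ?thesis by simp
qed

lemma nn_integral_unit_interval: "(\<integral>\<^sup>+x. f x * indicator {0..1} x \<partial>lborel) = (\<integral>\<^sup>+x. f x \<partial>\<I>)"
  by (rule nn_integral_restrict_space[symmetric]) simp

lemma nn_integral_unit_interval_uminus:
  fixes f :: "real \<Rightarrow> ennreal"
  assumes [measurable]: "f \<in> borel_measurable borel" and per: "\<And>x. f (x + 1) = f x"
  shows "(\<integral>\<^sup>+x. f (- x) \<partial>\<I>) = (\<integral>\<^sup>+x. f x \<partial>\<I>)"
proof -
  have "(\<integral>\<^sup>+x. f (- x) * indicator {0..1} x \<partial>lborel) = (\<integral>\<^sup>+x. f x * indicator {-1..0} x \<partial>lborel)"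
    by (subst (2) nn_integral_real_affine[where c = "-1" and t = 0]) (auto intro!: nn_integral_cong simp: indicator_def)
  also have "\<dots> = (\<integral>\<^sup>+x. f x * indicator {-1<..<-1+1} x \<partial>lborel)"
    by (simp add: nn_integral_indicator_Ioo_Icc)
  also have "\<dots> = (\<integral>\<^sup>+x. f x * indicator {0..1} x \<partial>lborel)"
    by (rule set_nn_integral_shift_period) (auto simp: per)
  finally show ?thesis by (simp only: nn_integral_unit_interval)
qed

context C2_closed_curve
begin

definition energy :: real
  where "energy = (LINT s|\<I>. LINT t|\<I>. k s t * k t s)"

lemma energy_borel: "(\<lambda>(s,t). k s t * k t s) \<in> borel_measurable borel"
proof -
  have "(\<lambda>p. k (fst p) (snd p)) \<in> borel_measurable (borel :: (real \<times> real) measure)"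
    "(\<lambda>p. k (snd p) (fst p)) \<in> borel_measurable (borel :: (real \<times> real) measure)"
    by (intro k_measurable borel_measurable_continuous_onI continuous_intros)+
  then show ?thesis unfolding split_def by measurable
qed

lemma nn_integral_energy:
  assumes nn: "\<And>s t. 0 \<le> k s t * k t s"
  shows "(\<integral>\<^sup>+s. \<integral>\<^sup>+t. ennreal (k s t * k t s) \<partial>\<I> \<partial>\<I>) = ennreal energy"
proof -
  interpret I: finite_measure \<I> by (rule unit_interval_finite)
  obtain C where C: "C > 0" "\<And>s t. \<bar>k s t\<bar> \<le> C" using k_bounded by blast
  have bd: "\<bar>k s t * k t s\<bar> \<le> C * C" for s t using C by (simp add: abs_mult mult_mono)
  have m: "(\<lambda>(s,t). k s t * k t s) \<in> borel_measurable (\<I> \<Otimes>\<^sub>M \<I>)"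
    by (rule pair_unit_interval_measurable[OF energy_borel])
  have m1: "(\<lambda>t. k s t * k t s) \<in> borel_measurable \<I>" for s
    by (intro borel_measurable_unit_interval borel_measurable_times k_measurable) auto
  have i1: "integrable \<I> (\<lambda>t. k s t * k t s)" for s
    by (rule I.integrable_const_bound[where B = "C * C"]) (use m1 bd in auto)
  have in1: "(\<integral>\<^sup>+t. ennreal (k s t * k t s) \<partial>\<I>) = ennreal (LINT t|\<I>. k s t * k t s)" for s
    by (rule nn_integral_eq_integral[OF i1]) (use nn in auto)
  have m2: "(\<lambda>s. LINT t|\<I>. k s t * k t s) \<in> borel_measurable \<I>"
    by (rule I.borel_measurable_lebesgue_integral) (use m in simp)
  have bd2: "\<bar>LINT t|\<I>. k s t * k t s\<bar> \<le> C * C" for s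
  proof -
    have "norm (LINT t|\<I>. k s t * k t s) \<le> (LINT t|\<I>. norm (k s t * k t s))" by (rule integral_norm_bound)
    also have "\<dots> \<le> (LINT t|\<I>. C * C)" by (rule integral_mono) (use i1 bd in auto)
    also have "\<dots> = C * C" by (simp add: unit_interval_measure space_restrict_space)
    finally show ?thesis by simp
  qed
  have i2: "integrable \<I> (\<lambda>s. LINT t|\<I>. k s t * k t s)"
    by (rule I.integrable_const_bound[where B = "C * C"]) (use m2 bd2 in auto)
  show ?thesis unfolding in1 energy_def
    by (rule nn_integral_eq_integral[OF i2]) (auto intro!: AE_I2 integral_nonneg_AE nn)
qed

lemma reversed: "C2_closed_curve (\<lambda>t. \<gamma> (- t)) (\<lambda>t. - \<gamma>' (- t)) (\<lambda>t. \<gamma>'' (- t))"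
proof
  fix s t :: real
  have "(\<gamma> \<circ> uminus has_vector_derivative ((- 1) *\<^sub>R \<gamma>' (- t))) (at t)"
    by (rule vector_diff_chain_at) (auto intro!: derivative_eq_intros deriv1)
  then show "((\<lambda>t. \<gamma> (- t)) has_vector_derivative - \<gamma>' (- t)) (at t)" by (simp add: o_def)
  have "(\<gamma>' \<circ> uminus has_vector_derivative ((- 1) *\<^sub>R \<gamma>'' (- t))) (at t)"
    by (rule vector_diff_chain_at) (auto intro!: derivative_eq_intros deriv2)
  then show "((\<lambda>t. - \<gamma>' (- t)) has_vector_derivative \<gamma>'' (- t)) (at t)"
    using has_vector_derivative_minus by (fastforce simp: o_def)
  show "continuous_on UNIV (\<lambda>t. \<gamma>'' (- t))"
    by (rule continuous_on_compose2[OF cont2]) (auto intro: continuous_intros)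
  show "- \<gamma>' (- t) \<noteq> 0" using regular by simp
  show "\<gamma> (- (t + 1)) = \<gamma> (- t)" using period[of "- t - 1"] by (simp add: minus_add_distrib)
  assume st: "0 \<le> s" "s < 1" "0 \<le> t" "t < 1" "\<gamma> (- s) = \<gamma> (- t)"
  then have "- s - (- t) \<in> \<int>" by (simp only: eq_iff)
  then obtain n :: int where n: "t - s = of_int n" by (auto elim: Ints_cases)
  then have "\<bar>of_int n :: real\<bar> < 1" using st by linarith
  then have "n = 0" by linarith
  then show "s = t" using n by simp
qed

text \<open>A supporting line at \<open>\<gamma> s\<close> must be the tangent, since the linear
  functional is minimal along the curve there. The side on which the domain lies is the sign of
  \<open>g s\<close>, seen from an interior point; it is continuous and never 0, hence the same for
  all \<open>s\<close>.\<close>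

lemma convex_orientation:
  assumes "compact \<Omega>" "convex \<Omega>" "interior \<Omega> \<noteq> {}" "frontier \<Omega> = range \<gamma>"
  shows "convex_curve \<gamma> \<gamma>' \<gamma>'' \<Omega> \<or> convex_curve (\<lambda>t. \<gamma> (- t)) (\<lambda>t. - \<gamma>' (- t)) (\<lambda>t. \<gamma>'' (- t)) \<Omega>"
proof -
  obtain x0 where x0: "x0 \<in> interior \<Omega>" using assms by blast
  have gO: "\<gamma> t \<in> \<Omega>" for t using frontier_subset_closed[OF compact_imp_closed[OF assms(1)]] assms(4) by blast
  have supp: "\<exists>\<nu>. \<nu> \<noteq> 0 \<and> (\<forall>x\<in>\<Omega>. 0 \<le> \<nu> * Im ((x - \<gamma> s) / \<gamma>' s)) \<and> 0 < \<nu> * Im ((x0 - \<gamma> s) / \<gamma>' s)" for s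
  proof -
    have "\<gamma> s \<notin> rel_interior \<Omega>"
      using assms by (simp add: rel_interior_nonempty_interior) (metis DiffD2 frontier_def rangeI)
    then obtain a where a: "\<And>y. y \<in> \<Omega> \<Longrightarrow> a \<bullet> \<gamma> s \<le> a \<bullet> y" "\<And>y. y \<in> rel_interior \<Omega> \<Longrightarrow> a \<bullet> \<gamma> s < a \<bullet> y"
      using supporting_hyperplane_rel_boundary[OF assms(2) gO] by metis
    have "((\<lambda>t. a \<bullet> \<gamma> t) has_real_derivative a \<bullet> \<gamma>' s) (at s)"
      using bounded_linear.has_vector_derivative[OF bounded_linear_inner_right deriv1]
      by (simp add: has_real_derivative_iff_has_vector_derivative)
    then have tang: "a \<bullet> \<gamma>' s = 0"
      by (rule DERIV_local_min[of _ _ _ 1]) (use a gO in auto)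
    define \<nu> where "\<nu> = a \<bullet> (\<i> * \<gamma>' s)"
    have dec: "a \<bullet> (x - \<gamma> s) = \<nu> * Im ((x - \<gamma> s) / \<gamma>' s)" for x
    proof -
      define q where "q = (x - \<gamma> s) / \<gamma>' s"
      have "x - \<gamma> s = Re q *\<^sub>R \<gamma>' s + Im q *\<^sub>R (\<i> * \<gamma>' s)"
      proof -
        have "x - \<gamma> s = q * \<gamma>' s" using regular[of s] by (simp add: q_def)
        also have "\<dots> = (of_real (Re q) + \<i> * of_real (Im q)) * \<gamma>' s" by (simp flip: complex_eq)
        also have "\<dots> = Re q *\<^sub>R \<gamma>' s + Im q *\<^sub>R (\<i> * \<gamma>' s)" by (simp only: scaleR_conv_of_real algebra_simps)
        finally show ?thesis .
      qed
      then have "a \<bullet> (x - \<gamma> s) = a \<bullet> (Re q *\<^sub>R \<gamma>' s + Im q *\<^sub>R (\<i> * \<gamma>' s))" by simp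
      then show ?thesis using tang unfolding inner_add_right inner_scaleR_right by (simp add: \<nu>_def q_def mult.commute)
    qed
    have 1: "0 \<le> \<nu> * Im ((x - \<gamma> s) / \<gamma>' s)" if "x \<in> \<Omega>" for x
      using a(1)[of x] that closure_subset unfolding dec[symmetric] by (auto simp: inner_diff_right)
    have "x0 \<in> rel_interior \<Omega>" using x0 interior_subset_rel_interior by blast
    then have 2: "0 < \<nu> * Im ((x0 - \<gamma> s) / \<gamma>' s)" using a(2) unfolding dec[symmetric] by (simp add: inner_diff_right)
    show ?thesis using 1 2 by (intro exI[of _ \<nu>]) auto
  qed
  define g where "g s = Im ((x0 - \<gamma> s) / \<gamma>' s)" for s
  have gne: "g s \<noteq> 0" for s using supp[of s] by (auto simp: g_def)
  have gc: "continuous_on UNIV g" unfolding g_def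
    by (intro continuous_on_Im continuous_on_divide continuous_on_diff continuous_on_const cont cont1) (use regular in auto)
  have "(\<forall>s. g s > 0) \<or> (\<forall>s. g s < 0)"
  proof (rule ccontr)
    assume "\<not> ((\<forall>s. g s > 0) \<or> (\<forall>s. g s < 0))"
    then obtain s t where "g s \<le> 0" "0 \<le> g t" by (meson not_less)
    moreover have "is_interval (g ` UNIV)"
      using gc connected_continuous_image[OF gc] is_interval_connected_1 by auto
    ultimately have "0 \<in> range g" unfolding is_interval_1 by (metis rangeI)
    then show False using gne by (metis imageE)
  qed
  then show ?thesis
  proof
    assume pos: "\<forall>s. g s > 0"
    have "0 \<le> Im ((x - \<gamma> s) / \<gamma>' s)" if "x \<in> \<Omega>" for x s
      using supp[of s] that pos[rule_format, of s] unfolding g_def[symmetric] by (auto simp: zero_less_mult_iff zero_le_mult_iff)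
    then have "convex_curve \<gamma> \<gamma>' \<gamma>'' \<Omega>" using assms by unfold_locales auto
    then show ?thesis by simp
  next
    assume neg: "\<forall>s. g s < 0"
    have le: "Im ((x - \<gamma> s) / \<gamma>' s) \<le> 0" if "x \<in> \<Omega>" for x s
      using supp[of s] that neg[rule_format, of s] unfolding g_def[symmetric] by (auto simp: zero_less_mult_iff zero_le_mult_iff)
    interpret R: C2_closed_curve "\<lambda>t. \<gamma> (- t)" "\<lambda>t. - \<gamma>' (- t)" "\<lambda>t. \<gamma>'' (- t)" by (rule reversed)
    have "range \<gamma> = range (\<lambda>t. \<gamma> (- t))" by (metis (no_types, lifting) add.inverse_inverse image_cong rangeI subset_antisym image_subsetI)
    then have "convex_curve (\<lambda>t. \<gamma> (- t)) (\<lambda>t. - \<gamma>' (- t)) (\<lambda>t. \<gamma>'' (- t)) \<Omega>"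
      using assms le by unfold_locales auto
    then show ?thesis by simp
  qed
qed

text \<open>Reversing the parameter changes the sign of both kernel factors, so the energy does not
  see the orientation and both cases of \<open>convex_orientation\<close> give the same
  formula.\<close>

lemma inverse_chord_integral_energy:
  fixes \<Omega> :: "(real^2) set"
  assumes \<Omega>: "compact \<Omega>" "compact (to_complex ` \<Omega>)" "convex (to_complex ` \<Omega>)" "interior (to_complex ` \<Omega>) \<noteq> {}"
    "frontier (to_complex ` \<Omega>) = range \<gamma>"
  shows "inverse_chord_integral \<Omega> = ennreal (energy / 2)" "energy \<ge> 0"
proof -
  have "2 * inverse_chord_integral \<Omega> = ennreal energy \<and> energy \<ge> 0"
    using convex_orientation[OF \<Omega>(2-5)]
  proof
    assume "convex_curve \<gamma> \<gamma>' \<gamma>'' (to_complex ` \<Omega>)"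
    then interpret convex_curve \<gamma> \<gamma>' \<gamma>'' "to_complex ` \<Omega>" .
    have "2 * inverse_chord_integral \<Omega> = (\<integral>\<^sup>+s. \<integral>\<^sup>+t. ennreal (k s t * k t s) \<partial>\<I> \<partial>\<I>)"
      unfolding twice_inverse_chord_integral[OF \<Omega>(1)] nn_integral_lines nn_integral_unit_interval ..
    also have "\<dots> = ennreal energy" by (rule nn_integral_energy) (simp add: k_nonneg)
    finally show ?thesis by (auto simp: energy_def intro!: integral_nonneg_AE AE_I2 k_nonneg mult_nonneg_nonneg)
  next
    assume "convex_curve (\<lambda>t. \<gamma> (- t)) (\<lambda>t. - \<gamma>' (- t)) (\<lambda>t. \<gamma>'' (- t)) (to_complex ` \<Omega>)"
    then interpret R: convex_curve "\<lambda>t. \<gamma> (- t)" "\<lambda>t. - \<gamma>' (- t)" "\<lambda>t. \<gamma>'' (- t)" "to_complex ` \<Omega>" .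
    have Rk: "R.k s t = - k (- s) (- t)" for s t by (simp add: R.k_def k_def)
    have nn: "0 \<le> k s t * k t s" for s t
      using mult_nonneg_nonneg[OF R.k_nonneg[of "- s" "- t"] R.k_nonneg[of "- t" "- s"]] by (simp add: Rk)
    have "2 * inverse_chord_integral \<Omega> = (\<integral>\<^sup>+s. \<integral>\<^sup>+t. ennreal (R.k s t * R.k t s) \<partial>\<I> \<partial>\<I>)"
      unfolding twice_inverse_chord_integral[OF \<Omega>(1)] R.nn_integral_lines nn_integral_unit_interval ..
    also have "\<dots> = (\<integral>\<^sup>+s. \<integral>\<^sup>+t. ennreal (k (- s) (- t) * k (- t) (- s)) \<partial>\<I> \<partial>\<I>)" by (simp add: Rk)
    also have "\<dots> = (\<integral>\<^sup>+s. \<integral>\<^sup>+t. ennreal (k (- s) t * k t (- s)) \<partial>\<I> \<partial>\<I>)"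
    proof (rule nn_integral_cong)
      fix s
      have m: "(\<lambda>t. ennreal (k (- s) t * k t (- s))) \<in> borel_measurable borel"
        by (intro measurable_compose[OF _ measurable_ennreal] borel_measurable_times k_measurable) auto
      show "(\<integral>\<^sup>+t. ennreal (k (- s) (- t) * k (- t) (- s)) \<partial>\<I>) = (\<integral>\<^sup>+t. ennreal (k (- s) t * k t (- s)) \<partial>\<I>)"
        using nn_integral_unit_interval_uminus[OF m] k_period_int[of "- s" 0 _ 1] k_period_int[of _ 1 "- s" 0] by simp
    qed
    also have "\<dots> = (\<integral>\<^sup>+s. \<integral>\<^sup>+t. ennreal (k s t * k t s) \<partial>\<I> \<partial>\<I>)"
    proof -
      interpret I: finite_measure \<I> by (rule unit_interval_finite)
      have "fst \<in> measurable (borel \<Otimes>\<^sub>M \<I>) borel" "snd \<in> measurable (borel \<Otimes>\<^sub>M \<I>) borel"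
        using measurable_compose[OF measurable_snd borel_measurable_unit_interval[OF measurable_ident]]
        by (auto simp: id_def)
      then have "(\<lambda>(s, t). ennreal (k s t * k t s)) \<in> borel_measurable (borel \<Otimes>\<^sub>M \<I>)"
        unfolding split_def by (intro measurable_compose[OF _ measurable_ennreal] borel_measurable_times k_measurable)
      then have m: "(\<lambda>s. \<integral>\<^sup>+t. ennreal (k s t * k t s) \<partial>\<I>) \<in> borel_measurable borel"
        by (rule I.borel_measurable_nn_integral)
      show ?thesis
        using nn_integral_unit_interval_uminus[OF m] k_period_int[of _ 1 _ 0] k_period_int[of _ 0 _ 1] by simp
    qed
    also have "\<dots> = ennreal energy" by (rule nn_integral_energy[OF nn])
    finally show ?thesis by (auto simp: energy_def intro!: integral_nonneg_AE AE_I2 nn)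
  qed
  then have e: "2 * inverse_chord_integral \<Omega> = ennreal energy" and nn: "energy \<ge> 0" by auto
  have "inverse_chord_integral \<Omega> = (2 * inverse_chord_integral \<Omega>) / 2"
    using ennreal_mult_divide_eq[of 2 "inverse_chord_integral \<Omega>"] by (simp add: mult.commute)
  also have "\<dots> = ennreal (energy / 2)" unfolding e using nn by (simp add: divide_ennreal flip: ennreal_numeral)
  finally show "inverse_chord_integral \<Omega> = ennreal (energy / 2)" .
  show "energy \<ge> 0" by fact
qed

end

section \<open>Moebius maps\<close>

definition of_complex :: "complex \<Rightarrow> real^2" where "of_complex z = vector [Re z, Im z]"

lemma to_of_complex[simp]: "to_complex (of_complex z) = z"
  by (simp add: to_complex_def of_complex_def)

lemma of_to_complex[simp]: "of_complex (to_complex x) = x"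
  by (simp add: to_complex_def of_complex_def vec_eq_iff forall_2)

text \<open>The point of the Riemann sphere with homogeneous coordinates \<open>x : y\<close>. In
  these coordinates inversions and reflections are conjugate-linear, and infinity is no special
  case.\<close>

definition hom_point :: "complex \<Rightarrow> complex \<Rightarrow> (real^2) option"
  where "hom_point x y = (if y = 0 then None else Some (of_complex (x / y)))"

text \<open>With \<open>C = to_complex c\<close> the inversion is
  \<open>z \<mapsto> C + r\<^sup>2 / cnj (z - C)\<close>; the coefficients come from writing this as
  one fraction in \<open>cnj z\<close>.\<close>

lemma circle_inversion_hom_point:
  assumes "x \<noteq> 0 \<or> y \<noteq> 0" "r > 0"
  shows "circle_inversion c r (hom_point x y) =
    hom_point (to_complex c * cnj x + (of_real (r\<^sup>2) - to_complex c * cnj (to_complex c)) * cnj y) (1 * cnj x + (- cnj (to_complex c)) * cnj y)"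
proof -
  define C where "C = to_complex c"
  have c: "c = of_complex C" by (simp add: C_def)
  show ?thesis
  proof (cases "y = 0")
    case True
    then show ?thesis using assms by (simp add: circle_inversion_def hom_point_def c)
  next
    case False
    define z where "z = x / y"
    have x: "x = z * y" using False by (simp add: z_def)
    have hp: "hom_point x y = Some (of_complex z)" using False by (simp add: hom_point_def z_def)
    have inj: "of_complex a = of_complex b \<longleftrightarrow> a = b" for a b by (metis to_of_complex)
    have den: "1 * cnj x + (- cnj C) * cnj y = cnj (z - C) * cnj y" by (simp add: x algebra_simps)
    have num: "C * cnj x + (of_real (r\<^sup>2) - C * cnj C) * cnj y = (C * cnj (z - C) + of_real (r\<^sup>2)) * cnj y"
      by (simp add: x algebra_simps)
    show ?thesis unfolding C_def[symmetric] den num hp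
    proof (cases "z = C")
      case True
      then show "circle_inversion c r (Some (of_complex z)) = hom_point ((C * cnj (z - C) + of_real (r\<^sup>2)) * cnj y) (cnj (z - C) * cnj y)"
        by (simp add: circle_inversion_def c hom_point_def)
    next
      case zC: False
      have "dist (of_complex z) c = cmod (z - C)" by (metis c dist_norm to_complex_dist to_of_complex)
      moreover have "c + (r\<^sup>2 / (cmod (z - C))\<^sup>2) *\<^sub>R (of_complex z - c) = of_complex (C + of_real (r\<^sup>2 / (cmod (z - C))\<^sup>2) * (z - C))"
        by (simp add: c of_complex_def vec_eq_iff forall_2)
      moreover have "C + of_real (r\<^sup>2 / (cmod (z - C))\<^sup>2) * (z - C) = (C * cnj (z - C) + of_real (r\<^sup>2)) / cnj (z - C)"
      proof -
        have "of_real ((cmod (z - C))\<^sup>2) = (z - C) * cnj (z - C)" by (rule complex_norm_square)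
        then have "of_real (r\<^sup>2 / (cmod (z - C))\<^sup>2) * (z - C) = of_real (r\<^sup>2) / cnj (z - C)"
          using zC by (simp only: of_real_divide) (simp add: divide_simps)
        then show ?thesis using zC by (simp only: add_divide_distrib) simp
      qed
      ultimately show "circle_inversion c r (Some (of_complex z)) = hom_point ((C * cnj (z - C) + of_real (r\<^sup>2)) * cnj y) (cnj (z - C) * cnj y)"
        using zC False inj by (simp add: circle_inversion_def c hom_point_def)
    qed
  qed
qed

text \<open>For a unit number \<open>U\<close> the reflection in the line is
  \<open>z \<mapsto> - U\<^sup>2 * cnj z + 2 * p * U\<close>.\<close>

lemma line_reflection_hom_point:
  assumes "x \<noteq> 0 \<or> y \<noteq> 0" "norm u = 1"
  shows "line_reflection u p (hom_point x y) =
    hom_point (- (to_complex u)\<^sup>2 * cnj x + (2 * of_real p * to_complex u) * cnj y) (0 * cnj x + 1 * cnj y)"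
proof (cases "y = 0")
  case True
  then show ?thesis by (simp add: line_reflection_def hom_point_def)
next
  case False
  define U where "U = to_complex u"
  define z where "z = x / y"
  have u: "u = of_complex U" by (simp add: U_def)
  have "to_complex 0 = 0" by (rule linear_0[OF linear_to_complex])
  then have "cmod U = 1" using to_complex_dist[of u 0] assms(2) by (simp add: U_def dist_norm)
  then have U1: "(Re U)\<^sup>2 + (Im U)\<^sup>2 = 1" by (simp add: cmod_def)
  have "u \<bullet> of_complex z = Re U * Re z + Im U * Im z" by (simp add: u of_complex_def inner_vec_def sum_2)
  then have "of_complex z - (2 * (u \<bullet> of_complex z - p)) *\<^sub>R u = of_complex (- U\<^sup>2 * cnj z + 2 * of_real p * U)"
  proof -
    assume i: "u \<bullet> of_complex z = Re U * Re z + Im U * Im z"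
    have 1: "Re z - 2 * (Re U * Re z + Im U * Im z - p) * Re U = Re (- U\<^sup>2 * cnj z + 2 * of_real p * U)"
      using U1 by (simp add: power2_eq_square) algebra
    have 2: "Im z - 2 * (Re U * Re z + Im U * Im z - p) * Im U = Im (- U\<^sup>2 * cnj z + 2 * of_real p * U)"
      using U1 by (simp add: power2_eq_square) algebra
    have "of_complex z - (2 * (Re U * Re z + Im U * Im z - p)) *\<^sub>R of_complex U
       = vector [Re z - 2 * (Re U * Re z + Im U * Im z - p) * Re U, Im z - 2 * (Re U * Re z + Im U * Im z - p) * Im U]"
      by (simp add: of_complex_def vec_eq_iff forall_2)
    then show ?thesis unfolding i unfolding u 1 2 by (simp add: of_complex_def)
  qed
  moreover have "(- U\<^sup>2 * cnj x + (2 * of_real p * U) * cnj y) / cnj y = - U\<^sup>2 * cnj z + 2 * of_real p * U"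
    using False by (simp add: z_def field_simps)
  ultimately show ?thesis using False by (simp add: line_reflection_def hom_point_def z_def U_def)
qed

text \<open>The map \<open>j\<close> is meant to be \<open>id\<close> or \<open>cnj\<close>: the
  transformation acts on homogeneous coordinates by an invertible matrix, possibly after
  conjugation.\<close>

definition lin_rep :: "(complex \<Rightarrow> complex) \<Rightarrow> ((real^2) option \<Rightarrow> (real^2) option) \<Rightarrow> bool"
  where "lin_rep j \<phi> \<longleftrightarrow> (\<exists>a b c d. a * d - b * c \<noteq> 0 \<and>
    (\<forall>x y. x \<noteq> 0 \<or> y \<noteq> 0 \<longrightarrow> \<phi> (hom_point x y) = hom_point (a * j x + b * j y) (c * j x + d * j y)))"

lemma det_nonzero_imp:
  fixes a b c d x y :: complex
  assumes "a * d - b * c \<noteq> 0" "x \<noteq> 0 \<or> y \<noteq> 0"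
  shows "a * x + b * y \<noteq> 0 \<or> c * x + d * y \<noteq> 0"
proof (rule ccontr)
  assume "\<not> ?thesis"
  then have 0: "a * x + b * y = 0" "c * x + d * y = 0" by auto
  have "(a * d - b * c) * x = d * (a * x + b * y) - b * (c * x + d * y)" "(a * d - b * c) * y = a * (c * x + d * y) - c * (a * x + b * y)"
    by (simp_all add: algebra_simps)
  then show False using 0 assms by auto
qed

text \<open>All generators of the group are conjugate-linear, so only such a map has to be composed
  from the left. The product uses the conjugate of the inner matrix, and the two types are
  interchanged.\<close>

lemma lin_rep_cnj_comp:
  assumes f: "lin_rep cnj f" and g: "lin_rep id g \<or> lin_rep cnj g"
  shows "lin_rep id (f \<circ> g) \<or> lin_rep cnj (f \<circ> g)"
proof -
  from f obtain a b c d where abcd: "a * d - b * c \<noteq> 0"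
    and F: "\<And>x y. x \<noteq> 0 \<or> y \<noteq> 0 \<Longrightarrow> f (hom_point x y) = hom_point (a * cnj x + b * cnj y) (c * cnj x + d * cnj y)"
    unfolding lin_rep_def by blast
  have key: "\<exists>A B C D. A * D - B * C \<noteq> 0 \<and> (\<forall>x y. x \<noteq> 0 \<or> y \<noteq> 0 \<longrightarrow> (f \<circ> g) (hom_point x y) = hom_point (A * cnj (j x) + B * cnj (j y)) (C * cnj (j x) + D * cnj (j y)))"
    if g: "lin_rep j g" and j: "j = id \<or> j = cnj" for j
  proof -
    from g obtain a' b' c' d' where abcd': "a' * d' - b' * c' \<noteq> 0"
      and G: "\<And>x y. x \<noteq> 0 \<or> y \<noteq> 0 \<Longrightarrow> g (hom_point x y) = hom_point (a' * j x + b' * j y) (c' * j x + d' * j y)"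
      unfolding lin_rep_def by blast
    have det: "(a * cnj a' + b * cnj c') * (c * cnj b' + d * cnj d') - (a * cnj b' + b * cnj d') * (c * cnj a' + d * cnj c') = (a * d - b * c) * cnj (a' * d' - b' * c')"
      by (simp add: algebra_simps)
    have "(f \<circ> g) (hom_point x y) = hom_point ((a * cnj a' + b * cnj c') * cnj (j x) + (a * cnj b' + b * cnj d') * cnj (j y)) ((c * cnj a' + d * cnj c') * cnj (j x) + (c * cnj b' + d * cnj d') * cnj (j y))"
      if xy: "x \<noteq> 0 \<or> y \<noteq> 0" for x y
    proof -
      have "j x \<noteq> 0 \<or> j y \<noteq> 0" using xy j by auto
      from det_nonzero_imp[OF abcd' this] have nz: "a' * j x + b' * j y \<noteq> 0 \<or> c' * j x + d' * j y \<noteq> 0" .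
      show ?thesis unfolding o_def G[OF xy] F[OF nz] by (simp add: algebra_simps)
    qed
    moreover have "(a * cnj a' + b * cnj c') * (c * cnj b' + d * cnj d') - (a * cnj b' + b * cnj d') * (c * cnj a' + d * cnj c') \<noteq> 0"
      unfolding det using abcd abcd' by (simp add: complex_cnj_zero_iff del: complex_cnj_diff complex_cnj_mult)
    ultimately show ?thesis by blast
  qed
  from g show ?thesis
  proof
    assume "lin_rep id g"
    from key[OF this] show ?thesis unfolding lin_rep_def by (simp del: comp_apply)
  next
    assume "lin_rep cnj g"
    from key[OF this] show ?thesis unfolding lin_rep_def by (simp del: comp_apply)
  qed
qed

lemma moebius_lin_rep: "moebius_transformation \<phi> \<Longrightarrow> lin_rep id \<phi> \<or> lin_rep cnj \<phi>"
proof (induction rule: moebius_transformation.induct)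
  case ident
  have "lin_rep id id" unfolding lin_rep_def by (rule exI[of _ 1], rule exI[of _ 0], rule exI[of _ 0], rule exI[of _ 1]) simp
  then show ?case ..
next
  case (inversion r f c)
  have "lin_rep cnj (circle_inversion c r)"
    unfolding lin_rep_def
  proof (rule exI[of _ "to_complex c"], rule exI[of _ "of_real (r\<^sup>2) - to_complex c * cnj (to_complex c)"], rule exI[of _ 1],
      rule exI[of _ "- cnj (to_complex c)"], intro conjI allI impI)
    show "to_complex c * - cnj (to_complex c) - (of_real (r\<^sup>2) - to_complex c * cnj (to_complex c)) * 1 \<noteq> 0"
      using inversion(1) by simp
  qed (rule circle_inversion_hom_point[OF _ inversion(1)])
  then show ?case using inversion.IH by (rule lin_rep_cnj_comp)
next
  case (reflection u f p)
  have u0: "to_complex u \<noteq> 0"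
  proof
    assume "to_complex u = 0"
    then have "to_complex u = to_complex 0" by (simp only: linear_0[OF linear_to_complex])
    then have "u = 0" by (rule injD[OF inj_to_complex])
    then show False using reflection(1) by simp
  qed
  have "lin_rep cnj (line_reflection u p)"
    unfolding lin_rep_def
  proof (rule exI[of _ "- (to_complex u)\<^sup>2"], rule exI[of _ "2 * of_real p * to_complex u"], rule exI[of _ 0], rule exI[of _ 1], intro conjI allI impI)
    show "- (to_complex u)\<^sup>2 * 1 - 2 * of_real p * to_complex u * 0 \<noteq> 0" using u0 by simp
  qed (rule line_reflection_hom_point[OF _ reflection(1)])
  then show ?case using reflection.IH by (rule lin_rep_cnj_comp)
qed

text \<open>Invariance of domain for \<open>f\<close> gives one inclusion; applied to the inverse,
  which is continuous because \<open>S\<close> is compact, it gives the other.\<close>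

lemma interior_image_compact:
  fixes f :: "complex \<Rightarrow> complex"
  assumes "compact S" "continuous_on S f" "inj_on f S"
  shows "interior (f ` S) = f ` interior S"
proof
  have "open (f ` interior S)"
    using assms interior_subset by (intro invariance_of_domain) (auto intro: continuous_on_subset inj_on_subset)
  then show "f ` interior S \<subseteq> interior (f ` S)" by (intro interior_maximal) (auto intro: image_mono interior_subset[THEN subsetD])
  define g where "g = inv_into S f"
  have gf: "g (f x) = x" if "x \<in> S" for x using assms(3) that by (simp add: g_def)
  have "continuous_on (f ` S) g" by (rule continuous_on_inv[OF assms(2,1)]) (simp add: gf)
  moreover have "inj_on g (f ` S)" by (auto simp: inj_on_def gf)
  ultimately have "open (g ` interior (f ` S))"
    using interior_subset by (intro invariance_of_domain) (auto intro: continuous_on_subset inj_on_subset)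
  moreover have "g ` interior (f ` S) \<subseteq> S" using gf interior_subset by force
  ultimately have sub: "g ` interior (f ` S) \<subseteq> interior S" by (rule interior_maximal[rotated])
  show "interior (f ` S) \<subseteq> f ` interior S"
  proof
    fix y assume y: "y \<in> interior (f ` S)"
    then obtain x where x: "x \<in> S" "y = f x" using interior_subset by blast
    then have "g y = x" by (simp add: gf)
    then show "y \<in> f ` interior S" using sub y x by blast
  qed
qed

lemma frontier_image_compact:
  fixes f :: "complex \<Rightarrow> complex"
  assumes "compact S" "continuous_on S f" "inj_on f S"
  shows "frontier (f ` S) = f ` frontier S"
proof -
  have "closed (f ` S)" using assms by (intro compact_imp_closed compact_continuous_image)
  moreover have "closed S" using assms compact_imp_closed by blast
  ultimately show ?thesis
    unfolding frontier_def interior_image_compact[OF assms] using inj_on_image_set_diff[OF assms(3), of S "interior S"] interior_subset[of S]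
    by (simp add: closure_closed)
qed

lemma LINT_unit_interval:
  fixes f :: "real \<Rightarrow> 'a::euclidean_space"
  assumes "continuous_on {0..1} f"
  shows "(LINT x|\<I>. f x) = integral {0..1} f"
proof -
  have "(LINT x|\<I>. f x) = (LINT x:{0..1}|lborel. f x)"
    by (simp add: integral_restrict_space set_lebesgue_integral_def)
  also have "\<dots> = integral {0..1} f"
    using borel_integrable_atLeastAtMost'[OF assms] by (rule set_borel_integral_eq_integral(2))
  finally show ?thesis .
qed

section \<open>The effect of Moebius maps and of conjugation on the energy\<close>

context C2_closed_curve
begin

lemma cont_log_derivative:
  assumes "\<And>s. c * \<gamma> s + d \<noteq> 0"
  shows "continuous_on S (\<lambda>s. Im (c * \<gamma>' s / (c * \<gamma> s + d)))"
proof (rule continuous_on_Im, rule continuous_on_divide)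
  show "continuous_on S (\<lambda>s. c * \<gamma>' s)" by (rule continuous_on_mult, rule continuous_on_const, rule cont1)
  show "continuous_on S (\<lambda>s. c * \<gamma> s + d)"
    by (rule continuous_on_add, rule continuous_on_mult, rule continuous_on_const, rule cont, rule continuous_on_const)
qed (simp add: assms)

text \<open>The affine function vanishes nowhere on the convex set, not only nowhere on the curve,
  so it has a continuous logarithm there and the integrand is the derivative of a closed quantity. A
  zero inside the curve would contribute plus or minus \<open>2 * pi\<close>.\<close>

lemma integral_log_derivative:
  assumes "convex S" "range \<gamma> \<subseteq> S" "\<And>x. x \<in> S \<Longrightarrow> c * x + d \<noteq> 0"
  shows "(LINT s|\<I>. Im (c * \<gamma>' s / (c * \<gamma> s + d))) = 0"
proof -
  have nz: "c * \<gamma> s + d \<noteq> 0" for s by (rule assms(3)) (use assms(2) in blast)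
  have "continuous_on S (\<lambda>x. c * x + d)" by (intro continuous_intros)
  then obtain h where h: "continuous_on S h" "\<And>x. x \<in> S \<Longrightarrow> c * x + d = exp (h x)"
    using assms(3) by (rule continuous_logarithm_on_contractible[OF _ convex_imp_contractible[OF assms(1)]]) (assumption, rule that)
  have hc: "continuous_on UNIV (\<lambda>s. h (\<gamma> s))" by (rule continuous_on_compose2[OF h(1) cont assms(2)])
  have der: "((\<lambda>s. h (\<gamma> s)) has_vector_derivative (c * \<gamma>' s) / (c * \<gamma> s + d)) (at s)" for s
  proof (rule continuous_log_has_vector_derivative)
    show "isCont (\<lambda>s. h (\<gamma> s)) s" using hc by (simp add: continuous_on_eq_continuous_at)
    have "c * \<gamma> y + d = exp (h (\<gamma> y))" for y by (rule h(2)) (use assms(2) in blast)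
    then show "\<forall>\<^sub>F y in nhds s. c * \<gamma> y + d = exp (h (\<gamma> y))" by (intro always_eventually) blast
    show "((\<lambda>s. c * \<gamma> s + d) has_vector_derivative c * \<gamma>' s) (at s)"
      using has_vector_derivative_add[OF has_vector_derivative_mult_right[OF deriv1[of s], of c] has_vector_derivative_const[of d]] by simp
  qed
  have der': "((\<lambda>s. Im (h (\<gamma> s))) has_vector_derivative Im ((c * \<gamma>' s) / (c * \<gamma> s + d))) (at s within {0..1})" for s
    by (rule has_vector_derivative_at_within[OF bounded_linear.has_vector_derivative[OF bounded_linear_Im der]])
  have hi: "((\<lambda>s. Im (c * \<gamma>' s / (c * \<gamma> s + d))) has_integral (Im (h (\<gamma> 1)) - Im (h (\<gamma> 0)))) {0..1}"
    by (rule fundamental_theorem_of_calculus) (simp, rule der')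
  have g: "\<gamma> 1 = \<gamma> 0" using period[of 0] by (simp only: add_0)
  have i0: "integral {0..1} (\<lambda>s. Im (c * \<gamma>' s / (c * \<gamma> s + d))) = 0"
    by (rule trans[OF integral_unique[OF hi]]) (simp only: g diff_self)
  have "continuous_on {0..1} (\<lambda>s. Im (c * \<gamma>' s / (c * \<gamma> s + d)))"
    by (rule cont_log_derivative[OF nz])
  from LINT_unit_interval[OF this] show ?thesis unfolding i0 .
qed

lemma moebius_curve:
  assumes det: "a * d - b * c \<noteq> 0" and nz: "\<And>t. c * \<gamma> t + d \<noteq> 0"
  shows "C2_closed_curve (\<lambda>t. (a * \<gamma> t + b) / (c * \<gamma> t + d)) (\<lambda>t. (a * d - b * c) * \<gamma>' t / (c * \<gamma> t + d)\<^sup>2)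
    (\<lambda>t. (a * d - b * c) * (\<gamma>'' t / (c * \<gamma> t + d)\<^sup>2 - 2 * c * (\<gamma>' t)\<^sup>2 / (c * \<gamma> t + d)^3))"
proof
  fix s t :: real
  have "((\<lambda>z. (a * z + b) / (c * z + d)) has_field_derivative (a * d - b * c) / (c * \<gamma> t + d)\<^sup>2) (at (\<gamma> t))"
    using nz[of t] by (auto intro!: derivative_eq_intros simp: power2_eq_square field_simps)
  from field_vector_diff_chain_at[OF deriv1 this]
  show "((\<lambda>t. (a * \<gamma> t + b) / (c * \<gamma> t + d)) has_vector_derivative (a * d - b * c) * \<gamma>' t / (c * \<gamma> t + d)\<^sup>2) (at t)"
    by (simp add: o_def mult.commute)
  have "((\<lambda>z. (a * d - b * c) / (c * z + d)\<^sup>2) has_field_derivative - 2 * c * (a * d - b * c) / (c * \<gamma> t + d)^3) (at (\<gamma> t))"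
  proof -
    define W where "W = c * \<gamma> t + d"
    have "W \<noteq> 0" using nz by (simp add: W_def)
    have "((\<lambda>z. (c * z + d)\<^sup>2) has_field_derivative 2 * c * W) (at (\<gamma> t))"
      by (auto intro!: derivative_eq_intros simp: W_def)
    from DERIV_cmult[OF DERIV_inverse'[OF this], of "a * d - b * c"] have
      "((\<lambda>z. (a * d - b * c) * inverse ((c * z + d)\<^sup>2)) has_field_derivative (a * d - b * c) * - (inverse (W\<^sup>2) * (2 * c * W) * inverse (W\<^sup>2))) (at (\<gamma> t))"
      using \<open>W \<noteq> 0\<close> by (simp add: W_def)
    moreover have "(a * d - b * c) * - (inverse (W\<^sup>2) * (2 * c * W) * inverse (W\<^sup>2)) = - 2 * c * (a * d - b * c) / W^3"
      using \<open>W \<noteq> 0\<close> by (simp add: divide_simps power2_eq_square power3_eq_cube)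
    ultimately show ?thesis unfolding W_def[symmetric] by (simp only: divide_inverse)
  qed
  from has_vector_derivative_mult[OF deriv2 field_vector_diff_chain_at[OF deriv1 this]]
  have "((\<lambda>t. \<gamma>' t * ((a * d - b * c) / (c * \<gamma> t + d)\<^sup>2)) has_vector_derivative
     \<gamma>' t * (\<gamma>' t * (- 2 * c * (a * d - b * c) / (c * \<gamma> t + d)^3)) + \<gamma>'' t * ((a * d - b * c) / (c * \<gamma> t + d)\<^sup>2)) (at t)"
    by (simp only: o_def)
  moreover have "\<gamma>' t * (\<gamma>' t * (- 2 * c * \<Delta> * v)) + \<gamma>'' t * (\<Delta> * w) = \<Delta> * (\<gamma>'' t * w - 2 * c * (\<gamma>' t)\<^sup>2 * v)" for \<Delta> v w
    by (simp add: algebra_simps power2_eq_square)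
  ultimately show "((\<lambda>t. (a * d - b * c) * \<gamma>' t / (c * \<gamma> t + d)\<^sup>2) has_vector_derivative
      (a * d - b * c) * (\<gamma>'' t / (c * \<gamma> t + d)\<^sup>2 - 2 * c * (\<gamma>' t)\<^sup>2 / (c * \<gamma> t + d)^3)) (at t)"
    by (simp only: divide_inverse mult.assoc mult.left_commute[of "\<gamma>' _" "a * d - b * c"])
  show "continuous_on UNIV (\<lambda>t. (a * d - b * c) * (\<gamma>'' t / (c * \<gamma> t + d)\<^sup>2 - 2 * c * (\<gamma>' t)\<^sup>2 / (c * \<gamma> t + d)^3))"
    by (intro continuous_intros cont cont1 cont2) (use nz in auto)
  show "(a * d - b * c) * \<gamma>' t / (c * \<gamma> t + d)\<^sup>2 \<noteq> 0" using det nz[of t] regular[of t] by simp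
  show "(a * \<gamma> (t + 1) + b) / (c * \<gamma> (t + 1) + d) = (a * \<gamma> t + b) / (c * \<gamma> t + d)" by (simp add: period)
  assume st: "0 \<le> s" "s < 1" "0 \<le> t" "t < 1" "(a * \<gamma> s + b) / (c * \<gamma> s + d) = (a * \<gamma> t + b) / (c * \<gamma> t + d)"
  then have "(a * \<gamma> s + b) * (c * \<gamma> t + d) = (a * \<gamma> t + b) * (c * \<gamma> s + d)" using nz[of s] nz[of t] by (simp add: frac_eq_eq)
  then have "(a * d - b * c) * (\<gamma> s - \<gamma> t) = 0" by (simp add: algebra_simps)
  then have "\<gamma> s = \<gamma> t" using det by simp
  then show "s = t" using inj st by blast
qed

text \<open>With the new kernel equal to \<open>k s t - A s\<close> the product has three extra
  terms. Each integrates to a multiple of the integral of \<open>A\<close>, which is 0: for two of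
  them because the integral of \<open>k t s\<close> over \<open>t\<close> is a constant \<sigma>, in
  one case after exchanging the integrations. The constant is left open since it is
  \<open>- pi\<close> for a conjugated curve.\<close>

lemma energy_moebius:
  assumes det: "a * d - b * c \<noteq> 0" and \<sigma>: "\<And>s. (LINT t|\<I>. k t s) = \<sigma>"
    and S: "convex S" "range \<gamma> \<subseteq> S" "\<And>x. x \<in> S \<Longrightarrow> c * x + d \<noteq> 0"
  shows "C2_closed_curve.energy (\<lambda>t. (a * \<gamma> t + b) / (c * \<gamma> t + d)) (\<lambda>t. (a * d - b * c) * \<gamma>' t / (c * \<gamma> t + d)\<^sup>2) = energy"
proof -
  have nz: "c * \<gamma> t + d \<noteq> 0" for t using S by auto
  interpret M: C2_closed_curve "\<lambda>t. (a * \<gamma> t + b) / (c * \<gamma> t + d)" "\<lambda>t. (a * d - b * c) * \<gamma>' t / (c * \<gamma> t + d)\<^sup>2"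
    "\<lambda>t. (a * d - b * c) * (\<gamma>'' t / (c * \<gamma> t + d)\<^sup>2 - 2 * c * (\<gamma>' t)\<^sup>2 / (c * \<gamma> t + d)^3)"
    by (rule moebius_curve[OF det nz])
  interpret I: finite_measure \<I> by (rule unit_interval_finite)
  define A where "A s = Im (c * \<gamma>' s / (c * \<gamma> s + d))" for s
  \<comment> \<open>Distinct points are required: for equal points both kernels are 0 by division by
    zero. For a given \<open>s\<close> only finitely many \<open>t\<close> are lost.\<close>
  have Mk: "M.k s t = k s t - A s" if ne: "\<gamma> s \<noteq> \<gamma> t" for s t
  proof -
    have "(a * \<gamma> s + b) / (c * \<gamma> s + d) - (a * \<gamma> t + b) / (c * \<gamma> t + d) = (a * d - b * c) * (\<gamma> s - \<gamma> t) / ((c * \<gamma> s + d) * (c * \<gamma> t + d))"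
      using nz[of s] nz[of t] by (simp add: divide_simps) (simp add: algebra_simps)
    then have "(a * d - b * c) * \<gamma>' s / (c * \<gamma> s + d)\<^sup>2 / ((a * \<gamma> s + b) / (c * \<gamma> s + d) - (a * \<gamma> t + b) / (c * \<gamma> t + d))
      = \<gamma>' s * (c * \<gamma> t + d) / ((c * \<gamma> s + d) * (\<gamma> s - \<gamma> t))"
      using nz[of s] nz[of t] det ne by (simp add: divide_simps power2_eq_square)
    also have "\<dots> = \<gamma>' s / (\<gamma> s - \<gamma> t) - c * \<gamma>' s / (c * \<gamma> s + d)"
      using nz[of s] ne by (simp add: divide_simps) (simp add: algebra_simps)
    finally show ?thesis by (simp add: M.k_def k_def A_def)
  qed
  obtain C where C: "C > 0" "\<And>s t. \<bar>k s t\<bar> \<le> C" using k_bounded by blast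
  have Ac: "continuous_on T A" for T unfolding A_def by (rule cont_log_derivative[OF nz])
  have "bounded (A ` {0..1})" using Ac by (intro compact_imp_bounded compact_continuous_image) auto
  then obtain D where D: "\<And>s. s \<in> {0..1} \<Longrightarrow> \<bar>A s\<bar> \<le> D" unfolding bounded_iff ball_simps real_norm_def by metis
  have Aint: "integrable \<I> A"
    by (rule I.integrable_const_bound[where B = D])
       (use D Ac[of UNIV] in \<open>auto intro!: AE_I2 borel_measurable_unit_interval borel_measurable_continuous_onI simp: space_restrict_space\<close>)
  have A0: "(LINT s|\<I>. A s) = 0" unfolding A_def by (rule integral_log_derivative[OF S])
  have kint: "integrable \<I> (\<lambda>t. k t s)" "integrable \<I> (\<lambda>t. k s t)" "integrable \<I> (\<lambda>t. k s t * k t s)" for s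
  proof -
    have bd: "\<bar>k s t * k t s\<bar> \<le> C * C" for t using C by (simp add: abs_mult mult_mono)
    show "integrable \<I> (\<lambda>t. k t s)" "integrable \<I> (\<lambda>t. k s t)"
      by (rule I.integrable_const_bound[where B = C]; use C in \<open>auto intro!: borel_measurable_unit_interval k_measurable\<close>)+
    show "integrable \<I> (\<lambda>t. k s t * k t s)"
      by (rule I.integrable_const_bound[where B = "C * C"]; use bd in \<open>auto intro!: borel_measurable_unit_interval k_measurable borel_measurable_times\<close>)
  qed
  have kA: "integrable \<I> (\<lambda>t. A t * k s t)" for s
  proof (rule I.integrable_const_bound[where B = "D * C"])
    show "AE t in \<I>. norm (A t * k s t) \<le> D * C"
      by (rule AE_I2) (use C D in \<open>auto simp: space_restrict_space abs_mult intro!: mult_mono order_trans[OF abs_ge_zero D]\<close>)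
    show "(\<lambda>t. A t * k s t) \<in> borel_measurable \<I>"
      by (intro borel_measurable_unit_interval k_measurable borel_measurable_times borel_measurable_continuous_onI Ac) auto
  qed
  have inner: "(LINT t|\<I>. M.k s t * M.k t s) = (LINT t|\<I>. k s t * k t s) - (LINT t|\<I>. A t * k s t) - A s * \<sigma>" if s: "s \<in> {0..1}" for s
  proof -
    have "(LINT t|\<I>. M.k s t * M.k t s) = (LINT t|\<I>. k s t * k t s - A t * k s t - A s * k t s + A s * A t)"
    proof (rule integral_cong_AE)
      have "AE t in lborel. t \<noteq> s \<and> t \<noteq> s + 1 \<and> t \<noteq> s - 1" 
        using AE_lborel_singleton[of s] AE_lborel_singleton[of "s+1"] AE_lborel_singleton[of "s-1"] by auto
      then have "AE t in lborel. t \<in> {0..1} \<longrightarrow> M.k s t * M.k t s = k s t * k t s - A t * k s t - A s * k t s + A s * A t"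
      proof eventually_elim
        case (elim t)
        show ?case
        proof
          assume t: "t \<in> {0..1}"
          then have "\<gamma> s \<noteq> \<gamma> t"
          proof (cases "s < t")
            case True
            moreover have "t < s + 1" using t s elim by auto
            ultimately show ?thesis by (rule neq)
          next
            case False
            then have "t < s" "s < t + 1" using t s elim by auto
            from neq[OF this] show ?thesis by simp
          qed
          then show "M.k s t * M.k t s = k s t * k t s - A t * k s t - A s * k t s + A s * A t"
            using Mk[of s t] Mk[of t s] by (simp only: not_sym simp_thms) (simp only: algebra_simps)
        qed
      qed
      then show "AE t in \<I>. M.k s t * M.k t s = k s t * k t s - A t * k s t - A s * k t s + A s * A t"
        by (simp add: AE_restrict_space_iff)
      show "(\<lambda>t. M.k s t * M.k t s) \<in> borel_measurable \<I>"
        by (intro borel_measurable_unit_interval borel_measurable_times M.k_measurable) auto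
      show "(\<lambda>t. k s t * k t s - A t * k s t - A s * k t s + A s * A t) \<in> borel_measurable \<I>"
        using kint[of s] kA[of s] Aint by (intro borel_measurable_add borel_measurable_diff borel_measurable_times borel_measurable_const) auto
    qed
    also have "\<dots> = (LINT t|\<I>. k s t * k t s) - (LINT t|\<I>. A t * k s t) - A s * (LINT t|\<I>. k t s) + A s * (LINT t|\<I>. A t)"
      using kint[of s] kA[of s] Aint by simp
    finally show ?thesis by (simp add: A0 \<sigma>)
  qed
  have mI: "(\<lambda>(s,t). A t * k s t) \<in> borel_measurable (\<I> \<Otimes>\<^sub>M \<I>)"
  proof -
    have "(\<lambda>p. A (snd p)) \<in> borel_measurable (borel :: (real \<times> real) measure)"
      by (intro borel_measurable_continuous_onI continuous_on_compose2[OF Ac[of UNIV]] continuous_intros) auto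
    moreover have "(\<lambda>p. k (fst p) (snd p)) \<in> borel_measurable (borel :: (real \<times> real) measure)"
      using k_borel by (simp add: split_def)
    ultimately show ?thesis by (intro pair_unit_interval_measurable) (simp add: split_def)
  qed
  interpret P: pair_sigma_finite \<I> \<I> by unfold_locales
  interpret PI: finite_measure "\<I> \<Otimes>\<^sub>M \<I>" by (rule finite_measure_pair_measure) (rule unit_interval_finite)+
  have iI: "integrable (\<I> \<Otimes>\<^sub>M \<I>) (\<lambda>(s,t). A t * k s t)"
  proof (rule PI.integrable_const_bound[where B = "D * C", OF _ mI])
    show "AE x in \<I> \<Otimes>\<^sub>M \<I>. norm (case x of (s, t) \<Rightarrow> A t * k s t) \<le> D * C"
      by (rule AE_I2) (use C D in \<open>auto simp: space_restrict_space space_pair_measure abs_mult intro!: mult_mono order_trans[OF abs_ge_zero D]\<close>)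
  qed
  have swap: "(LINT s|\<I>. LINT t|\<I>. A t * k s t) = 0"
  proof -
    have "(LINT s|\<I>. LINT t|\<I>. A t * k s t) = (LINT t|\<I>. LINT s|\<I>. A t * k s t)"
      using P.Fubini_integral[OF iI] by simp
    also have "\<dots> = (LINT t|\<I>. A t * \<sigma>)" by (simp add: \<sigma>)
    finally show ?thesis by (simp add: A0)
  qed
  have int1: "integrable \<I> (\<lambda>s. LINT t|\<I>. A t * k s t)" using P.integrable_fst[OF iI] by simp
  have int2: "integrable \<I> (\<lambda>s. LINT t|\<I>. k s t * k t s)"
  proof -
    have "integrable (\<I> \<Otimes>\<^sub>M \<I>) (\<lambda>(s,t). k s t * k t s)"
    proof (rule PI.integrable_const_bound[where B = "C * C"])
      show "AE x in \<I> \<Otimes>\<^sub>M \<I>. norm (case x of (s, t) \<Rightarrow> k s t * k t s) \<le> C * C"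
        by (rule AE_I2) (use C in \<open>auto simp: abs_mult intro!: mult_mono\<close>)
      show "(\<lambda>(s,t). k s t * k t s) \<in> borel_measurable (\<I> \<Otimes>\<^sub>M \<I>)" by (rule pair_unit_interval_measurable[OF energy_borel])
    qed
    from P.integrable_fst[OF this] show ?thesis by simp
  qed
  have "M.energy = (LINT s|\<I>. (LINT t|\<I>. k s t * k t s) - (LINT t|\<I>. A t * k s t) - A s * \<sigma>)"
    unfolding M.energy_def by (rule Bochner_Integration.integral_cong) (auto simp: inner space_restrict_space)
  also have "\<dots> = energy" using int1 int2 Aint by (simp add: swap A0 energy_def)
  finally show ?thesis .
qed

lemma cnj_curve: "C2_closed_curve (\<lambda>t. cnj (\<gamma> t)) (\<lambda>t. cnj (\<gamma>' t)) (\<lambda>t. cnj (\<gamma>'' t))"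
proof
  fix s t :: real
  show "((\<lambda>t. cnj (\<gamma> t)) has_vector_derivative cnj (\<gamma>' t)) (at t)" "((\<lambda>t. cnj (\<gamma>' t)) has_vector_derivative cnj (\<gamma>'' t)) (at t)"
    using bounded_linear.has_vector_derivative[OF bounded_linear_cnj] deriv1 deriv2 by blast+
  show "continuous_on UNIV (\<lambda>t. cnj (\<gamma>'' t))" by (intro continuous_intros cont2)
qed (use regular period inj in auto)

lemma energy_cnj: "C2_closed_curve.energy (\<lambda>t. cnj (\<gamma> t)) (\<lambda>t. cnj (\<gamma>' t)) = energy"
  "C2_closed_curve.k (\<lambda>t. cnj (\<gamma> t)) (\<lambda>t. cnj (\<gamma>' t)) s t = - k s t"
proof -
  interpret J: C2_closed_curve "\<lambda>t. cnj (\<gamma> t)" "\<lambda>t. cnj (\<gamma>' t)" "\<lambda>t. cnj (\<gamma>'' t)" by (rule cnj_curve)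
  show k: "J.k s t = - k s t" for s t
  proof -
    have "cnj (\<gamma>' s) / (cnj (\<gamma> s) - cnj (\<gamma> t)) = cnj (\<gamma>' s / (\<gamma> s - \<gamma> t))" by simp
    then show ?thesis unfolding J.k_def k_def by (simp only: cnj.simps)
  qed
  show "J.energy = energy" by (simp add: J.energy_def energy_def k)
qed

end

context convex_curve
begin

lemma integral_k: "(LINT t|\<I>. k t s) = pi"
proof -
  interpret I: finite_measure \<I> by (rule unit_interval_finite)
  obtain C where C: "C > 0" "\<And>s t. \<bar>k s t\<bar> \<le> C" using k_bounded by blast
  have "integrable \<I> (\<lambda>t. k t s)"
    by (rule I.integrable_const_bound[where B = C]; use C in \<open>auto intro!: borel_measurable_unit_interval k_measurable\<close>)
  then have "(\<integral>\<^sup>+t. ennreal (k t s) \<partial>\<I>) = ennreal (LINT t|\<I>. k t s)" by (rule nn_integral_eq_integral) (simp add: k_nonneg)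
  moreover have "(\<integral>\<^sup>+t. ennreal (k t s) \<partial>\<I>) = ennreal pi" using nn_integral_k by (simp add: nn_integral_unit_interval)
  moreover have "(LINT t|\<I>. k t s) \<ge> 0" by (simp add: k_nonneg)
  ultimately show ?thesis by simp
qed

end

section \<open>Boundary extension of the Riemann map\<close>

text \<open>The Schwarz lemma for \<open>Moebius_function 0 a \<circ> g\<close> with
  \<open>a = g 0\<close> gives both bounds with 0 as base point. The derivative at a general
  \<open>z\<close> is reached by precomposing with the disc automorphism that carries 0 to
  \<open>z\<close>.\<close>

lemma Schwarz_Pick:
  assumes f: "f holomorphic_on ball 0 1" "\<And>z. norm z < 1 \<Longrightarrow> norm (f z) < 1" and z: "norm z < 1"
  shows "norm (deriv f z) * (1 - (norm z)\<^sup>2) \<le> 1 - (norm (f z))\<^sup>2"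
    and "norm (f z - f 0) \<le> norm z * norm (1 - cnj (f 0) * f z)"
proof -
  have key: "norm (deriv g 0) \<le> 1 - (norm (g 0))\<^sup>2 \<and> (\<forall>w. norm w < 1 \<longrightarrow> norm (g w - g 0) \<le> norm w * norm (1 - cnj (g 0) * g w))"
    if g: "g holomorphic_on ball 0 1" "\<And>z. norm z < 1 \<Longrightarrow> norm (g z) < 1" for g
  proof -
    define a where "a = g 0"
    have a: "norm a < 1" using g(2)[of 0] by (simp add: a_def)
    have ne: "1 - cnj a * w \<noteq> 0" if "norm w < 1" for w
    proof
      assume "1 - cnj a * w = 0"
      then have "norm (cnj a * w) = 1" by (metis eq_iff_diff_eq_0 norm_one)
      moreover have "norm (cnj a * w) < 1" using mult_strict_mono'[OF a that] by (simp add: norm_mult)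
      ultimately show False by simp
    qed
    define h where "h = Moebius_function 0 a \<circ> g"
    have h_eq: "h w = (g w - a) / (1 - cnj a * g w)" for w by (simp add: h_def Moebius_function_simple)
    have hh: "h holomorphic_on ball 0 1"
      unfolding h_def by (rule holomorphic_on_compose_gen[OF g(1) Moebius_function_holomorphic[OF a]]) (use g in auto)
    have h0: "h 0 = 0" by (simp add: h_eq a_def)
    have h1: "norm (h w) < 1" if "norm w < 1" for w
      unfolding h_def o_def by (rule Moebius_function_norm_lt_1[OF a g(2)[OF that]])
    have S1: "norm (h w) \<le> norm w" if "norm w < 1" for w by (rule Schwarz_Lemma(1)[OF hh h0 h1 that])
    have S2: "norm (deriv h 0) \<le> 1" by (rule Schwarz_Lemma(2)[OF hh h0 h1, of 0]) auto
    have dg: "(g has_field_derivative deriv g 0) (at 0)" using g(1) by (auto intro!: holomorphic_derivI[of _ "ball 0 1"])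
    have "(h has_field_derivative deriv g 0 / (1 - cnj a * a)) (at 0)"
    proof -
      have "((\<lambda>w. (g w - a) / (1 - cnj a * g w)) has_field_derivative
         (deriv g 0 * (1 - cnj a * g 0) - (g 0 - a) * (- (cnj a * deriv g 0))) / ((1 - cnj a * g 0) * (1 - cnj a * g 0))) (at 0)"
        using ne[of "g 0"] g(2)[of 0] by (auto intro!: derivative_eq_intros dg)
      then show ?thesis using ne[of a] a by (simp add: h_eq[abs_def] a_def)
    qed
    then have "deriv h 0 = deriv g 0 / (1 - cnj a * a)" by (rule DERIV_imp_deriv)
    moreover have "1 - cnj a * a = of_real (1 - (norm a)\<^sup>2)" using complex_norm_square[of a] by (simp add: mult.commute)
    moreover have pos: "1 - (norm a)\<^sup>2 > 0" using a by (simp add: power_less_one_iff)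
    ultimately have "norm (deriv g 0) \<le> 1 - (norm a)\<^sup>2" using S2 by (simp add: norm_divide divide_le_eq del: of_real_diff)
    moreover have "norm (g w - a) \<le> norm w * norm (1 - cnj a * g w)" if "norm w < 1" for w
      using S1[OF that] ne[of "g w"] g(2)[OF that] by (simp add: h_eq norm_divide divide_le_eq)
    ultimately show ?thesis by (simp add: a_def)
  qed
  show "norm (f z - f 0) \<le> norm z * norm (1 - cnj (f 0) * f z)" using key[OF f] z by blast
  define m where "m = Moebius_function 0 (- z)"
  have mz: "norm (- z) < 1" using z by simp
  have m_eq: "m w = (w + z) / (1 + cnj z * w)" for w by (simp add: m_def Moebius_function_simple)
  have mh: "m holomorphic_on ball 0 1" unfolding m_def by (rule Moebius_function_holomorphic[OF mz])
  have m1: "norm (m w) < 1" if "norm w < 1" for w unfolding m_def by (rule Moebius_function_norm_lt_1[OF mz that])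
  have fm: "(f \<circ> m) holomorphic_on ball 0 1"
    by (rule holomorphic_on_compose_gen[OF mh f(1)]) (use m1 in auto)
  have "norm (deriv (f \<circ> m) 0) \<le> 1 - (norm ((f \<circ> m) 0))\<^sup>2" using key[OF fm] f(2) m1 by auto
  moreover have "deriv (f \<circ> m) 0 = deriv f z * of_real (1 - (norm z)\<^sup>2)"
  proof -
    have "(m has_field_derivative (1 * (1 + cnj z * 0) - (0 + z) * (cnj z * 1)) / ((1 + cnj z * 0) * (1 + cnj z * 0))) (at 0)"
      unfolding m_eq[abs_def] by (auto intro!: derivative_eq_intros)
    then have "(m has_field_derivative of_real (1 - (norm z)\<^sup>2)) (at 0)" using complex_norm_square[of z] by simp
    moreover have "(f has_field_derivative deriv f z) (at (m 0))" using z f(1) by (auto intro!: holomorphic_derivI[of _ "ball 0 1"] simp: m_eq)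
    ultimately show ?thesis using DERIV_chain DERIV_imp_deriv by blast
  qed
  moreover have "1 - (norm z)\<^sup>2 > 0" using z by (simp add: power_less_one_iff)
  ultimately show "norm (deriv f z) * (1 - (norm z)\<^sup>2) \<le> 1 - (norm (f z))\<^sup>2" by (simp add: norm_mult m_eq del: of_real_diff)
qed

text \<open>A quantitative Hopf lemma: up to a factor depending on \<open>f 0\<close> alone, the
  image approaches the circle no faster than the point does. It follows from the identity
  \<open>id\<close> and the lower bound \<open>1 - a * b\<close> for the norm of its first
  term.\<close>

lemma Schwarz_Pick_growth:
  assumes f: "f holomorphic_on ball 0 1" "\<And>z. norm z < 1 \<Longrightarrow> norm (f z) < 1" and z: "norm z < 1"
  shows "(1 - norm (f 0)) * (1 - norm z) \<le> 4 * (1 - norm (f z))"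
proof -
  define a b r where "a = norm (f 0)" and "b = norm (f z)" and "r = norm z"
  have r: "0 \<le> r" "r < 1" "0 \<le> a" "a < 1" "0 \<le> b" "b < 1" using z f(2)[of 0] f(2)[OF z] by (auto simp: a_def b_def r_def)
  have id: "(norm (1 - cnj (f 0) * f z))\<^sup>2 - (norm (f z - f 0))\<^sup>2 = (1 - a\<^sup>2) * (1 - b\<^sup>2)"
    unfolding a_def b_def cmod_power2 by (simp add: power2_eq_square algebra_simps)
  have "(norm (f z - f 0))\<^sup>2 \<le> r\<^sup>2 * (norm (1 - cnj (f 0) * f z))\<^sup>2"
    using power_mono[OF Schwarz_Pick(2)[OF f z], of 2] by (simp add: power_mult_distrib r_def)
  then have 1: "(1 - r\<^sup>2) * (norm (1 - cnj (f 0) * f z))\<^sup>2 \<le> (1 - a\<^sup>2) * (1 - b\<^sup>2)" using id by (simp add: algebra_simps)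
  have "1 - a * b \<le> norm (1 - cnj (f 0) * f z)"
    using norm_triangle_ineq2[of 1 "cnj (f 0) * f z"] by (simp add: norm_mult a_def b_def)
  moreover have ab: "0 \<le> 1 - a * b" "1 - a \<le> 1 - a * b" using r by (auto simp: mult_le_one mult_left_le)
  ultimately have "(1 - a * b)\<^sup>2 \<le> (norm (1 - cnj (f 0) * f z))\<^sup>2" by (intro power_mono)
  moreover have "(1 - a)\<^sup>2 \<le> (1 - a * b)\<^sup>2" using ab r by (intro power_mono) auto
  moreover have "1 - r\<^sup>2 \<ge> 0" using r by (simp add: power_le_one_iff)
  ultimately have "(1 - r\<^sup>2) * (1 - a)\<^sup>2 \<le> (1 - a\<^sup>2) * (1 - b\<^sup>2)" using 1 by (meson mult_left_mono order_trans)
  then have "(1 - a) * ((1 - r\<^sup>2) * (1 - a)) \<le> (1 - a) * ((1 + a) * (1 - b\<^sup>2))" by (simp add: power2_eq_square algebra_simps)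
  then have "(1 - r\<^sup>2) * (1 - a) \<le> (1 + a) * (1 - b\<^sup>2)" using r by simp
  also have "\<dots> = ((1 + a) * (1 + b)) * (1 - b)" by (simp add: power2_eq_square algebra_simps)
  also have "\<dots> \<le> ((1 + a) * 2) * (1 - b)" using r by (intro mult_right_mono mult_left_mono) auto
  also have "\<dots> \<le> (2 * 2) * (1 - b)" using r by (intro mult_right_mono) auto
  finally have 2: "(1 - r\<^sup>2) * (1 - a) \<le> 4 * (1 - b)" by simp
  have "(1 - a) * (1 - r) \<le> (1 - r\<^sup>2) * (1 - a)"
    using r by (simp add: power2_eq_square mult.commute[of "1 - a"] mult_left_le mult_right_mono)
  with 2 show ?thesis by (simp add: a_def b_def r_def)
qed

text \<open>The Cayley transform \<open>c\<close> carries the right half-plane to the disc. The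
  identity \<open>(norm (w + 1))\<^sup>2 - (norm (w - 1))\<^sup>2 = 4 * Re w\<close> translates the
  distance of the image to the circle into \<open>Re (P z)\<close>, and the preceding two lemmas are
  applied to \<open>c\<close>.\<close>

lemma half_plane_Schwarz:
  assumes P: "P holomorphic_on ball 0 1" "\<And>z. norm z < 1 \<Longrightarrow> Re (P z) > 0" and z: "norm z < 1"
  shows "norm (deriv P z) * (1 - (norm z)\<^sup>2) \<le> 2 * Re (P z)"
    and "(1 - norm z) * Re (P 0) \<le> 8 * (norm (P 0) + 1)\<^sup>2 * Re (P z)"
proof -
  define c where "c w = (P w - 1) / (P w + 1)" for w
  have ne: "P w + 1 \<noteq> 0" if "norm w < 1" for w
  proof -
    have "Re (P w + 1) > 0" using P(2)[OF that] by simp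
    then show ?thesis by (metis less_irrefl zero_complex.sel(1))
  qed
  have id: "1 - (norm (c w))\<^sup>2 = 4 * Re (P w) / (norm (P w + 1))\<^sup>2" if w: "norm w < 1" for w
  proof -
    have "(norm (P w + 1))\<^sup>2 - (norm (P w - 1))\<^sup>2 = 4 * Re (P w)" unfolding cmod_power2 by (simp add: power2_eq_square algebra_simps)
    then have e: "4 * Re (P w) = (norm (P w + 1))\<^sup>2 - (norm (P w - 1))\<^sup>2" by simp
    have "(norm (P w + 1))\<^sup>2 \<noteq> 0" using ne[OF w] by simp
    then show ?thesis unfolding e c_def norm_divide power_divide by (simp add: diff_divide_distrib)
  qed
  have ch: "c holomorphic_on ball 0 1" unfolding c_def by (intro holomorphic_intros P(1)) (use ne in auto)
  have c1: "norm (c w) < 1" if w: "norm w < 1" for w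
  proof -
    have "0 < 4 * Re (P w) / (norm (P w + 1))\<^sup>2" using P(2)[OF w] ne[OF w] by simp
    then have "(norm (c w))\<^sup>2 < 1" using id[OF w] by simp
    then show ?thesis by (simp add: abs_square_less_1)
  qed
  have dP: "(P has_field_derivative deriv P z) (at z)" using P(1) z by (auto intro!: holomorphic_derivI[of _ "ball 0 1"])
  have "(c has_field_derivative (deriv P z * (P z + 1) - (P z - 1) * deriv P z) / ((P z + 1) * (P z + 1))) (at z)"
    unfolding c_def using ne[OF z] by (auto intro!: derivative_eq_intros dP)
  then have "deriv c z = (deriv P z * (P z + 1) - (P z - 1) * deriv P z) / ((P z + 1) * (P z + 1))" by (rule DERIV_imp_deriv)
  also have "\<dots> = 2 * deriv P z / (P z + 1)\<^sup>2" by (simp add: power2_eq_square algebra_simps)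
  finally have "norm (deriv c z) = 2 * norm (deriv P z) / (norm (P z + 1))\<^sup>2" by (simp add: norm_divide norm_mult norm_power)
  then have "2 * norm (deriv P z) / (norm (P z + 1))\<^sup>2 * (1 - (norm z)\<^sup>2) \<le> 4 * Re (P z) / (norm (P z + 1))\<^sup>2"
    using Schwarz_Pick(1)[OF ch c1 z] id[OF z] by simp
  then show "norm (deriv P z) * (1 - (norm z)\<^sup>2) \<le> 2 * Re (P z)"
    using ne[OF z] by (simp add: divide_le_cancel times_divide_eq_left divide_right_mono_neg)
  have "(1 - norm (c 0)) * (1 - norm z) \<le> 4 * (1 - norm (c z))" by (rule Schwarz_Pick_growth[OF ch c1 z])
  also have "\<dots> \<le> 4 * (1 - (norm (c z))\<^sup>2)" using c1[OF z] by (simp add: power2_eq_square mult_left_le)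
  also have "\<dots> \<le> 4 * (4 * Re (P z))"
  proof -
    have "1 \<le> norm (P z + 1)" using complex_Re_le_cmod[of "P z + 1"] P(2)[OF z] by simp
    then have "1 \<le> (norm (P z + 1))\<^sup>2" by (simp add: one_le_power)
    then have "4 * Re (P z) / (norm (P z + 1))\<^sup>2 \<le> 4 * Re (P z) / 1" using P(2)[OF z] by (intro divide_left_mono) auto
    then show ?thesis using id[OF z] by simp
  qed
  finally have A: "(1 - norm (c 0)) * (1 - norm z) \<le> 16 * Re (P z)" by simp
  have B: "2 * Re (P 0) \<le> (norm (P 0) + 1)\<^sup>2 * (1 - norm (c 0))"
  proof -
    have "4 * Re (P 0) = (norm (P 0 + 1))\<^sup>2 * (1 - (norm (c 0))\<^sup>2)" using id[of 0] ne[of 0] by simp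
    also have "\<dots> \<le> (norm (P 0) + 1)\<^sup>2 * (1 - (norm (c 0))\<^sup>2)"
      using c1[of 0] norm_triangle_ineq[of "P 0" 1] by (intro mult_right_mono power_mono) (auto simp: power_le_one_iff)
    also have "\<dots> \<le> (norm (P 0) + 1)\<^sup>2 * (2 * (1 - norm (c 0)))"
    proof (rule mult_left_mono)
      have "(1 + norm (c 0)) * (1 - norm (c 0)) \<le> 2 * (1 - norm (c 0))" using c1[of 0] by (intro mult_right_mono) auto
      then show "1 - (norm (c 0))\<^sup>2 \<le> 2 * (1 - norm (c 0))" by (simp add: power2_eq_square algebra_simps)
    qed simp
    finally show ?thesis by (simp add: algebra_simps)
  qed
  have "(1 - norm z) * (2 * Re (P 0)) \<le> (1 - norm z) * ((norm (P 0) + 1)\<^sup>2 * (1 - norm (c 0)))"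
    using B z by (intro mult_left_mono) auto
  also have "\<dots> = (norm (P 0) + 1)\<^sup>2 * ((1 - norm (c 0)) * (1 - norm z))" by simp
  also have "\<dots> \<le> (norm (P 0) + 1)\<^sup>2 * (16 * Re (P z))" by (intro mult_left_mono A) auto
  finally show "(1 - norm z) * Re (P 0) \<le> 8 * (norm (P 0) + 1)\<^sup>2 * Re (P z)" by (simp only: mult_ac)
qed

lemma of_real_mult_sel: "Re (of_real r * z) = r * Re z" "Im (of_real r * z) = r * Im z"
  by simp_all

section \<open>Distance to the boundary, tangent discs and the Lipschitz bounds\<close>

context convex_curve
begin

text \<open>The rigid motion taking \<open>\<gamma> s\<close> to 0 and the inner normal to the
  positive real axis. It maps the domain into the right half-plane, so composed with the Riemann map
  it falls under \<open>half_plane_Schwarz\<close>.\<close>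

definition height :: "real \<Rightarrow> complex \<Rightarrow> complex"
  where "height s x = - \<i> * of_real (cmod (\<gamma>' s)) * ((x - \<gamma> s) / \<gamma>' s)"

lemma Re_height: "Re (height s x) = cmod (\<gamma>' s) * Im ((x - \<gamma> s) / \<gamma>' s)"
proof -
  have "height s x = of_real (cmod (\<gamma>' s)) * (- \<i> * ((x - \<gamma> s) / \<gamma>' s))" by (simp only: height_def mult_ac)
  also have "Re \<dots> = cmod (\<gamma>' s) * Re (- \<i> * ((x - \<gamma> s) / \<gamma>' s))" by (rule of_real_mult_sel)
  also have "Re (- \<i> * ((x - \<gamma> s) / \<gamma>' s)) = Im ((x - \<gamma> s) / \<gamma>' s)" by (simp only: mult_minus_left Re_i_times uminus_complex.sel minus_minus)
  finally show ?thesis .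
qed

lemma Re_height_nonneg: "x \<in> \<Omega> \<Longrightarrow> 0 \<le> Re (height s x)"
  unfolding Re_height using ccw by simp

lemma norm_height: "norm (height s x) = dist x (\<gamma> s)"
  using regular[of s] by (simp add: height_def norm_mult norm_divide dist_norm)

lemma height_add: "height s (x + y) = height s x - \<i> * of_real (cmod (\<gamma>' s)) * (y / \<gamma>' s)"
  by (simp add: height_def add_divide_distrib diff_divide_distrib algebra_simps)

lemma from_height: "x = \<gamma> s + height s x * (\<i> * \<gamma>' s / of_real (cmod (\<gamma>' s)))"
proof -
  have "- \<i> * b * (w / a) * (\<i> * a / b) = - (\<i> * \<i>) * w" if "a \<noteq> 0" "b \<noteq> 0" for a b w
    using that by (simp add: divide_simps mult.left_commute[of \<i>])
  from this[of "\<gamma>' s" "of_real (cmod (\<gamma>' s))" "x - \<gamma> s"] show ?thesis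
    using regular[of s] unfolding height_def by simp
qed

definition depth :: "complex \<Rightarrow> real" where "depth x = infdist x (frontier \<Omega>)"

lemma frontier_facts: "closed (frontier \<Omega>)" "frontier \<Omega> \<noteq> {}" "frontier \<Omega> \<subseteq> \<Omega>"
proof -
  show "closed (frontier \<Omega>)" by (rule frontier_closed)
  show "frontier \<Omega> \<noteq> {}" unfolding frontier by blast
  show "frontier \<Omega> \<subseteq> \<Omega>" by (rule frontier_subset_closed[OF compact_imp_closed[OF compact]])
qed

lemma depth_pos: "x \<in> interior \<Omega> \<Longrightarrow> depth x > 0"
  unfolding depth_def using infdist_pos_not_in_closed[OF frontier_facts(1,2), of x] by (auto simp: frontier_def)

lemma ball_avoid_frontier:
  assumes "ball x r \<inter> frontier \<Omega> = {}" "y \<in> ball x r" "y \<in> interior \<Omega>"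
  shows "ball x r \<subseteq> interior \<Omega>"
proof (rule ccontr)
  assume "\<not> ball x r \<subseteq> interior \<Omega>"
  then obtain w where w: "w \<in> ball x r" "w \<notin> interior \<Omega>" by blast
  have "frontier (interior \<Omega>) \<subseteq> frontier \<Omega>" by (rule frontier_interior_subset)
  moreover have "ball x r \<inter> frontier (interior \<Omega>) \<noteq> {}"
    by (rule connected_Int_frontier[OF connected_ball]) (use w assms in auto)
  ultimately show False using assms(1) by blast
qed

lemma depth_ball:
  assumes "x \<in> interior \<Omega>"
  shows "ball x (depth x) \<subseteq> interior \<Omega>"
proof (rule ball_avoid_frontier[OF _ _ assms])
  show "ball x (depth x) \<inter> frontier \<Omega> = {}"
    unfolding depth_def using infdist_le[of _ "frontier \<Omega>" x] by fastforce
  show "x \<in> ball x (depth x)" using depth_pos[OF assms] by simp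
qed

text \<open>At a nearest boundary point the squared distance is stationary, so the segment to it is
  normal to the curve and the height is real.\<close>

lemma depth_nearest:
  assumes "x \<in> interior \<Omega>"
  obtains s where "height s x = of_real (depth x)"
proof -
  obtain q where q: "q \<in> frontier \<Omega>" "infdist x (frontier \<Omega>) = dist x q"
    using infdist_attains_inf[OF frontier_facts(1,2)] by metis
  then obtain s where s: "q = \<gamma> s" using frontier by auto
  have min: "dist x (\<gamma> s) \<le> dist x (\<gamma> t)" for t
    using infdist_le[of "\<gamma> t" "frontier \<Omega>" x] frontier q s by auto
  define g where "g t = (x - \<gamma> t) \<bullet> (x - \<gamma> t)" for t
  have g_dist: "g t = (dist x (\<gamma> t))\<^sup>2" for t by (simp add: g_def dist_norm power2_norm_eq_inner)
  have "(g has_vector_derivative ((x - \<gamma> s) \<bullet> (- \<gamma>' s) + (- \<gamma>' s) \<bullet> (x - \<gamma> s))) (at s)"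
  proof -
    have D: "((\<lambda>t. x - \<gamma> t) has_vector_derivative (- \<gamma>' s)) (at s)"
      using has_vector_derivative_diff[OF has_vector_derivative_const[of x] deriv1[of s]] by simp
    show ?thesis unfolding g_def[abs_def] by (rule bounded_bilinear.has_vector_derivative[OF bounded_bilinear_inner D D])
  qed
  then have "(g has_real_derivative ((x - \<gamma> s) \<bullet> (- \<gamma>' s) + (- \<gamma>' s) \<bullet> (x - \<gamma> s))) (at s)"
    by (simp only: has_real_derivative_iff_has_vector_derivative)
  then have "(x - \<gamma> s) \<bullet> (- \<gamma>' s) + (- \<gamma>' s) \<bullet> (x - \<gamma> s) = 0"
    by (rule DERIV_local_min[of _ _ _ 1]) (auto simp: g_dist min intro!: power_mono)
  then have orth: "(x - \<gamma> s) \<bullet> \<gamma>' s = 0" by (simp add: inner_commute)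
  have "Re ((x - \<gamma> s) / \<gamma>' s) = 0"
  proof -
    have "(x - \<gamma> s) / \<gamma>' s = ((x - \<gamma> s) * cnj (\<gamma>' s)) / of_real ((cmod (\<gamma>' s))\<^sup>2)"
      using complex_div_cnj[of "x - \<gamma> s" "\<gamma>' s"] by simp
    moreover have "Re ((x - \<gamma> s) * cnj (\<gamma>' s)) = (x - \<gamma> s) \<bullet> \<gamma>' s" by (simp add: inner_complex_def)
    ultimately show ?thesis using orth by (simp only: Re_divide_of_real, simp?)
  qed
  then have "Im (height s x) = 0"
  proof -
    assume r: "Re ((x - \<gamma> s) / \<gamma>' s) = 0"
    have "height s x = of_real (cmod (\<gamma>' s)) * (- \<i> * ((x - \<gamma> s) / \<gamma>' s))" by (simp only: height_def mult_ac)
    then have "Im (height s x) = cmod (\<gamma>' s) * Im (- \<i> * ((x - \<gamma> s) / \<gamma>' s))" by (simp only: of_real_mult_sel)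
    also have "Im (- \<i> * ((x - \<gamma> s) / \<gamma>' s)) = 0" using r by (simp only: mult_minus_left Im_i_times uminus_complex.sel minus_zero)
    finally show ?thesis by simp
  qed
  moreover have "0 \<le> Re (height s x)" using assms interior_subset by (intro Re_height_nonneg) auto
  ultimately have "height s x = of_real (norm (height s x))" by (simp add: complex_eq_iff cmod_def)
  then show thesis using that[of s] q s by (simp add: norm_height depth_def)
qed

text \<open>The ball of radius \<open>depth x\<close> lies in the tangent half-plane, so its centre
  is at least this far from the tangent; \<open>e\<close> makes up for the ball being open.\<close>

lemma depth_le_height:
  assumes "x \<in> interior \<Omega>"
  shows "depth x \<le> Re (height s x)"
proof (rule field_le_epsilon)
  fix e :: real assume e: "e > 0"
  define r where "r = max 0 (depth x - e)"
  define y where "y = x + of_real (- r) * (\<i> * \<gamma>' s / of_real (cmod (\<gamma>' s)))"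
  have "r < depth x" using e depth_pos[OF assms] by (simp add: r_def)
  moreover have "dist x y = r" using regular[of s] by (simp add: y_def dist_norm norm_mult norm_divide r_def)
  ultimately have "y \<in> ball x (depth x)" by simp
  then have "y \<in> \<Omega>" using depth_ball[OF assms] interior_subset by blast
  then have "0 \<le> Re (height s y)" by (rule Re_height_nonneg)
  also have "height s y = height s x - of_real r" unfolding y_def height_add
    using regular[of s] by (simp add: mult.left_commute[of \<i>])
  finally show "depth x \<le> Re (height s x) + e" by (simp add: r_def)
qed

text \<open>The bound on \<open>k\<close> says that the height of every boundary point over the
  tangent at \<open>\<gamma> s\<close> is at most a fixed multiple of its squared distance to
  \<open>\<gamma> s\<close>. This is exactly the condition for lying outside a tangent disc, so the
  disc misses the frontier; it lies inside because it contains an interior point.\<close>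

lemma interior_ball:
  obtains R where "R > 0" "\<And>s. ball (\<gamma> s + of_real R * (\<i> * \<gamma>' s / of_real (cmod (\<gamma>' s)))) R \<subseteq> interior \<Omega>"
proof -
  obtain C where C: "C > 0" "\<And>s t. \<bar>k s t\<bar> \<le> C" using k_bounded by blast
  obtain s0 where s0: "s0 \<in> {0..1}" "\<And>s. s \<in> {0..1} \<Longrightarrow> cmod (\<gamma>' s0) \<le> cmod (\<gamma>' s)"
    using continuous_attains_inf[of "{0..1::real}" "\<lambda>s. cmod (\<gamma>' s)"] continuous_on_norm[OF cont1[of "{0..1}"]]
    by (metis atLeastAtMost_iff compact_Icc empty_iff order_refl zero_le_one)
  define m where "m = cmod (\<gamma>' s0)"
  have m: "m > 0" using regular by (simp add: m_def)
  have m': "m \<le> cmod (\<gamma>' s)" for s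
  proof -
    have "m \<le> cmod (\<gamma>' (frac s))" unfolding m_def by (rule s0(2)) (simp add: frac_lt_1 less_imp_le)
    also have "\<gamma>' (frac s) = \<gamma>' s" using period1_int[of s "- \<lfloor>s\<rfloor>"] by (simp add: frac_def)
    finally show ?thesis .
  qed
  \<comment> \<open>From \<open>Re (height s (\<gamma> t)) * cmod (\<gamma>' s) = k s t * (dist
    (\<gamma> t) (\<gamma> s))\<^sup>2\<close> with \<open>k\<close> at most \<open>C\<close> and
    the speed at least \<open>m\<close>, this radius gives
    \<open>2 * R * height \<le> dist\<^sup>2\<close>.\<close>
  define R where "R = m / (2 * C)"
  have R: "R > 0" using m C by (simp add: R_def)
  have "ball (\<gamma> s + of_real R * (\<i> * \<gamma>' s / of_real (cmod (\<gamma>' s)))) R \<subseteq> interior \<Omega>" for s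
  proof -
    define n where "n = \<i> * \<gamma>' s / of_real (cmod (\<gamma>' s))"
    have nn: "norm n = 1" using regular[of s] by (simp add: n_def norm_mult norm_divide)
    have dist_sq: "(dist (\<gamma> s + of_real R * n) x)\<^sup>2 = (dist x (\<gamma> s))\<^sup>2 - 2 * R * Re (height s x) + R\<^sup>2" for x
    proof -
      have "x = \<gamma> s + height s x * n" unfolding n_def by (rule from_height)
      then have "\<gamma> s + of_real R * n - x = (of_real R - height s x) * n" by (metis add_diff_cancel_left left_diff_distrib)
      then have "dist (\<gamma> s + of_real R * n) x = norm (of_real R - height s x)" using nn by (simp add: dist_norm norm_mult)
      then have "(dist (\<gamma> s + of_real R * n) x)\<^sup>2 = (R - Re (height s x))\<^sup>2 + (Im (height s x))\<^sup>2" by (simp add: cmod_power2)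
      moreover have "(dist x (\<gamma> s))\<^sup>2 = (Re (height s x))\<^sup>2 + (Im (height s x))\<^sup>2" by (simp add: cmod_power2 flip: norm_height)
      ultimately show ?thesis by (simp add: power2_eq_square algebra_simps)
    qed
    have avoid: "R \<le> dist (\<gamma> s + of_real R * n) (\<gamma> t)" for t
    proof -
      have "Re (height s (\<gamma> t)) * cmod (\<gamma>' s) = k s t * (dist (\<gamma> t) (\<gamma> s))\<^sup>2"
      proof (cases "\<gamma> s = \<gamma> t")
        case True then show ?thesis by (simp add: height_def)
      next
        case False
        define q where "q = (\<gamma> t - \<gamma> s) / \<gamma>' s"
        have "\<gamma>' s / (\<gamma> s - \<gamma> t) = - inverse q" by (simp add: q_def) (metis minus_diff_eq minus_divide_right)
        then have kq: "k s t = Im q / (cmod q)\<^sup>2" by (simp add: k_def cmod_power2)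
        have "q \<noteq> 0" using False regular[of s] by (auto simp: q_def)
        moreover have "dist (\<gamma> t) (\<gamma> s) = cmod q * cmod (\<gamma>' s)" using regular[of s] by (simp add: q_def norm_divide dist_norm)
        ultimately show ?thesis by (simp add: kq Re_height power_mult_distrib flip: q_def) (simp add: power2_eq_square)
      qed
      also have "\<dots> \<le> C * (dist (\<gamma> t) (\<gamma> s))\<^sup>2" using C(2)[of s t] by (intro mult_right_mono) auto
      finally have "Re (height s (\<gamma> t)) * m \<le> C * (dist (\<gamma> t) (\<gamma> s))\<^sup>2"
        using mult_left_mono[OF m'[of s] Re_height_nonneg[OF in_Omega, of s t]] by linarith
      then have "2 * R * Re (height s (\<gamma> t)) \<le> (dist (\<gamma> t) (\<gamma> s))\<^sup>2" using C(1) by (simp add: R_def field_simps)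
      then have "R\<^sup>2 \<le> (dist (\<gamma> s + of_real R * n) (\<gamma> t))\<^sup>2" unfolding dist_sq by simp
      then show ?thesis by (rule power2_le_imp_le) simp
    qed
    obtain y0 where y0: "y0 \<in> interior \<Omega>" using interior by blast
    define h where "h = Re (height s y0)"
    define D where "D = dist y0 (\<gamma> s)"
    have h: "h > 0" unfolding h_def Re_height using interior_left_of_tangent[OF y0] regular[of s] by simp
    have "h \<le> D" using norm_height[of s y0] complex_Re_le_cmod[of "height s y0"] by (simp add: h_def D_def)
    then have D: "D > 0" using h by linarith
    \<comment> \<open>The point at fraction \<open>e\<close> of the segment from
      \<open>\<gamma> s\<close> to \<open>y0\<close> has squared distance
      \<open>R\<^sup>2 - 2 * R * e * h + e\<^sup>2 * D\<^sup>2\<close> to the centre; this choice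
      makes the last term at most half of the middle one.\<close>
    define e where "e = min 1 (R * h / D\<^sup>2)"
    have e: "0 < e" "e \<le> 1" "e * D\<^sup>2 \<le> R * h" using R h D by (auto simp: e_def min_def field_simps split: if_splits)
    define y where "y = \<gamma> s - e *\<^sub>R (\<gamma> s - y0)"
    have yi: "y \<in> interior \<Omega>" unfolding y_def
      by (rule mem_interior_convex_shrink[OF convex y0 in_Omega]) (use e in auto)
    have hy: "height s y = of_real e * height s y0" by (simp add: height_def y_def scaleR_conv_of_real algebra_simps)
    have "dist y (\<gamma> s) = e * D" using norm_height[of s y] norm_height[of s y0] e(1) by (simp add: hy norm_mult D_def)
    then have "(dist (\<gamma> s + of_real R * n) y)\<^sup>2 = e * (e * D\<^sup>2) - 2 * R * e * h + R\<^sup>2"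
      unfolding dist_sq by (simp add: hy h_def power_mult_distrib power2_eq_square)
    also have "\<dots> \<le> e * (R * h) - 2 * R * e * h + R\<^sup>2" using e by (simp add: mult_left_mono)
    also have "\<dots> < R\<^sup>2" using e R h by (simp add: algebra_simps)
    finally have yb: "y \<in> ball (\<gamma> s + of_real R * n) R" using R by (simp add: power2_less_imp_less)
    have "ball (\<gamma> s + of_real R * n) R \<subseteq> interior \<Omega>"
    proof (rule ball_avoid_frontier[OF _ yb yi])
      show "ball (\<gamma> s + of_real R * n) R \<inter> frontier \<Omega> = {}"
      proof (rule equals0I)
        fix w assume "w \<in> ball (\<gamma> s + of_real R * n) R \<inter> frontier \<Omega>"
        then obtain t where "w = \<gamma> t" "dist (\<gamma> s + of_real R * n) w < R" unfolding frontier by auto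
        then show False using avoid[of t] by simp
      qed
    qed
    then show ?thesis by (simp add: n_def)
  qed
  then show thesis using that[OF R] by blast
qed

text \<open>Everything rests on comparing \<open>depth x\<close> with \<open>1 - norm (f x)\<close>.
  The supporting half-plane at the nearest boundary point gives
  \<open>1 - norm (f x) \<le> C * depth x\<close>, and Schwarz-Pick on the disc of radius
  \<open>depth x\<close> then bounds \<open>deriv f\<close>. The tangent discs give
  \<open>depth x \<le> C' * (1 - norm (f x))\<close>, and the half-plane form of Schwarz-Pick then
  bounds \<open>deriv g\<close>. Both domains are convex, so derivative bounds are Lipschitz
  bounds.\<close>

lemma riemann_map_bilipschitz:
  assumes f: "f holomorphic_on interior \<Omega>" "\<And>x. x \<in> interior \<Omega> \<Longrightarrow> f x \<in> ball 0 1"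
    and g: "g holomorphic_on ball 0 1" "\<And>z. z \<in> ball 0 1 \<Longrightarrow> g z \<in> interior \<Omega>"
    and fg: "\<And>z. z \<in> ball 0 1 \<Longrightarrow> f (g z) = z" "\<And>x. x \<in> interior \<Omega> \<Longrightarrow> g (f x) = x"
  obtains A B where "\<And>x y. x \<in> interior \<Omega> \<Longrightarrow> y \<in> interior \<Omega> \<Longrightarrow> dist (f x) (f y) \<le> A * dist x y"
    "\<And>z w. z \<in> ball 0 1 \<Longrightarrow> w \<in> ball 0 1 \<Longrightarrow> dist (g z) (g w) \<le> B * dist z w"
proof -
  have hh: "height s holomorphic_on T" for s T
    unfolding height_def by (intro holomorphic_intros) (simp add: regular)
  have hg: "(\<lambda>z. height s (g z)) holomorphic_on ball 0 1" for s
    using holomorphic_on_compose[OF g(1) hh] by (simp add: o_def)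
  have hpos: "0 < Re (height s (g z))" if "norm z < 1" for s z
    using depth_pos[of "g z"] depth_le_height[of "g z" s] g(2)[of z] that by auto
  have dh: "norm (deriv (\<lambda>z. height s (g z)) z) = norm (deriv g z)" if z: "norm z < 1" for s z
  proof -
    have "(g has_field_derivative deriv g z) (at z)" using g(1) z by (auto intro!: holomorphic_derivI[of _ "ball 0 1"])
    then have "((\<lambda>z. height s (g z)) has_field_derivative (- \<i> * of_real (cmod (\<gamma>' s)) / \<gamma>' s) * deriv g z) (at z)"
      unfolding height_def using regular[of s] by (auto intro!: derivative_eq_intros simp: field_simps)
    then have "deriv (\<lambda>z. height s (g z)) z = (- \<i> * of_real (cmod (\<gamma>' s)) / \<gamma>' s) * deriv g z" by (rule DERIV_imp_deriv)
    then show ?thesis using regular[of s] by (simp add: norm_mult norm_divide)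
  qed
  obtain Dm where Dm: "\<And>x y. x \<in> \<Omega> \<Longrightarrow> y \<in> \<Omega> \<Longrightarrow> dist x y \<le> Dm"
    using diameter_bounded_bound[OF compact_imp_bounded[OF compact]] by blast
  have Dm0: "Dm \<ge> 0" using Dm[OF in_Omega in_Omega, of 0 0] by simp
  have gO: "g z \<in> \<Omega>" "g z \<in> interior \<Omega>" if "norm z < 1" for z using g(2)[of z] that interior_subset by auto
  define \<delta>0 where "\<delta>0 = depth (g 0)"
  have d0: "\<delta>0 > 0" unfolding \<delta>0_def by (rule depth_pos) (simp add: gO)
  define C where "C = 8 * (Dm + 1)\<^sup>2 / \<delta>0"
  have C: "1 - norm (f x) \<le> C * depth x" if x: "x \<in> interior \<Omega>" for x
  proof -
    obtain s where s: "height s x = of_real (depth x)" using depth_nearest[OF x] by blast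
    have z: "norm (f x) < 1" using f(2)[OF x] by simp
    have "(1 - norm (f x)) * Re (height s (g 0)) \<le> 8 * (norm (height s (g 0)) + 1)\<^sup>2 * Re (height s (g (f x)))"
      by (rule half_plane_Schwarz(2)[OF hg hpos z])
    also have "\<dots> \<le> 8 * (Dm + 1)\<^sup>2 * depth x"
      unfolding fg(2)[OF x] s norm_height Re_complex_of_real using Dm[OF gO(1)[of 0] in_Omega] depth_pos[OF x]
      by (intro mult_mono power_mono) auto
    finally have "(1 - norm (f x)) * \<delta>0 \<le> 8 * (Dm + 1)\<^sup>2 * depth x"
    proof -
      have "0 \<le> 1 - norm (f x)" using z by simp
      from mult_left_mono[OF depth_le_height[of "g 0" s] this] have "(1 - norm (f x)) * \<delta>0 \<le> (1 - norm (f x)) * Re (height s (g 0))"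
        unfolding \<delta>0_def by (simp add: gO)
      then show "(1 - norm (f x)) * Re (height s (g 0)) \<le> 8 * (Dm + 1)\<^sup>2 * depth x \<Longrightarrow> ?thesis" by linarith
    qed
    then show ?thesis using d0 by (simp add: C_def field_simps)
  qed
  have df: "norm (deriv f x) \<le> 2 * C" if x: "x \<in> interior \<Omega>" for x
  proof -
    define d where "d = depth x"
    have d: "d > 0" using depth_pos[OF x] by (simp add: d_def)
    have sub: "x + of_real d * z \<in> interior \<Omega>" if "norm z < 1" for z
      using depth_ball[OF x] that d by (auto simp: subset_iff dist_norm norm_mult d_def)
    define h where "h z = f (x + of_real d * z)" for z
    have "h holomorphic_on ball 0 1"
    proof -
      have "(f \<circ> (\<lambda>z. x + of_real d * z)) holomorphic_on ball 0 1"
        by (rule holomorphic_on_compose_gen[OF _ f(1)]) (use sub in \<open>auto intro!: holomorphic_intros\<close>)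
      then show ?thesis by (simp add: o_def h_def[abs_def])
    qed
    then have "norm (deriv h 0) * (1 - (norm (0::complex))\<^sup>2) \<le> 1 - (norm (h 0))\<^sup>2"
      by (rule Schwarz_Pick(1)) (use f(2)[OF sub] in \<open>auto simp: h_def\<close>)
    moreover have "deriv h 0 = deriv f x * of_real d"
    proof -
      have "(f has_field_derivative deriv f x) (at (x + of_real d * 0))"
        using f(1) x by (auto intro!: holomorphic_derivI[of _ "interior \<Omega>"])
      moreover have "((\<lambda>z. x + of_real d * z) has_field_derivative of_real d) (at 0)" by (auto intro!: derivative_eq_intros)
      ultimately have "(f \<circ> (\<lambda>z. x + of_real d * z) has_field_derivative deriv f x * of_real d) (at 0)" by (rule DERIV_chain)
      then show ?thesis by (simp add: DERIV_imp_deriv h_def[abs_def] o_def)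
    qed
    ultimately have "norm (deriv f x) * d \<le> 1 - (norm (f x))\<^sup>2" using d by (simp add: h_def norm_mult)
    also have "\<dots> = (1 + norm (f x)) * (1 - norm (f x))" by (simp add: power2_eq_square algebra_simps)
    also have "\<dots> \<le> 2 * (1 - norm (f x))" using f(2)[OF x] by (intro mult_right_mono) auto
    also have "\<dots> \<le> (2 * C) * d" using C[OF x] by (simp add: d_def)
    finally show ?thesis using d by simp
  qed
  obtain R where R: "R > 0" "\<And>s. ball (\<gamma> s + of_real R * (\<i> * \<gamma>' s / of_real (cmod (\<gamma>' s)))) R \<subseteq> interior \<Omega>"
    using interior_ball by blast
  \<comment> \<open>The points of depth at least \<open>R\<close> form a compact part of the
    interior, on which \<open>norm (f x)\<close> stays below \<kappa> or equals it. It contains the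
    centres of all tangent discs, so \<kappa> works for every \<open>s\<close>.\<close>
  define K where "K = \<Omega> \<inter> {x. R \<le> depth x}"
  have Kcomp: "compact K" unfolding K_def depth_def
    by (rule compact_Int_closed[OF compact]) (intro closed_Collect_le continuous_intros)
  have Kint: "K \<subseteq> interior \<Omega>"
  proof
    fix x assume x: "x \<in> K"
    show "x \<in> interior \<Omega>"
    proof (rule ccontr)
      assume "x \<notin> interior \<Omega>"
      then have "x \<in> frontier \<Omega>" using x closure_subset by (auto simp: K_def frontier_def)
      then have "depth x = 0" by (simp add: depth_def)
      then show False using x R by (simp add: K_def)
    qed
  qed
  define y where "y s = \<gamma> s + of_real R * (\<i> * \<gamma>' s / of_real (cmod (\<gamma>' s)))" for s
  have yK: "y s \<in> K" for s
  proof -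
    have yi: "y s \<in> interior \<Omega>" using R(2)[of s] R(1) by (auto simp: y_def subset_iff)
    have "R \<le> depth (y s)"
    proof (rule ccontr)
      assume less: "\<not> ?thesis"
      obtain q where q: "q \<in> frontier \<Omega>" "infdist (y s) (frontier \<Omega>) = dist (y s) q"
        using infdist_attains_inf[OF frontier_facts(1,2)] by metis
      then have "q \<in> interior \<Omega>" using R(2)[of s] less by (auto simp: y_def depth_def)
      then show False using q by (simp add: frontier_def)
    qed
    then show ?thesis using yi interior_subset by (auto simp: K_def)
  qed
  have "continuous_on K (\<lambda>x. norm (f x))"
    by (intro continuous_on_norm continuous_on_subset[OF holomorphic_on_imp_continuous_on[OF f(1)] Kint])
  from continuous_attains_sup[OF Kcomp _ this] yK obtain x1 where x1: "x1 \<in> K" "\<And>x. x \<in> K \<Longrightarrow> norm (f x) \<le> norm (f x1)" by blast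
  define \<kappa> where "\<kappa> = norm (f x1)"
  have kap: "\<kappa> < 1" using f(2)[of x1] x1 Kint by (auto simp: \<kappa>_def)
  \<comment> \<open>Deep points are covered by the diameter bound \<open>Dm\<close>; the entry
    \<open>4 * R\<close> comes from \<open>Schwarz_Pick_growth\<close> in the tangent disc through
    the foot point of a shallow point.\<close>
  define C' where "C' = max (4 * R) Dm / (1 - \<kappa>)"
  have C': "depth x \<le> C' * (1 - norm (f x))" if x: "x \<in> interior \<Omega>" for x
  proof -
    have z: "norm (f x) < 1" using f(2)[OF x] by simp
    have "(1 - \<kappa>) * depth x \<le> max (4 * R) Dm * (1 - norm (f x))"
    proof (cases "R \<le> depth x")
      case True
      then have "x \<in> K" using x interior_subset by (auto simp: K_def)
      then have "1 - \<kappa> \<le> 1 - norm (f x)" using x1(2) by (simp add: \<kappa>_def)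
      moreover have "depth x \<le> Dm"
        using infdist_le[of "\<gamma> 0" "frontier \<Omega>" x] Dm[of x "\<gamma> 0"] in_Omega x interior_subset frontier by (auto simp: depth_def intro: order_trans)
      ultimately have "(1 - \<kappa>) * depth x \<le> (1 - norm (f x)) * Dm" using depth_pos[OF x] z by (intro mult_mono) auto
      also have "\<dots> \<le> (1 - norm (f x)) * max (4 * R) Dm" using z by (intro mult_left_mono) auto
      finally show ?thesis by (simp add: mult.commute)
    next
      case False
      obtain s where s: "height s x = of_real (depth x)" using depth_nearest[OF x] by blast
      define n where "n = \<i> * \<gamma>' s / of_real (cmod (\<gamma>' s))"
      have nn: "norm n = 1" using regular[of s] by (simp add: n_def norm_mult norm_divide)
      have xs: "x = \<gamma> s + of_real (depth x) * n" using from_height[of x s] by (simp add: s n_def)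
      have ys: "y s = \<gamma> s + of_real R * n" by (simp add: y_def n_def)
      define h where "h z = f (y s + of_real R * z)" for z
      have sub: "y s + of_real R * z \<in> interior \<Omega>" if "norm z < 1" for z
        using R(2)[of s] that R(1) by (auto simp: subset_iff dist_norm norm_mult y_def)
      have hh: "h holomorphic_on ball 0 1"
      proof -
        have "(f \<circ> (\<lambda>z. y s + of_real R * z)) holomorphic_on ball 0 1"
          by (rule holomorphic_on_compose_gen[OF _ f(1)]) (use sub in \<open>auto intro!: holomorphic_intros\<close>)
        then show ?thesis by (simp add: o_def h_def[abs_def])
      qed
      have h1: "norm (h z) < 1" if "norm z < 1" for z using f(2)[OF sub[OF that]] by (simp add: h_def)
      \<comment> \<open>The position of \<open>x\<close> in the tangent disc rescaled to the unit
        disc: \<open>x\<close> lies on the normal through the centre, so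
        \<open>1 - norm \<zeta>\<close> is \<open>depth x / R\<close>.\<close>
      define \<zeta> where "\<zeta> = of_real ((depth x - R) / R) * n"
      have nz: "norm \<zeta> = (R - depth x) / R" using False R(1) unfolding \<zeta>_def norm_mult nn norm_of_real by simp
      have z1: "norm \<zeta> < 1" unfolding nz using depth_pos[OF x] R(1) by (simp add: divide_less_eq)
      have hz: "h \<zeta> = f x"
      proof -
        have "y s + of_real R * \<zeta> = x"
        proof -
          have "of_real R * \<zeta> = of_real (depth x - R) * n" using R(1) by (simp add: \<zeta>_def)
          then have "y s + of_real R * \<zeta> = \<gamma> s + of_real (depth x) * n" by (simp add: ys algebra_simps)
          then show ?thesis using xs by simp
        qed
        then show ?thesis by (simp add: h_def)
      qed
      have "(1 - norm (h 0)) * (1 - norm \<zeta>) \<le> 4 * (1 - norm (h \<zeta>))" by (rule Schwarz_Pick_growth[OF hh h1 z1])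
      moreover have "1 - norm \<zeta> = depth x / R" using R(1) by (simp add: nz field_simps)
      moreover have "1 - \<kappa> \<le> 1 - norm (h 0)" using x1(2)[OF yK[of s]] by (simp add: h_def \<kappa>_def)
      ultimately have "(1 - \<kappa>) * (depth x / R) \<le> 4 * (1 - norm (f x))"
        using mult_right_mono[of "1 - \<kappa>" "1 - norm (h 0)" "depth x / R"] depth_pos[OF x] R(1) hz by auto
      then have "(1 - \<kappa>) * depth x \<le> (4 * R) * (1 - norm (f x))" using R(1) by (simp add: field_simps)
      also have "\<dots> \<le> max (4 * R) Dm * (1 - norm (f x))" using z by (intro mult_right_mono) auto
      finally show ?thesis .
    qed
    then show ?thesis using kap by (simp add: C'_def field_simps)
  qed
  have dg: "norm (deriv g z) \<le> 2 * C'" if "z \<in> ball 0 1" for z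
  proof -
    have z: "norm z < 1" using that by simp
    obtain s where s: "height s (g z) = of_real (depth (g z))" using depth_nearest[OF gO(2)[OF z]] by blast
    have "norm (deriv g z) * (1 - (norm z)\<^sup>2) \<le> 2 * depth (g z)"
      using half_plane_Schwarz(1)[OF hg hpos z, of s] unfolding dh[OF z] s by simp
    also have "\<dots> \<le> 2 * C' * (1 - norm z)" using C'[OF gO(2)[OF z]] fg(1)[OF that] by simp
    also have "\<dots> \<le> 2 * C' * (1 - (norm z)\<^sup>2)"
    proof (rule mult_left_mono)
      show "0 \<le> 2 * C'" using Dm0 kap by (auto simp: C'_def max_def divide_nonneg_pos)
      show "1 - norm z \<le> 1 - (norm z)\<^sup>2" using z by (simp add: power2_eq_square mult_left_le)
    qed
    finally show ?thesis using z by (simp add: power_less_one_iff)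
  qed
  show thesis
  proof (rule that)
    show "dist (f x) (f x') \<le> (2 * C) * dist x x'" if "x \<in> interior \<Omega>" "x' \<in> interior \<Omega>" for x x'
      unfolding dist_norm
      by (rule field_differentiable_bound[OF convex_interior[OF convex] _ df that])
         (rule has_field_derivative_at_within[OF holomorphic_derivI[OF f(1) open_interior]])
    show "dist (g z) (g w) \<le> (2 * C') * dist z w" if "z \<in> ball 0 1" "w \<in> ball 0 1" for z w
      unfolding dist_norm
      by (rule field_differentiable_bound[OF convex_ball _ dg that])
         (rule has_field_derivative_at_within[OF holomorphic_derivI[OF g(1) open_ball]])
  qed
qed

text \<open>Lipschitz maps extend continuously to the closures, and the extensions remain inverse to
  each other by density. That boundary goes to boundary follows, since an interior image would be
  carried back into the interior.\<close>

lemma riemann_map_extension: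
  obtains F G where "F holomorphic_on ball 0 1" "continuous_on (cball 0 1) F" "continuous_on \<Omega> G"
    "\<And>z. z \<in> ball 0 1 \<Longrightarrow> F z \<in> interior \<Omega>" "\<And>z. z \<in> sphere 0 1 \<Longrightarrow> F z \<in> frontier \<Omega>"
    "\<And>z. z \<in> cball 0 1 \<Longrightarrow> G (F z) = z" "\<And>x. x \<in> \<Omega> \<Longrightarrow> G x \<in> cball 0 1 \<and> F (G x) = x"
    "\<And>x. x \<in> frontier \<Omega> \<Longrightarrow> G x \<in> sphere 0 1"
proof -
  have "simply_connected (interior \<Omega>)" by (intro convex_imp_simply_connected convex_interior convex)
  then have "open (interior \<Omega>) \<and> simply_connected (interior \<Omega>)" by simp
  then have "interior \<Omega> = {} \<or> interior \<Omega> = UNIV \<or> (\<exists>f g. f holomorphic_on interior \<Omega> \<and> g holomorphic_on ball 0 1 \<and>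
           (\<forall>z \<in> interior \<Omega>. f z \<in> ball 0 1 \<and> g(f z) = z) \<and> (\<forall>z \<in> ball 0 1. g z \<in> interior \<Omega> \<and> f(g z) = z))"
    by (rule Riemann_mapping_theorem[THEN iffD1])
  moreover have "interior \<Omega> \<noteq> UNIV"
    using bounded_subset[OF compact_imp_bounded[OF compact] interior_subset] not_bounded_UNIV by metis
  ultimately obtain f g where f: "f holomorphic_on interior \<Omega>" and g: "g holomorphic_on ball 0 1"
    and fg: "\<forall>z \<in> interior \<Omega>. f z \<in> ball 0 1 \<and> g (f z) = z" "\<forall>z \<in> ball 0 1. g z \<in> interior \<Omega> \<and> f (g z) = z"
    using interior by blast
  have fg': "\<And>x. x \<in> interior \<Omega> \<Longrightarrow> f x \<in> ball 0 1" "\<And>z. z \<in> ball 0 1 \<Longrightarrow> g z \<in> interior \<Omega>"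
    "\<And>z. z \<in> ball 0 1 \<Longrightarrow> f (g z) = z" "\<And>x. x \<in> interior \<Omega> \<Longrightarrow> g (f x) = x" using fg by blast+
  obtain A B where A: "\<And>x y. x \<in> interior \<Omega> \<Longrightarrow> y \<in> interior \<Omega> \<Longrightarrow> dist (f x) (f y) \<le> A * dist x y"
    and B: "\<And>z w. z \<in> ball 0 1 \<Longrightarrow> w \<in> ball 0 1 \<Longrightarrow> dist (g z) (g w) \<le> B * dist z w"
    by (rule riemann_map_bilipschitz[OF f fg'(1) g fg'(2-4)]) (assumption+, rule that)
  have uc: "uniformly_continuous_on S h" if "\<And>x y. x \<in> S \<Longrightarrow> y \<in> S \<Longrightarrow> dist (h x) (h y) \<le> C * dist x y"
    for S and h :: "complex \<Rightarrow> complex" and C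
  proof (rule lipschitz_on_uniformly_continuous)
    show "\<bar>C\<bar>-lipschitz_on S h"
    proof (rule lipschitz_onI)
      fix x y assume "x \<in> S" "y \<in> S"
      then have "dist (h x) (h y) \<le> C * dist x y" by (rule that)
      also have "\<dots> \<le> \<bar>C\<bar> * dist x y" by (intro mult_right_mono) auto
      finally show "dist (h x) (h y) \<le> \<bar>C\<bar> * dist x y" .
    qed simp
  qed
  have cl\<Omega>: "closure (interior \<Omega>) = \<Omega>"
    using convex_closure_interior[OF convex interior] compact_imp_closed[OF compact] by simp
  obtain F where F: "uniformly_continuous_on (closure (ball 0 1)) F" "\<And>x. x \<in> ball 0 1 \<Longrightarrow> g x = F x"
    by (rule uniformly_continuous_on_extension_on_closure[OF uc[OF B]]) (assumption, assumption, rule that, assumption, blast)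
  obtain G where G: "uniformly_continuous_on (closure (interior \<Omega>)) G" "\<And>x. x \<in> interior \<Omega> \<Longrightarrow> f x = G x"
    by (rule uniformly_continuous_on_extension_on_closure[OF uc[OF A]]) (assumption, assumption, rule that, assumption, blast)
  have cF: "continuous_on (cball 0 1) F" and cG: "continuous_on \<Omega> G"
    using F(1) G(1) uniformly_continuous_imp_continuous by (auto simp: cl\<Omega>)
  have cball: "cball 0 1 = closure (ball (0::complex) 1)" by simp
  have FO: "F z \<in> \<Omega>" if "z \<in> cball 0 1" for z
  proof -
    have "F ` closure (ball 0 1) \<subseteq> \<Omega>"
    proof (rule image_closure_subset)
      show "F ` ball 0 1 \<subseteq> \<Omega>"
      proof
        fix x assume "x \<in> F ` ball 0 1"
        then obtain w where "w \<in> ball 0 1" "x = F w" by blast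
        then show "x \<in> \<Omega>" using F(2)[of w] fg(2) interior_subset by (metis subsetD)
      qed
    qed (use cF compact_imp_closed[OF compact] in \<open>auto simp: cball[symmetric]\<close>)
    then show ?thesis using that unfolding cball by blast
  qed
  have GO: "G x \<in> cball 0 1" if "x \<in> \<Omega>" for x
  proof -
    have "G ` closure (interior \<Omega>) \<subseteq> cball 0 1"
    proof (rule image_closure_subset)
      show "G ` interior \<Omega> \<subseteq> cball 0 1"
      proof
        fix z assume "z \<in> G ` interior \<Omega>"
        then obtain w where "w \<in> interior \<Omega>" "z = G w" by blast
        then show "z \<in> cball 0 1" using G(2)[of w] fg(1) ball_subset_cball by (metis subsetD)
      qed
    qed (use cG in \<open>auto simp: cl\<Omega>\<close>)
    then show ?thesis using that unfolding cl\<Omega> by blast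
  qed
  have GF: "G (F z) = z" if z: "z \<in> cball 0 1" for z
  proof -
    have "G (F z) - z = 0"
    proof (rule continuous_constant_on_closure[of "ball 0 1" "\<lambda>z. G (F z) - z"])
      have "continuous_on (cball 0 1) (\<lambda>z. G (F z))" by (rule continuous_on_compose2[OF cG cF]) (use FO in auto)
      then show "continuous_on (closure (ball 0 1)) (\<lambda>z. G (F z) - z)" unfolding cball[symmetric] by (intro continuous_intros)
      show "G (F w) - w = 0" if "w \<in> ball 0 1" for w using that F(2)[OF that] G(2)[of "F w"] fg(2) by (metis diff_self)
      show "z \<in> closure (ball 0 1)" using z unfolding cball .
    qed
    then show ?thesis by simp
  qed
  have FG: "F (G x) = x" if x: "x \<in> \<Omega>" for x
  proof -
    have "F (G x) - x = 0"
    proof (rule continuous_constant_on_closure[of "interior \<Omega>" "\<lambda>x. F (G x) - x"])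
      have "continuous_on \<Omega> (\<lambda>x. F (G x))" by (rule continuous_on_compose2[OF cF cG]) (use GO in auto)
      then show "continuous_on (closure (interior \<Omega>)) (\<lambda>x. F (G x) - x)" unfolding cl\<Omega> by (intro continuous_intros)
      show "F (G w) - w = 0" if "w \<in> interior \<Omega>" for w using that G(2)[OF that] F(2)[of "G w"] fg(1) by (metis diff_self)
      show "x \<in> closure (interior \<Omega>)" using x unfolding cl\<Omega> .
    qed
    then show ?thesis by simp
  qed
  have Fint: "F z \<in> interior \<Omega>" if "z \<in> ball 0 1" for z using F(2)[OF that] fg(2) that by metis
  have Gint: "G x \<in> ball 0 1" if "x \<in> interior \<Omega>" for x using G(2)[OF that] fg(1) that by metis
  have Fsph: "F z \<in> frontier \<Omega>" if "z \<in> sphere 0 1" for z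
  proof -
    have zc: "z \<in> cball 0 1" and zn: "z \<notin> ball 0 1" using that by auto
    have "F z \<notin> interior \<Omega>" using Gint[of "F z"] GF[OF zc] zn by auto
    then show ?thesis using FO[OF zc] closure_subset by (auto simp: frontier_def)
  qed
  have Gsph: "G x \<in> sphere 0 1" if "x \<in> frontier \<Omega>" for x
  proof -
    have xO: "x \<in> \<Omega>" "x \<notin> interior \<Omega>" using that frontier_facts(3) by (auto simp: frontier_def)
    then have "G x \<notin> ball 0 1" using Fint[of "G x"] FG[OF xO(1)] by auto
    then show ?thesis using GO[OF xO(1)] by simp
  qed
  have "F holomorphic_on ball 0 1" using g F(2) holomorphic_cong[OF refl, of "ball 0 1" g F] by blast
  then show thesis using that[OF _ cF cG Fint Fsph GF _ Gsph] GO FG by blast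
qed

end

section \<open>Fejer means\<close>

abbreviation circle_interval :: "real measure" ("\<J>")
  where "\<J> \<equiv> restrict_space lborel {0..2*pi}"

lemma circle_interval_measure: "emeasure \<J> {0..2*pi} = ennreal (2*pi)" "measure \<J> {0..2*pi} = 2*pi" "space \<J> = {0..2*pi}"
proof -
  show 1: "emeasure \<J> {0..2*pi} = ennreal (2*pi)" by (simp add: emeasure_restrict_space)
  then show "measure \<J> {0..2*pi} = 2*pi" by (simp add: measure_def)
  show "space \<J> = {0..2*pi}" by (simp add: space_restrict_space)
qed

lemma circle_interval_finite: "finite_measure \<J>"
  by (rule finite_measureI) (simp add: circle_interval_measure)

lemma borel_measurable_circle_interval: "f \<in> borel_measurable borel \<Longrightarrow> f \<in> borel_measurable \<J>"
  by (intro measurable_restrict_space1) simp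

lemma integrable_circle_interval:
  fixes f :: "real \<Rightarrow> complex"
  assumes "f \<in> borel_measurable borel" "\<And>x. x \<in> {0..2*pi} \<Longrightarrow> norm (f x) \<le> B"
  shows "integrable \<J> f"
  by (rule finite_measure.integrable_const_bound[OF circle_interval_finite, where B = B])
     (use assms in \<open>auto intro!: AE_I2 borel_measurable_circle_interval simp: circle_interval_measure\<close>)

lemma integrable_circle_interval_cont:
  fixes f :: "real \<Rightarrow> complex"
  assumes "continuous_on UNIV f"
  shows "integrable \<J> f"
proof -
  have "bounded (f ` {0..2*pi})" by (intro compact_imp_bounded compact_continuous_image continuous_on_subset[OF assms]) auto
  then obtain B where "\<forall>x\<in>{0..2*pi}. norm (f x) \<le> B" unfolding bounded_iff by blast
  then show ?thesis using assms by (intro integrable_circle_interval[of f B] borel_measurable_continuous_onI) auto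
qed

lemma LINT_circle_interval:
  fixes f :: "real \<Rightarrow> 'a::euclidean_space"
  assumes "continuous_on {0..2*pi} f"
  shows "(LINT x|\<J>. f x) = integral {0..2*pi} f"
proof -
  have "(LINT x|\<J>. f x) = (LINT x:{0..2*pi}|lborel. f x)"
    by (simp add: integral_restrict_space set_lebesgue_integral_def)
  also have "\<dots> = integral {0..2*pi} f"
    using borel_integrable_atLeastAtMost'[OF assms] by (rule set_borel_integral_eq_integral(2))
  finally show ?thesis .
qed

lemma norm_LINT_le:
  fixes f :: "'a \<Rightarrow> complex"
  assumes "integrable M f" "integrable M g" "\<And>x. norm (f x) \<le> g x"
  shows "norm (LINT x|M. f x) \<le> (LINT x|M. g x)"
proof -
  have "norm (LINT x|M. f x) \<le> (LINT x|M. norm (f x))" by (rule integral_norm_bound)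
  also have "\<dots> \<le> (LINT x|M. g x)" using assms by (intro Bochner_Integration.integral_mono) auto
  finally show ?thesis .
qed

lemma cont_cis: "continuous_on S f \<Longrightarrow> continuous_on S (\<lambda>x. cis (f x))"
  by (intro continuous_intros)

lemma cis_int_period: "cis (of_int m * (x + 2 * pi)) = cis (of_int m * x)"
proof -
  have "cis (of_int m * (x + 2 * pi)) = cis (of_int m * x) * cis (2 * pi * of_int m)"
    by (simp add: cis_mult algebra_simps)
  then show ?thesis by simp
qed

lemma integral_cis:
  assumes "m \<noteq> 0"
  shows "(LINT y|\<J>. cis (of_int m * y)) = 0"
proof -
  have cc: "continuous_on {0..2*pi} (\<lambda>y. cis (of_int m * y))" by (intro cont_cis continuous_intros)
  have "((\<lambda>y. cis (of_int m * y)) has_integral (cis (of_int m * (2*pi)) / (\<i> * of_int m) - cis (of_int m * 0) / (\<i> * of_int m))) {0..2*pi}"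
  proof (rule fundamental_theorem_of_calculus)
    fix x :: real
    have "((\<lambda>z. exp (\<i> * of_int m * z) / (\<i> * of_int m)) has_field_derivative exp (\<i> * of_int m * of_real x)) (at (of_real x))"
      using assms by (auto intro!: derivative_eq_intros)
    then have "((\<lambda>y. exp (\<i> * of_int m * of_real y) / (\<i> * of_int m)) has_vector_derivative exp (\<i> * of_int m * of_real x)) (at x within {0..2*pi})"
      by (rule has_vector_derivative_real_field[THEN has_vector_derivative_at_within])
    then show "((\<lambda>y. cis (of_int m * y) / (\<i> * of_int m)) has_vector_derivative cis (of_int m * x)) (at x within {0..2*pi})"
      by (simp add: cis_conv_exp mult.assoc)
  qed simp
  moreover have "cis (of_int m * (2*pi)) = 1" using cis_int_period[of m 0] by simp
  ultimately have "integral {0..2*pi} (\<lambda>y. cis (of_int m * y)) = 0" by (simp add: integral_unique)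
  then show ?thesis by (simp add: LINT_circle_interval[OF cc])
qed

text \<open>The Fejer kernel as a squared modulus, which makes its nonnegativity evident; its
  integral over a period is \<open>2 * pi\<close> rather than 1.\<close>

definition fejer :: "nat \<Rightarrow> real \<Rightarrow> real"
  where "fejer N x = (cmod (\<Sum>j<N. cis (real j * x)))\<^sup>2 / real N"

lemma fejer_nonneg: "0 \<le> fejer N x" by (simp add: fejer_def)

lemma fejer_sum: "complex_of_real (fejer N x) = (\<Sum>j<N. \<Sum>l<N. cis (of_int (int j - int l) * x)) / of_nat N"
proof -
  have "complex_of_real ((cmod (\<Sum>j<N. cis (real j * x)))\<^sup>2) = (\<Sum>j<N. cis (real j * x)) * cnj (\<Sum>l<N. cis (real l * x))"
    by (rule complex_norm_square)
  also have "\<dots> = (\<Sum>j<N. \<Sum>l<N. cis (real j * x) * cnj (cis (real l * x)))"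
    by (simp add: sum_product cnj_sum)
  also have "\<dots> = (\<Sum>j<N. \<Sum>l<N. cis (of_int (int j - int l) * x))"
    by (simp add: cis_cnj cis_mult algebra_simps)
  finally show ?thesis by (simp add: fejer_def)
qed

lemma fejer_cont: "continuous_on S f \<Longrightarrow> continuous_on S (\<lambda>x. fejer N (f x))"
  unfolding fejer_def divide_inverse by (intro continuous_intros cont_cis)

text \<open>Multiplication by \<open>cis x - 1\<close> telescopes the geometric sum to
  \<open>cis (real N * x) - 1\<close>, of modulus at most 2. Away from the multiples of
  \<open>2 * pi\<close> the kernel is thus of order \<open>1 / N\<close>.\<close>

lemma fejer_small: "fejer N x * (cmod (cis x - 1))\<^sup>2 \<le> 4 / real N"
proof -
  have "(cis x - 1) * (\<Sum>j<N. cis (real j * x)) = cis (real N * x) - 1"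
  proof (induction N)
    case (Suc N)
    have "cis x * cis (real N * x) = cis (real (Suc N) * x)" by (simp add: cis_mult algebra_simps)
    then show ?case using Suc by (simp add: algebra_simps)
  qed simp
  then have "cmod (cis x - 1) * cmod (\<Sum>j<N. cis (real j * x)) = cmod (cis (real N * x) - 1)" by (metis norm_mult)
  also have "\<dots> \<le> 2" using norm_triangle_ineq4[of "cis (real N * x)" 1] by simp
  finally have "(cmod (cis x - 1) * cmod (\<Sum>j<N. cis (real j * x)))\<^sup>2 \<le> 2\<^sup>2" by (intro power_mono) auto
  then have "(cmod (\<Sum>j<N. cis (real j * x)))\<^sup>2 * (cmod (cis x - 1))\<^sup>2 \<le> 4" by (simp add: power_mult_distrib mult.commute)
  then show ?thesis by (simp add: fejer_def divide_right_mono)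
qed

text \<open>Fourier coefficients without the factor \<open>1 / (2 * pi)\<close>, in accordance with
  the normalisation of the kernel.\<close>

definition fourier :: "(real \<Rightarrow> complex) \<Rightarrow> int \<Rightarrow> complex"
  where "fourier f n = (LINT y|\<J>. cis (of_int (- n) * y) * f y)"

lemma fejer_mean_eq:
  fixes f :: "real \<Rightarrow> complex"
  assumes f[measurable]: "f \<in> borel_measurable borel" and B: "\<And>y. norm (f y) \<le> B"
  shows "(LINT y|\<J>. of_real (fejer N (x - y)) * f y)
    = (\<Sum>j<N. \<Sum>l<N. cis (of_int (int j - int l) * x) * fourier f (int j - int l)) / of_nat N"
proof -
  have int: "integrable \<J> (\<lambda>y. cis (of_int m * y) * f y)" for m
  proof (rule integrable_circle_interval[where B = B])
    have "(\<lambda>y. cis (of_int m * y)) \<in> borel_measurable borel" by (intro borel_measurable_continuous_onI cont_cis continuous_intros)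
    then show "(\<lambda>y. cis (of_int m * y) * f y) \<in> borel_measurable borel" using f by (rule borel_measurable_times)
  qed (use B in \<open>auto simp: norm_mult\<close>)
  have eq: "of_real (fejer N (x - y)) * f y = (\<Sum>j<N. \<Sum>l<N. cis (of_int (int j - int l) * x) / of_nat N * (cis (of_int (- (int j - int l)) * y) * f y))" for y
  proof -
    have "cis (of_int m * (x - y)) = cis (of_int m * x) * cis (of_int (- m) * y)" for m by (simp add: cis_mult algebra_simps)
    then show ?thesis unfolding fejer_sum sum_divide_distrib sum_distrib_right
      by (intro sum.cong refl) (simp only: times_divide_eq_left times_divide_eq_right mult.assoc)
  qed
  have "(LINT y|\<J>. of_real (fejer N (x - y)) * f y) = (\<Sum>j<N. \<Sum>l<N. cis (of_int (int j - int l) * x) / of_nat N * fourier f (int j - int l))"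
    unfolding eq fourier_def by (subst Bochner_Integration.integral_sum, (intro Bochner_Integration.integrable_sum integrable_mult_right int)[1],
      subst Bochner_Integration.integral_sum, (intro integrable_mult_right int)[1]) simp
  then show ?thesis by (simp add: sum_divide_distrib)
qed

lemma fourier_one: "fourier (\<lambda>_. 1) m = (if m = 0 then of_real (2 * pi) else 0)"
  using integral_cis[of "- m"] by (simp add: fourier_def circle_interval_measure scaleR_conv_of_real)

lemma fejer_integral:
  assumes "N > 0"
  shows "(LINT y|\<J>. fejer N (x - y)) = 2 * pi"
proof -
  have "complex_of_real (LINT y|\<J>. fejer N (x - y)) = (LINT y|\<J>. of_real (fejer N (x - y)) * 1)"
    by (simp flip: integral_complex_of_real)
  also have "\<dots> = (\<Sum>j<N. \<Sum>l<N. cis (of_int (int j - int l) * x) * fourier (\<lambda>_. 1) (int j - int l)) / of_nat N"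
    by (rule fejer_mean_eq[where B = 1]) auto
  also have "\<dots> = (\<Sum>j<N. \<Sum>l<N. cis (of_int (int j - int l) * x) * (if int j - int l = 0 then of_real (2 * pi) else 0)) / of_nat N"
    by (simp only: fourier_one)
  also have "(\<Sum>j<N. \<Sum>l<N. cis (of_int (int j - int l) * x) * (if int j - int l = 0 then of_real (2 * pi) else 0)) = (\<Sum>j<N. of_real (2 * pi))"
  proof (rule sum.cong[OF refl])
    fix j assume j: "j \<in> {..<N}"
    have "(\<Sum>l<N. cis (of_int (int j - int l) * x) * (if int j - int l = 0 then of_real (2 * pi) else 0)) = (\<Sum>l<N. if l = j then of_real (2 * pi) else (0::complex))"
      by (rule sum.cong[OF refl]) auto
    also have "\<dots> = of_real (2 * pi)" using j by (simp add: sum.delta)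
    finally show "(\<Sum>l<N. cis (of_int (int j - int l) * x) * (if int j - int l = 0 then of_real (2 * pi) else 0)) = complex_of_real (2 * pi)" .
  qed
  finally have "complex_of_real (LINT y|\<J>. fejer N (x - y)) = of_real (2 * pi)" using assms by simp
  then show ?thesis using of_real_eq_iff by blast
qed

lemma fejer_integrable: "integrable \<J> (\<lambda>y. fejer N (x - y))"
proof -
  have "integrable \<J> (\<lambda>y. complex_of_real (fejer N (x - y)))"
    by (intro integrable_circle_interval_cont continuous_on_of_real fejer_cont continuous_intros)
  then show ?thesis by (simp only: complex_of_real_integrable_eq)
qed

lemma fejer_mean_bound:
  fixes f :: "real \<Rightarrow> complex"
  assumes f[measurable]: "f \<in> borel_measurable borel" and B: "\<And>y. norm (f y) \<le> B" and N: "N > 0"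
  shows "norm (LINT y|\<J>. of_real (fejer N (x - y)) * f y) \<le> 2 * pi * B"
proof -
  have "norm (LINT y|\<J>. of_real (fejer N (x - y)) * f y) \<le> (LINT y|\<J>. fejer N (x - y) * B)"
  proof (rule norm_LINT_le)
    show "integrable \<J> (\<lambda>y. complex_of_real (fejer N (x - y)) * f y)"
    proof (rule Bochner_Integration.integrable_bound[of _ "\<lambda>y. fejer N (x - y) * B"])
      show "integrable \<J> (\<lambda>y. fejer N (x - y) * B)" using fejer_integrable by simp
      show "(\<lambda>y. complex_of_real (fejer N (x - y)) * f y) \<in> borel_measurable \<J>"
        by (intro borel_measurable_circle_interval borel_measurable_times f borel_measurable_continuous_onI continuous_on_of_real fejer_cont continuous_intros)
      have "0 \<le> B" using B[of 0] norm_ge_zero order_trans by blast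
      then show "AE y in \<J>. norm (complex_of_real (fejer N (x - y)) * f y) \<le> norm (fejer N (x - y) * B)"
        using B by (intro AE_I2) (auto simp: norm_mult fejer_nonneg intro!: mult_left_mono)
    qed
    show "integrable \<J> (\<lambda>y. fejer N (x - y) * B)" using fejer_integrable by simp
  qed (use B in \<open>auto simp: norm_mult fejer_nonneg intro!: mult_left_mono\<close>)
  then show ?thesis using fejer_integral[OF N, of x] by simp
qed

text \<open>Only continuity at the one point \<open>x\<close> is demanded, with distances measured
  on the circle. The kernel integrated later is continuous only off the diagonal.\<close>

lemma fejer_tendsto:
  fixes f :: "real \<Rightarrow> complex"
  assumes f[measurable]: "f \<in> borel_measurable borel" and B: "\<And>y. norm (f y) \<le> B"
    and cts: "\<And>e. e > 0 \<Longrightarrow> \<exists>d>0. \<forall>y. cmod (cis y - cis x) < d \<longrightarrow> norm (f y - f x) \<le> e"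
  shows "(\<lambda>N. LINT y|\<J>. of_real (fejer (Suc N) (x - y)) * f y) \<longlonglongrightarrow> of_real (2 * pi) * f x"
proof (rule LIMSEQ_I)
  fix e :: real assume e: "e > 0"
  have B0: "0 \<le> B" using B[of 0] norm_ge_zero order_trans by blast
  \<comment> \<open>Against the mass \<open>2 * pi\<close> of the kernel \<open>e'\<close>
    contributes \<open>e / 2\<close>. The other half absorbs the points with
    \<open>cmod (cis y - cis x) \<ge> d\<close>: there \<open>fejer_small\<close> gives
    \<open>4 / d\<^sup>2\<close> over the order and \<open>f\<close> varies by at most
    \<open>2 * B\<close>, whence the constant \<open>C\<close> below.\<close>
  define e' where "e' = e / (4 * pi)"
  have e': "e' > 0" using e by (simp add: e'_def)
  obtain d where d: "d > 0" "\<And>y. cmod (cis y - cis x) < d \<Longrightarrow> norm (f y - f x) \<le> e'" using cts[OF e'] by blast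
  define C where "C = 2 * B * (4 / d\<^sup>2)"
  have C0: "C \<ge> 0" using B0 by (simp add: C_def)
  obtain N0 :: nat where N0: "real N0 > C * (2 * pi) / (e / 2)" using reals_Archimedean2 by blast
  show "\<exists>no. \<forall>N\<ge>no. norm ((LINT y|\<J>. of_real (fejer (Suc N) (x - y)) * f y) - of_real (2 * pi) * f x) < e"
  proof (intro exI allI impI)
    fix N assume N: "N \<ge> N0"
    let ?K = "\<lambda>y. fejer (Suc N) (x - y)"
    have intK: "integrable \<J> (\<lambda>y. complex_of_real (?K y))" using fejer_integrable by (simp only: complex_of_real_integrable_eq)
    have intKf: "integrable \<J> (\<lambda>y. complex_of_real (?K y) * g y)" if [measurable]: "g \<in> borel_measurable borel" and gB: "\<And>y. norm (g y) \<le> B'" for g B'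
    proof (rule Bochner_Integration.integrable_bound[of _ "\<lambda>y. ?K y * B'"])
      show "integrable \<J> (\<lambda>y. ?K y * B')" using fejer_integrable by simp
      show "(\<lambda>y. complex_of_real (?K y) * g y) \<in> borel_measurable \<J>"
        by (intro borel_measurable_circle_interval borel_measurable_times that(1) borel_measurable_continuous_onI continuous_on_of_real fejer_cont continuous_intros)
      have "0 \<le> B'" using gB[of 0] norm_ge_zero order_trans by blast
      then show "AE y in \<J>. norm (complex_of_real (?K y) * g y) \<le> norm (?K y * B')"
        using gB by (intro AE_I2) (auto simp: norm_mult fejer_nonneg intro!: mult_left_mono)
    qed
    have KI: "(LINT y|\<J>. complex_of_real (?K y)) = of_real (2 * pi)"
      unfolding integral_complex_of_real fejer_integral[OF zero_less_Suc] ..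
    have "(LINT y|\<J>. of_real (?K y) * f y) - of_real (2 * pi) * f x = (LINT y|\<J>. of_real (?K y) * f y) - (LINT y|\<J>. of_real (?K y) * f x)"
      by (simp only: integral_mult_left_zero KI)
    also have "\<dots> = (LINT y|\<J>. of_real (?K y) * f y - of_real (?K y) * f x)"
      by (rule Bochner_Integration.integral_diff[symmetric]) (use intKf[OF f B] intK in auto)
    finally have "norm ((LINT y|\<J>. of_real (?K y) * f y) - of_real (2 * pi) * f x) = norm (LINT y|\<J>. of_real (?K y) * (f y - f x))"
      by (simp add: right_diff_distrib)
    also have "\<dots> \<le> (LINT y|\<J>. ?K y * e' + C / real (Suc N))"
    proof (rule norm_LINT_le)
      have "norm (f y - f x) \<le> 2 * B" for y using norm_triangle_ineq4[of "f y" "f x"] B[of y] B[of x] by linarith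
      then show "integrable \<J> (\<lambda>y. complex_of_real (?K y) * (f y - f x))" by (intro intKf[of _ "2 * B"]) auto
      interpret finite_measure \<J> by (rule circle_interval_finite)
      show "integrable \<J> (\<lambda>y. ?K y * e' + C / real (Suc N))"
        using fejer_integrable[of "Suc N" x] by (intro Bochner_Integration.integrable_add integrable_mult_left) auto
      fix y
      show "norm (complex_of_real (?K y) * (f y - f x)) \<le> ?K y * e' + C / real (Suc N)"
      proof (cases "cmod (cis y - cis x) < d")
        case True
        then have "?K y * norm (f y - f x) \<le> ?K y * e'" by (intro mult_left_mono d(2) fejer_nonneg)
        then show ?thesis using C0 by (simp add: norm_mult fejer_nonneg) (smt (verit) divide_nonneg_nonneg of_nat_0_le_iff)
      next
        case False
        have "cmod (cis (x - y) - 1) = cmod (cis y - cis x)"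
        proof -
          have "cis (x - y) - 1 = (cis x - cis y) * cis (- y)" by (simp add: left_diff_distrib cis_mult)
          then show ?thesis by (simp add: norm_mult norm_minus_commute)
        qed
        then have "d\<^sup>2 \<le> (cmod (cis (x - y) - 1))\<^sup>2" using False d(1) by (intro power_mono) auto
        then have "?K y * d\<^sup>2 \<le> 4 / real (Suc N)"
          using fejer_small[of "Suc N" "x - y"] mult_left_mono[OF _ fejer_nonneg, of "d\<^sup>2" _ "Suc N" "x - y"] by (meson order_trans)
        then have "?K y \<le> 4 / real (Suc N) / d\<^sup>2" using d(1) by (subst pos_le_divide_eq) auto
        then have "?K y \<le> (4 / d\<^sup>2) / real (Suc N)" by (simp only: divide_divide_eq_left mult.commute)
        then have "?K y * norm (f y - f x) \<le> ((4 / d\<^sup>2) / real (Suc N)) * (2 * B)"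
          using norm_triangle_ineq4[of "f y" "f x"] B[of y] B[of x] by (intro mult_mono fejer_nonneg) auto
        then have "?K y * norm (f y - f x) \<le> C / real (Suc N)" by (simp add: C_def)
        then show ?thesis using fejer_nonneg[of "Suc N" "x - y"] e' by (simp add: norm_mult) (smt (verit) mult_nonneg_nonneg)
      qed
    qed
    also have "\<dots> = 2 * pi * e' + C / real (Suc N) * (2 * pi)"
    proof -
      interpret finite_measure \<J> by (rule circle_interval_finite)
      show ?thesis
        using fejer_integrable[of "Suc N" x] fejer_integral[of "Suc N" x]
        by (subst Bochner_Integration.integral_add) (auto simp: circle_interval_measure)
    qed
    also have "\<dots> < e"
    proof -
      have "C * (2 * pi) / (e / 2) < real (Suc N)" using N0 N by linarith
      then have "C * (2 * pi) / real (Suc N) < e / 2" using e by (simp add: field_simps)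
      moreover have "2 * pi * e' = e / 2" by (simp add: e'_def)
      ultimately show ?thesis by simp
    qed
    finally show "norm ((LINT y|\<J>. of_real (?K y) * f y) - of_real (2 * pi) * f x) < e" .
  qed
qed

text \<open>All Fejer means reduce to the contribution of index 0, hence so does their
  limit.\<close>

lemma fourier_zero_imp_constant:
  fixes g :: "complex \<Rightarrow> complex"
  assumes g: "continuous_on (sphere 0 1) g" and z: "\<And>n. n \<noteq> 0 \<Longrightarrow> fourier (\<lambda>y. g (cis y)) n = 0"
  shows "of_real (2 * pi) * g (cis x) = (LINT y|\<J>. g (cis y))"
proof -
  have c: "continuous_on UNIV (\<lambda>y. g (cis y))" by (rule continuous_on_compose2[OF g]) (auto intro: cont_cis continuous_intros)
  have "bounded (g ` sphere 0 1)" by (intro compact_imp_bounded compact_continuous_image g) auto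
  then obtain B where "\<forall>w\<in>sphere 0 1. norm (g w) \<le> B" unfolding bounded_iff by blast
  then have B: "norm (g (cis y)) \<le> B" for y by auto
  have m: "(\<lambda>y. g (cis y)) \<in> borel_measurable borel" using c by (rule borel_measurable_continuous_onI)
  have "(\<lambda>N. LINT y|\<J>. of_real (fejer (Suc N) (x - y)) * g (cis y)) \<longlonglongrightarrow> of_real (2 * pi) * g (cis x)"
  proof (rule fejer_tendsto[OF m B])
    fix e :: real assume "e > 0"
    then obtain d where d: "d > 0" "\<forall>w\<in>sphere 0 1. dist w (cis x) < d \<longrightarrow> dist (g w) (g (cis x)) < e"
      using g[unfolded continuous_on_iff, rule_format, of "cis x" e] by auto
    then show "\<exists>d>0. \<forall>y. cmod (cis y - cis x) < d \<longrightarrow> norm (g (cis y) - g (cis x)) \<le> e"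
      by (intro exI[of _ d]) (auto simp: dist_norm intro!: less_imp_le)
  qed
  moreover have "(LINT y|\<J>. of_real (fejer (Suc N) (x - y)) * g (cis y)) = (LINT y|\<J>. g (cis y))" for N
  proof -
    have "(\<Sum>j<Suc N. \<Sum>l<Suc N. cis (of_int (int j - int l) * x) * fourier (\<lambda>y. g (cis y)) (int j - int l)) = (\<Sum>j<Suc N. fourier (\<lambda>y. g (cis y)) 0)"
    proof (rule sum.cong[OF refl])
      fix j assume j: "j \<in> {..<Suc N}"
      have "(\<Sum>l<Suc N. cis (of_int (int j - int l) * x) * fourier (\<lambda>y. g (cis y)) (int j - int l)) = (\<Sum>l<Suc N. if l = j then fourier (\<lambda>y. g (cis y)) 0 else 0)"
        by (rule sum.cong[OF refl]) (use z in auto)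
      also have "\<dots> = fourier (\<lambda>y. g (cis y)) 0" using j by (simp only: sum.delta finite_lessThan if_True)
      finally show "(\<Sum>l<Suc N. cis (of_int (int j - int l) * x) * fourier (\<lambda>y. g (cis y)) (int j - int l)) = fourier (\<lambda>y. g (cis y)) 0" .
    qed
    then have "(LINT y|\<J>. of_real (fejer (Suc N) (x - y)) * g (cis y)) = fourier (\<lambda>y. g (cis y)) 0"
      unfolding fejer_mean_eq[OF m B] by (simp del: of_nat_Suc)
    then show ?thesis by (simp add: fourier_def)
  qed
  ultimately show ?thesis by (simp add: LIMSEQ_const_iff)
qed

section \<open>The logarithm of the divided difference of the Riemann map\<close>

lemma continuous_logs_differ_by_constant:
  fixes h1 h2 :: "'a::topological_space \<Rightarrow> complex"
  assumes S: "connected S" and c: "continuous_on S h1" "continuous_on S h2"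
    and eq: "\<And>x. x \<in> S \<Longrightarrow> exp (h1 x) = exp (h2 x)" and ab: "a \<in> S" "b \<in> S"
  shows "h1 a - h2 a = h1 b - h2 b"
proof -
  have "(\<lambda>x. h1 x - h2 x) constant_on S"
  proof (rule continuous_discrete_range_constant[OF S])
    show "continuous_on S (\<lambda>x. h1 x - h2 x)" by (intro continuous_intros c)
    fix x assume x: "x \<in> S"
    show "\<exists>e>0. \<forall>y. y \<in> S \<and> h1 y - h2 y \<noteq> h1 x - h2 x \<longrightarrow> e \<le> norm (h1 y - h2 y - (h1 x - h2 x))"
    proof (intro exI[of _ "2*pi"] conjI allI impI)
      fix y assume y: "y \<in> S \<and> h1 y - h2 y \<noteq> h1 x - h2 x"
      have "exp (h1 y - h2 y) = exp (h1 x - h2 x)" using eq x y by (simp add: exp_diff)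
      then obtain n :: int where n: "h1 y - h2 y = h1 x - h2 x + of_int (2 * n) * pi * \<i>" by (auto simp: exp_eq)
      then have "n \<noteq> 0" using y by auto
      then have "1 \<le> \<bar>real_of_int n\<bar>" by linarith
      moreover have "norm (h1 y - h2 y - (h1 x - h2 x)) = 2 * pi * \<bar>real_of_int n\<bar>"
        using n by (simp add: norm_mult)
      ultimately show "2 * pi \<le> norm (h1 y - h2 y - (h1 x - h2 x))" by simp
    qed simp
  qed
  then show ?thesis using ab unfolding constant_on_def by metis
qed

locale riemann_curve = convex_curve +
  fixes F G :: "complex \<Rightarrow> complex"
  assumes F_hol: "F holomorphic_on ball 0 1" and F_cont: "continuous_on (cball 0 1) F" and G_cont: "continuous_on \<Omega> G"
    and F_int: "z \<in> ball 0 1 \<Longrightarrow> F z \<in> interior \<Omega>" and F_fr: "z \<in> sphere 0 1 \<Longrightarrow> F z \<in> frontier \<Omega>"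
    and GF: "z \<in> cball 0 1 \<Longrightarrow> G (F z) = z" and FG: "x \<in> \<Omega> \<Longrightarrow> G x \<in> cball 0 1 \<and> F (G x) = x"
    and G_fr: "x \<in> frontier \<Omega> \<Longrightarrow> G x \<in> sphere 0 1"
begin

lemma F_inj: "z \<in> cball 0 1 \<Longrightarrow> w \<in> cball 0 1 \<Longrightarrow> F z = F w \<Longrightarrow> z = w"
  by (metis GF)

definition R :: "complex \<times> complex \<Rightarrow> complex"
  where "R p = (if fst p = snd p then deriv F (fst p) else (F (fst p) - F (snd p)) / (fst p - snd p))"

text \<open>The closed bidisc without the diagonal of the torus, where \<open>R\<close> would call
  for boundary values of \<open>deriv F\<close>. It is starlike about the origin, so the zero-free
  function \<open>R\<close> has a logarithm on it.\<close>

definition X :: "(complex \<times> complex) set"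
  where "X = {p. norm (fst p) \<le> 1 \<and> norm (snd p) \<le> 1 \<and> (fst p = snd p \<longrightarrow> norm (fst p) < 1)}"

lemma R_sym: "R (z, w) = R (w, z)"
  by (simp add: R_def) (metis minus_diff_eq minus_divide_divide)

lemma F_diff: "F z - F w = R (z, w) * (z - w)"
  by (simp add: R_def)

lemma R_nonzero: "p \<in> X \<Longrightarrow> R p \<noteq> 0"
proof (cases "fst p = snd p")
  case True
  assume "p \<in> X"
  then have p: "fst p \<in> ball 0 1" using True by (simp add: X_def)
  have "inj_on F (ball 0 1)" by (intro inj_onI) (auto intro: F_inj)
  from holomorphic_injective_imp_regular[OF F_hol open_ball this p] show ?thesis using True by (simp add: R_def)
next
  case False
  assume "p \<in> X"
  then show ?thesis using False F_inj[of "fst p" "snd p"] by (auto simp: R_def X_def)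
qed

text \<open>Away from the diagonal \<open>R\<close> is a quotient of continuous functions; at an
  interior diagonal point it is close to \<open>deriv F z0\<close> by the mean value
  inequality.\<close>

lemma R_cont: "continuous_on X R"
  unfolding continuous_on_eq_continuous_within
proof
  fix p assume p: "p \<in> X"
  show "continuous (at p within X) R"
  proof (cases "fst p = snd p")
    case False
    have op: "openin (top_of_set X) (X \<inter> {q. fst q \<noteq> snd q})"
      by (intro openin_open_Int open_Collect_neq continuous_intros)
    have "continuous_on (X \<inter> {q. fst q \<noteq> snd q}) (\<lambda>q. (F (fst q) - F (snd q)) / (fst q - snd q))"
      by (intro continuous_intros continuous_on_compose2[OF F_cont]) (auto simp: X_def)
    then have "continuous_on (X \<inter> {q. fst q \<noteq> snd q}) R"
      by (rule continuous_on_eq) (auto simp: R_def)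
    then have "continuous (at p within X \<inter> {q. fst q \<noteq> snd q}) R" using p False by (auto simp: continuous_on_eq_continuous_within)
    moreover have "at p within (X \<inter> {q. fst q \<noteq> snd q}) = at p within X"
    proof (rule at_within_nhd[of _ "{q. fst q \<noteq> snd q}"])
      show "open {q :: complex \<times> complex. fst q \<noteq> snd q}" by (intro open_Collect_neq continuous_intros)
    qed (use False in auto)
    ultimately show ?thesis by simp
  next
    case True
    define z0 where "z0 = fst p"
    have z0: "z0 \<in> ball 0 1" and pz: "p = (z0, z0)" using p True by (auto simp: X_def z0_def prod_eq_iff)
    have dF: "continuous_on (ball 0 1) (deriv F)" by (intro holomorphic_on_imp_continuous_on holomorphic_deriv F_hol open_ball)
    show ?thesis unfolding continuous_within_eps_delta
    proof (intro allI impI)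
      fix e :: real assume e: "e > 0"
      obtain r1 where r1: "r1 > 0" "\<And>w. w \<in> ball 0 1 \<Longrightarrow> dist w z0 < r1 \<Longrightarrow> dist (deriv F w) (deriv F z0) < e / 2"
        using dF[unfolded continuous_on_iff] z0 e by (metis half_gt_zero)
      obtain r2 where r2: "r2 > 0" "ball z0 r2 \<subseteq> ball 0 1" using z0 open_ball[of 0 1, unfolded open_contains_ball] by blast
      define r where "r = min r1 r2"
      have r: "r > 0" "ball z0 r \<subseteq> ball 0 1" using r1 r2 by (auto simp: r_def)
      have close: "dist (R q) (R p) < e" if q: "dist q p < r" for q
      proof -
        have q1: "fst q \<in> ball z0 r" "snd q \<in> ball z0 r"
          using dist_fst_le[of q p] dist_snd_le[of q p] q by (auto simp: pz dist_commute)
        have bd: "norm (deriv F w - deriv F z0) \<le> e / 2" if "w \<in> ball z0 r" for w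
          using r1(2)[of w] that r(2) by (force simp: r_def dist_norm norm_minus_commute)
        show ?thesis
        proof (cases "fst q = snd q")
          case True
          then have "dist (R q) (R p) = norm (deriv F (fst q) - deriv F z0)" by (simp add: R_def pz dist_norm)
          also have "\<dots> \<le> e / 2" by (rule bd) fact
          finally show ?thesis using e by simp
        next
          case False
          \<comment> \<open>Subtracting the linear function with slope \<open>deriv F z0\<close>
            leaves a function with small derivative near \<open>z0\<close>, whose difference
            quotient is \<open>R q - R p\<close>.\<close>
          have "norm ((F (fst q) - deriv F z0 * fst q) - (F (snd q) - deriv F z0 * snd q)) \<le> (e / 2) * norm (fst q - snd q)"
          proof (rule field_differentiable_bound[OF convex_ball _ _ q1])
            fix w assume w: "w \<in> ball z0 r"
            have "(F has_field_derivative deriv F w) (at w)" using w r(2) by (intro holomorphic_derivI[OF F_hol open_ball]) auto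
            then have "((\<lambda>w. F w - deriv F z0 * w) has_field_derivative (deriv F w - deriv F z0)) (at w)"
              by (auto intro!: derivative_eq_intros)
            then show "((\<lambda>w. F w - deriv F z0 * w) has_field_derivative (deriv F w - deriv F z0)) (at w within ball z0 r)"
              by (rule has_field_derivative_at_within)
            show "norm (deriv F w - deriv F z0) \<le> e / 2" by (rule bd[OF w])
          qed
          also have "(F (fst q) - deriv F z0 * fst q) - (F (snd q) - deriv F z0 * snd q) = (R q - R p) * (fst q - snd q)"
          proof -
            have "R q * (fst q - snd q) = F (fst q) - F (snd q)" using F_diff[of "fst q" "snd q"] by simp
            moreover have "R p = deriv F z0" by (simp add: R_def pz)
            ultimately show ?thesis by (simp add: left_diff_distrib right_diff_distrib)
          qed
          finally have "norm (R q - R p) \<le> e / 2" using False by (simp add: norm_mult)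
          then show ?thesis using e by (simp add: dist_norm)
        qed
      qed
      show "\<exists>d>0. \<forall>x'\<in>X. dist x' p < d \<longrightarrow> dist (R x') (R p) < e"
        using close r(1) by blast
    qed
  qed
qed

lemma X_starlike: "starlike X"
  unfolding starlike_def
proof (intro bexI ballI)
  show "(0, 0) \<in> X" by (simp add: X_def)
  fix p assume p: "p \<in> X"
  show "closed_segment (0, 0) p \<subseteq> X"
  proof
    fix q assume "q \<in> closed_segment (0, 0) p"
    then obtain u where u: "0 \<le> u" "u \<le> 1" "q = (1 - u) *\<^sub>R (0,0) + u *\<^sub>R p" by (auto simp: in_segment)
    have q: "fst q = u *\<^sub>R fst p" "snd q = u *\<^sub>R snd p" using u by auto
    have "norm (fst q) \<le> norm (fst p)" "norm (snd q) \<le> norm (snd p)" using u by (auto simp: q mult_left_le_one_le)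
    moreover have "norm (fst q) < 1" if "fst q = snd q"
    proof (cases "u = 0 \<or> fst p = snd p")
      case True
      then show ?thesis using p \<open>norm (fst q) \<le> norm (fst p)\<close> by (auto simp: q X_def)
    next
      case False
      then show ?thesis using that by (auto simp: q)
    qed
    ultimately show "q \<in> X" using p by (auto simp: X_def)
  qed
qed

lemma X_connected: "connected X" by (rule starlike_imp_connected[OF X_starlike])

lemma log_exists: "\<exists>H. continuous_on X H \<and> (\<forall>p\<in>X. R p = exp (H p))"
  using continuous_logarithm_on_contractible[OF R_cont starlike_imp_contractible[OF X_starlike] R_nonzero] by metis

definition H :: "complex \<times> complex \<Rightarrow> complex"
  where "H = (SOME H. continuous_on X H \<and> (\<forall>p\<in>X. R p = exp (H p)))"

lemma H_cont: "continuous_on X H" and H_exp: "p \<in> X \<Longrightarrow> exp (H p) = R p"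
  using someI_ex[OF log_exists] unfolding H_def by auto

text \<open>\<open>H\<close> and its transpose are continuous logarithms of the same symmetric
  function on a connected set, and they agree at the origin.\<close>

lemma H_sym: "(z, w) \<in> X \<Longrightarrow> H (z, w) = H (w, z)"
proof -
  assume zw: "(z, w) \<in> X"
  have sw: "(\<lambda>p. (snd p, fst p)) ` X \<subseteq> X" by (auto simp: X_def)
  have c: "continuous_on X (\<lambda>p. H (snd p, fst p))"
    by (rule continuous_on_compose2[OF H_cont _ sw]) (intro continuous_intros)
  have e: "exp (H p) = exp (H (snd p, fst p))" if "p \<in> X" for p
    using H_exp[OF that] H_exp[of "(snd p, fst p)"] sw that R_sym[of "fst p" "snd p"] by auto
  have "(0, 0) \<in> X" by (simp add: X_def)
  from continuous_logs_differ_by_constant[OF X_connected H_cont c e zw this] show ?thesis by simp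
qed

lemma ball_X: "z \<in> cball 0 1 \<Longrightarrow> w \<in> ball 0 1 \<Longrightarrow> (z, w) \<in> X" "z \<in> ball 0 1 \<Longrightarrow> w \<in> cball 0 1 \<Longrightarrow> (z, w) \<in> X"
  by (auto simp: X_def)

lemma H_cont1: "w \<in> ball 0 1 \<Longrightarrow> continuous_on (cball 0 1) (\<lambda>z. H (z, w))"
  by (rule continuous_on_compose2[OF H_cont]) (auto intro!: continuous_intros ball_X(1) simp del: mem_ball mem_cball)

lemma H_hol1: "w \<in> ball 0 1 \<Longrightarrow> (\<lambda>z. H (z, w)) holomorphic_on ball 0 1"
proof (rule continuous_log_holomorphic[OF open_ball])
  assume w: "w \<in> ball 0 1"
  show "continuous_on (ball 0 1) (\<lambda>z. H (z, w))" by (rule continuous_on_subset[OF H_cont1[OF w] ball_subset_cball])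
  show "R (z, w) = exp (H (z, w))" if "z \<in> ball 0 1" for z using H_exp[OF ball_X(2)[OF that]] w by simp
  have "(\<lambda>z. if z = w then deriv F w else (F z - F w) / (z - w)) holomorphic_on ball 0 1"
    by (rule pole_lemma[OF F_hol]) (use w in simp)
  then show "(\<lambda>z. R (z, w)) holomorphic_on ball 0 1" by (rule holomorphic_transform) (auto simp: R_def)
qed

lemma H_hol2: "z \<in> ball 0 1 \<Longrightarrow> (\<lambda>w. H (z, w)) holomorphic_on ball 0 1"
  by (rule holomorphic_transform[OF H_hol1[of z]]) (auto intro!: H_sym ball_X(1) simp del: mem_ball mem_cball intro: ball_subset_cball[THEN subsetD])

lemma same_ray:
  assumes "x0 \<in> interior \<Omega>" "x \<in> frontier \<Omega>" "y \<in> frontier \<Omega>" "x - x0 = of_real r * (y - x0)" "r > 0"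
  shows "x = y"
proof -
  have key: "\<not> r < 1" if h: "x \<in> frontier \<Omega>" "y \<in> frontier \<Omega>" "x - x0 = of_real r * (y - x0)" "r > 0" for x y r
  proof
    assume "r < 1"
    have "y \<in> \<Omega>" using h frontier_facts by auto
    have "y - (1 - r) *\<^sub>R (y - x0) \<in> interior \<Omega>"
      by (rule mem_interior_convex_shrink[OF convex assms(1) \<open>y \<in> \<Omega>\<close>]) (use \<open>r < 1\<close> h(4) in auto)
    also have "y - (1 - r) *\<^sub>R (y - x0) = x" using h(3) by (simp add: scaleR_conv_of_real algebra_simps)
    finally show False using h(1) by (simp add: frontier_def)
  qed
  have "\<not> r < 1" by (rule key[OF assms(2-5)])
  moreover have "\<not> 1 / r < 1"
    by (rule key[OF assms(3,2)]) (use assms(4,5) in auto)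
  ultimately have "r = 1" using assms(5) by (simp add: field_simps)
  then show ?thesis using assms(4) by simp
qed

text \<open>The function \<open>m\<close> is a continuous argument of
  \<open>F (cis a) - F w\<close>. By convexity a ray from \<open>F w\<close> meets the boundary only
  once, so over one period \<open>m\<close> varies by at most \<open>2 * pi\<close>. Removing
  \<open>a\<close> costs another \<open>2 * pi\<close>, and the two principal logarithms cost less
  than \<open>pi / 2\<close> each.\<close>

lemma Im_H_variation:
  assumes w: "w \<in> ball 0 1"
  shows "\<bar>Im (H (cis a, w)) - Im (H (1, w))\<bar> \<le> 5 * pi"
proof -
  have pos: "Re (1 - w * cis (- a)) > 0" for a
  proof -
    have "Re (w * cis (- a)) \<le> norm (w * cis (- a))" by (rule complex_Re_le_cmod)
    then show ?thesis using w by (simp add: norm_mult)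
  qed
  define m where "m a = Im (H (cis a, w)) + a + Im (Ln (1 - w * cis (- a)))" for a
  have lnb: "\<bar>Im (Ln (1 - w * cis (- a)))\<bar> < pi / 2" for a using pos[of a] Re_Ln_pos_lt_imp[of "1 - w * cis (- a)"] by blast
  have ne: "1 - w * cis (- a) \<noteq> 0" for a using pos[of a] by (metis less_irrefl zero_complex.sel(1))
  have mc: "continuous_on UNIV m"
  proof -
    have "continuous_on UNIV (\<lambda>a. H (cis a, w))"
      by (rule continuous_on_compose2[OF H_cont1[OF w]]) (auto intro!: cont_cis continuous_intros)
    moreover have "continuous_on UNIV (\<lambda>a. Ln (1 - w * cis (- a)))"
      by (intro continuous_intros cont_cis) (use pos in \<open>auto simp: complex_nonpos_Reals_iff not_le[symmetric] dest: leD\<close>)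
    ultimately show ?thesis unfolding m_def by (intro continuous_on_add continuous_on_Im continuous_on_id)
  qed
  have dir: "\<exists>\<rho>>0. F (cis a) - F w = of_real \<rho> * cis (m a)" for a
  proof -
    have "(cis a, w) \<in> X" by (rule ball_X(1)) (use w in auto)
    then have "F (cis a) - F w = exp (H (cis a, w)) * (cis a - w)" by (simp add: F_diff H_exp)
    also have "cis a - w = cis a * exp (Ln (1 - w * cis (- a)))" using ne[of a] by (simp add: algebra_simps cis_mult)
    also have "exp (H (cis a, w)) * (cis a * exp (Ln (1 - w * cis (- a)))) = exp (H (cis a, w) + \<i> * of_real a + Ln (1 - w * cis (- a)))"
      by (simp add: exp_add cis_conv_exp)
    also have "\<dots> = of_real (exp (Re (H (cis a, w) + \<i> * of_real a + Ln (1 - w * cis (- a))))) * cis (m a)"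
      by (subst exp_eq_polar) (simp add: m_def)
    finally show ?thesis by (intro exI[of _ "exp (Re (H (cis a, w) + \<i> * of_real a + Ln (1 - w * cis (- a))))"]) auto
  qed
  have inj: "cis a = cis a'" if "cis (m a) = cis (m a')" for a a'
  proof -
    obtain r where r: "r > 0" "F (cis a) - F w = of_real r * cis (m a)" using dir by blast
    obtain r' where r': "r' > 0" "F (cis a') - F w = of_real r' * cis (m a')" using dir by blast
    have "F (cis a) - F w = of_real (r / r') * (F (cis a') - F w)" using r r' that by simp
    then have "F (cis a) = F (cis a')"
      by (rule same_ray[OF F_int[OF w] F_fr F_fr, rotated 2]) (use r r' in auto)
    then show ?thesis by (rule F_inj[rotated 2]) auto
  qed
  \<comment> \<open>If the variation exceeded \<open>2 * pi\<close>, the intermediate value theorem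
    would give an earlier \<open>a'\<close> at which the direction of \<open>m 0\<close> recurs, so
    \<open>cis a' = 1\<close> strictly within one period.\<close>
  have bound: "\<bar>m a - m 0\<bar> \<le> 2 * pi" if a: "0 < a" "a < 2 * pi" for a
  proof (rule ccontr)
    assume "\<not> ?thesis"
    then consider "m a > m 0 + 2 * pi" | "m a < m 0 - 2 * pi" by linarith
    then obtain a' where a': "0 \<le> a'" "a' \<le> a" "m a' = m 0 + 2 * pi \<or> m a' = m 0 - 2 * pi"
    proof cases
      case 1
      have "\<exists>x\<ge>0. x \<le> a \<and> m x = m 0 + 2 * pi"
        by (rule IVT') (use 1 a continuous_on_subset[OF mc] in auto)
      then show thesis using that by blast
    next
      case 2
      have "\<exists>x\<ge>0. x \<le> a \<and> m x = m 0 - 2 * pi"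
        by (rule IVT2') (use 2 a continuous_on_subset[OF mc] in auto)
      then show thesis using that by blast
    qed
    then have "cis (m a') = cis (m 0)" by (auto simp: complex_eq_iff cos_diff sin_diff)
    then have "cis a' = cis 0" by (rule inj)
    then have "cos a' = 1" by (simp add: complex_eq_iff)
    then obtain n :: int where n: "a' = of_int n * 2 * pi" using cos_one_2pi_int by auto
    have "a' \<noteq> 0" using a'(3) by auto
    then have "real_of_int n \<ge> 1" using n a'(1) pi_gt_zero by (auto simp: zero_le_mult_iff)
    then have "a' \<ge> 2 * pi" unfolding n using mult_right_mono[of 1 "real_of_int n" "2 * pi"] by simp
    then show False using a a' by linarith
  qed
  define n where "n = \<lfloor>a / (2 * pi)\<rfloor>"
  define b where "b = a - of_int n * (2 * pi)"
  have b: "0 \<le> b" "b < 2 * pi"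
  proof -
    have "of_int n \<le> a / (2 * pi)" "a / (2 * pi) < of_int n + 1" by (auto simp: n_def)
    then show "0 \<le> b" "b < 2 * pi" by (auto simp: b_def field_simps)
  qed
  have cab: "cis a = cis b"
  proof -
    have "cis a = cis b * cis (2 * pi * of_int n)" by (simp add: b_def cis_mult algebra_simps)
    then show ?thesis by simp
  qed
  have "\<bar>m b - m 0\<bar> \<le> 2 * pi" using bound[of b] b by (cases "b = 0") auto
  then have "\<bar>Im (H (cis b, w)) - Im (H (1, w))\<bar> \<le> 5 * pi"
    using lnb[of b] lnb[of 0] b by (simp add: m_def)
  then show ?thesis by (simp add: cab)
qed

text \<open>The modulus of \<open>exp (\<i> * H)\<close> is \<open>exp (- Im H)\<close>. The maximum
  modulus principle for both signs of the exponent thus carries the bound from the circle into the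
  disc.\<close>

lemma Im_H_disk_variation:
  assumes w: "w \<in> ball 0 1" and z: "z \<in> cball 0 1"
  shows "\<bar>Im (H (z, w)) - Im (H (1, w))\<bar> \<le> 5 * pi"
proof -
  have key: "norm (exp (of_real e * \<i> * (H (z, w) - H (1, w)))) \<le> exp (5 * pi)" if e: "e = 1 \<or> e = -1" for e :: real
  proof (rule maximum_modulus_frontier[where S = "cball 0 1" and f = "\<lambda>z. exp (of_real e * \<i> * (H (z, w) - H (1, w)))"])
    show "(\<lambda>z. exp (of_real e * \<i> * (H (z, w) - H (1, w)))) holomorphic_on interior (cball 0 1)"
      using H_hol1[OF w] by (auto intro!: holomorphic_intros)
    show "continuous_on (closure (cball 0 1)) (\<lambda>z. exp (of_real e * \<i> * (H (z, w) - H (1, w))))"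
      using H_cont1[OF w] by (auto intro!: continuous_intros)
    show "norm (exp (of_real e * \<i> * (H (v, w) - H (1, w)))) \<le> exp (5 * pi)" if "v \<in> frontier (cball 0 1)" for v
    proof -
      have "norm v = 1" using that by (simp add: frontier_cball)
      then obtain a where a: "v = cis a" by (metis cis_Arg norm_zero sgn_eq scaleR_one inverse_1 zero_neq_one complex_sgn_def)
      have "\<bar>e * Im (H (v, w) - H (1, w))\<bar> \<le> 5 * pi" using Im_H_variation[OF w, of a] e by (auto simp: a)
      then show ?thesis by auto
    qed
  qed (use z in auto)
  show ?thesis using key[of 1] key[of "-1"] by auto
qed

text \<open>The variation bound is the same for all \<open>w\<close>, so by symmetry of
  \<open>H\<close> one gets from \<open>(z, w)\<close> to \<open>(0, w)\<close>, then to
  \<open>(w, 0)\<close> and on to \<open>(0, 0)\<close>, each time at a fixed cost.\<close>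

lemma Im_H_bounded: obtains B where "\<And>z w. z \<in> ball 0 1 \<Longrightarrow> w \<in> ball 0 1 \<Longrightarrow> \<bar>Im (H (z, w))\<bar> \<le> B"
proof -
  have 1: "\<bar>Im (H (z, w)) - Im (H (0, w))\<bar> \<le> 10 * pi" if "z \<in> ball 0 1" "w \<in> ball 0 1" for z w
    using Im_H_disk_variation[OF that(2), of z] Im_H_disk_variation[OF that(2), of 0] that by auto
  have "\<bar>Im (H (z, w))\<bar> \<le> 20 * pi + \<bar>Im (H (0, 0))\<bar>" if zw: "z \<in> ball 0 1" "w \<in> ball 0 1" for z w
  proof -
    have "H (0, w) = H (w, 0)" by (rule H_sym) (use zw in \<open>auto simp: X_def\<close>)
    then have "\<bar>Im (H (0, w)) - Im (H (0, 0))\<bar> \<le> 10 * pi" using 1[of w 0] zw by simp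
    then show ?thesis using 1[OF zw] by linarith
  qed
  then show thesis using that by blast
qed

lemma Im_H_bounded': obtains B where "\<And>p. p \<in> X \<Longrightarrow> \<bar>Im (H p)\<bar> \<le> B"
proof -
  obtain B where B: "\<And>z w. z \<in> ball 0 1 \<Longrightarrow> w \<in> ball 0 1 \<Longrightarrow> \<bar>Im (H (z, w))\<bar> \<le> B" using Im_H_bounded by blast
  have "\<bar>Im (H p)\<bar> \<le> B" if p: "p \<in> X" for p
  proof -
    define x where "x n = (1 - 1 / real (n + 2))" for n
    have x: "0 < x n" "x n < 1" for n by (auto simp: x_def field_simps)
    have xl: "x \<longlonglongrightarrow> 1" unfolding x_def by real_asymp
    have inX: "x n *\<^sub>R p \<in> X \<and> fst (x n *\<^sub>R p) \<in> ball 0 1 \<and> snd (x n *\<^sub>R p) \<in> ball 0 1" for n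
    proof -
      have "norm (fst p) \<le> 1" "norm (snd p) \<le> 1" using p by (auto simp: X_def)
      then have "x n * norm (fst p) \<le> x n" "x n * norm (snd p) \<le> x n" using x(1)[of n] by (auto intro: mult_left_le)
      moreover have "norm (x n *\<^sub>R fst p) = x n * norm (fst p)" "norm (x n *\<^sub>R snd p) = x n * norm (snd p)" using x(1)[of n] by auto
      ultimately have "norm (x n *\<^sub>R fst p) < 1" "norm (x n *\<^sub>R snd p) < 1" using x(2)[of n] by linarith+
      then show ?thesis by (auto simp: X_def)
    qed
    have "(\<lambda>n. x n *\<^sub>R p) \<longlonglongrightarrow> 1 *\<^sub>R p" by (intro tendsto_intros xl)
    then have "(\<lambda>n. H (x n *\<^sub>R p)) \<longlonglongrightarrow> H p"
      using continuous_on_tendsto_compose[OF H_cont, of "\<lambda>n. x n *\<^sub>R p" p sequentially] p inX by auto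
    then have "(\<lambda>n. \<bar>Im (H (x n *\<^sub>R p))\<bar>) \<longlonglongrightarrow> \<bar>Im (H p)\<bar>" by (intro tendsto_intros)
    moreover have "\<bar>Im (H (x n *\<^sub>R p))\<bar> \<le> B" for n
      using B[of "fst (x n *\<^sub>R p)" "snd (x n *\<^sub>R p)"] inX[of n] by (metis prod.collapse)
    ultimately show ?thesis by (intro LIMSEQ_le_const2[of "\<lambda>n. \<bar>Im (H (x n *\<^sub>R p))\<bar>"]) auto
  qed
  then show thesis using that by blast
qed

end

section \<open>The kernel in the circle parameter\<close>

text \<open>Adding the bound \<open>B\<close> makes the function nonnegative and reduces the claim
  to the version for nonnegative integrals.\<close>

lemma set_integral_shift_period_real:
  fixes f :: "real \<Rightarrow> real"
  assumes f[measurable]: "f \<in> borel_measurable borel" and B: "\<And>x. \<bar>f x\<bar> \<le> B" and per: "\<And>x. f (x + T) = f x" and T: "T > 0"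
  shows "(LINT x|lborel. indicator {c<..<c + T} x *\<^sub>R f x) = (LINT x|lborel. indicator {0..T} x *\<^sub>R f x)"
proof -
  have pos: "0 \<le> f x + B" for x using B[of x] by linarith
  have key: "(LINT x|lborel. indicator A x *\<^sub>R f x) = enn2real (\<integral>\<^sup>+x. ennreal (f x + B) * indicator A x \<partial>lborel) - B * measure lborel A"
    if A[measurable]: "A \<in> sets borel" and fin: "emeasure lborel A < \<infinity>" for A
  proof -
    have i1: "integrable lborel (\<lambda>x. indicator A x *\<^sub>R f x)"
    proof (rule integrableI_bounded_set_indicator[where B = B])
      show "AE x in lborel. x \<in> A \<longrightarrow> norm (f x) \<le> B" using B by auto
    qed (use fin in auto)
    have i2: "integrable lborel (\<lambda>x. B * indicator A x)" using fin by (auto intro!: integrable_real_indicator)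
    have "(LINT x|lborel. indicator A x * (f x + B)) = enn2real (\<integral>\<^sup>+x. ennreal (indicator A x * (f x + B)) \<partial>lborel)"
      by (rule integral_eq_nn_integral) (auto simp: pos)
    also have "(\<integral>\<^sup>+x. ennreal (indicator A x * (f x + B)) \<partial>lborel) = (\<integral>\<^sup>+x. ennreal (f x + B) * indicator A x \<partial>lborel)"
      by (intro nn_integral_cong) (auto simp: indicator_def)
    also have "(LINT x|lborel. indicator A x * (f x + B)) = (LINT x|lborel. indicator A x *\<^sub>R f x + B * indicator A x)"
      by (intro Bochner_Integration.integral_cong) (auto simp: algebra_simps)
    also have "\<dots> = (LINT x|lborel. indicator A x *\<^sub>R f x) + B * measure lborel A"
      using i1 i2 by (subst Bochner_Integration.integral_add) auto
    finally show ?thesis by simp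
  qed
  have "(\<integral>\<^sup>+x. ennreal (f x + B) * indicator {c<..<c + T} x \<partial>lborel) = (\<integral>\<^sup>+x. ennreal (f x + B) * indicator {0..T} x \<partial>lborel)"
    by (rule set_nn_integral_shift_period) (auto simp: per T)
  then show ?thesis using T by (subst (1 2) key) auto
qed

lemma set_integral_shift_period:
  fixes f :: "real \<Rightarrow> complex"
  assumes f[measurable]: "f \<in> borel_measurable borel" and B: "\<And>x. norm (f x) \<le> B" and per: "\<And>x. f (x + T) = f x" and T: "T > 0"
  shows "(LINT x|lborel. indicator {c<..<c + T} x *\<^sub>R f x) = (LINT x|restrict_space lborel {0..T}. f x)"
proof -
  have i: "integrable lborel (\<lambda>x. indicator A x *\<^sub>R f x)" if [measurable]: "A \<in> sets borel" and "emeasure lborel A < \<infinity>" for A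
    by (rule integrableI_bounded_set_indicator[where B = B]) (use that B in auto)
  have i1: "integrable lborel (\<lambda>x. indicator {c<..<c + T} x *\<^sub>R f x)" "integrable lborel (\<lambda>x. indicator {0..T} x *\<^sub>R f x)"
    using T by (auto intro!: i)
  have re: "\<bar>Re (f x)\<bar> \<le> B" "\<bar>Im (f x)\<bar> \<le> B" for x
    using abs_Re_le_cmod[of "f x"] abs_Im_le_cmod[of "f x"] B[of x] by linarith+
  have "Re (LINT x|lborel. indicator {c<..<c + T} x *\<^sub>R f x) = Re (LINT x|lborel. indicator {0..T} x *\<^sub>R f x)"
    using set_integral_shift_period_real[of "\<lambda>x. Re (f x)" B T c] re per T i1 by (simp flip: integral_Re)
  moreover have "Im (LINT x|lborel. indicator {c<..<c + T} x *\<^sub>R f x) = Im (LINT x|lborel. indicator {0..T} x *\<^sub>R f x)"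
    using set_integral_shift_period_real[of "\<lambda>x. Im (f x)" B T c] re per T i1 by (simp flip: integral_Im)
  ultimately have "(LINT x|lborel. indicator {c<..<c + T} x *\<^sub>R f x) = (LINT x|lborel. indicator {0..T} x *\<^sub>R f x)" by (simp add: complex_eq_iff)
  then show ?thesis by (simp add: integral_restrict_space)
qed

lemma cis_has_vector_derivative: "((\<lambda>a. cis (m * a)) has_vector_derivative \<i> * of_real m * cis (m * a)) (at a within S)"
proof -
  have "((\<lambda>z. exp (\<i> * of_real m * z)) has_field_derivative \<i> * of_real m * exp (\<i> * of_real m * of_real a)) (at (of_real a))"
    by (auto intro!: derivative_eq_intros)
  then have "((\<lambda>y. exp (\<i> * of_real m * of_real y)) has_vector_derivative \<i> * of_real m * exp (\<i> * of_real m * of_real a)) (at a within S)"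
    by (rule has_vector_derivative_real_field[THEN has_vector_derivative_at_within])
  then show ?thesis by (simp add: cis_conv_exp mult.assoc)
qed

text \<open>The lift \<open>\<theta>\<close> below is only known to be continuous and increasing, so the substitution cannot differentiate it.\<close>

lemma stieltjes_by_parts:
  fixes \<theta> Y k :: "real \<Rightarrow> real" and m :: real
  assumes cd: "c \<le> d" and \<theta>: "continuous_on {c..d} \<theta>" and mono: "\<And>x y. x \<in> {c..d} \<Longrightarrow> y \<in> {c..d} \<Longrightarrow> x \<le> y \<Longrightarrow> \<theta> x \<le> \<theta> y"
    and Y: "continuous_on {\<theta> c..\<theta> d} Y"
    and k: "\<And>s. s \<in> {c..d} \<Longrightarrow> ((\<lambda>s. Y (\<theta> s)) has_real_derivative k s) (at s within {c..d})"
  shows "((\<lambda>s. cis (m * \<theta> s) * of_real (k s)) has_integral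
     (cis (m * \<theta> d) * of_real (Y (\<theta> d)) - cis (m * \<theta> c) * of_real (Y (\<theta> c))
      - integral {\<theta> c..\<theta> d} (\<lambda>a. \<i> * of_real m * cis (m * a) * of_real (Y a)))) {c..d}"
proof -
  define f where "f a = \<i> * of_real m * cis (m * a) * of_real (Y a)" for a
  define \<Phi> where "\<Phi> u = integral {\<theta> c..u} f" for u
  define J where "J x = cis (m * \<theta> x) * of_real (Y (\<theta> x)) - \<Phi> (\<theta> x)" for x
  have fc: "continuous_on {\<theta> c..\<theta> d} f" unfolding f_def by (intro continuous_intros cont_cis Y)
  have dPhi: "(\<Phi> has_vector_derivative f u) (at u within {\<theta> c..\<theta> d})" if "u \<in> {\<theta> c..\<theta> d}" for u
    unfolding \<Phi>_def by (rule integral_has_vector_derivative[OF fc that])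
  have \<theta>in: "\<theta> x \<in> {\<theta> c..\<theta> d}" if "x \<in> {c..d}" for x using mono[of c x] mono[of x d] that cd by auto
  have "((\<lambda>s. cis (m * \<theta> s) * of_real (k s)) has_integral (J d - J c)) {c..d}"
  proof (rule fundamental_theorem_of_calculus[OF cd])
    fix x assume x: "x \<in> {c..d}"
    define g where "g y = Y (\<theta> y)" for y
    define E where "E y = cis (m * \<theta> y)" for y
    have gd: "(g has_derivative (\<lambda>h. k x * h)) (at x within {c..d})" using k[OF x] unfolding has_field_derivative_def g_def by simp
    have Ec: "continuous_on {c..d} E" unfolding E_def by (intro cont_cis continuous_intros \<theta>)
    have E1: "norm (E y) = 1" for y by (simp add: E_def)
    \<comment> \<open>Subtracting \<open>g x\<close> times the exponential makes the derivative of
      \<Psi> proportional to \<open>Y u - g x\<close>, which is small near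
      \<open>\<theta> x\<close>. The increment of \<open>J\<close> splits into
      \<open>E y * (g y - g x)\<close> and an increment of \<Psi> of smaller order than
      \<open>y - x\<close>, so that \<theta> is never differentiated.\<close>
    define \<Psi> where "\<Psi> u = \<Phi> u - of_real (g x) * cis (m * u)" for u
    have dPsi: "(\<Psi> has_vector_derivative \<i> * of_real m * cis (m * u) * of_real (Y u - g x)) (at u within {\<theta> c..\<theta> d})" if u: "u \<in> {\<theta> c..\<theta> d}" for u
    proof -
      have "(\<Psi> has_vector_derivative f u - of_real (g x) * (\<i> * of_real m * cis (m * u))) (at u within {\<theta> c..\<theta> d})"
        unfolding \<Psi>_def by (intro has_vector_derivative_diff dPhi[OF u] has_vector_derivative_mult_right cis_has_vector_derivative)
      also have "f u - of_real (g x) * (\<i> * of_real m * cis (m * u)) = \<i> * of_real m * cis (m * u) * of_real (Y u - g x)"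
        by (simp add: f_def algebra_simps)
      finally show ?thesis .
    qed
    show "(J has_vector_derivative cis (m * \<theta> x) * of_real (k x)) (at x within {c..d})"
      unfolding has_vector_derivative_def has_derivative_within_alt
    proof (intro conjI allI impI)
      show "bounded_linear (\<lambda>h. h *\<^sub>R (cis (m * \<theta> x) * of_real (k x)))" by (rule bounded_linear_scaleR_left)
      fix e :: real assume e: "e > 0"
      \<comment> \<open>The sum of the constants in the three error terms: the linearisation of
        \<open>g\<close>, the variation of \<open>E\<close>, and the increment of \<Psi>.\<close>
      define A where "A = 1 + \<bar>k x\<bar> + \<bar>m\<bar> * (\<bar>k x\<bar> + 1)"
      have A: "A > 0" unfolding A_def by (intro add_pos_nonneg) auto
      define e1 where "e1 = min 1 (e / A)"
      have e1: "e1 > 0" "e1 \<le> 1" "e1 * A \<le> e" using e A by (auto simp: e1_def min_def field_simps)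
      obtain d1 where d1: "d1 > 0" "\<And>y. y \<in> {c..d} \<Longrightarrow> norm (y - x) < d1 \<Longrightarrow> norm (g y - g x - k x * (y - x)) \<le> e1 * norm (y - x)"
        using gd e1(1) unfolding has_derivative_within_alt by blast
      obtain d2 where d2: "d2 > 0" "\<And>y. y \<in> {c..d} \<Longrightarrow> dist y x < d2 \<Longrightarrow> dist (E y) (E x) < e1"
        using Ec x e1(1) unfolding continuous_on_iff by metis
      obtain d3 where d3: "d3 > 0" "\<And>y. y \<in> {c..d} \<Longrightarrow> dist y x < d3 \<Longrightarrow> dist (\<theta> y) (\<theta> x) < e1"
        using \<theta> x e1(1) unfolding continuous_on_iff by metis
      define r where "r = min d1 (min d2 d3)"
      have gl: "\<bar>g y - g x\<bar> \<le> (\<bar>k x\<bar> + 1) * \<bar>y - x\<bar>" if y: "y \<in> {c..d}" "\<bar>y - x\<bar> < d1" for y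
      proof -
        have "\<bar>g y - g x - k x * (y - x)\<bar> \<le> e1 * \<bar>y - x\<bar>" using d1(2)[OF y(1)] y(2) by simp
        then have "\<bar>g y - g x\<bar> \<le> \<bar>k x * (y - x)\<bar> + e1 * \<bar>y - x\<bar>" by linarith
        also have "\<dots> \<le> (\<bar>k x\<bar> + 1) * \<bar>y - x\<bar>" using mult_right_mono[OF e1(2), of "\<bar>y - x\<bar>"] by (simp add: abs_mult distrib_right)
        finally show ?thesis .
      qed
      have "norm (J y - J x - (y - x) *\<^sub>R (cis (m * \<theta> x) * of_real (k x))) \<le> e * norm (y - x)"
        if y: "y \<in> {c..d}" "norm (y - x) < r" for y
      proof -
        have yr: "\<bar>y - x\<bar> < d1" "\<bar>y - x\<bar> < d2" "\<bar>y - x\<bar> < d3" using y(2) by (auto simp: r_def)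
        have JJ: "J y - J x = E y * of_real (g y - g x) - (\<Psi> (\<theta> y) - \<Psi> (\<theta> x))"
          by (simp add: J_def E_def g_def \<Psi>_def algebra_simps)
        have T2: "norm (\<Psi> (\<theta> y) - \<Psi> (\<theta> x)) \<le> (\<bar>m\<bar> * ((\<bar>k x\<bar> + 1) * \<bar>y - x\<bar>)) * norm (\<theta> y - \<theta> x)"
        proof (rule differentiable_bound[where S = "closed_segment (\<theta> x) (\<theta> y)" and f' = "\<lambda>u h. h *\<^sub>R (\<i> * of_real m * cis (m * u) * of_real (Y u - g x))"])
          fix u assume u: "u \<in> closed_segment (\<theta> x) (\<theta> y)"
          have sub: "closed_segment (\<theta> x) (\<theta> y) \<subseteq> {\<theta> c..\<theta> d}"
            using \<theta>in[OF x] \<theta>in[OF y(1)] by (auto simp: closed_segment_eq_real_ivl split: if_splits)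
          then have u': "u \<in> {\<theta> c..\<theta> d}" using u by blast
          show "(\<Psi> has_derivative (\<lambda>h. h *\<^sub>R (\<i> * of_real m * cis (m * u) * of_real (Y u - g x)))) (at u within closed_segment (\<theta> x) (\<theta> y))"
            using has_vector_derivative_within_subset[OF dPsi[OF u'] sub] by (simp add: has_vector_derivative_def)
          \<comment> \<open>By continuity of \<theta> each intermediate value \<open>u\<close> is
            attained between \<open>x\<close> and \<open>y\<close>, so \<open>Y u - g x\<close> is a
            difference of values of \<open>g\<close> and of order \<open>y - x\<close>.\<close>
          obtain v where v: "v \<in> closed_segment x y" "u = \<theta> v"
          proof -
            have sub': "closed_segment x y \<subseteq> {c..d}" using x y(1) by (auto simp: closed_segment_eq_real_ivl split: if_splits)
            have "connected (\<theta> ` closed_segment x y)"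
              by (intro connected_continuous_image continuous_on_subset[OF \<theta> sub'] connected_segment)
            then have "is_interval (\<theta> ` closed_segment x y)" by (simp only: is_interval_connected_1)
            then have "convex (\<theta> ` closed_segment x y)" by (rule is_interval_convex)
            then have "closed_segment (\<theta> x) (\<theta> y) \<subseteq> \<theta> ` closed_segment x y" by (intro closed_segment_subset) auto
            then show thesis using u that by blast
          qed
          have v': "v \<in> {c..d}" "\<bar>v - x\<bar> \<le> \<bar>y - x\<bar>"
            using v(1) x y(1) by (auto simp: closed_segment_eq_real_ivl split: if_splits)
          have "\<bar>Y u - g x\<bar> = \<bar>g v - g x\<bar>" by (simp add: v(2) g_def)
          also have "\<dots> \<le> (\<bar>k x\<bar> + 1) * \<bar>v - x\<bar>" by (rule gl[OF v'(1)]) (use v' yr in linarith)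
          also have "\<dots> \<le> (\<bar>k x\<bar> + 1) * \<bar>y - x\<bar>" by (intro mult_left_mono v') auto
          finally have Yb: "\<bar>m\<bar> * \<bar>Y u - g x\<bar> \<le> \<bar>m\<bar> * ((\<bar>k x\<bar> + 1) * \<bar>y - x\<bar>)" by (rule mult_left_mono) simp
          show "onorm (\<lambda>h. h *\<^sub>R (\<i> * of_real m * cis (m * u) * of_real (Y u - g x))) \<le> \<bar>m\<bar> * ((\<bar>k x\<bar> + 1) * \<bar>y - x\<bar>)"
          proof (rule onorm_le)
            fix h :: real
            have "norm (\<i> * of_real m * cis (m * u) * of_real (Y u - g x)) = \<bar>m\<bar> * \<bar>Y u - g x\<bar>"
              by (simp only: norm_mult norm_of_real norm_cis norm_ii mult_1 mult_1_right)
            then show "norm (h *\<^sub>R (\<i> * of_real m * cis (m * u) * of_real (Y u - g x))) \<le> \<bar>m\<bar> * ((\<bar>k x\<bar> + 1) * \<bar>y - x\<bar>) * norm h"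
              using mult_right_mono[OF Yb, of "\<bar>h\<bar>"] by (simp add: mult.commute)
          qed
        qed auto
        also have "\<dots> \<le> (\<bar>m\<bar> * ((\<bar>k x\<bar> + 1) * \<bar>y - x\<bar>)) * e1"
          using d3(2)[OF y(1)] yr(3) by (intro mult_left_mono) (auto simp: dist_real_def intro!: mult_nonneg_nonneg)
        finally have T2': "norm (\<Psi> (\<theta> y) - \<Psi> (\<theta> x)) \<le> (\<bar>m\<bar> * ((\<bar>k x\<bar> + 1) * \<bar>y - x\<bar>)) * e1" .
        have T1: "norm (E y * of_real (g y - g x) - (y - x) *\<^sub>R (E x * of_real (k x))) \<le> e1 * \<bar>y - x\<bar> + e1 * (\<bar>k x\<bar> * \<bar>y - x\<bar>)"
        proof -
          have "E y * of_real (g y - g x) - (y - x) *\<^sub>R (E x * of_real (k x))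
             = E y * of_real (g y - g x - k x * (y - x)) + (E y - E x) * of_real (k x * (y - x))"
            by (simp add: scaleR_conv_of_real algebra_simps)
          also have "norm \<dots> \<le> norm (E y * of_real (g y - g x - k x * (y - x))) + norm ((E y - E x) * of_real (k x * (y - x)))"
            by (rule norm_triangle_ineq)
          also have "norm (E y * of_real (g y - g x - k x * (y - x))) \<le> e1 * \<bar>y - x\<bar>"
            using d1(2)[OF y(1)] yr(1) by (simp only: norm_mult E1 norm_of_real real_norm_def mult_1)
          also have "norm ((E y - E x) * of_real (k x * (y - x))) \<le> e1 * (\<bar>k x\<bar> * \<bar>y - x\<bar>)"
            unfolding norm_mult norm_of_real abs_mult using d2(2)[OF y(1)] yr(2)
            by (intro mult_right_mono) (auto simp: dist_norm dist_real_def)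
          finally show ?thesis by simp
        qed
        have "norm (J y - J x - (y - x) *\<^sub>R (cis (m * \<theta> x) * of_real (k x)))
           = norm ((E y * of_real (g y - g x) - (y - x) *\<^sub>R (E x * of_real (k x))) - (\<Psi> (\<theta> y) - \<Psi> (\<theta> x)))"
          unfolding JJ by (simp add: E_def algebra_simps)
        also have "\<dots> \<le> norm (E y * of_real (g y - g x) - (y - x) *\<^sub>R (E x * of_real (k x))) + norm (\<Psi> (\<theta> y) - \<Psi> (\<theta> x))"
          by (rule norm_triangle_ineq4)
        also have "\<dots> \<le> e1 * \<bar>y - x\<bar> + e1 * (\<bar>k x\<bar> * \<bar>y - x\<bar>) + (\<bar>m\<bar> * ((\<bar>k x\<bar> + 1) * \<bar>y - x\<bar>)) * e1"
          using T1 T2' by (rule add_mono)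
        also have "\<dots> = (e1 * A) * \<bar>y - x\<bar>" by (simp add: A_def algebra_simps)
        also have "\<dots> \<le> e * \<bar>y - x\<bar>" by (intro mult_right_mono e1) auto
        finally show ?thesis by simp
      qed
      moreover have "r > 0" using d1 d2 d3 by (simp add: r_def)
      ultimately show "\<exists>d'>0. \<forall>y\<in>{c..d}. norm (y - x) < d' \<longrightarrow> norm (J y - J x - (y - x) *\<^sub>R (cis (m * \<theta> x) * of_real (k x))) \<le> e * norm (y - x)"
        by blast
    qed
  qed
  also have "J d - J c = cis (m * \<theta> d) * of_real (Y (\<theta> d)) - cis (m * \<theta> c) * of_real (Y (\<theta> c)) - integral {\<theta> c..\<theta> d} f"
    by (simp add: J_def \<Phi>_def)
  finally show ?thesis unfolding f_def .
qed

section \<open>The boundary correspondence and the phase of the chord\<close>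

context riemann_curve
begin

lemma lift_exists: "\<exists>\<theta>. continuous_on UNIV \<theta> \<and> (\<forall>s. G (\<gamma> s) = cis (\<theta> s))"
proof -
  have c: "continuous_on UNIV (\<lambda>s. G (\<gamma> s))"
    by (rule continuous_on_compose2[OF G_cont cont]) (use in_Omega in auto)
  have n1: "norm (G (\<gamma> s)) = 1" for s using G_fr[of "\<gamma> s"] frontier by simp
  have "\<exists>l. continuous_on UNIV l \<and> (\<forall>s\<in>UNIV. G (\<gamma> s) = exp (l s))"
    using continuous_logarithm_on_contractible[OF c convex_imp_contractible[OF convex_UNIV]] n1 by (metis norm_zero zero_neq_one)
  then obtain l where l: "continuous_on UNIV l" "\<And>s. G (\<gamma> s) = exp (l s)" by auto
  have "G (\<gamma> s) = cis (Im (l s))" for s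
  proof -
    have "exp (Re (l s)) = 1" using n1[of s] by (simp add: l(2))
    then show ?thesis using exp_eq_polar[of "l s"] by (simp add: l(2))
  qed
  moreover have "continuous_on UNIV (\<lambda>s. Im (l s))" by (intro continuous_intros l(1))
  ultimately show ?thesis by blast
qed

text \<open>The boundary parameter of the Riemann map as a function of the parameter of the curve.\<close>

definition \<theta> :: "real \<Rightarrow> real"
  where "\<theta> = (SOME \<theta>. continuous_on UNIV \<theta> \<and> (\<forall>s. G (\<gamma> s) = cis (\<theta> s)))"

lemma theta_lift: "continuous_on UNIV \<theta> \<and> (\<forall>s. G (\<gamma> s) = cis (\<theta> s))"
  unfolding \<theta>_def by (rule someI_ex[OF lift_exists])

lemma theta_cont: "continuous_on S \<theta>"
  using theta_lift continuous_on_subset[of UNIV \<theta> S] by blast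

lemma G_theta: "G (\<gamma> s) = cis (\<theta> s)"
  using theta_lift by blast

lemma F_theta: "F (cis (\<theta> s)) = \<gamma> s"
  using FG[OF in_Omega[of s]] by (simp add: G_theta)

lemma cis_theta_eq: "cis (\<theta> s) = cis (\<theta> t) \<longleftrightarrow> \<gamma> s = \<gamma> t"
  by (metis F_theta G_theta)

text \<open>The increment over a period is an integer multiple of \<open>2 * pi\<close>. It is
  positive because \<open>\<theta> s + Im (H (cis (\<theta> s), 0))\<close> is an argument of
  \<open>\<gamma> s - F 0\<close>, which increases since the interior point \<open>F 0\<close> lies
  strictly left of all tangents, while its second term is periodic.\<close>

lemma theta_period_aux: obtains n :: int where "n > 0" "\<And>s. \<theta> (s + 1) = \<theta> s + 2 * pi * of_int n"
proof -
  have c1: "continuous_on UNIV (\<lambda>s. \<i> * of_real (\<theta> (s + 1)))"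
    by (intro continuous_intros continuous_on_compose2[OF theta_cont[of UNIV]]) auto
  have c2: "continuous_on UNIV (\<lambda>s. \<i> * of_real (\<theta> s))" by (intro continuous_intros theta_cont)
  have e: "exp (\<i> * of_real (\<theta> (s + 1))) = exp (\<i> * of_real (\<theta> s))" for s
    unfolding cis_conv_exp[symmetric] cis_theta_eq by (rule period)
  have "\<i> * of_real (\<theta> (s + 1)) - \<i> * of_real (\<theta> s) = \<i> * of_real (\<theta> (0 + 1)) - \<i> * of_real (\<theta> 0)" for s
    by (rule continuous_logs_differ_by_constant[OF connected_UNIV c1 c2 e]) auto
  then have "\<i> * of_real (\<theta> (s + 1) - \<theta> s) = \<i> * of_real (\<theta> 1 - \<theta> 0)" for s by (simp add: right_diff_distrib)
  then have d: "\<theta> (s + 1) - \<theta> s = \<theta> 1 - \<theta> 0" for s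
    by (metis complex_i_not_zero mult_cancel_left of_real_eq_iff)
  obtain n :: int where n: "\<theta> 1 = \<theta> 0 + 2 * pi * of_int n"
  proof -
    have "exp (\<i> * of_real (\<theta> 1)) = exp (\<i> * of_real (\<theta> 0))" using e[of 0] by simp
    then obtain n :: int where "\<i> * of_real (\<theta> 1) = \<i> * of_real (\<theta> 0) + (of_int (2 * n) * pi) * \<i>" by (auto simp: exp_eq)
    then have "\<i> * of_real (\<theta> 1) = \<i> * of_real (\<theta> 0 + 2 * pi * of_int n)" by (simp add: algebra_simps)
    then have "\<theta> 1 = \<theta> 0 + 2 * pi * of_int n" by (metis complex_i_not_zero mult_cancel_left of_real_eq_iff)
    then show thesis using that by blast
  qed
  define x0 where "x0 = F 0"
  have x0: "x0 \<in> interior \<Omega>" unfolding x0_def by (rule F_int) simp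
  define l where "l s = H (cis (\<theta> s), 0) + \<i> * of_real (\<theta> s)" for s
  have lc: "continuous_on UNIV l" unfolding l_def
    by (intro continuous_intros theta_cont continuous_on_compose2[OF H_cont1[of 0]] cont_cis) auto
  have le: "\<gamma> s - x0 = exp (l s)" for s
  proof -
    have "(cis (\<theta> s), 0) \<in> X" by (rule ball_X) auto
    then have "exp (l s) = R (cis (\<theta> s), 0) * (cis (\<theta> s) - 0)" by (simp add: l_def exp_add H_exp cis_conv_exp)
    also have "\<dots> = F (cis (\<theta> s)) - F 0" by (rule F_diff[symmetric])
    finally show ?thesis by (simp add: F_theta x0_def)
  qed
  have ld: "(l has_vector_derivative \<gamma>' s / (\<gamma> s - x0)) (at s)" for s
  proof (rule continuous_log_has_vector_derivative)
    show "isCont l s" using lc by (simp add: continuous_on_eq_continuous_at)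
    show "\<forall>\<^sub>F y in nhds s. \<gamma> y - x0 = exp (l y)" using le by simp
    show "((\<lambda>y. \<gamma> y - x0) has_vector_derivative \<gamma>' s) (at s)"
      using has_vector_derivative_diff[OF deriv1[of s] has_vector_derivative_const[of x0]] by simp
  qed
  have "Im (l 0) < Im (l 1)"
  proof (rule DERIV_pos_imp_increasing[of 0 1 "\<lambda>s. Im (l s)"])
    fix s :: real
    have "((\<lambda>s. Im (l s)) has_real_derivative Im (\<gamma>' s / (\<gamma> s - x0))) (at s)"
      unfolding has_real_derivative_iff_has_vector_derivative by (rule bounded_linear.has_vector_derivative[OF bounded_linear_Im ld])
    moreover have "Im (\<gamma>' s / (\<gamma> s - x0)) > 0"
    proof -
      define q where "q = (x0 - \<gamma> s) / \<gamma>' s"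
      have q: "Im q > 0" unfolding q_def by (rule interior_left_of_tangent[OF x0])
      then have "q \<noteq> 0" by auto
      have "\<gamma>' s / (\<gamma> s - x0) = - inverse q" by (simp add: q_def) (metis minus_diff_eq minus_divide_right)
      then have "Im (\<gamma>' s / (\<gamma> s - x0)) = Im q / (cmod q)\<^sup>2" by (simp add: cmod_power2)
      then show ?thesis using q \<open>q \<noteq> 0\<close> by simp
    qed
    ultimately show "\<exists>y. ((\<lambda>s. Im (l s)) has_real_derivative y) (at s) \<and> y > 0" by blast
  qed simp
  moreover have "cis (\<theta> 1) = cis (\<theta> 0)" unfolding cis_theta_eq using period[of 0] by simp
  ultimately have "\<theta> 0 < \<theta> 1" by (simp add: l_def)
  then have "n > 0" using n by (simp add: zero_less_mult_iff)
  moreover have "\<theta> (s + 1) = \<theta> s + 2 * pi * of_int n" for s using d[of s] n by simp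
  ultimately show thesis using that by blast
qed

text \<open>If the increment were \<open>4 * pi\<close> or more, \<theta> would gain
  \<open>2 * pi\<close> at some parameter strictly between 0 and 1, contradicting simplicity of the
  curve.\<close>

lemma theta_period: "\<theta> (s + 1) = \<theta> s + 2 * pi"
proof -
  obtain n :: int where n: "n > 0" "\<And>s. \<theta> (s + 1) = \<theta> s + 2 * pi * of_int n" using theta_period_aux by blast
  have "n = 1"
  proof (rule ccontr)
    assume "n \<noteq> 1"
    then have "real_of_int n \<ge> 2" using n(1) by linarith
    then have big: "\<theta> 1 \<ge> \<theta> 0 + 4 * pi" using n(2)[of 0] mult_left_mono[of 2 "real_of_int n" "2 * pi"] by simp
    have "\<exists>x\<ge>0. x \<le> 1 \<and> \<theta> x = \<theta> 0 + 2 * pi"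
    proof (rule IVT'[OF _ _ _ theta_cont])
      show "\<theta> 0 + 2 * pi \<le> \<theta> 1" using big pi_gt_zero by linarith
    qed auto
    then obtain x where x: "0 \<le> x" "x \<le> 1" "\<theta> x = \<theta> 0 + 2 * pi" by blast
    then have "cis (\<theta> x) = cis (\<theta> 0)" by (simp add: complex_eq_iff)
    then have "\<gamma> 0 = \<gamma> x" by (simp add: cis_theta_eq)
    moreover have "x \<noteq> 0" using x(3) pi_gt_zero by auto
    moreover have "x \<noteq> 1"
    proof
      assume "x = 1" then show False using x(3) big pi_gt_zero by simp
    qed
    ultimately show False using neq[of 0 x] x by auto
  qed
  then show ?thesis using n(2) by simp
qed

lemma theta_period_int: "\<theta> (s + of_int n) = \<theta> s + 2 * pi * of_int n"
proof (induction n rule: int_induct[where k = 0])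
  case (step1 i) then show ?case using theta_period[of "s + of_int i"] by (simp add: algebra_simps)
next
  case (step2 i) then show ?case using theta_period[of "s + of_int (i - 1)"] by (simp add: algebra_simps)
qed simp

lemma theta_inj: "\<theta> s = \<theta> t \<Longrightarrow> s = t"
proof -
  assume eq: "\<theta> s = \<theta> t"
  then have "cis (\<theta> s) = cis (\<theta> t)" by simp
  then have "\<gamma> s = \<gamma> t" unfolding cis_theta_eq .
  then have "s - t \<in> \<int>" by (simp only: eq_iff)
  then obtain n :: int where n: "s = t + of_int n" by (metis Ints_cases add.commute diff_add_cancel)
  then have "n = 0" using eq theta_period_int[of t n] by simp
  then show ?thesis using n by simp
qed

lemma theta_strict_mono: "s < t \<Longrightarrow> \<theta> s < \<theta> t"
proof -
  assume st: "s < t"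
  obtain n :: nat where n: "t - s < real n" using reals_Archimedean2 by blast
  have "(\<theta> s < \<theta> t \<and> \<theta> t < \<theta> (s + real n)) \<or> (\<theta> (s + real n) < \<theta> t \<and> \<theta> t < \<theta> s)"
  proof (rule continuous_inj_imp_mono[OF st _ theta_cont])
    show "t < s + real n" using n by linarith
    show "inj_on \<theta> {s..s + real n}" by (rule inj_onI) (rule theta_inj)
  qed
  moreover have "\<theta> (s + real n) = \<theta> s + 2 * pi * real n" using theta_period_int[of s "int n"] by simp
  moreover have "0 \<le> 2 * pi * real n" by simp
  ultimately show ?thesis by linarith
qed

lemma theta_mono: "s \<le> t \<Longrightarrow> \<theta> s \<le> \<theta> t"
  by (cases "s < t") (use theta_strict_mono[of s t] in simp_all)

lemma theta_surj: obtains t where "\<theta> t = b"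
proof -
  obtain n :: nat where n: "\<bar>b - \<theta> 0\<bar> < real n" using reals_Archimedean2 by blast
  have n': "real n \<le> 2 * pi * real n" using pi_gt3 by (simp add: mult_le_cancel_right1)
  have "\<exists>x\<ge>- real n. x \<le> real n \<and> \<theta> x = b"
  proof (rule IVT'[OF _ _ _ theta_cont])
    show "\<theta> (- real n) \<le> b" using theta_period_int[of 0 "- int n"] n n' by simp
    show "b \<le> \<theta> (real n)" using theta_period_int[of 0 "int n"] n n' by simp
  qed simp
  then show thesis using that by blast
qed

text \<open>The chord from \<open>F (cis b)\<close> to \<open>F (cis a)\<close> has argument \<open>\<eta> a b + (a + b) / 2\<close> up to a constant.\<close>

definition \<eta> :: "real \<Rightarrow> real \<Rightarrow> real"
  where "\<eta> a b = (if cis a = cis b then 0 else Im (H (cis a, cis b)))"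

definition \<kappa> :: "real \<Rightarrow> real \<Rightarrow> real"
  where "\<kappa> s b = Im (\<gamma>' s / (\<gamma> s - F (cis b)))"

lemma kappa_theta: "\<kappa> s (\<theta> t) = k s t"
  by (simp add: \<kappa>_def k_def F_theta)

lemma cis_X: "cis a \<noteq> cis b \<Longrightarrow> (cis a, cis b) \<in> X"
  by (simp add: X_def)

lemma cis_neq: "b < a \<Longrightarrow> a < b + 2 * pi \<Longrightarrow> cis a \<noteq> cis b"
proof
  assume ab: "b < a" "a < b + 2 * pi" "cis a = cis b"
  have "cis (a - b) = cis a / cis b" by (rule cis_divide[symmetric])
  also have "\<dots> = 1" unfolding ab(3) by simp
  finally have "cis (a - b) = 1" .
  then have "Re (cis (a - b)) = Re 1" by (simp only:)
  then have "cos (a - b) = 1" by (simp only: cis.sel one_complex.sel)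
  then have "\<exists>n::int. a - b = of_int n * 2 * pi" by (rule cos_one_2pi_int[THEN iffD1])
  then obtain n :: int where n: "a - b = of_int n * 2 * pi" ..
  then have n': "a - b = of_int n * (2 * pi)" by simp
  consider "n \<ge> 1" | "n \<le> 0" by linarith
  then show False
  proof cases
    case 1
    then have "1 * (2 * pi) \<le> of_int n * (2 * pi)" by (intro mult_right_mono) auto
    then show False using n' ab by linarith
  next
    case 2
    then have "of_int n * (2 * pi) \<le> 0 * (2 * pi)" by (intro mult_right_mono) auto
    then show False using n' ab by linarith
  qed
qed

lemma cis_diff_polar: "cis a - cis b = exp (\<i> * of_real ((a + b) / 2)) * (2 * \<i> * of_real (sin ((a - b) / 2)))"
proof -
  have key: "cis (u + v) - cis (u - v) = cis u * (2 * \<i> * of_real (sin v))" for u v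
  proof -
    have "cis (u + v) - cis (u - v) = cis u * (cis v - cis (- v))" by (simp add: right_diff_distrib cis_mult)
    also have "cis v - cis (- v) = 2 * \<i> * of_real (sin v)" by (simp add: complex_eq_iff)
    finally show ?thesis .
  qed
  have "(a + b) / 2 + (a - b) / 2 = a" "(a + b) / 2 - (a - b) / 2 = b" by (auto simp: field_simps)
  then show ?thesis using key[of "(a + b) / 2" "(a - b) / 2"] by (simp only: cis_conv_exp)
qed

text \<open>The function \<open>l\<close> is an explicit continuous logarithm of the chord: factor
  it as \<open>R\<close> times \<open>cis a - cis b\<close> and write the latter as
  \<open>cis ((a + b) / 2) * 2 * \<i> * sin ((a - b) / 2)\<close>, whose sine is positive here. Its
  derivative is the logarithmic derivative of the chord.\<close>

lemma phase_deriv: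
  assumes st: "t < s" "s < t + 1"
  shows "((\<lambda>s. \<eta> (\<theta> s) (\<theta> t) + (\<theta> s + \<theta> t) / 2) has_real_derivative k s t) (at s)"
proof -
  have rng: "\<theta> t < \<theta> y \<and> \<theta> y < \<theta> t + 2 * pi" if "y \<in> {t<..<t+1}" for y
    using theta_strict_mono[of t y] theta_strict_mono[of y "t + 1"] theta_period[of t] that by auto
  have inX: "(cis (\<theta> y), cis (\<theta> t)) \<in> X" if "y \<in> {t<..<t+1}" for y
    using rng[OF that] by (intro cis_X cis_neq) auto
  have sinpos: "sin ((\<theta> y - \<theta> t) / 2) > 0" if "y \<in> {t<..<t+1}" for y
    using rng[OF that] by (intro sin_gt_zero) auto
  define l where "l y = H (cis (\<theta> y), cis (\<theta> t)) + \<i> * of_real ((\<theta> y + \<theta> t) / 2) + of_real (ln (2 * sin ((\<theta> y - \<theta> t) / 2))) + \<i> * of_real (pi / 2)" for y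
  have lc: "continuous_on {t<..<t+1} l" unfolding l_def
  proof (intro continuous_on_add)
    show "continuous_on {t<..<t+1} (\<lambda>y. H (cis (\<theta> y), cis (\<theta> t)))"
      by (rule continuous_on_compose2[OF H_cont]) (use inX in \<open>auto intro!: continuous_intros theta_cont cont_cis\<close>)
    have "continuous_on {t<..<t+1} (\<lambda>y. ln (2 * sin ((\<theta> y - \<theta> t) / 2)))"
    proof (rule continuous_on_ln)
      show "continuous_on {t<..<t+1} (\<lambda>y. 2 * sin ((\<theta> y - \<theta> t) / 2))" by (intro continuous_intros theta_cont) auto
      show "\<forall>y\<in>{t<..<t+1}. 2 * sin ((\<theta> y - \<theta> t) / 2) \<noteq> 0" using sinpos by fastforce
    qed
    then show "continuous_on {t<..<t+1} (\<lambda>y. complex_of_real (ln (2 * sin ((\<theta> y - \<theta> t) / 2))))" by (rule continuous_on_of_real)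
  qed (intro continuous_intros theta_cont; simp)+
  have le: "\<gamma> y - \<gamma> t = exp (l y)" if y: "y \<in> {t<..<t+1}" for y
  proof -
    have "exp (l y) = exp (H (cis (\<theta> y), cis (\<theta> t))) * (exp (\<i> * of_real ((\<theta> y + \<theta> t) / 2)) * (of_real (2 * sin ((\<theta> y - \<theta> t) / 2)) * exp (\<i> * of_real (pi / 2))))"
      unfolding l_def exp_add using sinpos[OF y] by (simp add: exp_of_real mult_ac)
    also have "exp (\<i> * of_real (pi / 2)) = \<i>" by (simp only: cis_conv_exp[symmetric] cis_pi_half)
    also have "exp (\<i> * of_real ((\<theta> y + \<theta> t) / 2)) * (of_real (2 * sin ((\<theta> y - \<theta> t) / 2)) * \<i>) = cis (\<theta> y) - cis (\<theta> t)"
      unfolding cis_diff_polar by simp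
    also have "exp (H (cis (\<theta> y), cis (\<theta> t))) * (cis (\<theta> y) - cis (\<theta> t)) = \<gamma> y - \<gamma> t"
      using H_exp[OF inX[OF y]] F_diff[of "cis (\<theta> y)" "cis (\<theta> t)"] by (simp add: F_theta)
    finally show ?thesis ..
  qed
  have evs: "\<forall>\<^sub>F y in nhds s. y \<in> {t<..<t+1}" by (rule eventually_nhds_in_open) (use st in auto)
  have "(l has_vector_derivative \<gamma>' s / (\<gamma> s - \<gamma> t)) (at s)"
  proof (rule continuous_log_has_vector_derivative[where f = "\<lambda>y. \<gamma> y - \<gamma> t"])
    show "isCont l s" using lc st by (simp add: continuous_on_eq_continuous_at)
    show "\<forall>\<^sub>F y in nhds s. \<gamma> y - \<gamma> t = exp (l y)" using evs by eventually_elim (rule le)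
    show "((\<lambda>y. \<gamma> y - \<gamma> t) has_vector_derivative \<gamma>' s) (at s)"
      using has_vector_derivative_diff[OF deriv1[of s] has_vector_derivative_const[of "\<gamma> t"]] by simp
  qed
  then have "((\<lambda>y. Im (l y)) has_real_derivative k s t) (at s)"
    unfolding has_real_derivative_iff_has_vector_derivative k_def by (rule bounded_linear.has_vector_derivative[OF bounded_linear_Im])
  from DERIV_diff[OF this DERIV_const[of "pi / 2"]]
  have "((\<lambda>y. Im (l y) - pi / 2) has_real_derivative k s t) (at s)" by simp
  moreover have "\<forall>\<^sub>F y in nhds s. Im (l y) - pi / 2 = \<eta> (\<theta> y) (\<theta> t) + (\<theta> y + \<theta> t) / 2"
    using evs
  proof eventually_elim
    case (elim y)
    have "cis (\<theta> y) \<noteq> cis (\<theta> t)" using rng[OF elim] by (intro cis_neq) auto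
    then show ?case by (simp add: l_def \<eta>_def)
  qed
  ultimately show ?thesis using DERIV_cong_ev[of s s "\<lambda>y. Im (l y) - pi / 2" "\<lambda>y. \<eta> (\<theta> y) (\<theta> t) + (\<theta> y + \<theta> t) / 2" "k s t" "k s t"] by blast
qed

end

lemma finite_measure_Icc: "finite_measure (restrict_space lborel {a..b::real})"
  by (rule finite_measureI) (simp add: emeasure_restrict_space space_restrict_space emeasure_lborel_Icc_eq)

lemma borel_measurable_Icc: "f \<in> borel_measurable borel \<Longrightarrow> f \<in> borel_measurable (restrict_space lborel {a..b::real})"
  by (intro measurable_restrict_space1) simp

lemma integrable_Icc:
  fixes f :: "real \<Rightarrow> complex"
  assumes "f \<in> borel_measurable borel" "\<And>x. norm (f x) \<le> B"
  shows "integrable (restrict_space lborel {a..b}) f"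
  by (rule finite_measure.integrable_const_bound[OF finite_measure_Icc, where B = B])
     (use assms in \<open>auto intro!: borel_measurable_Icc\<close>)

lemma pair_Icc_measurable:
  fixes f :: "real \<times> real \<Rightarrow> 'b::topological_space"
  assumes "f \<in> borel_measurable borel"
  shows "f \<in> borel_measurable (restrict_space lborel {a..b} \<Otimes>\<^sub>M restrict_space lborel {c..d})"
proof -
  let ?M = "restrict_space lborel {a..b} \<Otimes>\<^sub>M restrict_space lborel {c..d}"
  have "fst \<in> measurable ?M borel" "snd \<in> measurable ?M borel"
    using measurable_compose[OF measurable_fst borel_measurable_Icc[OF measurable_ident]]
      measurable_compose[OF measurable_snd borel_measurable_Icc[OF measurable_ident]]
    by (auto simp: id_def)
  then have "(\<lambda>x. (fst x, snd x)) \<in> measurable ?M (borel :: (real \<times> real) measure)"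
    by (rule borel_measurable_Pair)
  from measurable_compose[OF this assms] show ?thesis by simp
qed

lemma LINT_Icc_swap:
  fixes f :: "real \<Rightarrow> real \<Rightarrow> complex"
  assumes m: "(\<lambda>p. f (fst p) (snd p)) \<in> borel_measurable borel" and B: "\<And>x y. norm (f x y) \<le> B"
  shows "(LINT x|restrict_space lborel {a..b}. LINT y|restrict_space lborel {c..d}. f x y)
    = (LINT y|restrict_space lborel {c..d}. LINT x|restrict_space lborel {a..b}. f x y)"
    and "(\<lambda>x. LINT y|restrict_space lborel {c..d}. f x y) \<in> borel_measurable borel"
    and "norm (LINT y|restrict_space lborel {c..d}. f x y) \<le> B * (max 0 (d - c))"
proof -
  let ?M1 = "restrict_space lborel {a..b}" and ?M2 = "restrict_space lborel {c..d}"
  interpret M1: finite_measure ?M1 by (rule finite_measure_Icc)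
  interpret M2: finite_measure ?M2 by (rule finite_measure_Icc)
  interpret P: pair_sigma_finite ?M1 ?M2 by unfold_locales
  interpret PM: finite_measure "?M1 \<Otimes>\<^sub>M ?M2" by (rule finite_measure_pair_measure) (rule finite_measure_Icc)+
  have "integrable (?M1 \<Otimes>\<^sub>M ?M2) (\<lambda>(x, y). f x y)"
    by (rule PM.integrable_const_bound[where B = B]) (use B pair_Icc_measurable[OF m] in \<open>auto simp: split_def\<close>)
  from P.Fubini_integral[OF this] show "(LINT x|?M1. LINT y|?M2. f x y) = (LINT y|?M2. LINT x|?M1. f x y)" by simp
  have "fst \<in> measurable (borel \<Otimes>\<^sub>M ?M2) (borel :: real measure)" "snd \<in> measurable (borel \<Otimes>\<^sub>M ?M2) (borel :: real measure)"
    using measurable_compose[OF measurable_snd borel_measurable_Icc[OF measurable_ident]] by (auto simp: id_def)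
  then have "(\<lambda>x. (fst x, snd x)) \<in> measurable (borel \<Otimes>\<^sub>M ?M2) (borel :: (real \<times> real) measure)"
    by (rule borel_measurable_Pair)
  from measurable_compose[OF this m] have "(\<lambda>(x, y). f x y) \<in> borel_measurable (borel \<Otimes>\<^sub>M ?M2)" by (simp add: split_def)
  then show "(\<lambda>x. LINT y|?M2. f x y) \<in> borel_measurable borel" by (rule M2.borel_measurable_lebesgue_integral)
  have "(\<lambda>y. (x, y)) \<in> measurable borel (borel :: (real \<times> real) measure)" by (intro borel_measurable_Pair) auto
  from measurable_compose[OF this m] have my: "f x \<in> borel_measurable borel" by simp
  have "norm (LINT y|?M2. f x y) \<le> (LINT y|?M2. B)"
    by (rule norm_LINT_le[OF integrable_Icc[OF my B]]) (use B in auto)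
  also have "\<dots> = B * max 0 (d - c)"
    by (simp add: measure_def emeasure_restrict_space space_restrict_space emeasure_lborel_Icc_eq max_def)
  finally show "norm (LINT y|?M2. f x y) \<le> B * (max 0 (d - c))" .
qed

lemma LINT_interval_tendsto:
  fixes f :: "real \<Rightarrow> complex"
  assumes f[measurable]: "f \<in> borel_measurable borel" and B: "\<And>x. norm (f x) \<le> B"
    and c: "c \<longlonglongrightarrow> lo" "\<And>n. lo < c n" and d: "d \<longlonglongrightarrow> hi" "\<And>n. d n < hi"
  shows "(\<lambda>n. LINT x|lborel. indicator {c n..d n} x *\<^sub>R f x) \<longlonglongrightarrow> (LINT x|lborel. indicator {lo<..<hi} x *\<^sub>R f x)"
proof (rule integral_dominated_convergence[where w = "\<lambda>x. indicator {lo<..<hi} x *\<^sub>R B"])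
  show "integrable lborel (\<lambda>x. indicator {lo<..<hi} x *\<^sub>R B)"
  proof (rule integrableI_bounded_set_indicator[where B = B])
    have "emeasure lborel {lo<..<hi} \<le> emeasure lborel {lo..hi}" by (intro emeasure_mono) auto
    also have "\<dots> < \<infinity>" by (simp add: emeasure_lborel_Icc_eq)
    finally show "emeasure lborel {lo<..<hi} < \<infinity>" .
    have "0 \<le> B" using B[of 0] norm_ge_zero order_trans by blast
    then show "AE x in lborel. x \<in> {lo<..<hi} \<longrightarrow> norm B \<le> B" by simp
  qed auto
  show "AE x in lborel. (\<lambda>n. indicator {c n..d n} x *\<^sub>R f x) \<longlonglongrightarrow> indicator {lo<..<hi} x *\<^sub>R f x"
  proof (rule AE_I2)
    fix x
    show "(\<lambda>n. indicator {c n..d n} x *\<^sub>R f x) \<longlonglongrightarrow> indicator {lo<..<hi} x *\<^sub>R f x"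
    proof (cases "x \<in> {lo<..<hi}")
      case True
      then have "\<forall>\<^sub>F n in sequentially. c n < x" "\<forall>\<^sub>F n in sequentially. x < d n"
        using order_tendstoD(2)[OF c(1)] order_tendstoD(1)[OF d(1)] by auto
      then have "\<forall>\<^sub>F n in sequentially. indicator {lo<..<hi} x *\<^sub>R f x = indicator {c n..d n} x *\<^sub>R f x"
        by eventually_elim (use True in \<open>auto simp: indicator_def\<close>)
      then show ?thesis by (rule Lim_transform_eventually[OF tendsto_const])
    next
      case False
      then have "indicator {c n..d n} x *\<^sub>R f x = 0" for n using c(2)[of n] d(2)[of n] by (auto simp: indicator_def)
      moreover have "indicator {lo<..<hi} x *\<^sub>R f x = 0" using False by (auto simp: indicator_def)
      ultimately have "(\<lambda>n. indicator {c n..d n} x *\<^sub>R f x) = (\<lambda>n. indicator {lo<..<hi} x *\<^sub>R f x)" by (simp only:)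
      then show ?thesis by (simp only: tendsto_const)
    qed
  qed
  show "AE x in lborel. norm (indicator {c n..d n} x *\<^sub>R f x) \<le> indicator {lo<..<hi} x *\<^sub>R B" for n
  proof (rule AE_I2)
    fix x
    have "x \<in> {c n..d n} \<Longrightarrow> x \<in> {lo<..<hi}" using c(2)[of n] d(2)[of n] by auto
    then show "norm (indicator {c n..d n} x *\<^sub>R f x) \<le> indicator {lo<..<hi} x *\<^sub>R B"
      using B[of x] order_trans[OF norm_ge_zero B] by (auto simp: indicator_def)
  qed
qed auto

lemma LINT_indicator_eq_integral:
  fixes f :: "real \<Rightarrow> complex"
  assumes "continuous_on {c..d} f"
  shows "(LINT x|lborel. indicator {c..d} x *\<^sub>R f x) = integral {c..d} f"
  using set_borel_integral_eq_integral(2)[OF borel_integrable_atLeastAtMost'[OF assms]] by (simp add: set_lebesgue_integral_def)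

section \<open>Partial integration of the kernel against exponentials\<close>

context riemann_curve
begin

lemma eta_sym: "\<eta> a b = \<eta> b a"
  using H_sym[OF cis_X, of a b] by (auto simp: \<eta>_def)

lemma eta_bounded: obtains B where "B \<ge> 0" "\<And>a b. \<bar>\<eta> a b\<bar> \<le> B"
proof -
  obtain B where B: "\<And>p. p \<in> X \<Longrightarrow> \<bar>Im (H p)\<bar> \<le> B" using Im_H_bounded' by blast
  have "0 \<le> B" using B[of "(0,0)"] by (simp add: X_def)
  then show thesis using that[of B] B[OF cis_X] by (auto simp: \<eta>_def)
qed

lemma eta_cont: "continuous_on {p. cis (fst p) \<noteq> cis (snd p)} (\<lambda>p. \<eta> (fst p) (snd p))"
proof -
  have "continuous_on {p. cis (fst p) \<noteq> cis (snd p)} (\<lambda>p. Im (H (cis (fst p), cis (snd p))))"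
    by (intro continuous_on_Im continuous_on_compose2[OF H_cont] continuous_intros cont_cis) (use cis_X in auto)
  then show ?thesis by (rule continuous_on_eq) (auto simp: \<eta>_def)
qed

lemma eta_borel: "(\<lambda>p. \<eta> (fst p) (snd p)) \<in> borel_measurable borel"
proof -
  let ?S = "{p :: real \<times> real. cis (fst p) \<noteq> cis (snd p)}"
  have "open ?S" by (intro open_Collect_neq cont_cis continuous_intros)
  then have "(\<lambda>p. indicator ?S p *\<^sub>R \<eta> (fst p) (snd p)) \<in> borel_measurable borel"
    by (intro borel_measurable_continuous_on_indicator eta_cont) auto
  moreover have "(\<lambda>p. indicator ?S p *\<^sub>R \<eta> (fst p) (snd p)) = (\<lambda>p. \<eta> (fst p) (snd p))"
    by (auto simp: \<eta>_def fun_eq_iff)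
  ultimately show ?thesis by simp
qed

lemma eta_borel1: "(\<lambda>a. \<eta> a b) \<in> borel_measurable borel"
proof -
  have "(\<lambda>a. (a, b)) \<in> measurable borel (borel :: (real \<times> real) measure)" by (intro borel_measurable_Pair) auto
  from measurable_compose[OF this eta_borel] show ?thesis by simp
qed

lemma cis_borel: "(\<lambda>a. cis (c * a)) \<in> borel_measurable borel"
  by (intro borel_measurable_continuous_onI cont_cis continuous_intros)

lemma kappa_borel: "(\<lambda>p. \<kappa> (fst p) (snd p)) \<in> borel_measurable borel"
proof -
  have "continuous_on UNIV (\<lambda>p :: real \<times> real. F (cis (snd p)))"
    by (rule continuous_on_compose2[OF F_cont]) (auto intro!: cont_cis continuous_intros)
  then have "(\<lambda>p :: real \<times> real. F (cis (snd p))) \<in> borel_measurable borel" by (rule borel_measurable_continuous_onI)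
  moreover have "(\<lambda>p. \<gamma>' (fst p)) \<in> borel_measurable (borel :: (real \<times> real) measure)"
    "(\<lambda>p. \<gamma> (fst p)) \<in> borel_measurable (borel :: (real \<times> real) measure)"
    by (intro borel_measurable_continuous_onI cont_compose cont1_compose continuous_intros)+
  ultimately show ?thesis unfolding \<kappa>_def by measurable
qed

lemma kappa_borel1: "(\<lambda>s. \<kappa> s b) \<in> borel_measurable borel" and kappa_borel2: "\<kappa> s \<in> borel_measurable borel"
proof -
  have "(\<lambda>a. (a, b)) \<in> measurable borel (borel :: (real \<times> real) measure)" by (intro borel_measurable_Pair) auto
  from measurable_compose[OF this kappa_borel] show "(\<lambda>s. \<kappa> s b) \<in> borel_measurable borel" by simp
  have "(\<lambda>b. (s, b)) \<in> measurable borel (borel :: (real \<times> real) measure)" by (intro borel_measurable_Pair) auto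
  from measurable_compose[OF this kappa_borel] show "\<kappa> s \<in> borel_measurable borel" by simp
qed

lemma kappa_bounded: obtains C where "C > 0" "\<And>s b. \<bar>\<kappa> s b\<bar> \<le> C"
proof -
  obtain C where C: "C > 0" "\<And>s t. \<bar>k s t\<bar> \<le> C" using k_bounded by blast
  have "\<bar>\<kappa> s b\<bar> \<le> C" for s b
  proof -
    obtain t where "\<theta> t = b" using theta_surj by blast
    then show ?thesis using C(2)[of s t] kappa_theta[of s t] by simp
  qed
  then show thesis using that[OF C(1)] by blast
qed

text \<open>The arc stays away from the singular parameter \<open>t\<close>. The linear part
  \<open>(a + b) / 2\<close> of the phase is integrated explicitly: its boundary terms cancel, and
  half the integral of the exponential remains.\<close>

lemma partial_by_parts:
  fixes m :: int
  assumes cd: "t < c" "c \<le> d" "d < t + 1"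
  shows "(LINT s|lborel. indicator {c..d} s *\<^sub>R (cis (of_int m * \<theta> s) * of_real (k s t)))
    = cis (of_int m * \<theta> d) * of_real (\<eta> (\<theta> d) (\<theta> t)) - cis (of_int m * \<theta> c) * of_real (\<eta> (\<theta> c) (\<theta> t))
      + (LINT a|lborel. indicator {\<theta> c..\<theta> d} a *\<^sub>R cis (of_int m * a)) / 2
      - \<i> * of_int m * (LINT a|lborel. indicator {\<theta> c..\<theta> d} a *\<^sub>R (cis (of_int m * a) * of_real (\<eta> a (\<theta> t))))"
proof -
  define b where "b = \<theta> t"
  define Y where "Y a = \<eta> a b + (a + b) / 2" for a
  have rng: "b < \<theta> c" "\<theta> d < b + 2 * pi" "\<theta> c \<le> \<theta> d"
    using theta_strict_mono[of t c] theta_strict_mono[of d "t + 1"] theta_period[of t] theta_mono[of c d] cd by (auto simp: b_def)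
  have ec: "continuous_on {\<theta> c..\<theta> d} (\<lambda>a. \<eta> a b)"
  proof -
    have "continuous_on {\<theta> c..\<theta> d} (\<lambda>a. (\<lambda>p. \<eta> (fst p) (snd p)) (a, b))"
    proof (rule continuous_on_compose2[OF eta_cont])
      show "continuous_on {\<theta> c..\<theta> d} (\<lambda>a. (a, b))" by (intro continuous_intros)
      show "(\<lambda>a. (a, b)) ` {\<theta> c..\<theta> d} \<subseteq> {p. cis (fst p) \<noteq> cis (snd p)}" using rng cis_neq[of b] by auto
    qed
    then show ?thesis by simp
  qed
  have Yc: "continuous_on {\<theta> c..\<theta> d} Y" unfolding Y_def by (intro continuous_intros ec) auto
  have kd: "((\<lambda>s. Y (\<theta> s)) has_real_derivative k s t) (at s within {c..d})" if "s \<in> {c..d}" for s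
    using phase_deriv[of t s] that cd unfolding Y_def b_def by (intro has_field_derivative_at_within[of _ _ _ "{c..d}"]) auto
  have hi: "((\<lambda>s. cis (of_int m * \<theta> s) * of_real (k s t)) has_integral
     (cis (of_int m * \<theta> d) * of_real (Y (\<theta> d)) - cis (of_int m * \<theta> c) * of_real (Y (\<theta> c))
      - integral {\<theta> c..\<theta> d} (\<lambda>a. \<i> * of_real (of_int m) * cis (of_int m * a) * of_real (Y a)))) {c..d}"
    by (rule stieltjes_by_parts[OF cd(2) theta_cont _ Yc kd]) (use theta_mono in auto)
  have c1: "continuous_on {c..d} (\<lambda>s. cis (of_int m * \<theta> s) * of_real (k s t))"
  proof -
    have "continuous_on {c..d} (\<lambda>s. k s t)"
    proof (rule k_cont)
      show "\<gamma> s \<noteq> \<gamma> t" if "s \<in> {c..d}" for s using neq[of t s] that cd by auto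
    qed
    then show ?thesis by (intro continuous_on_mult continuous_on_of_real cont_cis continuous_on_const theta_cont)
  qed
  have c2: "continuous_on {\<theta> c..\<theta> d} (\<lambda>a. cis (of_int m * a))" by (intro cont_cis continuous_intros)
  have c3: "continuous_on {\<theta> c..\<theta> d} (\<lambda>a. cis (of_int m * a) * of_real (\<eta> a b))" by (intro continuous_on_mult continuous_on_of_real ec c2)
  have i2: "(\<lambda>a. cis (of_int m * a)) integrable_on {\<theta> c..\<theta> d}" by (rule integrable_continuous_real[OF c2])
  have i3: "(\<lambda>a. cis (of_int m * a) * of_real (\<eta> a b)) integrable_on {\<theta> c..\<theta> d}" by (rule integrable_continuous_real[OF c3])
  have lin: "((\<lambda>a. \<i> * of_int m * cis (of_int m * a) * of_real ((a + b) / 2) + cis (of_int m * a) / 2) has_integral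
     (cis (of_int m * \<theta> d) * of_real ((\<theta> d + b) / 2) - cis (of_int m * \<theta> c) * of_real ((\<theta> c + b) / 2))) {\<theta> c..\<theta> d}"
  proof (rule fundamental_theorem_of_calculus[OF rng(3)])
    fix a
    have "((\<lambda>a. complex_of_real ((a + b) / 2)) has_vector_derivative 1 / 2) (at a within {\<theta> c..\<theta> d})"
    proof -
      have "((\<lambda>a. (a + b) / 2) has_real_derivative 1 / 2) (at a within {\<theta> c..\<theta> d})" by (auto intro!: derivative_eq_intros)
      then have "((\<lambda>a. complex_of_real ((a + b) / 2)) has_vector_derivative complex_of_real (1 / 2)) (at a within {\<theta> c..\<theta> d})"
        by (rule has_vector_derivative_of_real)
      then show ?thesis by (simp only: of_real_divide of_real_1 of_real_numeral)
    qed
    from has_vector_derivative_mult[OF cis_has_vector_derivative[of "of_int m" a "{\<theta> c..\<theta> d}"] this]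
    show "((\<lambda>a. cis (of_int m * a) * of_real ((a + b) / 2)) has_vector_derivative
       \<i> * of_int m * cis (of_int m * a) * of_real ((a + b) / 2) + cis (of_int m * a) / 2) (at a within {\<theta> c..\<theta> d})"
      by (simp add: add.commute)
  qed
  have "((\<lambda>a. \<i> * of_real (of_int m) * cis (of_int m * a) * of_real (Y a)) has_integral
      \<i> * of_int m * integral {\<theta> c..\<theta> d} (\<lambda>a. cis (of_int m * a) * of_real (\<eta> a b))
      + ((cis (of_int m * \<theta> d) * of_real ((\<theta> d + b) / 2) - cis (of_int m * \<theta> c) * of_real ((\<theta> c + b) / 2))
         - integral {\<theta> c..\<theta> d} (\<lambda>a. cis (of_int m * a)) / 2)) {\<theta> c..\<theta> d}"
  proof (rule has_integral_eq_rhs[OF has_integral_eq])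
    show "((\<lambda>a. \<i> * of_int m * (cis (of_int m * a) * of_real (\<eta> a b)) + ((\<i> * of_int m * cis (of_int m * a) * of_real ((a + b) / 2) + cis (of_int m * a) / 2) - cis (of_int m * a) / 2)) has_integral
      (\<i> * of_int m * integral {\<theta> c..\<theta> d} (\<lambda>a. cis (of_int m * a) * of_real (\<eta> a b))
      + ((cis (of_int m * \<theta> d) * of_real ((\<theta> d + b) / 2) - cis (of_int m * \<theta> c) * of_real ((\<theta> c + b) / 2))
         - integral {\<theta> c..\<theta> d} (\<lambda>a. cis (of_int m * a)) / 2))) {\<theta> c..\<theta> d}"
      by (intro has_integral_add has_integral_diff has_integral_mult_right has_integral_divide integrable_integral i2 i3 lin)
    show "\<i> * of_int m * (cis (of_int m * a) * of_real (\<eta> a b)) + ((\<i> * of_int m * cis (of_int m * a) * of_real ((a + b) / 2) + cis (of_int m * a) / 2) - cis (of_int m * a) / 2)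
       = \<i> * of_real (of_int m) * cis (of_int m * a) * of_real (Y a)" for a
      by (simp add: Y_def algebra_simps)
  qed simp
  from integral_unique[OF this] have "integral {c..d} (\<lambda>s. cis (of_int m * \<theta> s) * of_real (k s t)) =
     cis (of_int m * \<theta> d) * of_real (Y (\<theta> d)) - cis (of_int m * \<theta> c) * of_real (Y (\<theta> c)) -
     (\<i> * of_int m * integral {\<theta> c..\<theta> d} (\<lambda>a. cis (of_int m * a) * of_real (\<eta> a b))
      + ((cis (of_int m * \<theta> d) * of_real ((\<theta> d + b) / 2) - cis (of_int m * \<theta> c) * of_real ((\<theta> c + b) / 2))
         - integral {\<theta> c..\<theta> d} (\<lambda>a. cis (of_int m * a)) / 2))"
    using integral_unique[OF hi] by (simp only:)
  then have "integral {c..d} (\<lambda>s. cis (of_int m * \<theta> s) * of_real (k s t)) =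
     cis (of_int m * \<theta> d) * of_real (\<eta> (\<theta> d) b) - cis (of_int m * \<theta> c) * of_real (\<eta> (\<theta> c) b)
     + integral {\<theta> c..\<theta> d} (\<lambda>a. cis (of_int m * a)) / 2
     - \<i> * of_int m * integral {\<theta> c..\<theta> d} (\<lambda>a. cis (of_int m * a) * of_real (\<eta> a b))"
    unfolding Y_def of_real_add by (simp only: ring_distribs) simp
  then show ?thesis unfolding LINT_indicator_eq_integral[OF c1] LINT_indicator_eq_integral[OF c2] LINT_indicator_eq_integral[OF c3] b_def[symmetric] .
qed

lemma eta_period: "\<eta> (a + 2 * pi) b = \<eta> a b"
  using cis_int_period[of 1 a] by (simp add: \<eta>_def)

lemma cis_theta_borel: "(\<lambda>s. cis (of_int m * \<theta> s)) \<in> borel_measurable borel"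
  by (intro borel_measurable_continuous_onI cont_cis continuous_on_mult continuous_on_const theta_cont)

lemma cis_theta_period: "cis (of_int m * \<theta> (s + 1)) = cis (of_int m * \<theta> s)"
  unfolding theta_period by (rule cis_int_period)

text \<open>The arcs exhaust a full period. No boundary value of \<eta> at the diagonal is known,
  but its values at the two ends become equal in the limit and they are bounded, so the boundary
  terms vanish.\<close>

lemma kappa_Fourier:
  fixes m :: int
  assumes m: "m \<noteq> 0"
  shows "(LINT s|\<I>. cis (of_int m * \<theta> s) * of_real (\<kappa> s b)) = - \<i> * of_int m * (LINT a|\<J>. cis (of_int m * a) * of_real (\<eta> a b))"
proof -
  obtain t where t: "\<theta> t = b" using theta_surj by blast
  have kt: "\<kappa> s b = k s t" for s using kappa_theta[of s t] t by simp
  obtain B where B: "B \<ge> 0" "\<And>a b. \<bar>\<eta> a b\<bar> \<le> B" using eta_bounded by blast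
  obtain C where C: "C > 0" "\<And>s b. \<bar>\<kappa> s b\<bar> \<le> C" using kappa_bounded by blast
  define c d where "c n = t + 1 / (real n + 3)" and "d n = t + 1 - 1 / (real n + 3)" for n
  have cl: "c \<longlonglongrightarrow> t" unfolding c_def by real_asymp
  have dl: "d \<longlonglongrightarrow> t + 1" unfolding d_def by real_asymp
  have cb: "t < c n" "d n < t + 1" for n by (auto simp: c_def d_def)
  have cd: "c n \<le> d n" for n unfolding c_def d_def by (simp add: field_simps)
  have isc: "isCont \<theta> s" for s using theta_cont[of UNIV] by (simp add: continuous_on_eq_continuous_at)
  have tcl: "(\<lambda>n. \<theta> (c n)) \<longlonglongrightarrow> b" using isCont_tendsto_compose[OF isc cl] t by simp
  have tdl: "(\<lambda>n. \<theta> (d n)) \<longlonglongrightarrow> b + 2 * pi" using isCont_tendsto_compose[OF isc dl] t theta_period[of t] by simp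
  have tcb: "b < \<theta> (c n)" "\<theta> (d n) < b + 2 * pi" for n
    using theta_strict_mono[OF cb(1)[of n]] theta_strict_mono[OF cb(2)[of n]] t theta_period[of t] by auto
  define A where "A m n = (LINT s|lborel. indicator {c n..d n} s *\<^sub>R (cis (of_int m * \<theta> s) * of_real (\<kappa> s b)))" for m :: int and n
  define D where "D m n = (LINT a|lborel. indicator {\<theta> (c n)..\<theta> (d n)} a *\<^sub>R cis (of_int m * a))" for m :: int and n
  define E where "E n = (LINT a|lborel. indicator {\<theta> (c n)..\<theta> (d n)} a *\<^sub>R (cis (of_int m * a) * of_real (\<eta> a b)))" for n
  have Al: "A m \<longlonglongrightarrow> (LINT s|\<I>. cis (of_int m * \<theta> s) * of_real (\<kappa> s b))" for m
  proof -
    have f: "(\<lambda>s. cis (of_int m * \<theta> s) * of_real (\<kappa> s b)) \<in> borel_measurable borel"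
      by (intro borel_measurable_times cis_theta_borel measurable_compose[OF kappa_borel1 borel_measurable_of_real])
    have n: "norm (cis (of_int m * \<theta> s) * of_real (\<kappa> s b)) \<le> C" for s using C(2) by (simp add: norm_mult)
    have p: "cis (of_int m * \<theta> (s + 1)) * of_real (\<kappa> (s + 1) b) = cis (of_int m * \<theta> s) * of_real (\<kappa> s b)" for s
      using k_period_int[of s 1 t 0] cis_theta_period[of m s] by (simp add: kt)
    show ?thesis using LINT_interval_tendsto[OF f n cl cb(1) dl cb(2)] unfolding A_def set_integral_shift_period[OF f n p zero_less_one] .
  qed
  have pp: "0 < 2 * pi" using pi_gt_zero by linarith
  have Dl: "D m \<longlonglongrightarrow> (LINT a|\<J>. cis (of_int m * a))" for m
  proof -
    have n: "norm (cis (of_int m * a)) \<le> 1" for a by simp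
    show ?thesis using LINT_interval_tendsto[OF cis_borel[of "of_int m"] n tcl tcb(1) tdl tcb(2)]
      unfolding D_def set_integral_shift_period[OF cis_borel[of "of_int m"] n cis_int_period pp] .
  qed
  have El: "E \<longlonglongrightarrow> (LINT a|\<J>. cis (of_int m * a) * of_real (\<eta> a b))"
  proof -
    have f: "(\<lambda>a. cis (of_int m * a) * of_real (\<eta> a b)) \<in> borel_measurable borel"
      by (intro borel_measurable_times cis_borel measurable_compose[OF eta_borel1 borel_measurable_of_real])
    have n: "norm (cis (of_int m * a) * of_real (\<eta> a b)) \<le> B" for a using B(2) by (simp add: norm_mult)
    have p: "cis (of_int m * (a + 2 * pi)) * of_real (\<eta> (a + 2 * pi) b) = cis (of_int m * a) * of_real (\<eta> a b)" for a
      by (simp only: cis_int_period eta_period)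
    show ?thesis using LINT_interval_tendsto[OF f n tcl tcb(1) tdl tcb(2)] unfolding E_def set_integral_shift_period[OF f n p pp] .
  qed
  have part: "A m n = cis (of_int m * \<theta> (d n)) * of_real (\<eta> (\<theta> (d n)) b) - cis (of_int m * \<theta> (c n)) * of_real (\<eta> (\<theta> (c n)) b)
      + D m n / 2 - \<i> * of_int m * E n" for n
    using partial_by_parts[OF cb(1) cd cb(2), of n m] unfolding A_def D_def E_def kt t .
  have part0: "A 0 n = of_real (\<eta> (\<theta> (d n)) b) - of_real (\<eta> (\<theta> (c n)) b) + D 0 n / 2" for n
    using partial_by_parts[OF cb(1) cd cb(2), of n 0] unfolding A_def D_def kt t by simp
  \<comment> \<open>The case of index 0 shows that the two end values of \<eta> merge: the total
    turning \<open>pi\<close> is already accounted for by half the period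
    \<open>2 * pi\<close>.\<close>
  have "(\<lambda>n. A 0 n - D 0 n / 2) \<longlonglongrightarrow> (LINT s|\<I>. cis (of_int 0 * \<theta> s) * of_real (\<kappa> s b)) - (LINT a|\<J>. cis (of_int 0 * a)) / 2"
    by (intro tendsto_diff tendsto_divide tendsto_const Al Dl) simp
  also have "(LINT s|\<I>. cis (of_int 0 * \<theta> s) * of_real (\<kappa> s b)) = of_real pi"
    by (simp add: kt integral_k)
  also have "(LINT a|\<J>. cis (of_int 0 * a)) = of_real (2 * pi)" by (simp add: circle_interval_measure scaleR_conv_of_real)
  finally have z: "(\<lambda>n. complex_of_real (\<eta> (\<theta> (d n)) b) - of_real (\<eta> (\<theta> (c n)) b)) \<longlonglongrightarrow> 0"
    by (simp add: part0)
  have ccl: "(\<lambda>n. cis (of_int m * \<theta> (c n))) \<longlonglongrightarrow> cis (of_int m * b)"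
    by (intro tendsto_cis tendsto_mult tendsto_const tcl)
  have cdl: "(\<lambda>n. cis (of_int m * \<theta> (d n))) \<longlonglongrightarrow> cis (of_int m * b)"
    unfolding cis_int_period[of m b, symmetric] by (intro tendsto_cis tendsto_mult tendsto_const tdl)
  have "(\<lambda>n. norm (cis (of_int m * \<theta> (d n)) - cis (of_int m * \<theta> (c n))) * B) \<longlonglongrightarrow> norm (cis (of_int m * b) - cis (of_int m * b)) * B"
    by (intro tendsto_mult tendsto_norm tendsto_diff tendsto_const ccl cdl)
  then have n0: "(\<lambda>n. norm (cis (of_int m * \<theta> (d n)) - cis (of_int m * \<theta> (c n))) * B) \<longlonglongrightarrow> 0" by simp
  have n1: "(\<lambda>n. (cis (of_int m * \<theta> (d n)) - cis (of_int m * \<theta> (c n))) * of_real (\<eta> (\<theta> (c n)) b)) \<longlonglongrightarrow> 0"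
    by (rule Lim_null_comparison[OF _ n0]) (auto simp: norm_mult intro!: always_eventually mult_left_mono B)
  have n2: "(\<lambda>n. cis (of_int m * \<theta> (d n)) * (complex_of_real (\<eta> (\<theta> (d n)) b) - of_real (\<eta> (\<theta> (c n)) b))) \<longlonglongrightarrow> cis (of_int m * b) * 0"
    by (intro tendsto_mult cdl z)
  have "A m \<longlonglongrightarrow> (cis (of_int m * b) * 0 + 0) + (LINT a|\<J>. cis (of_int m * a)) / 2 - \<i> * of_int m * (LINT a|\<J>. cis (of_int m * a) * of_real (\<eta> a b))"
  proof -
    have "A m = (\<lambda>n. (cis (of_int m * \<theta> (d n)) * (complex_of_real (\<eta> (\<theta> (d n)) b) - of_real (\<eta> (\<theta> (c n)) b))
       + (cis (of_int m * \<theta> (d n)) - cis (of_int m * \<theta> (c n))) * of_real (\<eta> (\<theta> (c n)) b)) + D m n / 2 - \<i> * of_int m * E n)"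
      unfolding part by (simp add: fun_eq_iff ring_distribs)
    then show ?thesis by (simp only:) (intro tendsto_diff tendsto_add tendsto_divide tendsto_mult tendsto_const El Dl n1 n2, simp)
  qed
  from LIMSEQ_unique[OF Al this] show ?thesis by (simp only: integral_cis[OF m]) simp
qed

end

section \<open>Fourier modes of the kernel\<close>

lemma LINT_Icc_dominated:
  fixes f :: "nat \<Rightarrow> real \<Rightarrow> complex"
  assumes f: "\<And>N. f N \<in> borel_measurable borel" and g: "g \<in> borel_measurable borel" and B: "\<And>N x. norm (f N x) \<le> B"
    and Z: "countable Z" and lim: "\<And>x. x \<notin> Z \<Longrightarrow> (\<lambda>N. f N x) \<longlonglongrightarrow> g x"
  shows "(\<lambda>N. LINT x|restrict_space lborel {a..b}. f N x) \<longlonglongrightarrow> (LINT x|restrict_space lborel {a..b}. g x)"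
proof (rule integral_dominated_convergence[where w = "\<lambda>_. B"])
  interpret finite_measure "restrict_space lborel {a..b}" by (rule finite_measure_Icc)
  show "integrable (restrict_space lborel {a..b}) (\<lambda>_. B)" by simp
  have "AE x in lborel. x \<notin> Z" by (intro AE_not_in countable_imp_null_set_lborel Z)
  then have "AE x in restrict_space lborel {a..b}. x \<notin> Z" by (subst AE_restrict_space_iff) auto
  then show "AE x in restrict_space lborel {a..b}. (\<lambda>N. f N x) \<longlonglongrightarrow> g x" by eventually_elim (rule lim)
qed (use f g B in \<open>auto intro!: borel_measurable_Icc\<close>)

lemma countable_cis_eq: "countable {a. cis a = cis b}"
proof -
  have "{a. cis a = cis b} \<subseteq> range (\<lambda>n::int. b + 2 * pi * of_int n)"
    using sin_cos_eq_iff[of _ b] by (auto simp: complex_eq_iff)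
  then show ?thesis by (rule countable_subset) auto
qed

text \<open>Cauchy's theorem and Cauchy's formula for derivatives. The factor
  \<open>cis (of_nat m * a)\<close> tests for the frequency \<open>- m\<close>, which a power series
  lacks; the other frequencies scale with the powers of the radius.\<close>

lemma disc_circle_integrals:
  assumes f: "f holomorphic_on ball 0 1" and r: "0 < r" "r < 1"
  shows "m > 0 \<Longrightarrow> (LINT a|\<J>. cis (of_nat m * a) * f (of_real r * cis a)) = 0"
    and "(LINT a|\<J>. cis (- of_nat m * a) * f (of_real r * cis a)) = of_real (2 * pi) * of_real r ^ m * (deriv ^^ m) f 0 / fact m"
proof -
  have c: "continuous_on UNIV (\<lambda>a. f (of_real r * cis a))"
    by (rule continuous_on_compose2[OF holomorphic_on_imp_continuous_on[OF f]])
       (use r in \<open>auto intro!: cont_cis continuous_intros simp: norm_mult\<close>)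
  have c1: "continuous_on {0..2*pi} (\<lambda>a. cis (x * a) * f (of_real r * cis a))" for x
    by (intro continuous_on_mult cont_cis continuous_intros continuous_on_subset[OF c]) auto
  have pp: "0 < 2 * pi" using pi_gt_zero by linarith
  show "(LINT a|\<J>. cis (of_nat m * a) * f (of_real r * cis a)) = 0" if m: "m > 0"
  proof -
    have "((\<lambda>u. f u * u ^ (m - 1)) has_contour_integral 0) (circlepath 0 r)"
      by (rule Cauchy_theorem_disc_simple[of _ 0 1]) (use r in \<open>auto intro!: holomorphic_intros f\<close>)
    then have i: "((\<lambda>t. f (0 + r * cis t) * (0 + r * cis t) ^ (m - 1) * r * \<i> * cis t) has_integral 0) {0..2*pi}"
      unfolding circlepath_def by (subst (asm) has_contour_integral_part_circlepath_iff[OF pp])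
    have eq: "1 / (\<i> * of_real r ^ m) * (f (0 + r * cis t) * (0 + r * cis t) ^ (m - 1) * r * \<i> * cis t) = cis (of_nat m * t) * f (of_real r * cis t)" for t
    proof -
      have p: "(r * cis t) ^ (m - 1) * (r * cis t) = of_real r ^ m * cis (of_nat m * t)"
        unfolding power_minus_mult[OF m] by (simp add: power_mult_distrib Complex.DeMoivre)
      have "1 / (\<i> * of_real r ^ m) * (f (0 + r * cis t) * (0 + r * cis t) ^ (m - 1) * r * \<i> * cis t)
        = 1 / (\<i> * of_real r ^ m) * (f (r * cis t) * \<i> * ((r * cis t) ^ (m - 1) * (r * cis t)))" by (simp only: mult_ac add_0_left)
      then show ?thesis unfolding p using r by simp
    qed
    have "((\<lambda>t. cis (of_nat m * t) * f (of_real r * cis t)) has_integral (1 / (\<i> * of_real r ^ m) * 0)) {0..2*pi}"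
      by (rule has_integral_eq[OF eq has_integral_mult_right[OF i]])
    from integral_unique[OF this] show ?thesis unfolding LINT_circle_interval[OF c1] by simp
  qed
  show "(LINT a|\<J>. cis (- of_nat m * a) * f (of_real r * cis a)) = of_real (2 * pi) * of_real r ^ m * (deriv ^^ m) f 0 / fact m"
  proof -
    have "((\<lambda>u. f u / (u - 0) ^ (Suc m)) has_contour_integral ((2 * pi * \<i>) / (fact m) * (deriv ^^ m) f 0)) (circlepath 0 r)"
      by (rule Cauchy_has_contour_integral_higher_derivative_circlepath)
         (use r in \<open>auto intro!: holomorphic_on_subset[OF f] holomorphic_on_imp_continuous_on\<close>)
    then have i: "((\<lambda>t. f (0 + r * cis t) / (0 + r * cis t - 0) ^ (Suc m) * r * \<i> * cis t) has_integral ((2 * pi * \<i>) / (fact m) * (deriv ^^ m) f 0)) {0..2*pi}"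
      unfolding circlepath_def by (subst (asm) has_contour_integral_part_circlepath_iff[OF pp])
    have eq: "of_real r ^ m / \<i> * (f (0 + r * cis t) / (0 + r * cis t - 0) ^ (Suc m) * r * \<i> * cis t) = cis (- of_nat m * t) * f (of_real r * cis t)" for t
    proof -
      have p: "(r * cis t) ^ Suc m = of_real r ^ m * cis (of_nat m * t) * (r * cis t)"
        by (simp only: power_Suc2 power_mult_distrib Complex.DeMoivre)
      have g: "x / \<i> * (u / (x * v * (y * c)) * y * \<i> * c) = w * u" if h: "x \<noteq> 0" "v * w = 1" "c \<noteq> 0" "y \<noteq> 0" for x y u v w c :: complex
      proof -
        have v: "v \<noteq> 0" using h(2) by auto
        then have w: "w = 1 / v" using h(2) by (simp add: eq_divide_eq mult.commute)
        show ?thesis unfolding w using v h(1,3,4) by (simp add: field_simps)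
      qed
      have c: "cis (of_nat m * t) * cis (- of_nat m * t) = 1" by (simp add: cis_mult)
      have "of_real r ^ m / \<i> * (f (r * cis t) / (r * cis t) ^ Suc m * r * \<i> * cis t) = cis (- of_nat m * t) * f (of_real r * cis t)"
        unfolding p by (rule g[OF _ c]) (use r in auto)
      then show ?thesis by (simp only: add_0_left diff_zero)
    qed
    have "((\<lambda>t. cis (- of_nat m * t) * f (of_real r * cis t)) has_integral (of_real r ^ m / \<i> * ((2 * pi * \<i>) / (fact m) * (deriv ^^ m) f 0))) {0..2*pi}"
      by (rule has_integral_eq[OF eq has_integral_mult_right[OF i]])
    moreover have "x / j * (y * j / z * d) = y * x * d / z" if "j \<noteq> 0" for x y z d j :: complex
      using that by (cases "z = 0") (auto simp: field_simps)
    ultimately have "((\<lambda>t. cis (- of_nat m * t) * f (of_real r * cis t)) has_integral (of_real (2 * pi) * of_real r ^ m * (deriv ^^ m) f 0 / fact m)) {0..2*pi}"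
      by (simp only: complex_i_not_zero not_False_eq_True of_real_mult of_real_numeral)
    from integral_unique[OF this] show ?thesis unfolding LINT_circle_interval[OF c1] .
  qed
qed

lemma disc_circle_integral_scale:
  assumes f: "f holomorphic_on ball 0 1" and r: "0 < r" "r < 1" "0 < r'" "r' < 1"
  shows "(LINT a|\<J>. cis (- of_nat m * a) * f (of_real r * cis a)) = of_real (r / r') ^ m * (LINT a|\<J>. cis (- of_nat m * a) * f (of_real r' * cis a))"
  unfolding disc_circle_integrals(2)[OF f r(1,2)] disc_circle_integrals(2)[OF f r(3,4)] using r by (simp add: power_divide)

lemma LINT_swap_factors:
  fixes f :: "real \<Rightarrow> real \<Rightarrow> complex"
  assumes m: "(\<lambda>p. f (fst p) (snd p)) \<in> borel_measurable borel" and B: "\<And>x y. norm (f x y) \<le> B"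
    and p: "p \<in> borel_measurable borel" "\<And>x. norm (p x) \<le> 1" and q: "q \<in> borel_measurable borel" "\<And>x. norm (q x) \<le> 1"
  shows "(LINT x|restrict_space lborel {a..b}. p x * (LINT y|restrict_space lborel {c..d}. q y * f x y))
    = (LINT y|restrict_space lborel {c..d}. q y * (LINT x|restrict_space lborel {a..b}. p x * f x y))"
proof -
  have B0: "0 \<le> B" using order_trans[OF norm_ge_zero B] .
  have f1: "fst \<in> borel_measurable (borel :: (real \<times> real) measure)" "snd \<in> borel_measurable (borel :: (real \<times> real) measure)"
    by (intro borel_measurable_continuous_onI continuous_intros)+
  have "(LINT x|restrict_space lborel {a..b}. LINT y|restrict_space lborel {c..d}. p x * (q y * f x y))
      = (LINT y|restrict_space lborel {c..d}. LINT x|restrict_space lborel {a..b}. p x * (q y * f x y))"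
  proof (rule LINT_Icc_swap(1)[where B = B])
    show "(\<lambda>z. p (fst z) * (q (snd z) * f (fst z) (snd z))) \<in> borel_measurable borel"
      by (intro borel_measurable_times m measurable_compose[OF f1(1) p(1)] measurable_compose[OF f1(2) q(1)])
    show "norm (p x * (q y * f x y)) \<le> B" for x y
    proof -
      have "norm (p x) * (norm (q y) * norm (f x y)) \<le> 1 * (1 * B)" by (intro mult_mono p(2) q(2) B mult_nonneg_nonneg norm_ge_zero B0) auto
      then show ?thesis by (simp add: norm_mult)
    qed
  qed
  moreover have "(LINT x|restrict_space lborel {a..b}. p x * (q y * f x y)) = q y * (LINT x|restrict_space lborel {a..b}. p x * f x y)" for y
    unfolding mult.left_commute[of "p _" "q y"] by (rule integral_mult_right_zero)
  ultimately show ?thesis by (simp only: integral_mult_right_zero)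
qed

context riemann_curve
begin

text \<open>The Fourier modes of \<open>\<eta>\<close> on the torus, and the mixed modes of the kernel \<open>\<kappa>\<close> obtained from them by partial integration.\<close>

definition e :: "int \<Rightarrow> int \<Rightarrow> complex"
  where "e m n = (LINT b|\<J>. cis (of_int n * b) * (LINT a|\<J>. cis (of_int m * a) * of_real (\<eta> a b)))"

definition U :: "int \<Rightarrow> int \<Rightarrow> complex"
  where "U m n = (LINT s|\<I>. cis (of_int m * \<theta> s) * fourier (\<lambda>b. of_real (\<kappa> s b)) n)"

text \<open>The index \<open>- n\<close> reflects that \<open>fourier\<close> integrates against
  \<open>cis (of_int (- n) * y)\<close> but \<open>e\<close> against
  \<open>cis (of_int n * b)\<close>. For \<open>m = 0\<close> the inner integral is the constant
  \<open>pi\<close>.\<close>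

lemma U_eq: "U m n = (if m = 0 then if n = 0 then of_real (2 * pi\<^sup>2) else 0 else - \<i> * of_int m * e m (- n))"
proof -
  obtain C where C: "C > 0" "\<And>s b. \<bar>\<kappa> s b\<bar> \<le> C" using kappa_bounded by blast
  have "U m n = (LINT b|\<J>. cis (of_int (- n) * b) * (LINT s|\<I>. cis (of_int m * \<theta> s) * of_real (\<kappa> s b)))"
    unfolding U_def fourier_def
    by (rule LINT_swap_factors[where B = C])
       (rule measurable_compose[OF kappa_borel borel_measurable_of_real], simp add: C(2), rule cis_theta_borel, simp, rule cis_borel, simp)
  moreover have "(LINT s|\<I>. cis (of_int 0 * \<theta> s) * of_real (\<kappa> s b)) = of_real pi" for b
  proof -
    obtain t where "\<theta> t = b" using theta_surj by blast
    then have "\<kappa> s b = k s t" for s using kappa_theta[of s t] by simp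
    then show ?thesis by (simp add: integral_k)
  qed
  moreover have "(LINT b|\<J>. cis (of_int (- n) * b) * of_real pi) = (if n = 0 then of_real (2 * pi\<^sup>2) else 0)"
    using integral_cis[of "- n"] by (simp add: circle_interval_measure scaleR_conv_of_real power2_eq_square)
  moreover have "(LINT b|\<J>. cis (of_int (- n) * b) * (LINT s|\<I>. cis (of_int m * \<theta> s) * of_real (\<kappa> s b))) = - \<i> * of_int m * e m (- n)" if "m \<noteq> 0"
  proof -
    have "(LINT b|\<J>. cis (of_int (- n) * b) * (LINT s|\<I>. cis (of_int m * \<theta> s) * of_real (\<kappa> s b)))
       = (LINT b|\<J>. - \<i> * of_int m * (cis (of_int (- n) * b) * (LINT a|\<J>. cis (of_int m * a) * of_real (\<eta> a b))))"
      unfolding kappa_Fourier[OF that] by (simp only: mult.left_commute)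
    then show ?thesis unfolding e_def by (simp only: integral_mult_right_zero)
  qed
  ultimately show ?thesis by (cases "m = 0") auto
qed

lemma e_sym: "e m n = e n m"
proof -
  obtain B where B: "B \<ge> 0" "\<And>a b. \<bar>\<eta> a b\<bar> \<le> B" using eta_bounded by blast
  have "e m n = (LINT b|\<J>. cis (of_int n * b) * (LINT a|\<J>. cis (of_int m * a) * of_real (\<eta> b a)))"
    unfolding e_def by (subst eta_sym) simp
  also have "\<dots> = (LINT a|\<J>. cis (of_int m * a) * (LINT b|\<J>. cis (of_int n * b) * of_real (\<eta> b a)))"
    by (rule LINT_swap_factors[where B = B])
       (rule measurable_compose[OF eta_borel borel_measurable_of_real], simp add: B(2), rule cis_borel, simp, rule cis_borel, simp)
  finally show ?thesis by (simp add: e_def)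
qed

lemma e_cnj: "cnj (e m n) = e (- m) (- n)"
  unfolding e_def by (simp only: Bochner_Integration.integral_cnj[symmetric] complex_cnj_mult cis_cnj of_int_minus complex_cnj_complex_of_real mult_minus_left)

text \<open>The Fourier modes of \<open>H\<close> on smaller tori, which recover those of \<open>\<eta>\<close> in the limit of radius 1.\<close>

definition h :: "int \<Rightarrow> int \<Rightarrow> real \<Rightarrow> real \<Rightarrow> complex"
  where "h m n r r' = (LINT b|\<J>. cis (of_int n * b) * (LINT a|\<J>. cis (of_int m * a) * H (of_real r * cis a, of_real r' * cis b)))"

lemma H_radial_cont:
  assumes "0 < r" "r < 1" "0 < r'" "r' < 1"
  shows "continuous_on UNIV (\<lambda>p. H (of_real r * cis (fst p), of_real r' * cis (snd p)))"
  by (rule continuous_on_compose2[OF H_cont])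
     (use assms in \<open>auto intro!: cont_cis continuous_intros ball_X simp: norm_mult\<close>)

lemma H_radial_borel:
  assumes "0 < r" "r < 1" "0 < r'" "r' < 1"
  shows "(\<lambda>p. H (of_real r * cis (fst p), of_real r' * cis (snd p))) \<in> borel_measurable borel"
  using H_radial_cont[OF assms] by (rule borel_measurable_continuous_onI)

lemma H_radial_bounded:
  assumes r: "0 < r" "r < 1" "0 < r'" "r' < 1"
  obtains B where "\<And>a b. norm (H (of_real r * cis a, of_real r' * cis b)) \<le> B"
proof -
  have "compact (H ` (cball 0 r \<times> cball 0 r'))"
    by (intro compact_continuous_image continuous_on_subset[OF H_cont] compact_Times compact_cball)
       (use r in \<open>auto intro!: ball_X\<close>)
  from compact_imp_bounded[OF this] obtain B where B: "\<forall>x\<in>H ` (cball 0 r \<times> cball 0 r'). norm x \<le> B" unfolding bounded_iff by blast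
  have "(of_real r * cis a, of_real r' * cis b) \<in> cball 0 r \<times> cball 0 r'" for a b using r by (simp add: norm_mult)
  then have "norm (H (of_real r * cis a, of_real r' * cis b)) \<le> B" for a b using B by blast
  then show thesis by (rule that)
qed

lemma h_swap:
  assumes r: "0 < r" "r < 1" "0 < r'" "r' < 1"
  shows "h m n r r' = (LINT a|\<J>. cis (of_int m * a) * (LINT b|\<J>. cis (of_int n * b) * H (of_real r * cis a, of_real r' * cis b)))"
proof -
  obtain B where B: "\<And>a b. norm (H (of_real r * cis a, of_real r' * cis b)) \<le> B" using H_radial_bounded[OF r] by blast
  show ?thesis unfolding h_def
    by (rule LINT_swap_factors[where B = B, symmetric]) (rule H_radial_borel[OF r], rule B, rule cis_borel, simp, rule cis_borel, simp)
qed

lemma in_disc: "0 < r \<Longrightarrow> r < 1 \<Longrightarrow> of_real r * cis a \<in> ball 0 1"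
  by (simp add: norm_mult)

lemma h_zero_left:
  assumes r: "0 < r" "r < 1" "0 < r'" "r' < 1" and m: "m > 0"
  shows "h m n r r' = 0"
proof -
  have "(LINT a|\<J>. cis (of_int m * a) * H (of_real r * cis a, of_real r' * cis b)) = 0" for b
    using disc_circle_integrals(1)[OF H_hol1[OF in_disc[OF r(3,4)]] r(1,2), of "nat m" b] m by simp
  then show ?thesis by (simp add: h_def)
qed

lemma h_zero_right:
  assumes r: "0 < r" "r < 1" "0 < r'" "r' < 1" and n: "n > 0"
  shows "h m n r r' = 0"
proof -
  have "(LINT b|\<J>. cis (of_int n * b) * H (of_real r * cis a, of_real r' * cis b)) = 0" for a
    using disc_circle_integrals(1)[OF H_hol2[OF in_disc[OF r(1,2)]] r(3,4), of "nat n" a] n by simp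
  then show ?thesis by (simp add: h_swap[OF r])
qed

text \<open>Holomorphy in each variable separately makes every mode a pure power in each radius, so
  its value on one torus determines it on all.\<close>

lemma h_scale:
  assumes r: "0 < r" "r < 1" "0 < r'" "r' < 1" "0 < \<rho>" "\<rho> < 1"
  shows "h (- int m) (- int n) r r' = of_real (r / \<rho>) ^ m * of_real (r' / \<rho>) ^ n * h (- int m) (- int n) \<rho> \<rho>"
proof -
  have "h (- int m) (- int n) r r' = of_real (r / \<rho>) ^ m * h (- int m) (- int n) \<rho> r'"
  proof -
    have "(LINT a|\<J>. cis (of_int (- int m) * a) * H (of_real r * cis a, of_real r' * cis b))
       = of_real (r / \<rho>) ^ m * (LINT a|\<J>. cis (of_int (- int m) * a) * H (of_real \<rho> * cis a, of_real r' * cis b))" for b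
      using disc_circle_integral_scale[OF H_hol1[OF in_disc[OF r(3,4)]] r(1,2,5,6), of m b] by simp
    then show ?thesis unfolding h_def by (simp only: mult.left_commute integral_mult_right_zero)
  qed
  also have "h (- int m) (- int n) \<rho> r' = of_real (r' / \<rho>) ^ n * h (- int m) (- int n) \<rho> \<rho>"
  proof -
    have "(LINT b|\<J>. cis (of_int (- int n) * b) * H (of_real \<rho> * cis a, of_real r' * cis b))
       = of_real (r' / \<rho>) ^ n * (LINT b|\<J>. cis (of_int (- int n) * b) * H (of_real \<rho> * cis a, of_real \<rho> * cis b))" for a
      using disc_circle_integral_scale[OF H_hol2[OF in_disc[OF r(5,6)]] r(3-6), of n a] by simp
    then show ?thesis unfolding h_swap[OF r(5,6,3,4)] h_swap[OF r(5,6,5,6)] by (simp only: mult.left_commute integral_mult_right_zero)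
  qed
  finally show ?thesis by (simp add: mult.assoc)
qed

end

lemma LINT_Im_split:
  fixes f g :: "real \<Rightarrow> complex"
  assumes "f \<in> borel_measurable borel" "\<And>x. norm (f x) \<le> B" "g \<in> borel_measurable borel" "\<And>x. norm (g x) \<le> C"
  shows "(LINT x|restrict_space lborel {a..b}. (f x - cnj (g x)) / (2 * \<i>))
    = ((LINT x|restrict_space lborel {a..b}. f x) - cnj (LINT x|restrict_space lborel {a..b}. g x)) / (2 * \<i>)"
proof -
  have "integrable (restrict_space lborel {a..b}) f" by (rule integrable_Icc[OF assms(1,2)])
  moreover have "integrable (restrict_space lborel {a..b}) (\<lambda>x. cnj (g x))" using integrable_Icc[OF assms(3,4)] by simp
  ultimately show ?thesis by (simp only: integral_divide_zero Bochner_Integration.integral_diff Bochner_Integration.integral_cnj)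
qed

context riemann_curve
begin

lemma Im_H_radial_double_integral:
  assumes r: "0 < r" "r < 1"
  shows "(LINT b|\<J>. cis (of_int n * b) * (LINT a|\<J>. cis (of_int m * a) * of_real (Im (H (of_real r * cis a, of_real r * cis b)))))
    = (h m n r r - cnj (h (- m) (- n) r r)) / (2 * \<i>)"
proof -
  obtain B where B: "\<And>a b. norm (H (of_real r * cis a, of_real r * cis b)) \<le> B" using H_radial_bounded[OF r r] by blast
  define A where "A m b = (LINT a|\<J>. cis (of_int m * a) * H (of_real r * cis a, of_real r * cis b))" for m :: int and b
  have c: "continuous_on UNIV (\<lambda>p. cis (of_int m * snd p) * H (of_real r * cis (snd p), of_real r * cis (fst p)))" for m :: int
    by (intro continuous_on_mult cont_cis continuous_intros continuous_on_compose2[OF H_cont])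
       (use r in \<open>auto intro!: ball_X simp: norm_mult\<close>)
  have c1: "continuous_on UNIV (\<lambda>a. cis (of_int m * a) * H (of_real r * cis a, of_real r * cis b))" for m :: int and b
    by (intro continuous_on_mult cont_cis continuous_intros continuous_on_compose2[OF H_cont])
       (use r in \<open>auto intro!: ball_X simp: norm_mult\<close>)
  have nb: "norm (cis (of_int m * a) * H (of_real r * cis a, of_real r * cis b)) \<le> B" for m :: int and a b
    using B by (simp add: norm_mult)
  have Ab: "A m \<in> borel_measurable borel" for m
    unfolding A_def by (rule LINT_Icc_swap(2)[OF borel_measurable_continuous_onI[OF c] nb])
  have AB: "norm (A m b) \<le> B * max 0 (2 * pi - 0)" for m b
    unfolding A_def by (rule LINT_Icc_swap(3)[OF borel_measurable_continuous_onI[OF c] nb])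
  have split: "cis (of_int m * a) * ((z - cnj w) / (2 * \<i>)) = (cis (of_int m * a) * z - cnj (cis (of_int (- m) * a) * w)) / (2 * \<i>)"
    for m :: int and a z w
    by (simp add: cis_cnj right_diff_distrib)
  have im: "of_real (Im z) = (z - cnj z) / (2 * \<i>)" for z by (simp add: complex_eq_iff)
  have inner: "(LINT a|\<J>. cis (of_int m * a) * of_real (Im (H (of_real r * cis a, of_real r * cis b)))) = (A m b - cnj (A (- m) b)) / (2 * \<i>)" for b
    unfolding im split A_def by (rule LINT_Im_split[OF borel_measurable_continuous_onI[OF c1] nb borel_measurable_continuous_onI[OF c1] nb])
  have "(LINT b|\<J>. cis (of_int n * b) * ((A m b - cnj (A (- m) b)) / (2 * \<i>)))
     = ((LINT b|\<J>. cis (of_int n * b) * A m b) - cnj (LINT b|\<J>. cis (of_int (- n) * b) * A (- m) b)) / (2 * \<i>)"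
    unfolding split
    by (rule LINT_Im_split[of _ "B * max 0 (2 * pi - 0)" _ "B * max 0 (2 * pi - 0)"])
       (use AB in \<open>auto simp: norm_mult simp del: of_int_minus intro!: borel_measurable_times cis_borel Ab\<close>)
  then show ?thesis unfolding inner h_def A_def .
qed

text \<open>Dominated convergence rests on the bound for \<open>Im H\<close>; the real part is the
  logarithm of \<open>cmod (R p)\<close>, for which no such bound is at hand. The diagonal, where
  \<eta> is 0 by convention, meets each circle in a countable set.\<close>

lemma h_tendsto_e:
  defines "\<rho> \<equiv> \<lambda>N. 1 - 1 / (real N + 2)"
  shows "(\<lambda>N. (h m n (\<rho> N) (\<rho> N) - cnj (h (- m) (- n) (\<rho> N) (\<rho> N))) / (2 * \<i>)) \<longlonglongrightarrow> e m n"
proof -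
  have r: "0 < \<rho> N" "\<rho> N < 1" for N by (auto simp: \<rho>_def field_simps)
  have rl: "\<rho> \<longlonglongrightarrow> 1" unfolding \<rho>_def by real_asymp
  obtain B where B: "\<And>p. p \<in> X \<Longrightarrow> \<bar>Im (H p)\<bar> \<le> B" using Im_H_bounded' by blast
  define f where "f N b a = cis (of_int m * a) * complex_of_real (Im (H (of_real (\<rho> N) * cis a, of_real (\<rho> N) * cis b)))" for N b a
  have inX: "(of_real (\<rho> N) * cis a, of_real (\<rho> N) * cis b) \<in> X" for N a b
    by (rule ball_X(2)) (use r[of N] in \<open>auto simp: norm_mult\<close>)
  have fB: "norm (f N b a) \<le> B" for N b a unfolding f_def using B[OF inX] by (simp add: norm_mult)
  have fc: "continuous_on UNIV (\<lambda>p. f N (fst p) (snd p))" for N unfolding f_def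
    by (intro continuous_on_mult continuous_on_of_real continuous_on_Im cont_cis continuous_intros continuous_on_compose2[OF H_cont])
       (use inX in auto)
  have fc1: "continuous_on UNIV (f N b)" for N b unfolding f_def
    by (intro continuous_on_mult continuous_on_of_real continuous_on_Im cont_cis continuous_intros continuous_on_compose2[OF H_cont])
       (use inX in auto)
  obtain B' where B': "B' \<ge> 0" "\<And>a b. \<bar>\<eta> a b\<bar> \<le> B'" using eta_bounded by blast
  have es: "(\<lambda>p. \<eta> (snd p) (fst p)) \<in> borel_measurable borel"
    using eta_borel by (subst eta_sym)
  have cs: "(\<lambda>p :: real \<times> real. cis (of_int m * snd p)) \<in> borel_measurable borel" by (intro borel_measurable_continuous_onI cont_cis continuous_intros)
  have gm: "(\<lambda>p. cis (of_int m * snd p) * complex_of_real (\<eta> (snd p) (fst p))) \<in> borel_measurable borel"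
    by (intro borel_measurable_times cs measurable_compose[OF es borel_measurable_of_real])
  have gB: "norm (cis (of_int m * a) * complex_of_real (\<eta> a b)) \<le> B'" for a b using B' by (simp add: norm_mult)
  have gm1: "(\<lambda>a. cis (of_int m * a) * complex_of_real (\<eta> a b)) \<in> borel_measurable borel" for b
    by (intro borel_measurable_times cis_borel measurable_compose[OF eta_borel1 borel_measurable_of_real])
  have inner: "(\<lambda>N. LINT a|\<J>. f N b a) \<longlonglongrightarrow> (LINT a|\<J>. cis (of_int m * a) * of_real (\<eta> a b))" for b
  proof (rule LINT_Icc_dominated[OF borel_measurable_continuous_onI[OF fc1] gm1 fB countable_cis_eq[of b]])
    fix a assume "a \<notin> {a. cis a = cis b}"
    then have ne: "cis a \<noteq> cis b" by simp
    have "(\<lambda>N. H (of_real (\<rho> N) * cis a, of_real (\<rho> N) * cis b)) \<longlonglongrightarrow> H (cis a, cis b)"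
    proof (rule continuous_on_tendsto_compose[OF H_cont _ cis_X[OF ne]])
      have "(\<lambda>N. complex_of_real (\<rho> N) * cis x) \<longlonglongrightarrow> of_real 1 * cis x" for x by (intro tendsto_mult tendsto_of_real rl tendsto_const)
      then show "(\<lambda>N. (of_real (\<rho> N) * cis a, of_real (\<rho> N) * cis b)) \<longlonglongrightarrow> (cis a, cis b)" by (intro tendsto_Pair) auto
      show "\<forall>\<^sub>F N in sequentially. (of_real (\<rho> N) * cis a, of_real (\<rho> N) * cis b) \<in> X" using inX by simp
    qed
    then show "(\<lambda>N. f N b a) \<longlonglongrightarrow> cis (of_int m * a) * of_real (\<eta> a b)"
      using ne unfolding f_def \<eta>_def by (auto intro!: tendsto_intros)
  qed
  have "(\<lambda>N. LINT b|\<J>. cis (of_int n * b) * (LINT a|\<J>. f N b a)) \<longlonglongrightarrow> (LINT b|\<J>. cis (of_int n * b) * (LINT a|\<J>. cis (of_int m * a) * of_real (\<eta> a b)))"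
  proof (rule LINT_Icc_dominated[where Z = "{}" and B = "B * max 0 (2 * pi - 0)"])
    show "(\<lambda>b. cis (of_int n * b) * (LINT a|\<J>. f N b a)) \<in> borel_measurable borel" for N
      by (intro borel_measurable_times cis_borel LINT_Icc_swap(2)[OF borel_measurable_continuous_onI[OF fc] fB])
    show "(\<lambda>b. cis (of_int n * b) * (LINT a|\<J>. cis (of_int m * a) * of_real (\<eta> a b))) \<in> borel_measurable borel"
      by (intro borel_measurable_times cis_borel LINT_Icc_swap(2)[OF gm gB])
    show "norm (cis (of_int n * b) * (LINT a|\<J>. f N b a)) \<le> B * max 0 (2 * pi - 0)" for N b
      using LINT_Icc_swap(3)[OF borel_measurable_continuous_onI[OF fc] fB, of 0 "2 * pi" N b] by (simp add: norm_mult)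
    show "(\<lambda>N. cis (of_int n * b) * (LINT a|\<J>. f N b a)) \<longlonglongrightarrow> cis (of_int n * b) * (LINT a|\<J>. cis (of_int m * a) * of_real (\<eta> a b))" for b
      by (intro tendsto_mult tendsto_const inner)
  qed simp
  then show ?thesis unfolding f_def e_def Im_H_radial_double_integral[OF r] .
qed

text \<open>In the approximating expression \<open>h m n\<close> vanishes since
  \<open>m > 0\<close>, and \<open>h (- m) (- n)\<close> vanishes since
  \<open>- n > 0\<close>.\<close>

lemma e_zero:
  assumes "m > 0" "n < 0 "
  shows "e m n = 0"
proof -
  let ?\<rho> = "\<lambda>N. 1 - 1 / (real N + 2)"
  have r: "0 < ?\<rho> N" "?\<rho> N < 1" for N by (auto simp: field_simps)
  have "(\<lambda>N. (h m n (?\<rho> N) (?\<rho> N) - cnj (h (- m) (- n) (?\<rho> N) (?\<rho> N))) / (2 * \<i>)) = (\<lambda>_. 0)"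
    using h_zero_left[OF r r assms(1), of n] h_zero_right[OF r r, of "- n" "- m"] assms by simp
  then show ?thesis using h_tendsto_e[of m n] LIMSEQ_unique[OF tendsto_const] by metis
qed

text \<open>For positive \<open>m\<close> and \<open>n\<close> only the conjugate term of the
  approximation survives. By scaling it is a fixed number, the mode on the torus of radius
  \<open>1/2\<close>, times a factor with nonzero limit; so the limit vanishes only if that number
  does.\<close>

lemma h_zero_if_e_zero:
  assumes m: "m > 0" and n: "n > 0" and e: "e (int m) (int n) = 0" and r: "0 < r" "r < 1" "0 < r'" "r' < 1"
  shows "h (- int m) (- int n) r r' = 0"
proof -
  define \<rho> where "\<rho> N = 1 - 1 / (real N + 2)" for N
  have p: "0 < \<rho> N" "\<rho> N < 1" for N by (auto simp: \<rho>_def field_simps)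
  have rl: "\<rho> \<longlonglongrightarrow> 1" unfolding \<rho>_def by real_asymp
  define c where "c = h (- int m) (- int n) (1/2) (1/2)"
  have sc: "h (- int m) (- int n) (\<rho> N) (\<rho> N) = of_real (\<rho> N / (1/2)) ^ m * of_real (\<rho> N / (1/2)) ^ n * c" for N
    unfolding c_def by (rule h_scale) (use p in auto)
  have "(\<lambda>N. (h (int m) (int n) (\<rho> N) (\<rho> N) - cnj (h (- int m) (- int n) (\<rho> N) (\<rho> N))) / (2 * \<i>)) \<longlonglongrightarrow> 0"
    using h_tendsto_e[of "int m" "int n"] e by (simp add: \<rho>_def)
  moreover have "h (int m) (int n) (\<rho> N) (\<rho> N) = 0" for N by (rule h_zero_left[OF p p]) (use m in auto)
  ultimately have l1: "(\<lambda>N. (0 - cnj (of_real (\<rho> N / (1/2)) ^ m * of_real (\<rho> N / (1/2)) ^ n * c)) / (2 * \<i>)) \<longlonglongrightarrow> 0"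
    by (simp only: sc)
  have l2: "(\<lambda>N. (0 - cnj (of_real (\<rho> N / (1/2)) ^ m * of_real (\<rho> N / (1/2)) ^ n * c)) / (2 * \<i>)) \<longlonglongrightarrow> (0 - cnj (of_real (1 / (1/2)) ^ m * of_real (1 / (1/2)) ^ n * c)) / (2 * \<i>)"
    by (intro tendsto_intros rl) auto
  have "c = 0" using LIMSEQ_unique[OF l1 l2] by simp
  then show ?thesis using h_scale[OF r, of "1/2" m n] by (simp add: c_def)
qed

end

section \<open>The lower bound\<close>

text \<open>Of the grid of index pairs only the main diagonal, with \<open>M\<close> entries, and
  the diagonal at offset \<open>m\<close>, with \<open>M - m\<close> entries, are kept. These counts
  are the Fejer weights.\<close>

lemma difference_sum_ge:
  fixes g :: "int \<Rightarrow> real"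
  assumes g: "\<And>x. 0 \<le> g x" and m: "m > 0" "m \<le> M"
  shows "real M * g 0 + (real M - real m) * g (int m) \<le> (\<Sum>j<M. \<Sum>l<M. g (int j - int l))"
proof -
  let ?A = "(\<lambda>j. (j, j)) ` {..<M}" and ?B = "(\<lambda>j. (j + m, j)) ` {..<M - m}"
  have i: "inj_on (\<lambda>j. (j, j)) {..<M}" "inj_on (\<lambda>j. (j + m, j)) {..<M - m}" by (auto simp: inj_on_def)
  have "real M * g 0 + (real M - real m) * g (int m) = (\<Sum>p\<in>?A. g (int (fst p) - int (snd p))) + (\<Sum>p\<in>?B. g (int (fst p) - int (snd p)))"
    using m(2) by (simp add: sum.reindex[OF i(1)] sum.reindex[OF i(2)] of_nat_diff)
  also have "\<dots> = (\<Sum>p\<in>?A \<union> ?B. g (int (fst p) - int (snd p)))"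
    by (rule sum.union_disjoint[symmetric]) (use m in auto)
  also have "\<dots> \<le> (\<Sum>p\<in>{..<M} \<times> {..<M}. g (int (fst p) - int (snd p)))"
    by (rule sum_mono2) (use m g in auto)
  also have "\<dots> = (\<Sum>j<M. \<Sum>l<M. g (int j - int l))" by (simp add: sum.cartesian_product split_def)
  finally show ?thesis .
qed

lemma difference_sum_ge':
  fixes g :: "int \<Rightarrow> real"
  assumes g: "\<And>x. 0 \<le> g x" and m: "m > 0" "m \<le> M"
  shows "real M * g 0 + (real M - real m) * g (- int m) \<le> (\<Sum>j<M. \<Sum>l<M. g (int j - int l))"
  using difference_sum_ge[of "\<lambda>x. g (- x)" m M, OF g m] by (subst sum.swap) simp

context riemann_curve
begin

text \<open>By symmetry and reality of \<eta> the modes \<open>e n (- m)\<close> and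
  \<open>e m (- n)\<close> are conjugate, so the product is \<open>- m * n\<close> times a squared
  modulus. It could be negative only for \<open>m * n > 0\<close>, where \<open>e_zero\<close> makes
  it 0.\<close>

lemma U_mult_U:
  defines "T \<equiv> \<lambda>m n. Re (U m n * U n m)"
  shows "U m n * U n m = of_real (T m n)" "T m n \<ge> 0" "T 0 0 = 4 * pi ^ 4"
    and "m > 0 \<Longrightarrow> n > 0 \<Longrightarrow> T m (- n) = of_int m * of_int n * (cmod (e m n))\<^sup>2"
proof -
  have gen: "U m n * U n m = of_real (- of_int m * of_int n * (cmod (e m (- n)))\<^sup>2)" if "m \<noteq> 0" "n \<noteq> 0" for m n
  proof -
    have "e n (- m) = cnj (e m (- n))" using e_sym[of n "- m"] e_cnj[of m "- n"] by simp
    then have "U m n * U n m = - of_int m * of_int n * (e m (- n) * cnj (e m (- n)))"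
      using that by (simp add: U_eq mult_ac)
    then show ?thesis by (simp only: complex_norm_square[symmetric] of_real_mult of_real_minus of_real_of_int_eq of_real_power)
  qed
  have z: "e m (- n) = 0" if "m * n > 0"
  proof (cases "m > 0")
    case True
    then show ?thesis using that e_zero[of m "- n"] by (simp add: zero_less_mult_iff)
  next
    case False
    then show ?thesis using that e_zero[of "- n" m] e_sym[of m "- n"] by (auto simp: zero_less_mult_iff)
  qed
  have ex: "\<exists>t\<ge>0. U m n * U n m = of_real t"
  proof (cases "m = 0 \<or> n = 0")
    case True
    then have "U m n * U n m = 0" if "\<not> (m = 0 \<and> n = 0)" using that by (auto simp: U_eq[of m n] U_eq[of n m])
    then consider "m = 0" "n = 0" | "U m n * U n m = 0" by blast
    then show ?thesis
    proof cases
      case 1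
      then have "U m n * U n m = of_real ((2 * pi\<^sup>2) * (2 * pi\<^sup>2))" by (simp add: U_eq)
      moreover have "(2 * pi\<^sup>2) * (2 * pi\<^sup>2) \<ge> 0" by simp
      ultimately show ?thesis by blast
    next
      case 2
      then show ?thesis by (intro exI[of _ 0]) simp
    qed
  next
    case False
    have "- of_int m * of_int n * (cmod (e m (- n)))\<^sup>2 \<ge> (0::real)"
    proof (cases "m * n > 0")
      case False
      then have "real_of_int (m * n) \<le> 0" by (simp only: of_int_le_0_iff not_less)
      then have "0 \<le> - real_of_int (m * n) * (cmod (e m (- n)))\<^sup>2" by (intro mult_nonneg_nonneg) auto
      then show ?thesis by simp
    qed (simp add: z)
    then show ?thesis using gen[of m n] False by blast
  qed
  then obtain t where t: "t \<ge> 0" "U m n * U n m = of_real t" by blast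
  show "U m n * U n m = of_real (T m n)" unfolding T_def t(2) by simp
  show "T m n \<ge> 0" unfolding T_def t(2) using t(1) by simp
  show "T 0 0 = 4 * pi ^ 4" unfolding T_def by (simp add: U_eq power2_eq_square power4_eq_xxxx flip: of_real_mult)
  show "T m (- n) = of_int m * of_int n * (cmod (e m n))\<^sup>2" if "m > 0" "n > 0"
    unfolding T_def gen[of m "- n", simplified] using gen[of m "- n"] that by simp
qed

text \<open>Fejer means of the kernel in its second variable; \<open>Q\<close> below is the energy of these means.\<close>

definition S :: "nat \<Rightarrow> real \<Rightarrow> real \<Rightarrow> complex"
  where "S N s x = (LINT y|\<J>. of_real (fejer (Suc N) (x - y)) * of_real (\<kappa> s y))"

definition c\<kappa> :: "int \<Rightarrow> real \<Rightarrow> complex"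
  where "c\<kappa> n s = fourier (\<lambda>b. of_real (\<kappa> s b)) n"

lemma ckappa_borel: "c\<kappa> n \<in> borel_measurable borel" and ckappa_bounded: "\<exists>B. \<forall>n s. norm (c\<kappa> n s) \<le> B"
proof -
  obtain C where C: "C > 0" "\<And>s b. \<bar>\<kappa> s b\<bar> \<le> C" using kappa_bounded by blast
  have m: "(\<lambda>p. cis (of_int (- n) * snd p) * of_real (\<kappa> (fst p) (snd p))) \<in> borel_measurable borel" for n
    by (intro borel_measurable_times measurable_compose[OF kappa_borel borel_measurable_of_real] borel_measurable_continuous_onI cont_cis continuous_intros)
  have B: "norm (cis (of_int (- n) * b) * complex_of_real (\<kappa> s b)) \<le> C" for n :: int and s b using C by (simp add: norm_mult)
  show "c\<kappa> n \<in> borel_measurable borel" unfolding c\<kappa>_def fourier_def by (rule LINT_Icc_swap(2)[OF m B])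
  have "norm (c\<kappa> n s) \<le> C * max 0 (2 * pi - 0)" for n s unfolding c\<kappa>_def fourier_def by (rule LINT_Icc_swap(3)[OF m B])
  then show "\<exists>B. \<forall>n s. norm (c\<kappa> n s) \<le> B" by blast
qed

lemma S_eq: "S N s x = (\<Sum>p\<in>{..<Suc N} \<times> {..<Suc N}. cis (of_int (int (fst p) - int (snd p)) * x) * c\<kappa> (int (fst p) - int (snd p)) s) / of_nat (Suc N)"
proof -
  obtain C where C: "C > 0" "\<And>s b. \<bar>\<kappa> s b\<bar> \<le> C" using kappa_bounded by blast
  have "norm (complex_of_real (\<kappa> s b)) \<le> C" for b using C by simp
  from fejer_mean_eq[OF measurable_compose[OF kappa_borel2 borel_measurable_of_real] this, of "Suc N" x]
  show ?thesis unfolding S_def c\<kappa>_def by (simp only: sum.cartesian_product split_def)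
qed

lemma S_bounded: obtains B where "\<And>N s x. norm (S N s x) \<le> B"
proof -
  obtain C where C: "C > 0" "\<And>s b. \<bar>\<kappa> s b\<bar> \<le> C" using kappa_bounded by blast
  have n: "norm (complex_of_real (\<kappa> s b)) \<le> C" for s b using C by simp
  have "norm (S N s x) \<le> 2 * pi * C" for N s x unfolding S_def
    by (rule fejer_mean_bound[OF measurable_compose[OF kappa_borel2 borel_measurable_of_real] n]) simp
  then show thesis by (rule that)
qed

lemma S_borel: "(\<lambda>p. S N (fst p) (\<theta> (snd p))) \<in> borel_measurable borel"
proof -
  have f1: "fst \<in> borel_measurable (borel :: (real \<times> real) measure)" "snd \<in> borel_measurable (borel :: (real \<times> real) measure)"
    by (intro borel_measurable_continuous_onI continuous_intros)+
  show ?thesis unfolding S_eq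
    by (intro borel_measurable_divide borel_measurable_const borel_measurable_sum borel_measurable_times
      measurable_compose[OF f1(1) ckappa_borel] measurable_compose[OF f1(2) cis_theta_borel])
qed

lemma S_tendsto:
  assumes "\<gamma> s \<noteq> \<gamma> t"
  shows "(\<lambda>N. S N s (\<theta> t)) \<longlonglongrightarrow> of_real (2 * pi * k s t)"
proof -
  obtain C where C: "C > 0" "\<And>s b. \<bar>\<kappa> s b\<bar> \<le> C" using kappa_bounded by blast
  have n: "norm (complex_of_real (\<kappa> s b)) \<le> C" for b using C by simp
  have "(\<lambda>N. S N s (\<theta> t)) \<longlonglongrightarrow> of_real (2 * pi) * of_real (\<kappa> s (\<theta> t))" unfolding S_def
  proof (rule fejer_tendsto[OF measurable_compose[OF kappa_borel2 borel_measurable_of_real] n])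
    fix \<epsilon> :: real assume e: "\<epsilon> > 0"
    have "continuous (at (cis (\<theta> t)) within cball 0 1) (\<lambda>z. Im (\<gamma>' s / (\<gamma> s - F z)))"
    proof (intro continuous_Im continuous_at_within_divide continuous_diff continuous_const)
      show "continuous (at (cis (\<theta> t)) within cball 0 1) F" using F_cont by (simp add: continuous_on_eq_continuous_within)
      show "\<gamma> s - F (cis (\<theta> t)) \<noteq> 0" using assms by (simp add: F_theta)
    qed
    then obtain d where d: "d > 0" "\<And>z. z \<in> cball 0 1 \<Longrightarrow> dist z (cis (\<theta> t)) < d \<Longrightarrow> dist (Im (\<gamma>' s / (\<gamma> s - F z))) (Im (\<gamma>' s / (\<gamma> s - F (cis (\<theta> t))))) < \<epsilon>"
      using e unfolding continuous_within_eps_delta by blast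
    show "\<exists>d>0. \<forall>y. cmod (cis y - cis (\<theta> t)) < d \<longrightarrow> norm (complex_of_real (\<kappa> s y) - of_real (\<kappa> s (\<theta> t))) \<le> \<epsilon>"
    proof (intro exI[of _ d] conjI allI impI d(1))
      fix y assume "cmod (cis y - cis (\<theta> t)) < d"
      then have "\<bar>\<kappa> s y - \<kappa> s (\<theta> t)\<bar> < \<epsilon>" using d(2)[of "cis y"] by (simp add: dist_norm \<kappa>_def)
      then show "norm (complex_of_real (\<kappa> s y) - of_real (\<kappa> s (\<theta> t))) \<le> \<epsilon>"
        by (simp only: of_real_diff[symmetric] norm_of_real less_imp_le)
    qed
  qed
  then show ?thesis by (simp add: kappa_theta)
qed

definition Q :: "nat \<Rightarrow> complex"
  where "Q N = (LINT s|\<I>. LINT t|\<I>. S N s (\<theta> t) * S N t (\<theta> s))"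

lemma countable_curve_eq: "countable {t. \<gamma> s = \<gamma> t}"
proof -
  have "{t. \<gamma> s = \<gamma> t} \<subseteq> range (\<lambda>n::int. s - of_int n)"
  proof
    fix t assume "t \<in> {t. \<gamma> s = \<gamma> t}"
    then have "s - t \<in> \<int>" by (simp add: eq_iff)
    then obtain n where "s - t = of_int n" by (elim Ints_cases)
    then have "t = s - of_int n" by simp
    then show "t \<in> range (\<lambda>n::int. s - of_int n)" by blast
  qed
  then show ?thesis by (rule countable_subset) auto
qed

text \<open>The means converge off the diagonal and are bounded uniformly, so dominated convergence
  applies in both variables. Each of the two means carries the mass \<open>2 * pi\<close> of the
  kernel.\<close>

lemma Q_tendsto: "Q \<longlonglongrightarrow> of_real (4 * pi\<^sup>2 * energy)"
proof -
  obtain B where B: "\<And>N s x. norm (S N s x) \<le> B" using S_bounded by blast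
  have B0: "0 \<le> B" using order_trans[OF norm_ge_zero B] .
  obtain C where C: "C > 0" "\<And>s t. \<bar>k s t\<bar> \<le> C" using k_bounded by blast
  have swp: "(\<lambda>p. (snd p, fst p)) \<in> measurable (borel :: (real \<times> real) measure) (borel :: (real \<times> real) measure)"
    by (intro borel_measurable_continuous_onI continuous_intros)
  have fm: "(\<lambda>p. S N (fst p) (\<theta> (snd p)) * S N (snd p) (\<theta> (fst p))) \<in> borel_measurable borel" for N
    using S_borel measurable_compose[OF swp S_borel] by (intro borel_measurable_times) simp_all
  have fB: "norm (S N s (\<theta> t) * S N t (\<theta> s)) \<le> B * B" for N s t
    unfolding norm_mult by (intro mult_mono B B0 norm_ge_zero)
  define g where "g s t = of_real (2 * pi * k s t) * complex_of_real (2 * pi * k t s)" for s t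
  have geq: "g s t = of_real (4 * pi\<^sup>2 * (k s t * k t s))" for s t by (simp add: g_def power2_eq_square mult_ac)
  have gm: "(\<lambda>p. g (fst p) (snd p)) \<in> borel_measurable borel"
    unfolding geq by (rule measurable_compose[OF borel_measurable_times[OF borel_measurable_const energy_borel[unfolded split_def]] borel_measurable_of_real])
  have gB: "norm (g s t) \<le> 4 * pi\<^sup>2 * (C * C)" for s t
  proof -
    have "\<bar>k s t\<bar> * \<bar>k t s\<bar> \<le> C * C" by (intro mult_mono C(2)) (use C(1) in auto)
    then show ?thesis by (simp add: geq abs_mult del: of_real_mult of_real_power)
  qed
  have p1: "(\<lambda>t. (s, t)) \<in> measurable borel (borel :: (real \<times> real) measure)" for s :: real by (intro borel_measurable_Pair) auto
  have fm1: "(\<lambda>t. S N s (\<theta> t) * S N t (\<theta> s)) \<in> borel_measurable borel" for N s using measurable_compose[OF p1 fm] by simp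
  have gm1: "g s \<in> borel_measurable borel" for s using measurable_compose[OF p1 gm] by simp
  have inner: "(\<lambda>N. LINT t|\<I>. S N s (\<theta> t) * S N t (\<theta> s)) \<longlonglongrightarrow> (LINT t|\<I>. g s t)" for s
  proof (rule LINT_Icc_dominated[OF fm1 gm1 fB countable_curve_eq[of s]])
    fix t assume "t \<notin> {t. \<gamma> s = \<gamma> t}"
    then have "\<gamma> s \<noteq> \<gamma> t" "\<gamma> t \<noteq> \<gamma> s" by auto
    then show "(\<lambda>N. S N s (\<theta> t) * S N t (\<theta> s)) \<longlonglongrightarrow> g s t" unfolding g_def by (intro tendsto_mult S_tendsto)
  qed
  have "Q \<longlonglongrightarrow> (LINT s|\<I>. LINT t|\<I>. g s t)" unfolding Q_def
  proof (rule LINT_Icc_dominated[where Z = "{}" and B = "B * B * max 0 (1 - 0)"])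
    show "(\<lambda>s. LINT t|\<I>. S N s (\<theta> t) * S N t (\<theta> s)) \<in> borel_measurable borel" for N by (rule LINT_Icc_swap(2)[OF fm fB])
    show "(\<lambda>s. LINT t|\<I>. g s t) \<in> borel_measurable borel" by (rule LINT_Icc_swap(2)[OF gm gB])
    show "norm (LINT t|\<I>. S N s (\<theta> t) * S N t (\<theta> s)) \<le> B * B * max 0 (1 - 0)" for N s by (rule LINT_Icc_swap(3)[OF fm fB])
  qed (use inner in auto)
  moreover have "(LINT s|\<I>. LINT t|\<I>. g s t) = of_real (4 * pi\<^sup>2 * energy)"
    unfolding geq energy_def by (simp only: integral_complex_of_real integral_mult_right_zero)
  ultimately show ?thesis by (simp only:)
qed

text \<open>Each mean is a finite sum of products of an exponential in one parameter and a
  coefficient in the other. Integrating over \<open>t\<close> pairs the exponential of one mean with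
  the coefficient of the other, which produces \<open>U\<close>; likewise over
  \<open>s\<close>.\<close>

lemma Q_eq: "Q N = (\<Sum>p\<in>{..<Suc N} \<times> {..<Suc N}. \<Sum>q\<in>{..<Suc N} \<times> {..<Suc N}.
    U (int (fst p) - int (snd p)) (int (fst q) - int (snd q)) * U (int (fst q) - int (snd q)) (int (fst p) - int (snd p))) / (of_nat (Suc N))\<^sup>2"
proof -
  define P where "P = {..<Suc N} \<times> {..<Suc N}"
  define \<delta> where "\<delta> p = int (fst p) - int (snd p)" for p :: "nat \<times> nat"
  define c where "c m t = cis (of_int m * \<theta> t)" for m :: int and t
  obtain B where B: "\<And>n s. norm (c\<kappa> n s) \<le> B" using ckappa_bounded by blast
  have int: "integrable \<I> (\<lambda>t. c m t * c\<kappa> n t)" for m n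
    by (rule integrable_Icc[where B = B])
       (use B in \<open>auto simp: c_def norm_mult intro!: borel_measurable_times ckappa_borel cis_theta_borel\<close>)
  have U: "U m n = (LINT t|\<I>. c m t * c\<kappa> n t)" for m n by (simp add: U_def c_def c\<kappa>_def)
  have S: "S N s (\<theta> t) = (\<Sum>p\<in>P. c (\<delta> p) t * c\<kappa> (\<delta> p) s) / of_nat (Suc N)" for s t
    unfolding S_eq P_def \<delta>_def c_def ..
  have SS: "S N s (\<theta> t) * S N t (\<theta> s) = (\<Sum>p\<in>P. \<Sum>q\<in>P. (c (\<delta> q) s * c\<kappa> (\<delta> p) s / (of_nat (Suc N))\<^sup>2) * (c (\<delta> p) t * c\<kappa> (\<delta> q) t))" for s t
  proof -
    have "S N s (\<theta> t) * S N t (\<theta> s) = (\<Sum>p\<in>P. \<Sum>q\<in>P. (c (\<delta> p) t * c\<kappa> (\<delta> p) s) * (c (\<delta> q) s * c\<kappa> (\<delta> q) t)) / (of_nat (Suc N))\<^sup>2"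
      unfolding S times_divide_times_eq sum_product power2_eq_square ..
    then show ?thesis by (simp only: sum_divide_distrib) (intro sum.cong refl, simp add: mult_ac)
  qed
  have "(LINT t|\<I>. S N s (\<theta> t) * S N t (\<theta> s)) = (\<Sum>p\<in>P. \<Sum>q\<in>P. (U (\<delta> p) (\<delta> q) / (of_nat (Suc N))\<^sup>2) * (c (\<delta> q) s * c\<kappa> (\<delta> p) s))" for s
  proof -
    have "(LINT t|\<I>. S N s (\<theta> t) * S N t (\<theta> s)) = (\<Sum>p\<in>P. \<Sum>q\<in>P. (c (\<delta> q) s * c\<kappa> (\<delta> p) s / (of_nat (Suc N))\<^sup>2) * U (\<delta> p) (\<delta> q))"
      unfolding SS U
      by (subst Bochner_Integration.integral_sum, (intro Bochner_Integration.integrable_sum integrable_mult_right int)[1],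
        subst Bochner_Integration.integral_sum, (intro integrable_mult_right int)[1]) (simp only: integral_mult_right_zero)
    then show ?thesis by (simp add: mult_ac)
  qed
  then have "Q N = (LINT s|\<I>. (\<Sum>p\<in>P. \<Sum>q\<in>P. (U (\<delta> p) (\<delta> q) / (of_nat (Suc N))\<^sup>2) * (c (\<delta> q) s * c\<kappa> (\<delta> p) s)))"
    unfolding Q_def by (simp only:)
  also have "\<dots> = (\<Sum>p\<in>P. \<Sum>q\<in>P. (U (\<delta> p) (\<delta> q) / (of_nat (Suc N))\<^sup>2) * U (\<delta> q) (\<delta> p))"
    unfolding U[of "\<delta> _" "\<delta> _"]
    by (subst Bochner_Integration.integral_sum, (intro Bochner_Integration.integrable_sum integrable_mult_right int)[1],
      subst Bochner_Integration.integral_sum, (intro integrable_mult_right int)[1]) (simp only: integral_mult_right_zero)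
  finally show ?thesis unfolding P_def \<delta>_def by (simp add: sum_divide_distrib)
qed

text \<open>All terms of the finite double sum are nonnegative. Only the mode at the origin and the
  mode \<open>(m, - n)\<close> are kept, and the Fejer weight of the latter tends to 1.\<close>

lemma energy_lower_bound:
  fixes m n :: nat
  assumes "m > 0" "n > 0"
  shows "4 * pi ^ 4 + real m * real n * (cmod (e (int m) (int n)))\<^sup>2 \<le> 4 * pi\<^sup>2 * energy"
proof -
  define T where "T m n = Re (U m n * U n m)" for m n
  note T = U_mult_U[folded T_def]
  let ?t = "real m * real n * (cmod (e (int m) (int n)))\<^sup>2"
  define f where "f N = 4 * pi ^ 4 + (1 - real n / real (Suc N)) * (1 - real m / real (Suc N)) * ?t" for N
  have fl: "f \<longlonglongrightarrow> 4 * pi ^ 4 + (1 - 0) * (1 - 0) * ?t"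
    unfolding f_def by (intro tendsto_add tendsto_mult tendsto_diff tendsto_const LIMSEQ_Suc[OF lim_const_over_n])
  have ge: "f N \<le> Re (Q N)" if N: "m + n \<le> N" for N
  proof -
    define M where "M = Suc N"
    have mM: "m \<le> M" "n \<le> M" "M > 0" using N by (auto simp: M_def)
    have "(\<Sum>j<M. \<Sum>l<M. \<Sum>j'<M. \<Sum>l'<M. T (int j - int l) (int j' - int l'))
       \<ge> (\<Sum>j<M. \<Sum>l<M. real M * T (int j - int l) 0 + (real M - real n) * T (int j - int l) (- int n))"
      by (intro sum_mono difference_sum_ge' T(2) assms mM)
    moreover have "(\<Sum>j<M. \<Sum>l<M. real M * T (int j - int l) 0 + (real M - real n) * T (int j - int l) (- int n))
       = real M * (\<Sum>j<M. \<Sum>l<M. T (int j - int l) 0) + (real M - real n) * (\<Sum>j<M. \<Sum>l<M. T (int j - int l) (- int n))"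
      by (simp only: sum.distrib sum_distrib_left)
    moreover have "real M * (\<Sum>j<M. \<Sum>l<M. T (int j - int l) 0) \<ge> real M * (real M * T 0 0)"
    proof (rule mult_left_mono)
      have "real M * T 0 0 + (real M - real m) * T (int m) 0 \<le> (\<Sum>j<M. \<Sum>l<M. T (int j - int l) 0)"
        by (intro difference_sum_ge T(2) assms mM)
      moreover have "0 \<le> (real M - real m) * T (int m) 0" using mM by (intro mult_nonneg_nonneg T(2)) auto
      ultimately show "real M * T 0 0 \<le> (\<Sum>j<M. \<Sum>l<M. T (int j - int l) 0)" by linarith
    qed simp
    moreover have "(real M - real n) * (\<Sum>j<M. \<Sum>l<M. T (int j - int l) (- int n)) \<ge> (real M - real n) * ((real M - real m) * T (int m) (- int n))"
    proof (rule mult_left_mono)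
      have "real M * T 0 (- int n) + (real M - real m) * T (int m) (- int n) \<le> (\<Sum>j<M. \<Sum>l<M. T (int j - int l) (- int n))"
        by (intro difference_sum_ge T(2) assms mM)
      moreover have "0 \<le> real M * T 0 (- int n)" by (intro mult_nonneg_nonneg T(2)) auto
      ultimately show "(real M - real m) * T (int m) (- int n) \<le> (\<Sum>j<M. \<Sum>l<M. T (int j - int l) (- int n))" by linarith
    qed (use mM in simp)
    ultimately have big: "real M * (real M * T 0 0) + (real M - real n) * ((real M - real m) * T (int m) (- int n))
       \<le> (\<Sum>j<M. \<Sum>l<M. \<Sum>j'<M. \<Sum>l'<M. T (int j - int l) (int j' - int l'))" by linarith
    have Teq: "T (int m) (- int n) = ?t" using T(4)[of "int m" "int n"] assms by simp
    have "Re (Q N) = (\<Sum>j<M. \<Sum>l<M. \<Sum>j'<M. \<Sum>l'<M. T (int j - int l) (int j' - int l')) / (real M)\<^sup>2"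
    proof -
      have "Q N = of_real ((\<Sum>p\<in>{..<M} \<times> {..<M}. \<Sum>q\<in>{..<M} \<times> {..<M}. T (int (fst p) - int (snd p)) (int (fst q) - int (snd q))) / (real M)\<^sup>2)"
        unfolding Q_eq T(1) M_def by simp
      then have "Re (Q N) = (\<Sum>p\<in>{..<M} \<times> {..<M}. \<Sum>q\<in>{..<M} \<times> {..<M}. T (int (fst p) - int (snd p)) (int (fst q) - int (snd q))) / (real M)\<^sup>2"
        by (simp only: Re_complex_of_real)
      then show ?thesis by (simp only: sum.cartesian_product' fst_conv snd_conv)
    qed
    moreover have "f N = (real M * (real M * T 0 0) + (real M - real n) * ((real M - real m) * T (int m) (- int n))) / (real M)\<^sup>2"
      unfolding f_def M_def[symmetric] Teq T(3) using mM(3) by (simp add: field_simps power2_eq_square)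
    ultimately show ?thesis using big by (simp add: divide_right_mono)
  qed
  have "(\<lambda>N. Re (Q N)) \<longlonglongrightarrow> 4 * pi\<^sup>2 * energy" using tendsto_Re[OF Q_tendsto] by simp
  from LIMSEQ_le[OF fl this] ge show ?thesis by auto
qed

end

section \<open>The extremal domains\<close>

text \<open>A compact convex set is the hull of its frontier, so it lies in the ball. The open ball
  is connected, meets the set and contains no frontier point, so it lies in the set.\<close>

lemma frontier_sphere_imp_cball:
  fixes S :: "'a::euclidean_space set"
  assumes S: "compact S" "convex S" "interior S \<noteq> {}" and f: "frontier S \<subseteq> sphere c r"
  shows "S = cball c r" "r > 0"
proof -
  have "S = convex hull (frontier S)" by (rule Krein_Milman_frontier[OF S(2,1)])
  also have "\<dots> \<subseteq> cball c r" by (rule hull_minimal) (use f in auto)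
  finally have sub: "S \<subseteq> cball c r" .
  then have int: "interior S \<subseteq> ball c r" using interior_mono interior_cball by metis
  then have "ball c r \<noteq> {}" using S(3) by blast
  then show "r > 0" by (simp only: ball_eq_empty not_le)
  have "ball c r \<inter> frontier S = {}" using f by auto
  then have "ball c r \<subseteq> S"
    using connected_Int_frontier[OF connected_ball, of c r S] int S(3) interior_subset[of S] by blast
  then have "closure (ball c r) \<subseteq> S" using compact_imp_closed[OF S(1)] by (rule closure_minimal)
  then show "S = cball c r" using sub \<open>r > 0\<close> by simp
qed

context riemann_curve
begin

lemma h_zero_if_extremal:
  assumes E: "energy = pi\<^sup>2" and r: "0 < r" "r < 1" "0 < r'" "r' < 1" and mn: "m \<noteq> 0" "n \<noteq> 0"
  shows "h m n r r' = 0"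
proof -
  consider "m > 0" | "n > 0" | "m < 0" "n < 0" using mn by linarith
  then show ?thesis
  proof cases
    case 3
    define m' n' where "m' = nat (- m)" and "n' = nat (- n)"
    have mn': "m' > 0" "n' > 0" "m = - int m'" "n = - int n'" using 3 by (auto simp: m'_def n'_def)
    have "4 * pi ^ 4 + real m' * real n' * (cmod (e (int m') (int n')))\<^sup>2 \<le> 4 * pi ^ 4"
      using energy_lower_bound[OF mn'(1,2)] E by (simp add: power2_eq_square power4_eq_xxxx)
    then have "real m' * real n' * (cmod (e (int m') (int n')))\<^sup>2 \<le> 0" by linarith
    then have "e (int m') (int n') = 0" using mn'(1,2) by (auto simp: mult_le_0_iff)
    then show ?thesis unfolding mn'(3,4) by (rule h_zero_if_e_zero[OF mn'(1,2) _ r])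
  qed (use h_zero_left[OF r] h_zero_right[OF r] in auto)
qed

lemma H_circle_mean:
  assumes r: "0 < r" "r < 1" and w: "w \<in> ball 0 1"
  shows "(LINT a|\<J>. H (of_real r * cis a, w)) = of_real (2 * pi) * H (0, w)"
    and "(LINT a|\<J>. H (w, of_real r * cis a)) = of_real (2 * pi) * H (w, 0)"
  using disc_circle_integrals(2)[OF H_hol1[OF w] r, of 0] disc_circle_integrals(2)[OF H_hol2[OF w] r, of 0] by simp_all

text \<open>Since the mixed modes vanish, each mode of nonzero index in the first variable is
  constant in the second. A difference of values in the second variable is therefore constant on the
  circle of the first, hence equal to its mean, which is the value at the centre. Averaging over the
  second variable finishes the argument.\<close>

lemma H_splits_aux:
  assumes E: "energy = pi\<^sup>2" and r: "0 < r" "r < 1" "0 < r'" "r' < 1"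
  shows "H (of_real r * cis x, of_real r' * cis y) = H (of_real r * cis x, 0) + H (0, of_real r' * cis y) - H (0, 0)"
proof -
  have ir: "of_real r * cis a \<in> ball 0 1" "of_real r' * cis a \<in> ball 0 1" for a by (rule in_disc[OF r(1,2)], rule in_disc[OF r(3,4)])
  have cont: "continuous_on UNIV (\<lambda>a. H (of_real r * cis a, of_real r' * cis b))" for b
    by (rule continuous_on_compose2[OF H_cont]) (use r in \<open>auto intro!: cont_cis continuous_intros ball_X simp: norm_mult\<close>)
  define g where "g m w = (LINT a|\<J>. cis (of_int m * a) * H (of_real r * cis a, of_real r' * w))" for m :: int and w
  have g_const: "g m (cis b) = g m (cis b')" if m: "m \<noteq> 0" for m b b'
  proof -
    have pc: "continuous_on (sphere 0 1 \<times> cbox 0 (2 * pi)) (\<lambda>(w, a). cis (of_int m * a) * H (of_real r * cis a, of_real r' * w))"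
      unfolding split_def
      by (intro continuous_on_mult cont_cis continuous_intros continuous_on_compose2[OF H_cont])
         (use r in \<open>auto intro!: ball_X simp: norm_mult\<close>)
    have c0: "continuous_on (sphere 0 1) (\<lambda>w. integral (cbox 0 (2 * pi)) (\<lambda>a. cis (of_int m * a) * H (of_real r * cis a, of_real r' * w)))"
      by (rule integral_continuous_on_param[OF pc])
    have g0: "g m w = integral (cbox 0 (2 * pi)) (\<lambda>a. cis (of_int m * a) * H (of_real r * cis a, of_real r' * w))" if "w \<in> sphere 0 1" for w
      unfolding g_def cbox_interval
      by (rule LINT_circle_interval)
         (intro continuous_on_mult cont_cis continuous_intros continuous_on_compose2[OF H_cont],
          use r that in \<open>auto intro!: ball_X simp: norm_mult\<close>)
    have gc: "continuous_on (sphere 0 1) (g m)" by (rule continuous_on_eq[OF c0 g0[symmetric]])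
    have "fourier (\<lambda>b. g m (cis b)) n = 0" if n: "n \<noteq> 0" for n
    proof -
      have "fourier (\<lambda>b. g m (cis b)) n = h m (- n) r r'" unfolding fourier_def g_def h_def ..
      also have "\<dots> = 0" using h_zero_if_extremal[OF E r m] n by simp
      finally show ?thesis .
    qed
    from fourier_zero_imp_constant[OF gc this, of b] fourier_zero_imp_constant[OF gc this, of b']
    have "of_real (2 * pi) * g m (cis b) = of_real (2 * pi) * g m (cis b')" by simp
    then show ?thesis by simp
  qed
  have D: "H (of_real r * cis x, of_real r' * cis b) - H (of_real r * cis x, of_real r' * cis b')
      = H (0, of_real r' * cis b) - H (0, of_real r' * cis b')" for b b'
  proof -
    let ?D = "\<lambda>z. H (of_real r * z, of_real r' * cis b) - H (of_real r * z, of_real r' * cis b')"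
    have Dc: "continuous_on (sphere 0 1) ?D"
      by (intro continuous_on_diff continuous_on_compose2[OF H_cont])
         (use r in \<open>auto intro!: continuous_intros ball_X simp: norm_mult\<close>)
    have int: "integrable \<J> (\<lambda>a. cis (of_int m * a) * H (of_real r * cis a, of_real r' * cis b))" for b and m :: int
      by (intro integrable_circle_interval_cont continuous_on_mult cont_cis continuous_intros cont)
    have int0: "integrable \<J> (\<lambda>a. H (of_real r * cis a, of_real r' * cis b))" for b
      by (intro integrable_circle_interval_cont cont)
    have zn: "fourier (\<lambda>a. ?D (cis a)) n = 0" if n: "n \<noteq> 0" for n
    proof -
      have "fourier (\<lambda>a. ?D (cis a)) n = g (- n) (cis b) - g (- n) (cis b')"
        unfolding fourier_def g_def by (simp only: right_diff_distrib Bochner_Integration.integral_diff[OF int int])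
      then show ?thesis using g_const[of "- n" b b'] n by simp
    qed
    have "of_real (2 * pi) * ?D (cis x) = (LINT y|\<J>. ?D (cis y))" by (rule fourier_zero_imp_constant[OF Dc zn])
    then have "of_real (2 * pi) * ?D (cis x) = of_real (2 * pi) * (H (0, of_real r' * cis b) - H (0, of_real r' * cis b'))"
      by (simp only: Bochner_Integration.integral_diff[OF int0 int0] H_circle_mean(1)[OF r(1,2) ir(2)] right_diff_distrib)
    then show ?thesis by simp
  qed
  have cont2: "continuous_on UNIV (\<lambda>b. H (z, of_real r' * cis b))" if "z \<in> ball 0 1" for z
    by (rule continuous_on_compose2[OF H_cont]) (use r that in \<open>auto intro!: cont_cis continuous_intros ball_X simp: norm_mult\<close>)
  have int2: "integrable \<J> (\<lambda>b. H (z, of_real r' * cis b))" if "z \<in> ball 0 1" for z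
    by (intro integrable_circle_interval_cont cont2 that)
  define v where "v = H (of_real r * cis x, of_real r' * cis y) - H (0, of_real r' * cis y)"
  have "v = H (of_real r * cis x, of_real r' * cis b) - H (0, of_real r' * cis b)" for b
    using D[of y b] by (simp add: v_def algebra_simps)
  then have "(LINT b|\<J>. v) = (LINT b|\<J>. H (of_real r * cis x, of_real r' * cis b) - H (0, of_real r' * cis b))"
    by (intro Bochner_Integration.integral_cong) auto
  also have "\<dots> = of_real (2 * pi) * (H (of_real r * cis x, 0) - H (0, 0))"
    by (subst Bochner_Integration.integral_diff[OF int2 int2])
       (use ir H_circle_mean(2)[OF r(3,4) ir(1)] H_circle_mean(2)[OF r(3,4), of 0] in \<open>auto simp: right_diff_distrib\<close>)
  finally have "v = H (of_real r * cis x, 0) - H (0, 0)" by (simp add: circle_interval_measure scaleR_conv_of_real)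
  then show ?thesis by (simp add: v_def algebra_simps)
qed

lemma H_splits:
  assumes E: "energy = pi\<^sup>2" and z: "z \<in> ball 0 1" "z \<noteq> 0" and w: "w \<in> ball 0 1" "w \<noteq> 0"
  shows "H (z, w) = H (z, 0) + H (0, w) - H (0, 0)"
  using H_splits_aux[OF E, of "cmod z" "cmod w" "Arg z" "Arg w"] z w rcis_cmod_Arg[of z] rcis_cmod_Arg[of w]
  by (simp add: rcis_def)

text \<open>Exponentiating the splitting gives
  \<open>R (z, w) * R (0, 0) = R (z, 0) * R (0, w)\<close>. In terms of \<open>F\<close> this says
  that \<open>g / (F z - F 0) - 1 / z\<close> does not depend on \<open>z\<close>; the constant
  \<open>K\<close> is its value at \<open>1/2\<close>.\<close>

lemma extremal_Moebius:
  assumes E: "energy = pi\<^sup>2"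
  obtains g K where "g \<noteq> 0" "\<And>z. z \<in> cball 0 1 \<Longrightarrow> (F z - F 0) * (1 + K * z) = g * z"
proof -
  define g where "g = R (0, 0)"
  define q where "q = F (1/2) - F 0"
  define K where "K = g / q - 2"
  have g0: "g \<noteq> 0" unfolding g_def by (rule R_nonzero[OF ball_X(1)]) auto
  have q0: "q \<noteq> 0" using F_inj[of "1/2" 0] by (auto simp: q_def)
  have key: "(F z - F 0 - (F w - F 0)) * g * z * w = (F z - F 0) * (F w - F 0) * (z - w)"
    if z: "z \<in> ball 0 1" "z \<noteq> 0" and w: "w \<in> ball 0 1" "w \<noteq> 0" for z w
  proof -
    have X: "(z, w) \<in> X" "(z, 0) \<in> X" "(0, w) \<in> X" "(0, 0) \<in> X" using z w by (auto intro!: ball_X)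
    have "exp (H (z, w) + H (0, 0)) = exp (H (z, 0) + H (0, w))" using H_splits[OF E z w] by simp
    then have "R (z, w) * g = R (z, 0) * R (0, w)" unfolding exp_add g_def using X by (simp add: H_exp)
    moreover have "F z - F 0 - (F w - F 0) = R (z, w) * (z - w)" using F_diff[of z w] by simp
    moreover have "F z - F 0 = R (z, 0) * z" using F_diff[of z 0] by simp
    moreover have "F w - F 0 = R (0, w) * w" using F_diff[of 0 w] by (simp add: algebra_simps)
    ultimately show ?thesis by algebra
  qed
  have main: "(F z - F 0) * (1 + K * z) = g * z" if z: "z \<in> ball 0 1" for z
  proof (cases "z = 0")
    case False
    have "(F z - F 0 - q) * g * z * (1/2) = (F z - F 0) * q * (z - 1/2)"
      using key[OF z False, of "1/2"] by (simp add: q_def)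
    moreover have "K * q = g - 2 * q" using q0 by (simp add: K_def field_simps)
    ultimately have "((F z - F 0) * (1 + K * z)) * q = (g * z) * q" by algebra
    then show ?thesis using q0 by simp
  qed simp
  have "(F z - F 0) * (1 + K * z) - g * z = 0" if z: "z \<in> cball 0 1" for z
  proof (rule continuous_constant_on_closure[where S = "ball 0 1" and f = "\<lambda>z. (F z - F 0) * (1 + K * z) - g * z" and x = z])
    show "continuous_on (closure (ball 0 1)) (\<lambda>z. (F z - F 0) * (1 + K * z) - g * z)"
      using F_cont by (auto intro!: continuous_intros)
  qed (use main z in auto)
  then show thesis using that[OF g0, of K] by simp
qed

text \<open>The denominator \<open>1 + K * z\<close> has no zero in the closed disc, because there
  the right-hand side \<open>g * z\<close> would vanish as well. Hence \<open>cmod K < 1\<close>,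
  and the unit circle is mapped into a genuine circle.\<close>

lemma extremal_disc:
  assumes E: "energy = pi\<^sup>2"
  obtains c r where "r > 0" "\<Omega> = cball c r"
proof -
  obtain g K where g: "g \<noteq> 0" and M: "\<And>z. z \<in> cball 0 1 \<Longrightarrow> (F z - F 0) * (1 + K * z) = g * z" using extremal_Moebius[OF E] by blast
  have nz: "1 + K * z \<noteq> 0" if "z \<in> cball 0 1" for z
  proof
    assume 0: "1 + K * z = 0"
    then have "z \<noteq> 0" by auto
    then show False using M[OF that] g 0 by simp
  qed
  have K1: "cmod K < 1"
  proof (rule ccontr)
    assume "\<not> cmod K < 1"
    then have "K \<noteq> 0" "- 1 / K \<in> cball 0 1" by (auto simp: norm_divide divide_le_eq)
    then show False using nz[of "- 1 / K"] by simp
  qed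
  define D where "D = 1 - (cmod K)\<^sup>2"
  have D: "D > 0" using K1 by (simp add: D_def power_less_one_iff)
  \<comment> \<open>With this centre, \<open>x - c\<close> on the unit circle equals
    \<open>g * z * cnj (1 + K * z) / (D * (1 + K * z))\<close>, whose modulus is the constant
    \<open>r\<close>.\<close>
  define c where "c = F 0 - g * cnj K / of_real D"
  define r where "r = cmod g / D"
  have "frontier \<Omega> \<subseteq> sphere c r"
  proof
    fix x assume x: "x \<in> frontier \<Omega>"
    define z where "z = G x"
    have z1: "cmod z = 1" unfolding z_def using G_fr[OF x] by simp
    have Fz: "F z = x" unfolding z_def using FG[of x] x frontier_subset_compact[OF compact] by auto
    have n: "1 + K * z \<noteq> 0" using z1 by (intro nz) simp
    have DK: "of_real D = 1 - K * cnj K" by (simp add: D_def complex_norm_square[symmetric])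
    have D0: "complex_of_real D \<noteq> 0" using D by simp
    have "F z - F 0 = g * z / (1 + K * z)" using M[of z] z1 n by (simp add: field_simps)
    then have "x - c = g * z / (1 + K * z) + g * cnj K / of_real D" by (simp add: c_def Fz[symmetric])
    also have "\<dots> = g * (z * of_real D + cnj K * (1 + K * z)) / (of_real D * (1 + K * z))"
      using n D0 by (simp add: field_simps)
    also have "z * of_real D + cnj K * (1 + K * z) = z + cnj K" unfolding DK by (simp add: algebra_simps)
    also have "z + cnj K = z * cnj (1 + K * z)"
    proof -
      have "z * cnj z = 1" using z1 complex_norm_square[of z] by simp
      then have "cnj K = cnj K * (z * cnj z)" by simp
      then show ?thesis by (simp add: algebra_simps)
    qed
    finally have "cmod (x - c) = cmod g * (1 * cmod (1 + K * z)) / (D * cmod (1 + K * z))"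
      using z1 D by (simp only: norm_mult norm_divide complex_mod_cnj norm_of_real abs_of_pos)
    then have "cmod (x - c) = r" using n by (simp add: r_def)
    then show "x \<in> sphere c r" by (simp add: dist_norm norm_minus_commute)
  qed
  from frontier_sphere_imp_cball[OF compact convex interior this] that show thesis by blast
qed

end

lemma (in convex_curve) energy_ge_and_extremal:
  shows "pi\<^sup>2 \<le> energy" and "energy = pi\<^sup>2 \<Longrightarrow> \<exists>c r. r > 0 \<and> \<Omega> = cball c r"
proof -
  obtain F G where FG: "F holomorphic_on ball 0 1" "continuous_on (cball 0 1) F" "continuous_on \<Omega> G"
    "\<And>z. z \<in> ball 0 1 \<Longrightarrow> F z \<in> interior \<Omega>" "\<And>z. z \<in> sphere 0 1 \<Longrightarrow> F z \<in> frontier \<Omega>"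
    "\<And>z. z \<in> cball 0 1 \<Longrightarrow> G (F z) = z" "\<And>x. x \<in> \<Omega> \<Longrightarrow> G x \<in> cball 0 1 \<and> F (G x) = x"
    "\<And>x. x \<in> frontier \<Omega> \<Longrightarrow> G x \<in> sphere 0 1"
    by (rule riemann_map_extension) (rule that)
  interpret R: riemann_curve \<gamma> \<gamma>' \<gamma>'' \<Omega> F G by unfold_locales (fact FG)+
  have "4 * pi ^ 4 \<le> 4 * pi\<^sup>2 * energy"
    by (rule order_trans[OF _ R.energy_lower_bound[of 1 1]]) simp_all
  then have "(4 * pi\<^sup>2) * pi\<^sup>2 \<le> (4 * pi\<^sup>2) * energy" by (simp add: power2_eq_square power4_eq_xxxx)
  then show "pi\<^sup>2 \<le> energy" by (rule mult_left_le_imp_le) simp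
  show "\<exists>c r. r > 0 \<and> \<Omega> = cball c r" if "energy = pi\<^sup>2" using R.extremal_disc[OF that] by blast
qed

section \<open>Transfer to the real plane\<close>

lemma bij_to_complex: "bij to_complex"
  using inj_to_complex surj_to_complex by (simp add: bij_def)

lemma to_complex_image_facts:
  shows "compact \<Omega> \<Longrightarrow> compact (to_complex ` \<Omega>)" "convex \<Omega> \<Longrightarrow> convex (to_complex ` \<Omega>)"
    "interior (to_complex ` \<Omega>) = to_complex ` interior \<Omega>" "frontier (to_complex ` \<Omega>) = to_complex ` frontier \<Omega>"
proof -
  show "compact \<Omega> \<Longrightarrow> compact (to_complex ` \<Omega>)" 
    using linear_to_complex by (intro compact_continuous_image linear_continuous_on) (auto simp: linear_conv_bounded_linear)
  show "convex \<Omega> \<Longrightarrow> convex (to_complex ` \<Omega>)" using linear_to_complex by (rule convex_linear_image)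
  show i: "interior (to_complex ` \<Omega>) = to_complex ` interior \<Omega>"
    using linear_to_complex bij_to_complex by (rule interior_bijective_linear_image)
  have "closure (to_complex ` \<Omega>) = to_complex ` closure \<Omega>"
    using closure_injective_linear_image[OF linear_to_complex inj_to_complex] by simp
  then show "frontier (to_complex ` \<Omega>) = to_complex ` frontier \<Omega>"
    unfolding frontier_def i using inj_to_complex by (simp add: image_set_diff)
qed

lemma convex_curve_exists:
  fixes \<Omega> :: "(real^2) set"
  assumes "compact \<Omega>" "convex \<Omega>" "interior \<Omega> \<noteq> {}" "C2_simple_closed_curve (frontier \<Omega>)"
  obtains \<gamma> \<gamma>' \<gamma>'' where "convex_curve \<gamma> \<gamma>' \<gamma>'' (to_complex ` \<Omega>)"
proof -
  obtain c c' c'' :: "real \<Rightarrow> real^2" where c: "\<And>t. (c has_vector_derivative c' t) (at t)" "\<And>t. (c' has_vector_derivative c'' t) (at t)"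
    "continuous_on UNIV c''" "\<And>t. c' t \<noteq> 0" "\<And>t. c (t + 1) = c t" "simple_path c" "path_image c = frontier \<Omega>"
    using assms(4) unfolding C2_simple_closed_curve_def by blast
  have bl: "bounded_linear to_complex" using linear_to_complex by (simp add: linear_conv_bounded_linear)
  have z: "to_complex 0 = 0" by (rule linear_0[OF linear_to_complex])
  interpret C2_closed_curve "\<lambda>t. to_complex (c t)" "\<lambda>t. to_complex (c' t)" "\<lambda>t. to_complex (c'' t)"
  proof
    fix s t :: real
    show "((\<lambda>t. to_complex (c t)) has_vector_derivative to_complex (c' t)) (at t)"
      "((\<lambda>t. to_complex (c' t)) has_vector_derivative to_complex (c'' t)) (at t)"
      using bounded_linear.has_vector_derivative[OF bl] c(1,2) by blast+
    show "continuous_on UNIV (\<lambda>t. to_complex (c'' t))" using bounded_linear.continuous_on[OF bl c(3)] .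
    show "to_complex (c' t) \<noteq> 0" using c(4)[of t] inj_to_complex z by (metis injD)
    show "to_complex (c (t + 1)) = to_complex (c t)" by (simp add: c(5))
    assume "0 \<le> s" "s < 1" "0 \<le> t" "t < 1" "to_complex (c s) = to_complex (c t)"
    moreover from this have "c s = c t" using inj_to_complex by (metis injD)
    ultimately show "s = t" using c(6) unfolding simple_path_def loop_free_def by fastforce
  qed
  have "frontier (to_complex ` \<Omega>) = range (\<lambda>t. to_complex (c t))"
    unfolding range_eq to_complex_image_facts(4) c(7)[symmetric] path_image_def by (simp add: image_image)
  from convex_orientation[OF to_complex_image_facts(1)[OF assms(1)] to_complex_image_facts(2)[OF assms(2)] _ this]
  show thesis using assms(3) that by (auto simp: to_complex_image_facts(3))
qed

lemma (in convex_curve) inverse_chord_integral: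
  assumes "compact \<Omega>'" "\<Omega> = to_complex ` \<Omega>'"
  shows "inverse_chord_integral \<Omega>' = ennreal (energy / 2)"
  using inverse_chord_integral_energy(1)[OF assms(1)] compact convex interior frontier by (simp add: assms(2))

lemma (in C2_closed_curve) inverse_chord_integral_moebius:
  assumes det: "a * d - b * c \<noteq> 0" and \<sigma>: "\<And>s. (LINT t|\<I>. k t s) = \<sigma>"
    and S: "compact S" "convex S" "interior S \<noteq> {}" "frontier S = range \<gamma>" "\<And>x. x \<in> S \<Longrightarrow> c * x + d \<noteq> 0"
    and \<Omega>': "compact \<Omega>'" "convex \<Omega>'" "to_complex ` \<Omega>' = (\<lambda>z. (a * z + b) / (c * z + d)) ` S"
  shows "inverse_chord_integral \<Omega>' = ennreal (energy / 2)"
proof -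
  let ?f = "\<lambda>z. (a * z + b) / (c * z + d)"
  have rs: "range \<gamma> \<subseteq> S" using S(4) frontier_subset_compact[OF S(1)] by simp
  then have nz: "c * \<gamma> t + d \<noteq> 0" for t using S(5) by blast
  interpret M: C2_closed_curve "\<lambda>t. (a * \<gamma> t + b) / (c * \<gamma> t + d)" "\<lambda>t. (a * d - b * c) * \<gamma>' t / (c * \<gamma> t + d)\<^sup>2"
    "\<lambda>t. (a * d - b * c) * (\<gamma>'' t / (c * \<gamma> t + d)\<^sup>2 - 2 * c * (\<gamma>' t)\<^sup>2 / (c * \<gamma> t + d)^3)"
    by (rule moebius_curve[OF det nz])
  have fc: "continuous_on S ?f" by (intro continuous_intros) (use S(5) in auto)
  have fi: "inj_on ?f S"
  proof (rule inj_onI)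
    fix x y assume xy: "x \<in> S" "y \<in> S" "?f x = ?f y"
    then have "(a * x + b) * (c * y + d) = (a * y + b) * (c * x + d)" using S(5) by (simp add: frac_eq_eq)
    then have "(a * d - b * c) * (x - y) = 0" by algebra
    then show "x = y" using det by simp
  qed
  have "interior (to_complex ` \<Omega>') \<noteq> {}" unfolding \<Omega>'(3) interior_image_compact[OF S(1) fc fi] using S(3) by simp
  moreover have "frontier (to_complex ` \<Omega>') = range (\<lambda>t. (a * \<gamma> t + b) / (c * \<gamma> t + d))"
    unfolding \<Omega>'(3) frontier_image_compact[OF S(1) fc fi] S(4) by (simp add: image_image)
  ultimately have "inverse_chord_integral \<Omega>' = ennreal (M.energy / 2)"
    by (rule M.inverse_chord_integral_energy(1)[OF \<Omega>'(1) to_complex_image_facts(1)[OF \<Omega>'(1)] to_complex_image_facts(2)[OF \<Omega>'(2)]])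
  then show ?thesis using energy_moebius[OF det \<sigma> S(2) rs S(5)] by simp
qed

text \<open>An orientation-reversing map is conjugation followed by a fractional linear map.
  Conjugation changes the sign of \<open>k\<close>, hence of its constant integral, but preserves
  the energy. That the image consists of finite points keeps the denominator nonzero on the whole
  domain.\<close>

lemma (in convex_curve) inverse_chord_integral_moebius_invariant:
  assumes \<Omega>0: "\<Omega> = to_complex ` \<Omega>0" and \<phi>: "moebius_transformation \<phi>" "\<phi> ` Some ` \<Omega>0 = Some ` \<Omega>'" and \<Omega>': "compact \<Omega>'" "convex \<Omega>'"
  shows "inverse_chord_integral \<Omega>' = ennreal (energy / 2)"
proof -
  have rep: "\<exists>a b c d. a * d - b * c \<noteq> 0 \<and> (\<forall>z\<in>j ` \<Omega>. c * z + d \<noteq> 0) \<and> to_complex ` \<Omega>' = (\<lambda>z. (a * z + b) / (c * z + d)) ` j ` \<Omega>"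
    if lr: "lin_rep j \<phi>" and j1: "j 1 = 1" for j
  proof -
    obtain a b c d where abcd: "a * d - b * c \<noteq> 0" "\<And>x y. x \<noteq> 0 \<or> y \<noteq> 0 \<Longrightarrow> \<phi> (hom_point x y) = hom_point (a * j x + b * j y) (c * j x + d * j y)"
      using lr unfolding lin_rep_def by blast
    have ph: "c * j (to_complex v) + d \<noteq> 0 \<and> \<phi> (Some v) = Some (of_complex ((a * j (to_complex v) + b) / (c * j (to_complex v) + d)))" if "v \<in> \<Omega>0" for v
    proof -
      have "\<phi> (Some v) \<in> Some ` \<Omega>'" using \<phi>(2) that by blast
      moreover have "\<phi> (Some v) = hom_point (a * j (to_complex v) + b) (c * j (to_complex v) + d)"
        using abcd(2)[of "to_complex v" 1] j1 by (simp add: hom_point_def)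
      ultimately show ?thesis by (auto simp: hom_point_def split: if_splits)
    qed
    have "Some ` \<Omega>' = (\<lambda>v. Some (of_complex ((a * j (to_complex v) + b) / (c * j (to_complex v) + d)))) ` \<Omega>0"
      unfolding \<phi>(2)[symmetric] image_image using ph by (intro image_cong) auto
    then have "(to_complex \<circ> the) ` Some ` \<Omega>' = (to_complex \<circ> the) ` (\<lambda>v. Some (of_complex ((a * j (to_complex v) + b) / (c * j (to_complex v) + d)))) ` \<Omega>0"
      by (rule arg_cong)
    then have img: "to_complex ` \<Omega>' = (\<lambda>z. (a * z + b) / (c * z + d)) ` j ` \<Omega>" unfolding \<Omega>0 image_image by simp
    have nz: "\<forall>z\<in>j ` \<Omega>. c * z + d \<noteq> 0" using ph by (auto simp: \<Omega>0)
    show ?thesis by (rule exI[of _ a], rule exI[of _ b], rule exI[of _ c], rule exI[of _ d]) (intro conjI abcd(1) nz img)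
  qed
  from moebius_lin_rep[OF \<phi>(1)] show ?thesis
  proof
    assume "lin_rep id \<phi>"
    from rep[OF this id_apply, unfolded id_def image_ident] obtain a b c d where abcd: "a * d - b * c \<noteq> 0" "\<forall>z\<in>\<Omega>. c * z + d \<noteq> 0"
      "to_complex ` \<Omega>' = (\<lambda>z. (a * z + b) / (c * z + d)) ` \<Omega>"
      by (elim exE conjE) (rule that)
    show ?thesis by (rule inverse_chord_integral_moebius[OF abcd(1) integral_k compact convex interior frontier abcd(2)[rule_format] \<Omega>' abcd(3)])
  next
    assume "lin_rep cnj \<phi>"
    from rep[OF this complex_cnj_one] obtain a b c d where abcd: "a * d - b * c \<noteq> 0" "\<forall>z\<in>cnj ` \<Omega>. c * z + d \<noteq> 0"
      "to_complex ` \<Omega>' = (\<lambda>z. (a * z + b) / (c * z + d)) ` cnj ` \<Omega>"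
      by (elim exE conjE) (rule that)
    interpret J: C2_closed_curve "\<lambda>t. cnj (\<gamma> t)" "\<lambda>t. cnj (\<gamma>' t)" "\<lambda>t. cnj (\<gamma>'' t)" by (rule cnj_curve)
    have cc: "continuous_on \<Omega> cnj" "inj_on cnj \<Omega>" by (auto intro!: continuous_intros inj_onI)
    have sig: "(LINT t|\<I>. J.k t s) = - pi" for s unfolding energy_cnj(2) by (simp add: integral_k)
    have "compact (cnj ` \<Omega>)" by (rule compact_continuous_image[OF cc(1) compact])
    moreover have "convex (cnj ` \<Omega>)" by (rule convex_linear_image[OF bounded_linear.linear[OF bounded_linear_cnj] convex])
    moreover have "interior (cnj ` \<Omega>) \<noteq> {}" unfolding interior_image_compact[OF compact cc] using interior by simp
    moreover have "frontier (cnj ` \<Omega>) = range (\<lambda>t. cnj (\<gamma> t))" unfolding frontier_image_compact[OF compact cc] frontier by (simp add: image_image)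
    ultimately have "inverse_chord_integral \<Omega>' = ennreal (J.energy / 2)"
      by (rule J.inverse_chord_integral_moebius[OF abcd(1) sig _ _ _ _ abcd(2)[rule_format] \<Omega>' abcd(3)])
    then show ?thesis by (simp add: energy_cnj(1))
  qed
qed

lemma circle_curve:
  assumes r: "r > 0"
  shows "C2_closed_curve (\<lambda>t. c + of_real r * cis (2 * pi * t)) (\<lambda>t. of_real r * (\<i> * of_real (2 * pi) * cis (2 * pi * t)))
    (\<lambda>t. of_real r * (\<i> * of_real (2 * pi) * (\<i> * of_real (2 * pi) * cis (2 * pi * t))))"
proof
  fix s t :: real
  have d: "((\<lambda>t. cis (2 * pi * t)) has_vector_derivative \<i> * of_real (2 * pi) * cis (2 * pi * t)) (at t)"
    by (rule cis_has_vector_derivative)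
  have "((\<lambda>t. of_real r * cis (2 * pi * t)) has_vector_derivative of_real r * (\<i> * of_real (2 * pi) * cis (2 * pi * t))) (at t)"
    by (rule has_vector_derivative_mult_right[OF d])
  then show "((\<lambda>t. c + of_real r * cis (2 * pi * t)) has_vector_derivative of_real r * (\<i> * of_real (2 * pi) * cis (2 * pi * t))) (at t)"
    using has_vector_derivative_add[OF has_vector_derivative_const] by fastforce
  show "((\<lambda>t. of_real r * (\<i> * of_real (2 * pi) * cis (2 * pi * t))) has_vector_derivative
      of_real r * (\<i> * of_real (2 * pi) * (\<i> * of_real (2 * pi) * cis (2 * pi * t)))) (at t)"
    by (intro has_vector_derivative_mult_right d)
  show "continuous_on UNIV (\<lambda>t. of_real r * (\<i> * of_real (2 * pi) * (\<i> * of_real (2 * pi) * cis (2 * pi * t))))"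
    by (intro continuous_on_mult continuous_on_const cont_cis continuous_intros)
  show "of_real r * (\<i> * of_real (2 * pi) * cis (2 * pi * t)) \<noteq> 0" using r by simp
  show "c + of_real r * cis (2 * pi * (t + 1)) = c + of_real r * cis (2 * pi * t)"
    using cis_int_period[of 1 "2 * pi * t"] by (simp add: distrib_left)
  assume st: "0 \<le> s" "s < 1" "0 \<le> t" "t < 1" "c + of_real r * cis (2 * pi * s) = c + of_real r * cis (2 * pi * t)"
  then have "cis (2 * pi * s) = cis (2 * pi * t)" using r by simp
  then obtain n :: int where "2 * pi * s = 2 * pi * t + 2 * pi * of_int n"
    using sin_cos_eq_iff[of "2 * pi * s" "2 * pi * t"] by (auto simp: complex_eq_iff)
  then have "2 * pi * s = 2 * pi * (t + of_int n)" by (simp add: distrib_left)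
  then have n: "s = t + of_int n" by simp
  then have "\<bar>of_int n :: real\<bar> < 1" using st by linarith
  then have "n = 0" by linarith
  then show "s = t" using n by simp
qed

text \<open>The inscribed angle theorem: the quotient is equally far from 0 and 1. It makes the
  kernel constant on a circle.\<close>

lemma Re_divide_diff_equal_norm:
  assumes "cmod u = cmod v" "u \<noteq> v"
  shows "Re (u / (u - v)) = 1 / 2"
proof -
  define q where "q = u / (u - v)"
  have "q - 1 = v / (u - v)" using assms(2) by (simp add: q_def field_simps)
  then have "cmod (q - 1) = cmod q" using assms(1) by (simp add: q_def norm_divide)
  then have "(cmod (q - 1))\<^sup>2 = (cmod q)\<^sup>2" by simp
  then show ?thesis unfolding q_def[symmetric] cmod_power2 by (simp add: power2_eq_square algebra_simps)
qed

lemma circle_energy: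
  assumes r: "r > 0"
  shows "C2_closed_curve.energy (\<lambda>t. c + of_real r * cis (2 * pi * t)) (\<lambda>t. of_real r * (\<i> * of_real (2 * pi) * cis (2 * pi * t))) = pi\<^sup>2"
proof -
  interpret C2_closed_curve "\<lambda>t. c + of_real r * cis (2 * pi * t)" "\<lambda>t. of_real r * (\<i> * of_real (2 * pi) * cis (2 * pi * t))"
    "\<lambda>t. of_real r * (\<i> * of_real (2 * pi) * (\<i> * of_real (2 * pi) * cis (2 * pi * t)))"
    by (rule circle_curve[OF r])
  have k: "k s t = pi" if "cis (2 * pi * s) \<noteq> cis (2 * pi * t)" for s t
  proof -
    define u v where "u = cis (2 * pi * s)" and "v = cis (2 * pi * t)"
    have 1: "Re (u / (u - v)) = 1 / 2" by (rule Re_divide_diff_equal_norm) (use that in \<open>auto simp: u_def v_def\<close>)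
    have 2: "k s t = Im (of_real r * (\<i> * of_real (2 * pi) * u) / (of_real r * (u - v)))"
      unfolding k_def u_def v_def by (simp add: algebra_simps)
    have 3: "of_real r * (\<i> * of_real (2 * pi) * u) / (of_real r * (u - v)) = \<i> * (of_real (2 * pi) * (u / (u - v)))"
      using r by simp
    have 4: "Im (\<i> * (of_real (2 * pi) * q)) = 2 * pi * Re q" for q by simp
    show ?thesis unfolding 2 3 4 1 by simp
  qed
  have AE: "AE t in \<I>. k s t * k t s = pi\<^sup>2" for s
  proof -
    have "{t. cis (2 * pi * t) = cis (2 * pi * s)} = (\<lambda>a. a / (2 * pi)) ` {a. cis a = cis (2 * pi * s)}"
    proof (intro equalityI subsetI)
      fix t assume "t \<in> {t. cis (2 * pi * t) = cis (2 * pi * s)}"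
      then show "t \<in> (\<lambda>a. a / (2 * pi)) ` {a. cis a = cis (2 * pi * s)}" by (intro image_eqI[of _ _ "2 * pi * t"]) auto
    qed auto
    then have "countable {t. cis (2 * pi * t) = cis (2 * pi * s)}" using countable_cis_eq by simp
    then have "AE t in lborel. t \<notin> {t. cis (2 * pi * t) = cis (2 * pi * s)}" by (intro AE_not_in countable_imp_null_set_lborel)
    then have "AE t in \<I>. t \<notin> {t. cis (2 * pi * t) = cis (2 * pi * s)}" by (subst AE_restrict_space_iff) auto
    then show ?thesis
    proof eventually_elim
      case (elim t)
      then have "cis (2 * pi * t) \<noteq> cis (2 * pi * s)" by simp
      from k[OF this] k[OF this[symmetric]] show ?case by (simp add: power2_eq_square)
    qed
  qed
  have "(LINT t|\<I>. k s t * k t s) = pi\<^sup>2" for s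
  proof -
    have p1: "(\<lambda>t. (s, t)) \<in> measurable borel (borel :: (real \<times> real) measure)" by (intro borel_measurable_Pair) auto
    have "(\<lambda>t. k s t * k t s) \<in> borel_measurable borel" using measurable_compose[OF p1 energy_borel] by simp
    then have "(LINT t|\<I>. k s t * k t s) = (LINT t|\<I>. pi\<^sup>2)"
      by (intro integral_cong_AE AE borel_measurable_Icc) auto
    then show ?thesis by (simp add: unit_interval_measure space_restrict_space)
  qed
  then show ?thesis unfolding energy_def by (simp add: unit_interval_measure space_restrict_space)
qed

lemma inverse_chord_integral_cball:
  assumes r: "r > 0"
  shows "inverse_chord_integral (cball c r) = ennreal (pi\<^sup>2 / 2)"
proof -
  interpret C2_closed_curve "\<lambda>t. to_complex c + of_real r * cis (2 * pi * t)" "\<lambda>t. of_real r * (\<i> * of_real (2 * pi) * cis (2 * pi * t))"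
    "\<lambda>t. of_real r * (\<i> * of_real (2 * pi) * (\<i> * of_real (2 * pi) * cis (2 * pi * t)))"
    by (rule circle_curve[OF r])
  have "frontier (to_complex ` cball c r) = to_complex ` sphere c r" using r by (simp add: to_complex_image_facts(4))
  also have "\<dots> = range (\<lambda>t. to_complex c + of_real r * cis (2 * pi * t))"
  proof (intro equalityI subsetI)
    fix z assume "z \<in> to_complex ` sphere c r"
    then have "cmod (z - to_complex c) = r" by (metis dist_commute dist_norm image_iff mem_sphere to_complex_dist)
    then have "z - to_complex c = of_real r * cis (Arg (z - to_complex c))" using rcis_cmod_Arg[of "z - to_complex c"] by (simp add: rcis_def)
    then have "z = to_complex c + of_real r * cis (2 * pi * (Arg (z - to_complex c) / (2 * pi)))" by (simp add: algebra_simps)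
    then show "z \<in> range (\<lambda>t. to_complex c + of_real r * cis (2 * pi * t))" by (rule range_eqI)
  next
    fix z assume "z \<in> range (\<lambda>t. to_complex c + of_real r * cis (2 * pi * t))"
    then have "dist (to_complex c) z = r" using r by (auto simp: dist_norm norm_mult)
    then have "dist c (of_complex z) = r" using to_complex_dist[of c "of_complex z"] by simp
    then show "z \<in> to_complex ` sphere c r" by (intro image_eqI[of _ _ "of_complex z"]) auto
  qed
  finally have "inverse_chord_integral (cball c r) = ennreal (energy / 2)"
    using r by (intro inverse_chord_integral_energy(1) to_complex_image_facts(1,2)) (auto simp: to_complex_image_facts(3))
  then show ?thesis by (simp only: circle_energy[OF r])
qed

theorem corollary4:
  fixes \<Omega> :: "(real^2) set"
  assumes "compact \<Omega>" and "convex \<Omega>" and "interior \<Omega> \<noteq> {}"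
    and "C2_simple_closed_curve (frontier \<Omega>)"
  shows "inverse_chord_integral \<Omega> \<ge> ennreal (pi\<^sup>2 / 2) \<and>
    (inverse_chord_integral \<Omega> = ennreal (pi\<^sup>2 / 2) \<longleftrightarrow>
       (\<exists>c r. r > 0 \<and> \<Omega> = cball c r)) \<and>
    (\<forall>\<phi> \<Omega>'. moebius_transformation \<phi> \<and> \<phi> ` Some ` \<Omega> = Some ` \<Omega>' \<and> compact \<Omega>' \<and> convex \<Omega>' \<longrightarrow>
       inverse_chord_integral \<Omega>' = inverse_chord_integral \<Omega>)"
proof -
  obtain \<gamma> \<gamma>' \<gamma>'' where cc: "convex_curve \<gamma> \<gamma>' \<gamma>'' (to_complex ` \<Omega>)" using convex_curve_exists[OF assms] .
  interpret convex_curve \<gamma> \<gamma>' \<gamma>'' "to_complex ` \<Omega>" by (rule cc)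
  have I: "inverse_chord_integral \<Omega> = ennreal (energy / 2)" by (rule inverse_chord_integral[OF assms(1) refl])
  have ge: "ennreal (pi\<^sup>2 / 2) \<le> inverse_chord_integral \<Omega>"
    unfolding I using energy_ge_and_extremal(1) by (intro ennreal_leI) simp
  have "\<exists>c r. r > 0 \<and> \<Omega> = cball c r" if "inverse_chord_integral \<Omega> = ennreal (pi\<^sup>2 / 2)"
  proof -
    have "energy = pi\<^sup>2" using that energy_ge_and_extremal(1) zero_le_power2[of pi] unfolding I by (subst (asm) ennreal_inj) linarith+
    then obtain c r where cr: "r > 0" "to_complex ` \<Omega> = cball c r" using energy_ge_and_extremal(2) by blast
    have "x \<in> \<Omega> \<longleftrightarrow> x \<in> cball (of_complex c) r" for x
    proof -
      have "x \<in> \<Omega> \<longleftrightarrow> to_complex x \<in> to_complex ` \<Omega>" using inj_to_complex by (simp add: inj_image_mem_iff)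
      then show ?thesis unfolding cr(2) using to_complex_dist[of "of_complex c" x] by simp
    qed
    then show ?thesis using cr(1) by blast
  qed
  moreover have "inverse_chord_integral \<Omega> = ennreal (pi\<^sup>2 / 2)" if "\<exists>c r. r > 0 \<and> \<Omega> = cball c r"
    using that inverse_chord_integral_cball by blast
  moreover have "inverse_chord_integral \<Omega>' = inverse_chord_integral \<Omega>"
    if "moebius_transformation \<phi>" "\<phi> ` Some ` \<Omega> = Some ` \<Omega>'" "compact \<Omega>'" "convex \<Omega>'" for \<phi> \<Omega>'
    unfolding I by (rule inverse_chord_integral_moebius_invariant[OF refl that])
  ultimately show ?thesis using ge by blast
qed

end
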